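(* Let $k\ge 2$ and fix a probability vector $(p_1,\dots,p_k)$ with $p_1>\max_{2\le i\le k}p_i$. For each $d\ge1$ consider the multi-type symmetric stable matching of a homogeneous Poisson process of rate $1$ in $\mathbb{R}^d$, in which each point independently receives colour $i$ with probability $p_i$, and two points may be matched if and only if they have different colours. Then there exists a strictly positive $\lambda=\lambda(p_1,\dots,p_k)$ such that the intensity of unmatched points of colour $1$ converges to $\lambda$ as $d\to\infty$. In the case where $p_i$ are equal for all $i\ge 2$, we have $\lambda=(p_1-p_2)^{k-1}p_1^{-(k-2)}$.
   Context: Stable matching. Let $V$ be a set and $\ell:V\times V\to[0,\infty)\cup\{\infty\}$ a symmetric function with $\ell(x,x)=\infty$ for all $x$. A matching is an involution $M:V\to V$ such that $\ell(x,M(x))<\infty$ whenever $M(x)\neq x$; $x$ is unmatched if $M(x)=x$. Put $d_M(x)=\ell(x,M(x))$ (so $d_M(x)=\infty$ if $x$ is unmatched). $M$ is stable if $\ell(x,y)\ge\min(d_M(x),d_M(y))$ for all $x,y\in V$. Multi-type symmetric model in $\mathbb{R}^d$: $V$ is the set of points of the coloured Poisson process; for distinct $x,y\in V$, $\ell(x,y)=|x-y|$ (Euclidean distance) if $x$ and $y$ have different colours, and $\ell(x,y)=\infty$ if they have the same colour. With probability 1 there is a unique stable matching. The intensity of a (translation-invariantly determined) random set of points is the expected number of its points in $[0,1]^d$. *)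

theory Defs
  imports "HOL-Probability.Probability"
begin

text \<open>
  The dimension varies in the limit, so points of \<open>d\<close>-dimensional space are represented as
  functions on \<open>{..<d}\<close> that are \<open>undefined\<close> elsewhere; the product measure is Lebesgue measure.
\<close>

definition euclid :: "nat \<Rightarrow> (nat \<Rightarrow> real) measure" where
  "euclid d = (\<Pi>\<^sub>M i\<in>{..<d}. lborel)"

definition euclid_dist :: "nat \<Rightarrow> (nat \<Rightarrow> real) \<Rightarrow> (nat \<Rightarrow> real) \<Rightarrow> real" where
  "euclid_dist d x y = L2_set (\<lambda>i. x i - y i) {..<d}"

definition unit_cube :: "nat \<Rightarrow> (nat \<Rightarrow> real) set" where
  "unit_cube d = (\<Pi>\<^sub>E i\<in>{..<d}. {0..1})"


subsection \<open>Stable matchings\<close>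

text \<open>
  A matching of \<open>V\<close> is extended by the identity outside \<open>V\<close>, so that uniqueness of a
  stable matching of \<open>V\<close> is uniqueness as a function on the whole type.
\<close>

definition is_matching :: "('v \<Rightarrow> 'v \<Rightarrow> ennreal) \<Rightarrow> 'v set \<Rightarrow> ('v \<Rightarrow> 'v) \<Rightarrow> bool" where
  "is_matching l V M \<longleftrightarrow>
     (\<forall>x\<in>V. M x \<in> V \<and> M (M x) = x \<and> (M x \<noteq> x \<longrightarrow> l x (M x) < \<infinity>)) \<and>
     (\<forall>x. x \<notin> V \<longrightarrow> M x = x)"

definition match_dist :: "('v \<Rightarrow> 'v \<Rightarrow> ennreal) \<Rightarrow> ('v \<Rightarrow> 'v) \<Rightarrow> 'v \<Rightarrow> ennreal" where
  "match_dist l M x = l x (M x)"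

definition stable_matching :: "('v \<Rightarrow> 'v \<Rightarrow> ennreal) \<Rightarrow> 'v set \<Rightarrow> ('v \<Rightarrow> 'v) \<Rightarrow> bool" where
  "stable_matching l V M \<longleftrightarrow>
     is_matching l V M \<and>
     (\<forall>x\<in>V. \<forall>y\<in>V. l x y \<ge> min (match_dist l M x) (match_dist l M y))"

definition the_stable_matching :: "('v \<Rightarrow> 'v \<Rightarrow> ennreal) \<Rightarrow> 'v set \<Rightarrow> 'v \<Rightarrow> 'v" where
  "the_stable_matching l V = (THE M. stable_matching l V M)"


subsection \<open>The coloured Poisson process\<close>

text \<open>
  \<open>Q\<close> is the law of a random sequence \<open>X\<close> that enumerates, without repetition, the points of
  a Poisson process of rate 1. The explicit finiteness condition is needed because \<open>card\<close> is 0
  on infinite sets; the Poisson weights sum to 1, so finite volume implies finitely many points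
  almost surely.
\<close>

definition poisson_process_law :: "nat \<Rightarrow> (nat \<Rightarrow> nat \<Rightarrow> real) measure \<Rightarrow> bool" where
  "poisson_process_law d Q \<longleftrightarrow>
     prob_space Q \<and>
     sets Q = sets (\<Pi>\<^sub>M n\<in>UNIV. euclid d) \<and>
     (AE X in Q. inj X) \<and>
     (\<forall>B \<in> sets (euclid d). emeasure (euclid d) B < \<infinity> \<longrightarrow>
        (\<forall>m. measure Q {X \<in> space Q. finite {n. X n \<in> B} \<and> card {n. X n \<in> B} = m} =
             exp (- measure (euclid d) B) * measure (euclid d) B ^ m / fact m)) \<and>
     (\<forall>N. \<forall>B :: nat \<Rightarrow> (nat \<Rightarrow> real) set.
        (\<forall>j<N. B j \<in> sets (euclid d) \<and> emeasure (euclid d) (B j) < \<infinity>) \<longrightarrow>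
        disjoint_family_on B {..<N} \<longrightarrow>
        prob_space.indep_vars Q (\<lambda>_. count_space UNIV) (\<lambda>j X. card {n. X n \<in> B j}) {..<N})"

text \<open>
  The \<open>n\<close>-th point receives the colour \<open>c n\<close>; the colours are independent of each other
  and of the points, and each has distribution \<open>p\<close> on \<open>{1..k}\<close>.
\<close>

definition coloured_law ::
  "nat \<Rightarrow> (nat \<Rightarrow> real) \<Rightarrow> (nat \<Rightarrow> nat \<Rightarrow> real) measure \<Rightarrow>
     ((nat \<Rightarrow> nat \<Rightarrow> real) \<times> (nat \<Rightarrow> nat)) measure" where
  "coloured_law k p Q =
     Q \<Otimes>\<^sub>M (\<Pi>\<^sub>M n\<in>UNIV. point_measure {1..k} (\<lambda>i. ennreal (p i)))"

definition coloured_points ::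
  "(nat \<Rightarrow> nat \<Rightarrow> real) \<times> (nat \<Rightarrow> nat) \<Rightarrow> ((nat \<Rightarrow> real) \<times> nat) set" where
  "coloured_points w = (case w of (X, c) \<Rightarrow> range (\<lambda>n. (X n, c n)))"

definition colour_dist ::
  "nat \<Rightarrow> (nat \<Rightarrow> real) \<times> nat \<Rightarrow> (nat \<Rightarrow> real) \<times> nat \<Rightarrow> ennreal" where
  "colour_dist d u v =
     (if snd u \<noteq> snd v then ennreal (euclid_dist d (fst u) (fst v)) else \<infinity>)"

lemma colour_dist_commute: "colour_dist d u v = colour_dist d v u"
  by (simp add: colour_dist_def euclid_dist_def L2_set_def power2_commute)

lemma colour_dist_self [simp]: "colour_dist d u u = \<infinity>"
  by (simp add: colour_dist_def)

definition unmatched_points ::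
  "nat \<Rightarrow> nat \<Rightarrow> (nat \<Rightarrow> nat \<Rightarrow> real) \<times> (nat \<Rightarrow> nat) \<Rightarrow> ((nat \<Rightarrow> real) \<times> nat) set" where
  "unmatched_points d i w =
     {v \<in> coloured_points w. snd v = i \<and>
        the_stable_matching (colour_dist d) (coloured_points w) v = v}"

definition unmatched_intensity ::
  "nat \<Rightarrow> nat \<Rightarrow> (nat \<Rightarrow> real) \<Rightarrow> (nat \<Rightarrow> nat \<Rightarrow> real) measure \<Rightarrow> nat \<Rightarrow> ennreal" where
  "unmatched_intensity d k p Q i =
     (\<integral>\<^sup>+ w. emeasure (count_space UNIV) {v \<in> unmatched_points d i w. fst v \<in> unit_cube d}
        \<partial>coloured_law k p Q)"

end

theory Submission
  imports Defs
begin

text \<open>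
  Measure distance by the volume of the ball of that radius. Say that \<open>x\<close> is available at distance \<open>t\<close> if
  no point \<open>y\<close> of another colour nearer than \<open>t\<close> is available at its distance from \<open>x\<close>; then \<open>x\<close> is matched at
  distance at least \<open>t\<close>, or unmatched, iff it is available at \<open>t\<close>. Truncating this recursion at depth \<open>n\<close>
  overestimates availability for even \<open>n\<close> and underestimates it for odd \<open>n\<close>.

  Two balls of equal volume whose centres are not very close have an overlap that is exponentially small in
  \<open>d\<close>, so as \<open>d \<rightarrow> \<infinity>\<close> the neighbourhood of a point looks like a tree on which the truncated availability
  probabilities solve \<open>a\<^sub>i' = - a\<^sub>i (\<Sum>j\<noteq>i. p\<^sub>j a\<^sub>j)\<close>. For \<open>t \<rightarrow> \<infinity>\<close> the densities \<open>p\<^sub>i a\<^sub>i\<close> tend to \<open>0\<close> for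
  \<open>i \<ge> 2\<close>, and \<open>p\<^sub>1 a\<^sub>1\<close> tends to \<open>p\<^sub>1 (\<Prod>i\<ge>2. 1 - p\<^sub>i / p\<^sub>1)\<close>.

  The intensity of unmatched points of colour 1 is at most that of points of colour 1 available at \<open>t\<close>. The excess
  comes from points of colour 1 matched beyond distance \<open>t\<close>; by mass transport it equals the intensity of
  their partners, which have other colours and are still available at \<open>t\<close>, hence are rare.
\<close>

text \<open>Seen from a point, volume distances are spread like Lebesgue measure on the half-line in
  every dimension, so the dimension enters only through overlaps of balls. The intensity is squeezed
  for every time and depth; with these fixed the dimension tends to infinity, and no rate of
  convergence is needed.

  The obstacle is the dependence between the availabilities of neighbouring points. The induction on
  the depth therefore treats a finite family of separated probes at once: all are available at depth
  \<open>n + 1\<close> iff no Poisson point hits one of them. By the Mecke formula the factorial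
  moments of the number of hits are integrals of joint availability probabilities at depth
  \<open>n\<close> for the hitting points, which are again separated outside a set of small measure.
  Inclusion-exclusion recovers the probability of no hit.

  A law \<open>Q\<close> is that of an enumeration in an unknown order, and translating it may
  change the law of the sequence. All computations therefore take place in windows of finite volume,
  where only counts matter.\<close>

subsection \<open>The limiting recursion\<close>

text \<open>
  The probability that the root, of colour \<open>i\<close>, of a tree of depth \<open>n\<close> is available at distance \<open>t\<close>, when the
  distances from each vertex to its children form a Poisson process of rate 1.
\<close>

fun tree_av :: "nat \<Rightarrow> (nat \<Rightarrow> real) \<Rightarrow> nat \<Rightarrow> nat \<Rightarrow> real \<Rightarrow> real" where
  "tree_av k p 0 i t = 1"
| "tree_av k p (Suc n) i t = exp (- integral {0..t} (\<lambda>s. \<Sum>j\<in>{1..k} - {i}. p j * tree_av k p n j s))"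

locale colour_probs =
  fixes k :: nat and p :: "nat \<Rightarrow> real"
  assumes p_nonneg: "\<And>i. i \<in> {1..k} \<Longrightarrow> p i \<ge> 0" and p_sum: "(\<Sum>i=1..k. p i) = 1"
begin

abbreviation "tav \<equiv> tree_av k p"

definition rate :: "(nat \<Rightarrow> real \<Rightarrow> real) \<Rightarrow> nat \<Rightarrow> real \<Rightarrow> real" where
  "rate f i s = (\<Sum>j\<in>{1..k} - {i}. p j * f j s)"

lemma a_Suc: "tav (Suc n) i t = exp (- integral {0..t} (rate (tav n) i))"
  by (simp add: rate_def[abs_def])

lemma continuous_rate:
  "(\<And>j. continuous_on A (f j)) \<Longrightarrow> continuous_on A (rate f i)"
  unfolding rate_def[abs_def] by (intro continuous_intros) auto

lemma rate_nonneg: "(\<And>j. 0 \<le> f j s) \<Longrightarrow> 0 \<le> rate f i s"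
  unfolding rate_def using p_nonneg by (intro sum_nonneg mult_nonneg_nonneg) auto

text \<open>The weights \<open>p j\<close> sum to at most 1, so \<open>rate\<close> is a sub-average
  and does not enlarge uniform distances. This keeps Lipschitz constants out of the estimates for
  the iteration.\<close>

lemma rate_diff_le:
  assumes "\<And>j. \<bar>f j s - g j s\<bar> \<le> c" "c \<ge> 0"
  shows "\<bar>rate f i s - rate g i s\<bar> \<le> c"
proof -
  have "\<bar>rate f i s - rate g i s\<bar> = \<bar>\<Sum>j\<in>{1..k} - {i}. p j * (f j s - g j s)\<bar>"
    unfolding rate_def by (simp add: sum_subtractf algebra_simps)
  also have "\<dots> \<le> (\<Sum>j\<in>{1..k} - {i}. p j * c)"
    using assms p_nonneg by (intro order_trans[OF sum_abs] sum_mono) (auto simp: abs_mult intro!: mult_left_mono)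
  also have "\<dots> \<le> (\<Sum>j\<in>{1..k}. p j * c)"
    using assms p_nonneg by (intro sum_mono2) auto
  also have "\<dots> = c" using p_sum by (simp flip: sum_distrib_right)
  finally show ?thesis .
qed


lemma cont_indef:
  assumes f: "continuous_on {0..} (f :: real \<Rightarrow> real)" and t: "t \<ge> 0"
  shows "((\<lambda>t. integral {0..t} f) has_real_derivative f t) (at t within {0..})"
proof -
  have "((\<lambda>t. integral {0..t} f) has_real_derivative f t) (at t within {0..t+1})"
    using t by (intro integral_has_real_derivative continuous_on_subset[OF f]) auto
  \<comment> \<open>Differentiability is local: near \<open>t\<close> the interval and the half-line
    coincide. The one-sided filter covers \<open>t = 0\<close>.\<close>
  moreover have "at t within {0..t+1} = at t within {0..}"
    by (rule at_within_nhd[of _ "{t-1<..<t+1}"]) auto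
  ultimately show ?thesis by simp
qed

lemma continuous_indef:
  assumes f: "continuous_on {0..} (f :: real \<Rightarrow> real)"
  shows "continuous_on {0..} (\<lambda>t. integral {0..t} f)"
  using cont_indef[OF f] by (intro DERIV_continuous_on) auto

lemma continuous_a: "continuous_on {0..} (tav n i)"
proof (induction n arbitrary: i)
  case 0 thus ?case by (simp add: continuous_on_const)
next
  case (Suc n)
  show ?case unfolding a_Suc[abs_def]
    by (intro continuous_intros continuous_indef continuous_rate Suc)
qed

lemma a_pos: "0 < tav n i t" by (cases n) auto


lemma exp_diff_le: "u \<ge> 0 \<Longrightarrow> w \<ge> 0 \<Longrightarrow> \<bar>exp (- u) - exp (- w)\<bar> \<le> \<bar>u - (w::real)\<bar>"
proof (induction u w rule: linorder_wlog)
  case (le u w)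
  have "exp (- u) - exp (- w) = exp (- u) * (1 - exp (- (w - u)))"
    by (simp add: algebra_simps flip: exp_add)
  moreover have "1 - exp (- (w - u)) \<le> w - u"
    using exp_ge_add_one_self[of "- (w - u)"] by linarith
  hence "exp (- u) * (1 - exp (- (w - u))) \<le> 1 * (w - u)"
    using le by (intro mult_mono) auto
  ultimately have "exp (- u) - exp (- w) \<le> w - u" "exp (- w) \<le> exp (- u)" using le by simp_all
  thus ?case using le by simp
qed (simp add: abs_minus_commute)

lemma integrable_rate: "(\<And>j. continuous_on {0..} (f j)) \<Longrightarrow> rate f i integrable_on {0..t}"
  by (intro integrable_continuous_interval continuous_on_subset[OF continuous_rate[of "{0..}"]]) auto

lemma a_le_1: "tav n i t \<le> 1"
proof (cases n)
  case (Suc m)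
  have "0 \<le> integral {0..t} (rate (tav m) i)"
    by (intro integral_nonneg integrable_rate continuous_a rate_nonneg less_imp_le[OF a_pos])
  thus ?thesis by (simp only: Suc a_Suc) simp
qed simp

text \<open>The usual estimate for Picard iteration: \<open>exp (- u)\<close> is 1-Lipschitz for
  nonnegative \<open>u\<close> and \<open>rate\<close> does not enlarge differences, so each step
  integrates the previous bound once.\<close>

lemma a_diff: "t \<ge> 0 \<Longrightarrow> \<bar>tav (Suc n) i t - tav n i t\<bar> \<le> t ^ Suc n / fact (Suc n)"
proof (induction n arbitrary: i t)
  case 0
  have "\<bar>tav (Suc 0) i t - tav 0 i t\<bar> = \<bar>exp (- integral {0..t} (rate (tav 0) i)) - exp (- 0)\<bar>"
    by (simp only: a_Suc) simp
  also have "\<dots> \<le> \<bar>integral {0..t} (rate (tav 0) i) - 0\<bar>"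
    by (intro exp_diff_le integral_nonneg integrable_rate continuous_a rate_nonneg) (auto simp: a_pos less_imp_le)
  also have "\<dots> = norm (integral {0..t} (rate (tav 0) i))" by simp
  also have "\<dots> \<le> integral {0..t} (\<lambda>s. 1)"
  proof (rule integral_norm_bound_integral)
    fix s show "norm (rate (tav 0) i s) \<le> 1"
      using rate_diff_le[of "tav 0" s "\<lambda>_ _. 0" 1 i] by (simp add: rate_def)
  qed (auto intro!: integrable_rate continuous_a)
  finally show ?case using 0 by simp
next
  case (Suc n)
  let ?I = "\<lambda>n. integral {0..t} (rate (tav n) i)"
  have "\<bar>tav (Suc (Suc n)) i t - tav (Suc n) i t\<bar> \<le> \<bar>?I (Suc n) - ?I n\<bar>"
    unfolding a_Suc[of "Suc n"] a_Suc[of n i t]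
    by (intro exp_diff_le integral_nonneg integrable_rate continuous_a rate_nonneg) (auto simp: a_pos less_imp_le simp del: tree_av.simps)
  also have "?I (Suc n) - ?I n = integral {0..t} (\<lambda>s. rate (tav (Suc n)) i s - rate (tav n) i s)"
    by (intro integral_diff[symmetric] integrable_rate continuous_a)
  also have "\<bar>\<dots>\<bar> \<le> integral {0..t} (\<lambda>s. s ^ Suc n / fact (Suc n))"
    unfolding real_norm_def[symmetric]
  proof (rule integral_norm_bound_integral)
    show "(\<lambda>s. rate (tav (Suc n)) i s - rate (tav n) i s) integrable_on {0..t}"
      by (intro integrable_diff integrable_rate continuous_a)
    show "(\<lambda>s. s ^ Suc n / fact (Suc n) :: real) integrable_on {0..t}"
      by (intro integrable_continuous_interval continuous_intros) auto
    fix s assume "s \<in> {0..t}"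
    thus "norm (rate (tav (Suc n)) i s - rate (tav n) i s) \<le> s ^ Suc n / fact (Suc n)"
      unfolding real_norm_def by (intro rate_diff_le Suc.IH) auto
  qed
  also have "\<dots> = t ^ Suc (Suc n) / fact (Suc (Suc n))"
  proof (rule integral_unique)
    have "((\<lambda>s. s ^ Suc n / fact (Suc n)) has_integral
      (t ^ Suc (Suc n) / fact (Suc (Suc n)) - 0 ^ Suc (Suc n) / fact (Suc (Suc n)))) {0..t}"
    proof (rule fundamental_theorem_of_calculus[OF Suc.prems])
      fix s :: real assume "s \<in> {0..t}"
      have "((\<lambda>s. s ^ Suc (Suc n) / fact (Suc (Suc n))) has_real_derivative
          (real (Suc (Suc n)) * s ^ Suc n) / fact (Suc (Suc n))) (at s within {0..t})"
        using DERIV_cdivide[OF DERIV_pow[of "Suc (Suc n)" s "{0..t}"], of "fact (Suc (Suc n))"]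
        by (simp del: power_Suc of_nat_Suc fact_Suc)
      moreover have "(real (Suc (Suc n)) * s ^ Suc n) / fact (Suc (Suc n)) = s ^ Suc n / fact (Suc n)"
        by (simp del: power_Suc of_nat_Suc add: fact_Suc[of "Suc n"])
      ultimately show "((\<lambda>s. s ^ Suc (Suc n) / fact (Suc (Suc n))) has_vector_derivative s ^ Suc n / fact (Suc n)) (at s within {0..t})"
        by (simp add: has_real_derivative_iff_has_vector_derivative del: power_Suc fact_Suc of_nat_Suc)
    qed
    thus "((\<lambda>s. s ^ Suc n / fact (Suc n)) has_integral (t ^ Suc (Suc n) / fact (Suc (Suc n)))) {0..t}" by simp
  qed
  finally show ?case .
qed

lemma uniform_limit_sum_finite:
  fixes f :: "'j \<Rightarrow> 'b \<Rightarrow> 'c \<Rightarrow> 'd :: real_normed_vector"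
  assumes "finite J" "\<And>j. j \<in> J \<Longrightarrow> uniform_limit S (f j) (g j) F"
  shows "uniform_limit S (\<lambda>n s. \<Sum>j\<in>J. f j n s) (\<lambda>s. \<Sum>j\<in>J. g j s) F"
  using assms by (induction J rule: finite_induct) (auto intro!: uniform_limit_add uniform_limit_const)

end

section \<open>The fixed point of the recursion and its behaviour for large times\<close>

locale dominant_colour = colour_probs +
  assumes k2: "k \<ge> 2" and dom: "\<And>i. i \<in> {2..k} \<Longrightarrow> p i < p 1"
begin

definition A :: "nat \<Rightarrow> real \<Rightarrow> real" where "A i t = lim (\<lambda>n. tav n i t)"

text \<open>The iterates are the partial sums of their telescoping series, which
  \<open>a_diff\<close> dominates on \<open>{0..T}\<close> by the exponential series of
  \<open>T\<close>.\<close>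

lemma uniform_A: "uniform_limit {0..T} (\<lambda>n. tav n i) (A i) sequentially"
proof -
  have "uniform_limit {0..T} (\<lambda>n t. \<Sum>m<n. tav (Suc m) i t - tav m i t)
     (\<lambda>t. \<Sum>m. tav (Suc m) i t - tav m i t) sequentially"
  proof (rule Weierstrass_m_test)
    fix n t assume t: "t \<in> {0..T}"
    have "norm (tav (Suc n) i t - tav n i t) \<le> t ^ Suc n / fact (Suc n)"
      using a_diff[of t n i] t by (simp del: tree_av.simps)
    also have "\<dots> \<le> T ^ Suc n / fact (Suc n)" using t by (intro divide_right_mono power_mono) auto
    finally show "norm (tav (Suc n) i t - tav n i t) \<le> T ^ Suc n / fact (Suc n)" .
  next
    show "summable (\<lambda>n. T ^ Suc n / fact (Suc n))"
      using summable_exp[of T] by (subst summable_Suc_iff) (simp add: divide_inverse mult.commute)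
  qed
  hence u: "uniform_limit {0..T} (\<lambda>n t. 1 + (\<Sum>m<n. tav (Suc m) i t - tav m i t))
     (\<lambda>t. 1 + (\<Sum>m. tav (Suc m) i t - tav m i t)) sequentially"
    by (intro uniform_limit_intros)
  have s: "1 + (\<Sum>m<n. tav (Suc m) i t - tav m i t) = tav n i t" for n t
    by (subst sum_lessThan_telescope) simp
  have A: "A i t = 1 + (\<Sum>m. tav (Suc m) i t - tav m i t)" if "t \<in> {0..T}" for t
    unfolding A_def using tendsto_uniform_limitI[OF u that] unfolding s by (rule limI)
  have u': "uniform_limit {0..T} (\<lambda>n. tav n i) (\<lambda>t. 1 + (\<Sum>m. tav (Suc m) i t - tav m i t)) sequentially"
    using u unfolding s .
  show ?thesis by (rule iffD1[OF uniform_limit_cong' u']) (assumption | rule refl A[symmetric])+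
qed

lemma tendsto_A: "t \<ge> 0 \<Longrightarrow> (\<lambda>n. tav n i t) \<longlonglongrightarrow> A i t"
  using tendsto_uniform_limitI[OF uniform_A[where T = t and i = i], of t] by simp

lemma continuous_A: "continuous_on {0..} (A i)"
proof -
  have "continuous_on {0..T} (A i)" for T
    by (rule uniform_limit_theorem[OF _ uniform_A])
       (auto intro!: always_eventually continuous_on_subset[OF continuous_a])
  thus ?thesis
    unfolding continuous_on_eq_continuous_within
  proof (intro ballI)
    fix t :: real assume t: "t \<in> {0..}" and c: "\<And>T. \<forall>x\<in>{0..T}. continuous (at x within {0..T}) (A i)"
    have "at t within {0..t+1} = at t within {0..}"
      by (rule at_within_nhd[of _ "{t-1<..<t+1}"]) auto
    thus "continuous (at t within {0..}) (A i)" using bspec[OF c[of "t+1"], of t] t by simp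
  qed
qed

lemma A_nonneg: "t \<ge> 0 \<Longrightarrow> 0 \<le> A i t"
  using tendsto_A by (rule tendsto_lowerbound) (auto intro: always_eventually less_imp_le a_pos)

text \<open>Uniform convergence lets the limit pass through the integral, so \<open>A\<close> solves
  the untruncated equation.\<close>

lemma A_eq:
  assumes t: "t \<ge> 0" shows "A i t = exp (- integral {0..t} (rate A i))"
proof -
  have "uniform_limit {0..t} (\<lambda>n. rate (tav n) i) (rate A i) sequentially"
    unfolding rate_def[abs_def]
    by (intro uniform_limit_sum_finite bounded_linear_mult_right[THEN bounded_linear.uniform_limit] uniform_A) simp
  hence "uniform_limit (cbox 0 t) (\<lambda>n. rate (tav n) i) (rate A i) sequentially" by simp
  then obtain I J where IJ: "\<And>n. (rate (tav n) i has_integral I n) (cbox 0 t)" "(rate A i has_integral J) (cbox 0 t)" "I \<longlonglongrightarrow> J"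
    by (rule uniform_limit_integral_cbox)
       (auto intro!: continuous_on_subset[OF continuous_rate[OF continuous_a]] )
  hence "I n = integral {0..t} (rate (tav n) i)" "J = integral {0..t} (rate A i)" for n
    by (auto intro!: integral_unique[symmetric])
  hence "I = (\<lambda>n. integral {0..t} (rate (tav n) i))" "J = integral {0..t} (rate A i)" by auto
  with IJ(3) have "(\<lambda>n. integral {0..t} (rate (tav n) i)) \<longlonglongrightarrow> integral {0..t} (rate A i)" by simp
  hence "(\<lambda>n. tav (Suc n) i t) \<longlonglongrightarrow> exp (- integral {0..t} (rate A i))"
    unfolding a_Suc by (intro tendsto_intros)
  moreover have "(\<lambda>n. tav (Suc n) i t) \<longlonglongrightarrow> A i t" using tendsto_A[OF t] by (rule LIMSEQ_Suc)
  ultimately show ?thesis using LIMSEQ_unique by blast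
qed

text \<open>\<open>X i\<close> is the limiting density of available points of colour
  \<open>i\<close>. Passing from \<open>A\<close> to \<open>X\<close> and its integral
  \<open>I\<close> makes the system symmetric in the colours: each colour is suppressed by the
  integrated densities of all the others.\<close>

definition X :: "nat \<Rightarrow> real \<Rightarrow> real" where "X i t = p i * A i t"
definition I :: "nat \<Rightarrow> real \<Rightarrow> real" where "I i t = integral {0..t} (X i)"

lemma continuous_X: "continuous_on {0..} (X i)"
  unfolding X_def[abs_def] by (intro continuous_intros continuous_A)

lemma X_eq:
  assumes t: "t \<ge> 0" shows "X i t = p i * exp (- (\<Sum>j\<in>{1..k} - {i}. I j t))"
proof -
  have "integral {0..t} (rate A i) = (\<Sum>j\<in>{1..k} - {i}. I j t)"
    unfolding rate_def[abs_def] I_def X_def[abs_def]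
    by (intro integral_sum integrable_continuous_interval continuous_intros continuous_on_subset[OF continuous_A]) auto
  thus ?thesis by (simp add: X_def A_eq[OF t])
qed

lemma I_deriv: "t \<ge> 0 \<Longrightarrow> (I i has_real_derivative X i t) (at t within {0..})"
  unfolding I_def[abs_def] by (rule cont_indef[OF continuous_X])

lemma I_0: "I i 0 = 0" by (simp add: I_def)


lemma p1_pos: "p 1 > 0"
  using dom[of 2] p_nonneg[of 2] k2 by simp

definition r where "r i = p i / p 1"

lemma r_bounds: "i \<in> {2..k} \<Longrightarrow> 0 \<le> r i \<and> r i < 1"
  using dom[of i] p_nonneg[of i] p1_pos by (auto simp: r_def)

definition lam where "lam = p 1 * (\<Prod>i=2..k. 1 - r i)"

lemma lam_pos: "lam > 0"
  unfolding lam_def using p1_pos r_bounds by (intro mult_pos_pos prod_pos) auto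

text \<open>The exponents for the colours 1 and \<open>i\<close> share every term except
  \<open>I 1\<close> and \<open>I i\<close>, so the ratio of the two densities involves only
  \<open>I 1 - I i\<close>.\<close>

lemma ratio:
  assumes i: "i \<in> {2..k}" and t: "t \<ge> 0"
  shows "X i t = X 1 t * r i * exp (- (I 1 t - I i t))"
proof -
  have "(\<Sum>j\<in>{1..k} - {1}. I j t) + I 1 t = (\<Sum>j\<in>{1..k} - {i}. I j t) + I i t"
    using i k2 by (simp add: sum_diff1)
  hence "- (\<Sum>j\<in>{1..k} - {i}. I j t) = - (\<Sum>j\<in>{1..k} - {1}. I j t) - (I 1 t - I i t)" by simp
  hence "exp (- (\<Sum>j\<in>{1..k} - {i}. I j t)) = exp (- (\<Sum>j\<in>{1..k} - {1}. I j t)) * exp (- (I 1 t - I i t))"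
    by (simp only: exp_add[symmetric]) simp
  thus ?thesis using p1_pos by (simp add: X_eq[OF t] r_def)
qed

(* The difference of the equations for two colours is linear in exp (I 1 - I i). *)
lemma exp_diff_eq:
  assumes i: "i \<in> {2..k}" and t: "t \<ge> 0"
  shows "exp (I 1 t - I i t) = r i + (1 - r i) * exp (I 1 t)"
proof -
  \<comment> \<open>\<open>D = exp (I 1 - I i)\<close> satisfies
    \<open>D' = X 1 * (D - r i)\<close>. The integrating factor is \<open>exp (- I 1)\<close>, and
    \<open>D = 1\<close> at time 0.\<close>
  let ?f = "\<lambda>t. (exp (I 1 t - I i t) - r i) * exp (- I 1 t)"
  have "(?f has_real_derivative 0) (at s within {0..})" if s: "s \<in> {0..}" for s
  proof -
    have "(?f has_real_derivative
       (exp (I 1 s - I i s) * (X 1 s - X i s)) * exp (- I 1 s) + exp (- I 1 s) * (- X 1 s) * (exp (I 1 s - I i s) - r i)) (at s within {0..})"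
      using s by (auto intro!: derivative_eq_intros I_deriv)
    moreover have e: "exp D * (x * y * exp (- D)) = x * y" for D x y :: real
      by (simp add: exp_minus)
    have "exp (I 1 s - I i s) * X i s = X 1 s * r i"
      using s by (subst ratio[OF i]) (auto simp only: e atLeast_iff)
    hence "(exp (I 1 s - I i s) * (X 1 s - X i s)) * exp (- I 1 s) + exp (- I 1 s) * (- X 1 s) * (exp (I 1 s - I i s) - r i) = 0"
      by (simp add: algebra_simps)
    ultimately show ?thesis by simp
  qed
  hence "\<exists>c. \<forall>x\<in>{0..}. ?f x = c"
    by (intro has_field_derivative_zero_constant) auto
  hence "?f t = ?f 0" using t by auto
  hence "exp (I 1 t - I i t) - r i = (1 - r i) * exp (I 1 t)"
    by (simp add: I_0 exp_minus field_simps)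
  thus ?thesis by simp
qed

lemma exp_I:
  assumes i: "i \<in> {2..k}" and t: "t \<ge> 0"
  shows "exp (- I i t) = r i * exp (- I 1 t) + (1 - r i)"
proof -
  have "exp (- I i t) = exp (I 1 t - I i t) * exp (- I 1 t)" by (simp flip: exp_add)
  also have "\<dots> = r i * exp (- I 1 t) + (1 - r i) * (exp (I 1 t) * exp (- I 1 t))"
    by (simp only: exp_diff_eq[OF assms] ring_distribs mult.assoc)
  also have "exp (I 1 t) * exp (- I 1 t) = 1" by (simp flip: exp_add)
  finally show ?thesis by simp
qed

text \<open>All other colours are now expressed through the single unknown
  \<open>exp (- I 1 t)\<close>. Replacing it by 0 turns the product into \<open>lam\<close>, which
  is both a lower bound and the limit of \<open>X 1\<close>.\<close>

lemma X1_eq: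
  assumes t: "t \<ge> 0" shows "X 1 t = p 1 * (\<Prod>i=2..k. r i * exp (- I 1 t) + (1 - r i))"
proof -
  have "{1..k} - {1} = {2..k}" by auto
  hence "X 1 t = p 1 * (\<Prod>i=2..k. exp (- I i t))"
    by (simp add: X_eq[OF t] exp_sum flip: sum_negf)
  thus ?thesis using exp_I[OF _ t] by simp
qed

lemma X1_ge: "t \<ge> 0 \<Longrightarrow> lam \<le> X 1 t"
  unfolding X1_eq lam_def using r_bounds p1_pos
  by (intro mult_left_mono prod_mono) (auto intro: less_imp_le)

text \<open>A density of colour 1 that stays above \<open>lam > 0\<close> drives the unknown
  \<open>exp (- I 1 t)\<close> to 0 exponentially fast. This is where the strict dominance of colour
  1 decides the limit.\<close>

lemma I1_ge: "t \<ge> 0 \<Longrightarrow> lam * t \<le> I 1 t"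
proof -
  assume t: "t \<ge> 0"
  have "integral {0..t} (\<lambda>_. lam) \<le> integral {0..t} (X 1)"
    by (intro integral_le integrable_continuous_interval continuous_on_subset[OF continuous_X]) (use X1_ge in auto)
  thus ?thesis using t by (simp add: I_def mult.commute)
qed

lemma exp_I1_tendsto: "((\<lambda>t. exp (- I 1 t)) \<longlongrightarrow> 0) at_top"
proof (rule tendsto_sandwich[of "\<lambda>_. 0" _ _ "\<lambda>t. exp (- (lam * t))"])
  show "((\<lambda>t. exp (- (lam * t))) \<longlongrightarrow> 0) at_top"     by (rule filterlim_compose[OF exp_at_bot], subst filterlim_uminus_at_bot)
       (simp add: filterlim_tendsto_pos_mult_at_top[OF tendsto_const lam_pos filterlim_ident])
  show "\<forall>\<^sub>F t in at_top. exp (- I 1 t) \<le> exp (- (lam * t))"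
    using eventually_ge_at_top[of 0] by eventually_elim (simp only: exp_le_cancel_iff neg_le_iff_le I1_ge)
qed auto

lemma X1_tendsto: "(X 1 \<longlongrightarrow> lam) at_top"
proof -
  have "((\<lambda>t. p 1 * (\<Prod>i=2..k. r i * exp (- I 1 t) + (1 - r i))) \<longlongrightarrow> p 1 * (\<Prod>i=2..k. r i * 0 + (1 - r i))) at_top"
    by (intro tendsto_intros exp_I1_tendsto)
  moreover have "\<forall>\<^sub>F t in at_top. X 1 t = p 1 * (\<Prod>i=2..k. r i * exp (- I 1 t) + (1 - r i))"
    using eventually_ge_at_top[of 0] by eventually_elim (rule X1_eq)
  ultimately show ?thesis by (simp add: lam_def filterlim_cong)
qed

text \<open>In \<open>ratio\<close> the last factor is at most
  \<open>exp (- I 1 t) / (1 - r i)\<close> by \<open>exp_diff_eq\<close>, while \<open>X 1\<close>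
  converges.\<close>

lemma Xi_tendsto:
  assumes i: "i \<in> {2..k}" shows "(X i \<longlongrightarrow> 0) at_top"
proof (rule tendsto_sandwich[of "\<lambda>_. 0" _ _ "\<lambda>t. X 1 t * r i * (exp (- I 1 t) / (1 - r i))"])
  show "\<forall>\<^sub>F t in at_top. 0 \<le> X i t"
    using eventually_ge_at_top[of 0] by eventually_elim (use i p_nonneg A_nonneg in \<open>auto simp: X_def\<close>)
  show "\<forall>\<^sub>F t in at_top. X i t \<le> X 1 t * r i * (exp (- I 1 t) / (1 - r i))"
    using eventually_ge_at_top[of 0]
  proof eventually_elim
    case (elim t)
    have r: "0 \<le> r i" "r i < 1" using r_bounds[OF i] by auto
    have "(1 - r i) * exp (I 1 t) \<le> exp (I 1 t - I i t)" using exp_diff_eq[OF i elim] r by simp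
    hence "inverse (exp (I 1 t - I i t)) \<le> inverse ((1 - r i) * exp (I 1 t))"
      using r by (intro le_imp_inverse_le) auto
    hence "exp (- (I 1 t - I i t)) \<le> exp (- I 1 t) / (1 - r i)"
      unfolding exp_minus divide_inverse inverse_mult_distrib by (simp add: mult.commute)
    moreover have "0 \<le> X 1 t * r i" using X1_ge[OF elim] lam_pos r by simp
    ultimately show ?case unfolding ratio[OF i elim] by (rule mult_left_mono)
  qed
  have "((\<lambda>t. X 1 t * r i * (exp (- I 1 t) / (1 - r i))) \<longlongrightarrow> lam * r i * (0 / (1 - r i))) at_top"
    using r_bounds[OF i] by (intro tendsto_intros exp_I1_tendsto X1_tendsto) auto
  thus "((\<lambda>t. X 1 t * r i * (exp (- I 1 t) / (1 - r i))) \<longlongrightarrow> 0) at_top" by simp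
qed auto

lemma lam_equal: "(\<forall>i\<in>{2..k}. p i = p 2) \<Longrightarrow> lam = (p 1 - p 2) ^ (k - 1) / p 1 ^ (k - 2)"
proof -
  assume eq: "\<forall>i\<in>{2..k}. p i = p 2"
  have "1 - r i = (p 1 - p 2) / p 1" if "i \<in> {2..k}" for i
    using bspec[OF eq that] p1_pos unfolding r_def by (simp add: diff_divide_distrib)
  hence "lam = p 1 * (\<Prod>i=2..k. (p 1 - p 2) / p 1)"
    unfolding lam_def by (intro arg_cong[where f="\<lambda>x. p 1 * x"] prod.cong refl)
  moreover obtain m where "k = Suc (Suc m)" using k2 by (metis add_2_eq_Suc le_Suc_ex)
  ultimately show ?thesis using p1_pos by (simp add: power_divide)
qed

text \<open>The time is chosen first, from the limits of the fixed point, and only then the depth.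
  Both parities are recorded for colour 1, because even depths bound availability from above and odd
  ones from below; for the other colours an upper bound suffices.\<close>

lemma tree_av_limit:
  assumes "e > 0"
  obtains t n where "t > 0" "\<bar>p 1 * tav (2 * n) 1 t - lam\<bar> < e" "\<bar>p 1 * tav (Suc (2 * n)) 1 t - lam\<bar> < e"
    "(\<Sum>j=2..k. p j * tav (2 * n) j t) < e"
proof -
  have "((\<lambda>t. \<Sum>j=2..k. X j t) \<longlongrightarrow> (\<Sum>j=2..k. 0)) at_top"
    by (intro tendsto_sum Xi_tendsto)
  hence "\<forall>\<^sub>F t in at_top. (\<Sum>j=2..k. X j t) < e" using assms by (intro order_tendstoD) auto
  moreover have "\<forall>\<^sub>F t in at_top. dist (X 1 t) lam < e" using X1_tendsto assms by (rule tendstoD)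
  ultimately have "\<forall>\<^sub>F t in at_top. t > 0 \<and> (\<Sum>j=2..k. X j t) < e \<and> dist (X 1 t) lam < e"
    using eventually_gt_at_top[of 0] by eventually_elim auto
  then obtain t where t: "t > 0" "(\<Sum>j=2..k. X j t) < e" "dist (X 1 t) lam < e"
    using eventually_happens'[OF trivial_limit_at_top_linorder] by blast
  have "(\<lambda>n. \<Sum>j=2..k. p j * tav n j t) \<longlonglongrightarrow> (\<Sum>j=2..k. X j t)"
    unfolding X_def by (intro tendsto_intros tendsto_A less_imp_le[OF t(1)])
  hence e1: "\<forall>\<^sub>F n in sequentially. (\<Sum>j=2..k. p j * tav n j t) < e" using t by (intro order_tendstoD)
  have "(\<lambda>n. dist (p 1 * tav n 1 t) lam) \<longlonglongrightarrow> dist (X 1 t) lam"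
    unfolding X_def by (intro tendsto_intros tendsto_A less_imp_le[OF t(1)])
  hence "\<forall>\<^sub>F n in sequentially. dist (p 1 * tav n 1 t) lam < e" using t by (intro order_tendstoD)
  with e1 have "\<forall>\<^sub>F n in sequentially. (\<Sum>j=2..k. p j * tav n j t) < e \<and> dist (p 1 * tav n 1 t) lam < e"
    by eventually_elim auto
  then obtain N where N: "\<And>n. n \<ge> N \<Longrightarrow> (\<Sum>j=2..k. p j * tav n j t) < e \<and> dist (p 1 * tav n 1 t) lam < e"
    unfolding eventually_sequentially by blast
  show ?thesis using N[of "2 * N"] N[of "Suc (2 * N)"] t(1)
    by (intro that[of t N]) (auto simp: dist_real_def simp del: tree_av.simps)
qed

end

subsection \<open>Volume distance\<close>

definition vdist :: "nat \<Rightarrow> (nat \<Rightarrow> real) \<Rightarrow> (nat \<Rightarrow> real) \<Rightarrow> real" where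
  "vdist d x y = unit_ball_vol (real d) * euclid_dist d x y ^ d"

lemma euclid_dist_nonneg [simp]: "0 \<le> euclid_dist d x y"
  by (simp add: euclid_dist_def)

lemma euclid_dist_commute: "euclid_dist d x y = euclid_dist d y x"
  by (simp add: euclid_dist_def L2_set_def power2_commute)

lemma euclid_dist_triangle: "euclid_dist d x z \<le> euclid_dist d x y + euclid_dist d y z"
  using L2_set_triangle_ineq[of "\<lambda>i. x i - y i" "\<lambda>i. y i - z i" "{..<d}"]
  by (simp add: euclid_dist_def)

lemma space_euclid: "space (euclid d) = {..<d} \<rightarrow>\<^sub>E UNIV"
  by (simp add: euclid_def space_PiM)

lemma sets_euclid: "sets (euclid d) = sets (PiM {..<d} (\<lambda>_. lborel))"
  by (simp add: euclid_def)

lemma measurable_euclid_component [measurable]: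
  assumes "i < d" shows "(\<lambda>x. x i) \<in> borel_measurable (euclid d)"
  using measurable_component_singleton[of i "{..<d}" "\<lambda>_. lborel :: real measure"] assms
  by (simp add: euclid_def)

lemma sigma_finite_euclid: "sigma_finite_measure (euclid d)"
proof -
  interpret product_sigma_finite "\<lambda>_::nat. lborel :: real measure" by standard
  show ?thesis unfolding euclid_def by (rule sigma_finite) simp
qed

lemma euclid_dist_eq_0_iff:
  assumes "x \<in> space (euclid d)" "y \<in> space (euclid d)"
  shows "euclid_dist d x y = 0 \<longleftrightarrow> x = y"
proof -
  have "euclid_dist d x y = 0 \<longleftrightarrow> (\<forall>i<d. x i = y i)"
    by (auto simp: euclid_dist_def L2_set_eq_0_iff)
  also have "\<dots> \<longleftrightarrow> x = y"
    using PiE_ext[of x "{..<d}" "\<lambda>_. UNIV" y] assms by (auto simp: space_euclid)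
  finally show ?thesis .
qed

lemma measurable_euclid_dist [measurable]:
  assumes [measurable]: "f \<in> M \<rightarrow>\<^sub>M euclid d" "g \<in> M \<rightarrow>\<^sub>M euclid d"
  shows "(\<lambda>w. euclid_dist d (f w) (g w)) \<in> borel_measurable M"
proof -
  have "(\<lambda>w. f w i) \<in> borel_measurable M" "(\<lambda>w. g w i) \<in> borel_measurable M" if "i < d" for i
    using that by measurable
  thus ?thesis unfolding euclid_dist_def L2_set_def by measurable
qed

lemma measurable_vdist [measurable]:
  assumes [measurable]: "f \<in> M \<rightarrow>\<^sub>M euclid d" "g \<in> M \<rightarrow>\<^sub>M euclid d"
  shows "(\<lambda>w. vdist d (f w) (g w)) \<in> borel_measurable M"
  unfolding vdist_def by measurable

lemma vdist_commute: "vdist d x y = vdist d y x"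
  by (simp add: vdist_def euclid_dist_commute)

lemma unit_ball_vol_nat_pos: "0 < unit_ball_vol (real d)"
  by simp

lemma unit_ball_vol_nat_neq_0: "unit_ball_vol (real d) \<noteq> 0"
  by (rule less_imp_neq[OF unit_ball_vol_nat_pos, symmetric])

lemma vdist_nonneg [simp]: "0 \<le> vdist d x y"
  using unit_ball_vol_nat_pos[of d] by (simp add: vdist_def)

lemma vdist_less_iff:
  assumes "d \<ge> 1"
  shows "vdist d x y < vdist d x' y' \<longleftrightarrow> euclid_dist d x y < euclid_dist d x' y'"
  using assms unit_ball_vol_nat_pos[of d]
  by (auto simp: vdist_def intro!: power_strict_mono dest: power_less_imp_less_base)

lemma vdist_eq_0_iff:
  assumes "d \<ge> 1" "x \<in> space (euclid d)" "y \<in> space (euclid d)"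
  shows "vdist d x y = 0 \<longleftrightarrow> x = y"
  using assms euclid_dist_eq_0_iff[OF assms(2,3)] unit_ball_vol_nat_neq_0[of d]
  by (auto simp: vdist_def)

text \<open>The Euclidean radius of a ball of volume \<open>t\<close>.\<close>

definition vrad :: "nat \<Rightarrow> real \<Rightarrow> real" where
  "vrad d t = root d (t / unit_ball_vol (real d))"

lemma vrad_nonneg: "t \<ge> 0 \<Longrightarrow> vrad d t \<ge> 0"
  using unit_ball_vol_nat_pos[of d] by (cases "d = 0") (simp_all add: vrad_def)

lemma vrad_pow: "d \<ge> 1 \<Longrightarrow> t \<ge> 0 \<Longrightarrow> unit_ball_vol (real d) * vrad d t ^ d = t"
  using unit_ball_vol_nat_neq_0[of d] by (simp add: vrad_def)

lemma vdist_less_vrad: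
  assumes "d \<ge> 1" "t \<ge> 0"
  shows "vdist d x y < t \<longleftrightarrow> euclid_dist d x y < vrad d t"
proof -
  have "vdist d x y < t \<longleftrightarrow> euclid_dist d x y ^ d < vrad d t ^ d"
    using vrad_pow[OF assms] unit_ball_vol_nat_pos[of d]
    by (metis vdist_def mult_less_cancel_left_pos)
  also have "\<dots> \<longleftrightarrow> euclid_dist d x y < vrad d t"
    using assms vrad_nonneg[of t d] by (auto intro!: power_strict_mono dest: power_less_imp_less_base)
  finally show ?thesis .
qed

lemma vdist_le_vrad:
  assumes "d \<ge> 1" "t \<ge> 0"
  shows "vdist d x y \<le> t \<longleftrightarrow> euclid_dist d x y \<le> vrad d t"
proof -
  have "vdist d x y \<le> t \<longleftrightarrow> euclid_dist d x y ^ d \<le> vrad d t ^ d"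
    using vrad_pow[OF assms] unit_ball_vol_nat_pos[of d]
    by (metis vdist_def mult_le_cancel_left_pos)
  also have "\<dots> \<longleftrightarrow> euclid_dist d x y \<le> vrad d t"
    using assms vrad_nonneg[of t d] by simp
  finally show ?thesis .
qed

section \<open>Translations, volumes of balls and their overlaps\<close>

definition eshift :: "nat \<Rightarrow> (nat \<Rightarrow> real) \<Rightarrow> (nat \<Rightarrow> real) \<Rightarrow> (nat \<Rightarrow> real)" where
  "eshift d z x = (\<lambda>i\<in>{..<d}. x i + z i)"

lemma measurable_eshift [measurable]: "eshift d z \<in> euclid d \<rightarrow>\<^sub>M euclid d"
  unfolding eshift_def euclid_def by measurable

text \<open>On boxes the claim splits into the translation invariance of \<open>lborel\<close> in
  each coordinate, and boxes determine the product measure.\<close>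

lemma distr_eshift: "distr (euclid d) (euclid d) (eshift d z) = euclid d"
proof -
  interpret product_sigma_finite "\<lambda>_::nat. lborel :: real measure" by standard
  have "distr (euclid d) (euclid d) (eshift d z) = PiM {..<d} (\<lambda>_. lborel)"
  proof (rule PiM_eqI)
    fix A assume A: "\<And>i. i \<in> {..<d} \<Longrightarrow> A i \<in> sets (lborel :: real measure)"
    have eq: "eshift d z -` Pi\<^sub>E {..<d} A \<inter> space (euclid d) = (\<Pi>\<^sub>E i\<in>{..<d}. (\<lambda>x. x + z i) -` A i)"
      by (auto simp: space_euclid eshift_def PiE_iff extensional_def)
    have m: "(\<lambda>x. x + z i) -` A i \<in> sets (lborel :: real measure)" if "i < d" for i
      using A[of i] that measurable_sets_borel[of "\<lambda>x. x + z i" borel "A i"] by auto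
    have e: "emeasure lborel ((\<lambda>x. x + z i) -` A i) = emeasure lborel (A i)" if "i < d" for i
    proof -
      have "emeasure lborel (A i) = emeasure (distr lborel borel ((+) (z i))) (A i)"
        using lborel_distr_plus[of "z i"] by simp
      also have "\<dots> = emeasure lborel ((\<lambda>x. x + z i) -` A i)"
        using A[of i] that by (subst emeasure_distr) (auto intro!: arg_cong[where f="emeasure lborel"] simp: add.commute)
      finally show ?thesis by simp
    qed
    have "emeasure (distr (euclid d) (euclid d) (eshift d z)) (Pi\<^sub>E {..<d} A)
       = emeasure (euclid d) (\<Pi>\<^sub>E i\<in>{..<d}. (\<lambda>x. x + z i) -` A i)"
      using A by (subst emeasure_distr) (auto simp: sets_euclid eq[symmetric] intro!: sets_PiM_I_finite)
    also have "\<dots> = (\<Prod>i\<in>{..<d}. emeasure lborel ((\<lambda>x. x + z i) -` A i))"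
      unfolding euclid_def using m by (intro emeasure_PiM) auto
    finally show "emeasure (distr (euclid d) (euclid d) (eshift d z)) (Pi\<^sub>E {..<d} A) = (\<Prod>i\<in>{..<d}. emeasure lborel (A i))"
      using e by simp
  qed (simp_all add: sets_euclid)
  thus ?thesis by (simp add: euclid_def)
qed

lemma euclid_dist_eshift [simp]: "euclid_dist d (eshift d z x) (eshift d z y) = euclid_dist d x y"
  unfolding euclid_dist_def eshift_def by (intro L2_set_cong) auto

lemma vdist_eshift [simp]: "vdist d (eshift d z x) (eshift d z y) = vdist d x y"
  by (simp add: vdist_def)

lemma emeasure_euclid_eshift:
  assumes "B \<in> sets (euclid d)"
  shows "emeasure (euclid d) (eshift d z -` B \<inter> space (euclid d)) = emeasure (euclid d) B"
  using assms by (subst (2) distr_eshift[of d z, symmetric]) (simp add: emeasure_distr)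

lemma emeasure_vball_pos:
  assumes d: "d \<ge> 1" and t: "t > 0"
  shows "emeasure (euclid d) {y \<in> space (euclid d). vdist d x y \<le> t} = ennreal t"
proof -
  let ?r = "vrad d t"
  have r: "?r > 0" using d t unit_ball_vol_nat_pos[of d] by (simp add: vrad_def)
  let ?B = "{f. sqrt (\<Sum>i\<in>{..<d}. (f i)\<^sup>2) \<le> ?r} \<inter> space (euclid d)"
  have B: "emeasure (euclid d) ?B = ennreal t"
    using emeasure_cball_aux[of "{..<d}" ?r] r vrad_pow[of d t] d t by (simp add: euclid_def)
  have [measurable]: "?B \<in> sets (euclid d)"
  proof -
    have "?B = {f \<in> space (euclid d). sqrt (\<Sum>i\<in>{..<d}. (f i)\<^sup>2) \<le> ?r}" by auto
    also have "\<dots> \<in> sets (euclid d)" by measurable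
    finally show ?thesis .
  qed
  have "eshift d (\<lambda>i. - x i) -` ?B \<inter> space (euclid d) = {y \<in> space (euclid d). vdist d x y \<le> t}"
    using d t by (auto simp: vdist_le_vrad euclid_dist_def L2_set_def eshift_def space_euclid power2_commute)
  thus ?thesis using emeasure_euclid_eshift[of ?B d "\<lambda>i. - x i"] B by simp
qed

text \<open>The centre need not lie in the space, as with a midpoint of two points. Only its
  coordinates below \<open>d\<close> matter, so it can be replaced by an extensional
  function.\<close>

lemma measurable_vdist_left [measurable]: "vdist d x \<in> borel_measurable (euclid d)"
proof -
  have eq: "vdist d x = vdist d (restrict x {..<d})"
    unfolding vdist_def euclid_dist_def
    by (intro ext arg_cong[where f="\<lambda>a. unit_ball_vol (real d) * a ^ d"] L2_set_cong) auto
  have "restrict x {..<d} \<in> space (euclid d)" by (simp add: space_euclid)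
  thus ?thesis by (subst eq, intro measurable_vdist) auto
qed

lemma emeasure_vball:
  assumes d: "d \<ge> 1"
  shows "emeasure (euclid d) {y \<in> space (euclid d). vdist d x y \<le> t} = ennreal t"
proof (cases "t > 0")
  case True thus ?thesis using emeasure_vball_pos[OF d] by simp
next
  case False
  \<comment> \<open>For \<open>t\<close> at most 0 the set lies in balls of volume
    \<open>1 / real (Suc n)\<close>, so it is null, in agreement with
    \<open>ennreal t = 0\<close>.\<close>
  have "emeasure (euclid d) {y \<in> space (euclid d). vdist d x y \<le> t} \<le> ennreal (1 / real (Suc n))" for n
  proof -
    have "emeasure (euclid d) {y \<in> space (euclid d). vdist d x y \<le> t}
      \<le> emeasure (euclid d) {y \<in> space (euclid d). vdist d x y \<le> 1 / real (Suc n)}"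
    proof (intro emeasure_mono subsetI)
      fix y assume "y \<in> {y \<in> space (euclid d). vdist d x y \<le> t}"
      moreover have "t \<le> 0" "(0::real) \<le> 1 / real (Suc n)" using False by auto
      ultimately show "y \<in> {y \<in> space (euclid d). vdist d x y \<le> 1 / real (Suc n)}"
        using order_trans by (metis (mono_tags, lifting) mem_Collect_eq)
    qed simp
    thus ?thesis using emeasure_vball_pos[OF d, of "1 / real (Suc n)" x] by simp
  qed
  moreover have "(\<lambda>n. ennreal (1 / real (Suc n))) \<longlonglongrightarrow> ennreal 0"
    by (intro tendsto_ennrealI lim_1_over_n[THEN LIMSEQ_Suc, unfolded o_def] )
  ultimately have "emeasure (euclid d) {y \<in> space (euclid d). vdist d x y \<le> t} \<le> ennreal 0"
    by (intro tendsto_lowerbound[of _ _ sequentially]) auto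
  thus ?thesis using False by (simp add: ennreal_neg)
qed

text \<open>This is the reason for measuring distance by volume: from any point and in any
  dimension, distances are spread like Lebesgue measure on the half-line. The sets
  \<open>{..t}\<close> generate the Borel sets and have finite measure, so it is enough to compare
  them.\<close>

lemma distr_vdist:
  assumes d: "d \<ge> 1"
  shows "distr (euclid d) borel (vdist d x) = density lborel (indicator {0..})"
proof (rule measure_eqI_generator_eq[where E="range (\<lambda>t::real. {..t})" and \<Omega>=UNIV and A="\<lambda>n. {..real n}"])
  show "Int_stable (range (\<lambda>t::real. {..t}))"
    by (auto simp: Int_stable_def)
  show "(\<Union>i. {..real i}) = (UNIV::real set)"
    using real_arch_simple by auto
  fix X assume "X \<in> range (\<lambda>t::real. {..t})"
  then obtain t where t: "X = {..t}" by auto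
  have "emeasure (distr (euclid d) borel (vdist d x)) X = ennreal t"
    unfolding t by (subst emeasure_distr) (auto simp: emeasure_vball[OF d, of x t, symmetric] vimage_def intro!: arg_cong[where f="emeasure _"])
  moreover have "emeasure (density lborel (indicator {0..})) X = ennreal t"
  proof -
    have "emeasure (density lborel (indicator {0..})) X = emeasure lborel ({0..} \<inter> {..t})"
      unfolding t by (subst emeasure_density) (auto simp: nn_integral_indicator[symmetric] indicator_inter_arith simp del: nn_integral_indicator)
    also have "{0..} \<inter> {..t} = {0..t}" by auto
    also have "emeasure lborel {0..t} = ennreal t" by (cases "t \<ge> 0") (auto simp: ennreal_neg)
    finally show ?thesis .
  qed
  ultimately show "emeasure (distr (euclid d) borel (vdist d x)) X = emeasure (density lborel (indicator {0..})) X" by simp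
next
  fix i show "emeasure (distr (euclid d) borel (vdist d x)) {..real i} \<noteq> \<infinity>"
    using emeasure_vball[OF d, of x "real i"] by (subst emeasure_distr) (auto simp: vimage_def Int_def conj_commute)
qed (auto simp: borel_eq_atMost)

lemma nn_integral_vdist:
  assumes d: "d \<ge> 1" and [measurable]: "f \<in> borel_measurable borel"
  shows "(\<integral>\<^sup>+y. f (vdist d x y) \<partial>euclid d) = (\<integral>\<^sup>+s. indicator {0..} s * f s \<partial>lborel)"
proof -
  have "(\<integral>\<^sup>+y. f (vdist d x y) \<partial>euclid d) = (\<integral>\<^sup>+s. f s \<partial>distr (euclid d) borel (vdist d x))"
    by (subst nn_integral_distr) auto
  thus ?thesis by (simp add: distr_vdist[OF d] nn_integral_density)
qed

lemma emeasure_open_vball: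
  assumes d: "d \<ge> 1"
  shows "emeasure (euclid d) {y \<in> space (euclid d). vdist d x y < t} = ennreal t"
proof -
  have "emeasure (euclid d) {y \<in> space (euclid d). vdist d x y < t} = (\<integral>\<^sup>+y. indicator {..<t} (vdist d x y) \<partial>euclid d)"
    by (subst nn_integral_indicator[symmetric]) (auto intro!: nn_integral_cong simp del: nn_integral_indicator split: split_indicator)
  also have "\<dots> = (\<integral>\<^sup>+s. indicator {0..<t} s \<partial>lborel)"
    by (subst nn_integral_vdist[OF d])
       (auto intro!: nn_integral_cong simp del: nn_integral_indicator split: split_indicator)
  also have "\<dots> = ennreal t" by (cases "t \<ge> 0") (auto simp: ennreal_neg)
  finally show ?thesis .
qed

lemma emeasure_vsphere:
  assumes d: "d \<ge> 1"
  shows "emeasure (euclid d) {y \<in> space (euclid d). vdist d x y = s} = 0"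
proof -
  have "emeasure (euclid d) {y \<in> space (euclid d). vdist d x y = s} = (\<integral>\<^sup>+y. indicator {s} (vdist d x y) \<partial>euclid d)"
    by (subst nn_integral_indicator[symmetric]) (auto intro!: nn_integral_cong simp del: nn_integral_indicator split: split_indicator)
  also have "\<dots> \<le> (\<integral>\<^sup>+s'. indicator {s} s' \<partial>lborel)"
    by (subst nn_integral_vdist[OF d])
       (auto intro!: nn_integral_mono simp del: nn_integral_indicator split: split_indicator)
  finally show ?thesis by simp
qed

text \<open>Apollonius' formula for the median of a triangle, checked coordinate by
  coordinate.\<close>

lemma euclid_median:
  "(euclid_dist d y (\<lambda>i. (x i + w i) / 2))\<^sup>2 =
     ((euclid_dist d x y)\<^sup>2 + (euclid_dist d w y)\<^sup>2) / 2 - (euclid_dist d x w)\<^sup>2 / 4"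
proof -
  have "(\<Sum>i<d. (y i - (x i + w i) / 2)\<^sup>2) =
    (\<Sum>i<d. ((x i - y i)\<^sup>2 + (w i - y i)\<^sup>2) / 2 - (x i - w i)\<^sup>2 / 4)"
    by (intro sum.cong refl) (simp add: power2_eq_square field_simps)
  also have "\<dots> = ((\<Sum>i<d. (x i - y i)\<^sup>2) + (\<Sum>i<d. (w i - y i)\<^sup>2)) / 2 - (\<Sum>i<d. (x i - w i)\<^sup>2) / 4"
    by (simp add: sum_subtractf sum.distrib flip: sum_divide_distrib)
  finally have eq: "(\<Sum>i<d. (y i - (x i + w i) / 2)\<^sup>2) =
    ((\<Sum>i<d. (x i - y i)\<^sup>2) + (\<Sum>i<d. (w i - y i)\<^sup>2)) / 2 - (\<Sum>i<d. (x i - w i)\<^sup>2) / 4" .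
  have s: "(euclid_dist d a b)\<^sup>2 = (\<Sum>i<d. (a i - b i)\<^sup>2)" for a b
    by (simp add: euclid_dist_def L2_set_def sum_nonneg)
  show ?thesis unfolding s by (rule eq)
qed

text \<open>
  A point of both balls is, by the median identity, at distance at most \<open>sqrt (15/16)\<close> times the radius from the
  midpoint of the centres.
\<close>

lemma vball_overlap:
  assumes d: "d \<ge> 1" and T: "T \<ge> 0" and far: "vdist d x w \<ge> (1/2)^d * T"
  shows "emeasure (euclid d) {y \<in> space (euclid d). vdist d x y < T \<and> vdist d w y < T}
    \<le> ennreal (sqrt (15/16) ^ d * T)"
proof -
  let ?r = "vrad d T" let ?m = "\<lambda>i. (x i + w i) / 2"
  have r: "?r \<ge> 0" using T by (rule vrad_nonneg)
  \<comment> \<open>In volume distance the factor \<open>(1/2)^d\<close> halves a radius, so the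
    hypothesis says that the centres are at least half a radius apart.\<close>
  have "(1/2)^d * T = unit_ball_vol (real d) * (?r / 2) ^ d"
    using vrad_pow[OF d T] by (simp add: power_divide field_simps)
  hence "(?r / 2) ^ d \<le> euclid_dist d x w ^ d"
    using far unit_ball_vol_nat_pos[of d] unfolding vdist_def by (metis mult_le_cancel_left_pos)
  hence f: "?r / 2 \<le> euclid_dist d x w"
    using d r power_mono_iff[of "?r/2" "euclid_dist d x w" d] by simp
  hence f2: "?r\<^sup>2 / 4 \<le> (euclid_dist d x w)\<^sup>2"
    using power_mono[OF f, of 2] r by (simp add: power_divide)
  \<comment> \<open>\<open>15/16\<close> is \<open>1 - (1/4) / 4\<close>: an average of two squared
    radii minus a quarter of a squared distance of at least \<open>R / 4\<close>.\<close>
  have ar: "m \<le> 15/16 * R" if "a \<le> R" "b \<le> R" "m = (a + b) / 2 - c / 4" "R / 4 \<le> c" for a b c m R :: real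
    using that by (simp add: field_simps)
  have sub: "vdist d ?m y \<le> sqrt (15/16) ^ d * T"
    if "vdist d x y < T" "vdist d w y < T" for y
  proof -
    have "euclid_dist d x y \<le> ?r" "euclid_dist d w y \<le> ?r"
      using that vdist_le_vrad[OF d T] by (auto intro: less_imp_le)
    hence "(euclid_dist d x y)\<^sup>2 \<le> ?r\<^sup>2" "(euclid_dist d w y)\<^sup>2 \<le> ?r\<^sup>2"
      by (auto intro!: power_mono)
    hence "(euclid_dist d y ?m)\<^sup>2 \<le> (15/16) * ?r\<^sup>2"
      using euclid_median[of d y x w] f2 by (intro ar) auto
    also have "\<dots> = (sqrt (15/16) * ?r)\<^sup>2" by (simp add: power_mult_distrib)
    finally have "euclid_dist d y ?m \<le> sqrt (15/16) * ?r"
      using r power2_le_imp_le by (metis mult_nonneg_nonneg real_sqrt_ge_zero zero_le_divide_iff zero_le_numeral)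
    hence "euclid_dist d ?m y ^ d \<le> sqrt (15/16) ^ d * ?r ^ d"
      by (metis euclid_dist_commute euclid_dist_nonneg power_mono power_mult_distrib)
    hence "vdist d ?m y \<le> unit_ball_vol (real d) * (sqrt (15/16) ^ d * ?r ^ d)"
      unfolding vdist_def using unit_ball_vol_nat_pos[of d] by (intro mult_left_mono) auto
    also have "\<dots> = sqrt (15/16) ^ d * T" using vrad_pow[OF d T] by (simp add: mult_ac)
    finally show ?thesis .
  qed
  have "emeasure (euclid d) {y \<in> space (euclid d). vdist d x y < T \<and> vdist d w y < T}
    \<le> emeasure (euclid d) {y \<in> space (euclid d). vdist d ?m y \<le> sqrt (15/16) ^ d * T}"
    using sub by (intro emeasure_mono) auto
  thus ?thesis by (simp add: emeasure_vball[OF d])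
qed

text \<open>Dyadic cells of side \<open>1 / 2 ^ N\<close>, coded by lists of integers so that the
  labels form a countable type.\<close>

definition grid_cell :: "nat \<Rightarrow> nat \<Rightarrow> (nat \<Rightarrow> real) \<Rightarrow> int list" where
  "grid_cell d N x = map (\<lambda>i. \<lfloor>2 ^ N * x i\<rfloor>) [0..<d]"

lemma measurable_grid_cell [measurable]: "grid_cell d N \<in> euclid d \<rightarrow>\<^sub>M count_space UNIV"
proof -
  have iff: "grid_cell d N x = a \<longleftrightarrow> length a = d \<and> (\<forall>i\<in>{..<d}. \<lfloor>2 ^ N * x i\<rfloor> = a ! i)" for x a
    by (cases "length a = d") (simp_all add: grid_cell_def list_eq_iff_nth_eq Ball_def)
  have "grid_cell d N -` {a} \<inter> space (euclid d) \<in> sets (euclid d)" for a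
  proof (cases "length a = d")
    case True
    have "grid_cell d N -` {a} \<inter> space (euclid d) = {x \<in> space (euclid d). \<forall>i\<in>{..<d}. \<lfloor>2 ^ N * x i\<rfloor> = a ! i}"
      using True by (simp add: iff vimage_def Int_def conj_commute)
    also have "\<dots> \<in> sets (euclid d)"
    proof (intro sets.sets_Collect_finite_All)
      fix i assume "i \<in> {..<d}"
      hence [measurable]: "(\<lambda>x. x i) \<in> borel_measurable (euclid d)" by simp
      show "{x \<in> space (euclid d). \<lfloor>2 ^ N * x i\<rfloor> = a ! i} \<in> sets (euclid d)" by measurable
    qed auto
    finally show ?thesis .
  next
    case False
    hence "grid_cell d N -` {a} \<inter> space (euclid d) = {}" by (simp add: iff vimage_def)
    thus ?thesis by simp
  qed
  thus ?thesis by (subst measurable_count_space_eq_countable) auto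
qed

lemma grid_cell_refine:
  assumes "grid_cell d (Suc N) x = grid_cell d (Suc N) y" shows "grid_cell d N x = grid_cell d N y"
proof -
  have "\<lfloor>2 ^ N * x i\<rfloor> = \<lfloor>2 ^ N * y i\<rfloor>" if "i < d" for i
  proof -
    have *: "\<lfloor>2 ^ Suc N * x i\<rfloor> = \<lfloor>2 ^ Suc N * y i\<rfloor>"
      using assms that by (auto simp: grid_cell_def list_eq_iff_nth_eq)
    have **: "\<lfloor>2 ^ N * a\<rfloor> = \<lfloor>2 ^ Suc N * a\<rfloor> div 2" for a :: real
      using floor_divide_real_eq_div[of 2 "2 ^ Suc N * a"] by simp
    show ?thesis unfolding ** * ..
  qed
  thus ?thesis by (auto simp: grid_cell_def)
qed

lemma grid_cell_separates:
  assumes "x \<in> space (euclid d)" "y \<in> space (euclid d)" "x \<noteq> y"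
  shows "\<exists>N. grid_cell d N x \<noteq> grid_cell d N y"
proof -
  obtain i where i: "i < d" "x i \<noteq> y i"
    using assms by (auto simp: space_euclid PiE_def extensional_def fun_eq_iff) (metis not_less)
  obtain N where N: "1 / \<bar>x i - y i\<bar> < 2 ^ N"
    using real_arch_pow[of 2] by auto
  hence "1 < 2 ^ N * \<bar>x i - y i\<bar>" using i by (simp add: field_simps)
  also have "2 ^ N * \<bar>x i - y i\<bar> = \<bar>2 ^ N * x i - 2 ^ N * y i\<bar>" by (simp add: abs_mult flip: right_diff_distrib)
  finally have "\<lfloor>2 ^ N * x i\<rfloor> \<noteq> \<lfloor>2 ^ N * y i\<rfloor>" by linarith
  thus ?thesis using i by (intro exI[of _ N]) (auto simp: grid_cell_def)
qed

text \<open>The cube in the definition of intensity is closed, but only half-open cubes tile the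
  space, as mass transport requires. Upper bounds use the closed cube, lower bounds this subset of
  the same volume.\<close>

definition half_cube :: "nat \<Rightarrow> (nat \<Rightarrow> real) set" where
  "half_cube d = (\<Pi>\<^sub>E i\<in>{..<d}. {0..<1})"

lemma sets_cubes [measurable]: "half_cube d \<in> sets (euclid d)" "unit_cube d \<in> sets (euclid d)"
  unfolding half_cube_def unit_cube_def sets_euclid by (auto intro!: sets_PiM_I_finite)

lemma emeasure_cubes:
  "emeasure (euclid d) (half_cube d) = 1" "emeasure (euclid d) (unit_cube d) = 1"
proof -
  interpret product_sigma_finite "\<lambda>_::nat. lborel :: real measure" by standard
  show "emeasure (euclid d) (half_cube d) = 1" "emeasure (euclid d) (unit_cube d) = 1"
    unfolding half_cube_def unit_cube_def euclid_def by (subst emeasure_PiM; simp)+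
qed

lemma half_cube_subset: "half_cube d \<subseteq> unit_cube d"
  unfolding half_cube_def unit_cube_def by (intro PiE_mono) auto

subsection \<open>Availability in a fixed configuration\<close>

declare split_paired_All [simp del] split_paired_Ex [simp del]

fun avail :: "nat \<Rightarrow> nat \<Rightarrow> ((nat \<Rightarrow> real) \<times> nat) set \<Rightarrow> (nat \<Rightarrow> real) \<times> nat \<Rightarrow> real \<Rightarrow> bool" where
  "avail d 0 S x t = True"
| "avail d (Suc n) S x t =
     (\<forall>y\<in>S. snd y \<noteq> snd x \<and> vdist d (fst x) (fst y) < t \<longrightarrow> \<not> avail d n S y (vdist d (fst x) (fst y)))"

lemma avail_mono_time: "t' \<le> t \<Longrightarrow> avail d n S x t \<Longrightarrow> avail d n S x t'"
  by (cases n) auto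

text \<open>One step of the recursion reverses implications, so two steps preserve them; the chain
  starts from depth 0, where everything is available.\<close>

lemma avail_even_decreasing: "avail d (2 * Suc n) S x t \<Longrightarrow> avail d (2 * n) S x t"
proof (induction n arbitrary: x t)
  case (Suc n)
  have odd: "avail d (Suc (2 * Suc n)) S y s" if "avail d (Suc (2 * n)) S y s" for y s
    using that Suc.IH unfolding avail.simps(2) by blast
  have e: "2 * Suc m = Suc (Suc (2 * m))" for m by simp
  have "avail d (Suc (Suc (2 * Suc n))) S x t" using Suc.prems unfolding e[of "Suc n"] .
  thus ?case using odd
    unfolding e[of n] avail.simps(2)[of d "Suc (2 * n)"] avail.simps(2)[of d "Suc (Suc (Suc (2 * n)))"] by blast
qed simp

lemma avail_even_antimono: "m \<le> n \<Longrightarrow> avail d (2 * n) S x t \<Longrightarrow> avail d (2 * m) S x t"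
  by (induction n arbitrary: x t rule: dec_induct) (blast dest: avail_even_decreasing)+

text \<open>Each step of the recursion moves by at most \<open>r\<close>, so from within
  \<open>R - real n * r\<close> of \<open>o'\<close> the recursion of depth \<open>n\<close> sees
  only points within \<open>R\<close>.\<close>

lemma avail_local:
  assumes near: "\<And>j y. j < n \<Longrightarrow> euclid_dist d o' (fst y) \<le> R - real j * r \<Longrightarrow> y \<in> S \<longleftrightarrow> y \<in> S'"
    and x: "euclid_dist d o' (fst x) \<le> R - real n * r"
    and t: "t \<le> T" and T: "\<And>a b. vdist d a b < T \<Longrightarrow> euclid_dist d a b \<le> r"
  shows "avail d n S x t \<longleftrightarrow> avail d n S' x t"
  using near x t
proof (induction n arbitrary: x t)
  case (Suc n)
  have "(y \<in> S \<longleftrightarrow> y \<in> S') \<and> (avail d n S y (vdist d (fst x) (fst y)) \<longleftrightarrow> avail d n S' y (vdist d (fst x) (fst y)))"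
    if y: "vdist d (fst x) (fst y) < t" for y
  proof -
    have "euclid_dist d (fst x) (fst y) \<le> r" using y Suc.prems(3) by (intro T) simp
    hence le: "euclid_dist d o' (fst y) \<le> R - real n * r"
      using euclid_dist_triangle[of d o' "fst y" "fst x"] Suc.prems(2) by (simp add: algebra_simps)
    have "avail d n S y (vdist d (fst x) (fst y)) \<longleftrightarrow> avail d n S' y (vdist d (fst x) (fst y))"
      using le y Suc.prems(3) by (intro Suc.IH Suc.prems(1)) auto
    thus ?thesis using Suc.prems(1)[of n y] le by simp
  qed
  thus ?case by auto
qed simp

text \<open>The deterministic properties on which the theory of stable matchings rests; they hold
  almost surely by \<open>AE_stable_config\<close>. The case \<open>y = x\<close> of
  \<open>no_isosceles\<close> also excludes two points at the same place. Without descending chains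
  the recursion for availability, which refers to ever shorter distances, is well founded.\<close>

locale stable_config =
  fixes d :: nat and S :: "((nat \<Rightarrow> real) \<times> nat) set"
  assumes d: "d \<ge> 1"
    and finite_near: "\<And>x t. x \<in> S \<Longrightarrow> finite {y \<in> S. vdist d (fst x) (fst y) < t}"
    and no_isosceles: "\<And>x y y'. x \<in> S \<Longrightarrow> y \<in> S \<Longrightarrow> y' \<in> S \<Longrightarrow>
      vdist d (fst x) (fst y) = vdist d (fst x) (fst y') \<Longrightarrow> y = y'"
    and no_descending_chain: "\<And>f :: nat \<Rightarrow> _. (\<And>i. f i \<in> S) \<Longrightarrow>
      (\<And>i. vdist d (fst (f (Suc i))) (fst (f (Suc (Suc i)))) < vdist d (fst (f i)) (fst (f (Suc i)))) \<Longrightarrow> False"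
begin

abbreviation v where "v x y \<equiv> vdist d (fst x) (fst y)"

lemma v_commute: "v x y = v y x" by (rule vdist_commute)

text \<open>The relation is on directed edges because the recursion is: availability of
  \<open>y\<close> at its distance from \<open>x\<close> asks only about edges from \<open>y\<close>
  shorter than the edge from \<open>x\<close> to \<open>y\<close>. A descending sequence is a path
  with decreasing steps.\<close>

definition descent :: "((((nat \<Rightarrow> real) \<times> nat) \<times> ((nat \<Rightarrow> real) \<times> nat)) \<times> (((nat \<Rightarrow> real) \<times> nat) \<times> ((nat \<Rightarrow> real) \<times> nat))) set" where
  "descent = {(p, q). fst p = snd q \<and> fst q \<in> S \<and> fst p \<in> S \<and> snd p \<in> S \<and>
     v (fst p) (snd p) < v (fst q) (snd q)}"

lemma wf_descent: "wf descent"
proof (unfold wf_iff_no_infinite_down_chain, rule notI, elim exE)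
  fix g assume g: "\<forall>i. (g (Suc i), g i) \<in> descent"
  define f where "f i = fst (g i)" for i
  have s: "snd (g i) = f (Suc i)" "f i \<in> S" for i
    using g[rule_format, of i] by (auto simp: descent_def f_def)
  have "v (f (Suc i)) (f (Suc (Suc i))) < v (f i) (f (Suc i))" for i
    using g[rule_format, of i] s(1)[of i] s(1)[of "Suc i"] by (simp add: descent_def f_def)
  thus False using no_descending_chain[of f] s(2) by blast
qed

text \<open>Only finitely many neighbours lie within \<open>t\<close>, so the largest of their
  stabilisation depths serves for all.\<close>

lemma eventually_const_step:
  assumes x: "x \<in> S"
    and nb: "\<And>y. y \<in> S \<Longrightarrow> v x y < t \<Longrightarrow> \<exists>N. \<forall>n\<ge>N. avail d n S y (v x y) = avail d N S y (v x y)"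
  shows "\<exists>N. \<forall>n\<ge>N. avail d n S x t = avail d N S x t"
proof -
  let ?Y = "{y \<in> S. v x y < t}"
  obtain N where N: "\<And>y n. y \<in> ?Y \<Longrightarrow> n \<ge> N y \<Longrightarrow> avail d n S y (v x y) = avail d (N y) S y (v x y)"
    using nb by (metis (no_types, lifting) mem_Collect_eq)
  have fin: "finite ?Y" by (rule finite_near[OF x])
  define K where "K = Max (insert 0 (N ` ?Y))"
  have K: "N y \<le> K" if "y \<in> ?Y" for y using that fin unfolding K_def by (intro Max_ge) auto
  have "avail d n S x t = avail d (Suc K) S x t" if n: "n \<ge> Suc K" for n
  proof -
    obtain m where m: "n = Suc m" "m \<ge> K" using n by (cases n) auto
    have "avail d m S y (v x y) = avail d K S y (v x y)" if "y \<in> ?Y" for y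
      using N[OF that, of m] N[OF that, of K] K[OF that] m by simp
    thus ?thesis unfolding m(1) by auto
  qed
  thus ?thesis by blast
qed

lemma eventually_const_edge:
  assumes "x \<in> S" "y \<in> S"
  shows "\<exists>N. \<forall>n\<ge>N. avail d n S y (v x y) = avail d N S y (v x y)"
proof -
  have "fst e \<in> S \<Longrightarrow> snd e \<in> S \<Longrightarrow>
    \<exists>N. \<forall>n\<ge>N. avail d n S (snd e) (v (fst e) (snd e)) = avail d N S (snd e) (v (fst e) (snd e))" for e
  proof (induction e rule: wf_induct_rule[OF wf_descent])
    case (1 e)
    show ?case
    proof (rule eventually_const_step)
      fix z assume z: "z \<in> S" "v (snd e) z < v (fst e) (snd e)"
      have "((snd e, z), e) \<in> descent"
        using z 1(2,3) by (simp add: descent_def)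
      from 1(1)[OF this] z 1(3) show "\<exists>N. \<forall>n\<ge>N. avail d n S z (v (snd e) z) = avail d N S z (v (snd e) z)"
        by simp
    qed (use 1 in auto)
  qed
  from this[of "(x, y)"] assms show ?thesis by simp
qed

lemma eventually_const:
  assumes "x \<in> S" shows "\<exists>N. \<forall>n\<ge>N. avail d n S x t = avail d N S x t"
  by (rule eventually_const_step[OF assms]) (rule eventually_const_edge[OF assms])

text \<open>Every truncation stabilises (\<open>eventually_const\<close>), so this is the solution
  of the untruncated recursion; phrased as eventual truth it needs no choice of depth.\<close>

definition av where "av x t \<longleftrightarrow> (\<exists>N. \<forall>n\<ge>N. avail d n S x t)"

lemma av_iff_const:
  assumes "\<And>n. n \<ge> N \<Longrightarrow> avail d n S x t = avail d N S x t"
  shows "av x t \<longleftrightarrow> avail d N S x t"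
proof
  assume "av x t"
  then obtain K where "\<And>n. n \<ge> K \<Longrightarrow> avail d n S x t" unfolding av_def by blast
  from this[of "max K N"] assms[of "max K N"] show "avail d N S x t" by simp
next
  assume "avail d N S x t" thus "av x t" unfolding av_def using assms by blast
qed

lemma av_eventually: "x \<in> S \<Longrightarrow> \<exists>N. \<forall>n\<ge>N. avail d n S x t = av x t"
  using eventually_const[of x t] av_iff_const by metis

text \<open>Finitely many neighbours are involved, so a single depth represents \<open>av\<close> at
  the point and at all of them.\<close>

lemma av_rec:
  assumes x: "x \<in> S"
  shows "av x t \<longleftrightarrow> (\<forall>y\<in>S. snd y \<noteq> snd x \<and> v x y < t \<longrightarrow> \<not> av y (v x y))"
proof -
  obtain N where N: "\<And>n. n \<ge> N \<Longrightarrow> avail d n S x t = avail d N S x t"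
    using eventually_const[OF x] by blast
  hence 1: "av x t \<longleftrightarrow> avail d N S x t" by (rule av_iff_const)
  let ?Y = "{y \<in> S. v x y < t}"
  have "\<forall>y\<in>?Y. \<exists>N. \<forall>n\<ge>N. avail d n S y (v x y) = av y (v x y)"
  proof
    fix y assume "y \<in> ?Y"
    thus "\<exists>N. \<forall>n\<ge>N. avail d n S y (v x y) = av y (v x y)"
      using av_eventually[of y "v x y"] by simp
  qed
  from bchoice[OF this] obtain M where
    M: "\<And>y n. y \<in> ?Y \<Longrightarrow> n \<ge> M y \<Longrightarrow> avail d n S y (v x y) = av y (v x y)"
    by blast
  define K where "K = Max (insert N (M ` ?Y))"
  have fin: "finite ?Y" by (rule finite_near[OF x])
  have K: "N \<le> K" "\<And>y. y \<in> ?Y \<Longrightarrow> M y \<le> K" using fin unfolding K_def by (auto intro!: Max_ge)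
  have "av x t \<longleftrightarrow> avail d (Suc K) S x t" using 1 N[of "Suc K"] K by simp
  also have "\<dots> \<longleftrightarrow> (\<forall>y\<in>S. snd y \<noteq> snd x \<and> v x y < t \<longrightarrow> \<not> av y (v x y))"
    using M K(2) by auto
  finally show ?thesis .
qed

text \<open>One application of the recursion exchanges over- and underestimates, so the two claims
  are proved together.\<close>

lemma av_imp_avail_even: "x \<in> S \<Longrightarrow> av x t \<Longrightarrow> avail d (2 * n) S x t"
  and avail_odd_imp_av: "x \<in> S \<Longrightarrow> avail d (Suc (2 * n)) S x t \<Longrightarrow> av x t"
proof (induction n arbitrary: x t)
  case 0
  { case 2
    thus ?case by (subst av_rec) auto }
next
  case (Suc n)
  have even: "avail d (2 * Suc n) S x t" if "x \<in> S" "av x t" for x t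
  proof -
    have "\<not> avail d (Suc (2 * n)) S y (v x y)" if "y \<in> S" "snd y \<noteq> snd x \<and> v x y < t" for y
      using that \<open>av x t\<close> av_rec[OF \<open>x \<in> S\<close>] Suc.IH(2)[of y "v x y"] by blast
    thus ?thesis by (simp del: avail.simps(2) add: avail.simps(2)[of d "Suc (2 * n)"])
  qed
  { case 1 thus ?case by (rule even)
  next
    case 2
    thus ?case using even unfolding avail.simps(2)[of d "2 * Suc n"] av_rec[OF 2(1)] by blast }
qed simp

text \<open>The even truncations decrease to \<open>av\<close>. In this form it is a countable
  intersection of measurable conditions, to which downward monotone convergence applies.\<close>

lemma av_iff_all_even: "x \<in> S \<Longrightarrow> av x t \<longleftrightarrow> (\<forall>n. avail d (2 * n) S x t)"
proof
  assume x: "x \<in> S" and all: "\<forall>n. avail d (2 * n) S x t"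
  show "av x t"
  proof (rule ccontr)
    assume "\<not> av x t"
    then obtain N where "\<And>n. n \<ge> N \<Longrightarrow> \<not> avail d n S x t" using av_eventually[OF x, of t] by auto
    from this[of "2 * N"] all show False by simp
  qed
qed (auto intro: av_imp_avail_even)

lemma colour_dist_less_iff:
  assumes "snd x \<noteq> snd y" "snd x' \<noteq> snd y'"
  shows "colour_dist d x y < colour_dist d x' y' \<longleftrightarrow> v x y < v x' y'"
  using assms vdist_less_iff[OF d] by (simp add: colour_dist_def ennreal_less_iff)

lemma colour_dist_le_iff:
  assumes "snd x \<noteq> snd y" "snd x' \<noteq> snd y'"
  shows "colour_dist d x y \<le> colour_dist d x' y' \<longleftrightarrow> v x y \<le> v x' y'"
  using colour_dist_less_iff[OF assms(2,1)] by (metis not_less)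

lemma colour_dist_finite_iff: "colour_dist d x y < \<infinity> \<longleftrightarrow> snd x \<noteq> snd y"
  by (simp add: colour_dist_def)

context
  fixes M assumes M: "stable_matching (colour_dist d) S M"
begin

lemma M_props:
  assumes "x \<in> S"
  shows "M x \<in> S" "M (M x) = x" "M x \<noteq> x \<Longrightarrow> snd x \<noteq> snd (M x)"
  using M assms colour_dist_finite_iff unfolding stable_matching_def is_matching_def by blast+

lemma M_stable: "x \<in> S \<Longrightarrow> y \<in> S \<Longrightarrow>
    min (colour_dist d x (M x)) (colour_dist d y (M y)) \<le> colour_dist d x y"
  using M unfolding stable_matching_def match_dist_def by blast

text \<open>If \<open>y\<close> is matched closer than \<open>s\<close>, its partner is available at
  their common distance and so blocks \<open>y\<close>. Conversely, suppose an available
  \<open>z\<close> within \<open>s\<close> blocks \<open>y\<close>. Then \<open>y\<close> prefers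
  \<open>z\<close> to its own match, so stability makes \<open>z\<close> matched no farther than
  \<open>y\<close>, and availability no nearer; by \<open>no_isosceles\<close> the partner of
  \<open>z\<close> is \<open>y\<close>, which is absurd.\<close>

lemma av_step:
  assumes y: "y \<in> S"
    and IH: "\<And>z. z \<in> S \<Longrightarrow> snd z \<noteq> snd y \<Longrightarrow> v y z < s \<Longrightarrow> av z (v y z) \<longleftrightarrow> (M z = z \<or> v y z \<le> v z (M z))"
  shows "av y s \<longleftrightarrow> (M y = y \<or> s \<le> v y (M y))"
proof
  assume av: "av y s"
  show "M y = y \<or> s \<le> v y (M y)"
  proof (rule ccontr)
    assume neg: "\<not> (M y = y \<or> s \<le> v y (M y))"
    have "\<not> av (M y) (v y (M y))" using av neg M_props[OF y] by (auto simp: av_rec[OF y])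
    moreover have "av (M y) (v y (M y))"
      using IH[of "M y"] neg M_props[OF y] v_commute[of y "M y"] by auto
    ultimately show False by simp
  qed
next
  assume far: "M y = y \<or> s \<le> v y (M y)"
  have "\<not> av z (v y z)" if z: "z \<in> S" "snd z \<noteq> snd y" "v y z < s" for z
  proof
    assume "av z (v y z)"
    hence zz: "M z = z \<or> v y z \<le> v z (M z)" using IH z by simp
    have ly: "colour_dist d y z < colour_dist d y (M y)"
    proof (cases "M y = y")
      case True thus ?thesis using z by (simp add: colour_dist_def)
    next
      case False thus ?thesis using far z M_props[OF y] by (subst colour_dist_less_iff) auto
    qed
    hence lz: "colour_dist d z (M z) \<le> colour_dist d y z"
      using M_stable[OF y z(1)] by (auto simp: min_def split: if_splits)
    hence "M z \<noteq> z" using z by (auto simp: colour_dist_def top_unique)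
    hence "v z (M z) \<le> v y z" using lz z M_props[OF z(1)] by (subst (asm) colour_dist_le_iff) auto
    hence "v z (M z) = v z y" using zz \<open>M z \<noteq> z\<close> v_commute[of y z] by simp
    hence "M z = y" using no_isosceles z(1) y M_props[OF z(1)] by blast
    hence "M y = z" using M_props[OF z(1)] by auto
    thus False using ly by simp
  qed
  thus "av y s" by (auto simp: av_rec[OF y])
qed

lemma av_edge:
  assumes "x \<in> S" "y \<in> S"
  shows "av y (v x y) \<longleftrightarrow> (M y = y \<or> v x y \<le> v y (M y))"
proof -
  have "fst e \<in> S \<Longrightarrow> snd e \<in> S \<Longrightarrow>
    av (snd e) (v (fst e) (snd e)) \<longleftrightarrow> (M (snd e) = snd e \<or> v (fst e) (snd e) \<le> v (snd e) (M (snd e)))" for e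
  proof (induction e rule: wf_induct_rule[OF wf_descent])
    case (1 e)
    show ?case
    proof (rule av_step)
      fix z assume z: "z \<in> S" "v (snd e) z < v (fst e) (snd e)"
      have "((snd e, z), e) \<in> descent"
        using z 1(2,3) by (simp add: descent_def)
      from 1(1)[OF this] z 1(3) show "av z (v (snd e) z) = (M z = z \<or> v (snd e) z \<le> v z (M z))"
        by simp
    qed (use 1 in auto)
  qed
  from this[of "(x, y)"] assms show ?thesis by simp
qed

lemma av_iff_match_dist:
  assumes "x \<in> S" shows "av x t \<longleftrightarrow> (M x = x \<or> t \<le> v x (M x))"
  by (rule av_step[OF assms]) (rule av_edge[OF assms])

text \<open>The right-hand side does not mention \<open>M\<close>, so any two stable matchings
  agree. For the backward direction, availability keeps both points from being matched closer than
  \<open>v x y\<close>, and stability forces one of them to be matched no farther.\<close>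

lemma matched_iff:
  assumes x: "x \<in> S"
  shows "M x = y \<and> y \<noteq> x \<longleftrightarrow> y \<in> S \<and> snd y \<noteq> snd x \<and> av x (v x y) \<and> av y (v x y)"
proof (intro iffI conjI)
  assume a: "M x = y \<and> y \<noteq> x"
  show "y \<in> S" "snd y \<noteq> snd x" using a M_props[OF x] by auto
  show "av x (v x y)" using a by (simp add: av_iff_match_dist[OF x])
  have "M y = x" using a M_props(2)[OF x] by simp
  thus "av y (v x y)" using \<open>y \<in> S\<close> v_commute[of x y] by (simp add: av_iff_match_dist)
next
  assume a: "y \<in> S \<and> snd y \<noteq> snd x \<and> av x (v x y) \<and> av y (v x y)"
  hence y: "y \<in> S" and c: "snd y \<noteq> snd x" by auto
  show "y \<noteq> x" using c by auto
  have 1: "M x = x \<or> v x y \<le> v x (M x)" using a av_iff_match_dist[OF x] by simp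
  have 2: "M y = y \<or> v y x \<le> v y (M y)" using a av_iff_match_dist[OF y] v_commute[of x y] by simp
  consider "colour_dist d x (M x) \<le> colour_dist d x y" | "colour_dist d y (M y) \<le> colour_dist d y x"
    using M_stable[OF x y] colour_dist_commute[of d x y] by (auto simp: min_def split: if_splits)
  thus "M x = y"
  proof cases
    case 1
    hence ne: "M x \<noteq> x" using c by (auto simp: colour_dist_def top_unique)
    hence "v x (M x) \<le> v x y" using 1 c M_props[OF x] by (subst (asm) colour_dist_le_iff) auto
    hence "v x (M x) = v x y" using ne \<open>M x = x \<or> v x y \<le> v x (M x)\<close> by simp
    thus ?thesis using no_isosceles x y M_props[OF x] by blast
  next
    case 2
    hence ne: "M y \<noteq> y" using c by (auto simp: colour_dist_def top_unique)
    hence "v y (M y) \<le> v y x" using 2 c M_props[OF y] by (subst (asm) colour_dist_le_iff) auto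
    hence "v y (M y) = v y x" using ne \<open>M y = y \<or> v y x \<le> v y (M y)\<close> by simp
    hence "M y = x" using no_isosceles x y M_props[OF y] by blast
    thus ?thesis using M_props[OF y] by auto
  qed
qed

end

definition partner where
  "partner x y \<longleftrightarrow> x \<in> S \<and> y \<in> S \<and> snd y \<noteq> snd x \<and> av x (v x y) \<and> av y (v x y)"

lemma partner_sym: "partner x y \<Longrightarrow> partner y x"
  using v_commute[of x y] by (auto simp: partner_def)

text \<open>The nearer of two partners is available at its distance and so blocks \<open>x\<close>
  at the farther one.\<close>

lemma partner_unique:
  assumes "partner x y" "partner x z" shows "y = z"
proof (rule ccontr)
  assume ne: "y \<noteq> z"
  have *: False if "partner x y" "partner x z" "v x y < v x z" for y z
    using that av_rec[of x "v x z"] by (auto simp: partner_def)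
  have "v x y \<noteq> v x z" using ne no_isosceles[of x y z] assms by (auto simp: partner_def)
  thus False using * assms by (meson linorder_neqE)
qed

text \<open>Match mutually available pairs. If two points preferred each other to their matches,
  each would be available at their distance (\<open>key\<close>), which makes them partners after
  all.\<close>

lemma exists_stable_matching: "\<exists>M. stable_matching (colour_dist d) S M"
proof -
  define M where "M x = (if \<exists>y. partner x y then (SOME y. partner x y) else x)" for x
  have M1: "M x = y" if "partner x y" for x y
  proof -
    have "partner x (SOME y. partner x y)" using that by (rule someI)
    hence "(SOME y. partner x y) = y" using that by (rule partner_unique)
    thus ?thesis using that unfolding M_def by metis
  qed
  have M2: "M x \<noteq> x \<Longrightarrow> partner x (M x)" for x
    unfolding M_def by (auto intro: someI split: if_splits)
  have M3: "M x = x" if "\<nexists>y. partner x y" for x using that by (simp add: M_def)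
  have match: "is_matching (colour_dist d) S M"
    unfolding is_matching_def
  proof (intro conjI ballI allI impI)
    fix x assume x: "x \<in> S"
    show "M x \<in> S" using M2[of x] x by (cases "M x = x") (auto simp: partner_def)
    show "M (M x) = x" using M2[of x] M1[OF partner_sym] by metis
    assume "M x \<noteq> x"
    thus "colour_dist d x (M x) < \<infinity>" using M2[of x] unfolding colour_dist_finite_iff by (auto simp: partner_def)
  next
    fix x assume "x \<notin> S" thus "M x = x" by (intro M3) (auto simp: partner_def)
  qed
  have key: "av x (v x y)" if "x \<in> S" "y \<in> S" "snd x \<noteq> snd y" "colour_dist d x y < colour_dist d x (M x)" for x y
  proof (rule ccontr)
    assume "\<not> av x (v x y)"
    \<comment> \<open>The nearest available point closer than \<open>y\<close> finds
      \<open>x\<close> available as well, so it is the match of \<open>x\<close>; but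
      \<open>x\<close> was to prefer \<open>y\<close> to its match.\<close>
    define Z where "Z = {z \<in> S. v x z < v x y \<and> snd z \<noteq> snd x \<and> av z (v x z)}"
    have "finite Z" unfolding Z_def by (rule finite_subset[OF _ finite_near[OF \<open>x \<in> S\<close>, of "v x y"]]) auto
    moreover have "Z \<noteq> {}" using \<open>\<not> av x (v x y)\<close> av_rec[OF \<open>x \<in> S\<close>] by (auto simp: Z_def)
    ultimately obtain z where z: "z \<in> Z" "\<And>z'. z' \<in> Z \<Longrightarrow> v x z \<le> v x z'"
      using ex_min_if_finite[of "v x ` Z"] by (metis (no_types, lifting) arg_min_if_finite(1) arg_min_least)
    have "av x (v x z)"
    proof (subst av_rec[OF \<open>x \<in> S\<close>], intro ballI impI notI)
      fix z' assume "z' \<in> S" "snd z' \<noteq> snd x \<and> v x z' < v x z" "av z' (v x z')"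
      hence "z' \<in> Z" using z(1) by (auto simp: Z_def)
      thus False using z(2)[of z'] \<open>snd z' \<noteq> snd x \<and> v x z' < v x z\<close> by linarith
    qed
    hence "partner x z" using z(1) \<open>x \<in> S\<close> by (auto simp: partner_def Z_def)
    hence "M x = z" by (rule M1)
    hence "v x y < v x z"
      using that(3,4) \<open>partner x z\<close> colour_dist_less_iff[of x y x z] by (simp add: partner_def)
    thus False using z(1) by (auto simp: Z_def)
  qed
  have "stable_matching (colour_dist d) S M"
    unfolding stable_matching_def match_dist_def
  proof (intro conjI match ballI)
    fix x y assume xy: "x \<in> S" "y \<in> S"
    show "min (colour_dist d x (M x)) (colour_dist d y (M y)) \<le> colour_dist d x y"
    proof (rule ccontr)
      assume "\<not> ?thesis"
      hence l: "colour_dist d x y < colour_dist d x (M x)" "colour_dist d y x < colour_dist d y (M y)"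
        unfolding not_le min_less_iff_conj colour_dist_commute[of d y x] by blast+
      have c: "snd x \<noteq> snd y" using l by (auto simp: colour_dist_def)
      have "partner x y"
        using key[OF xy c l(1)] key[OF xy(2,1) c[symmetric] l(2)] xy c v_commute[of x y] by (auto simp: partner_def)
      thus False using M1[of x y] l by simp
    qed
  qed
  thus ?thesis by blast
qed

lemma stable_matching_unique:
  assumes M: "stable_matching (colour_dist d) S M" and M': "stable_matching (colour_dist d) S M'"
  shows "M = M'"
proof
  fix x show "M x = M' x"
  proof (cases "x \<in> S")
    case True
    show ?thesis
      using matched_iff[OF M True, of "M x"] matched_iff[OF M' True, of "M x"]
        matched_iff[OF M True, of "M' x"] matched_iff[OF M' True, of "M' x"] by metis
  next
    case False thus ?thesis using M M' unfolding stable_matching_def is_matching_def by metis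
  qed
qed

lemma the_stable_matching: "stable_matching (colour_dist d) S (the_stable_matching (colour_dist d) S)"
proof -
  obtain M where M: "stable_matching (colour_dist d) S M" using exists_stable_matching by blast
  show ?thesis unfolding the_stable_matching_def
    by (rule theI[where P = "stable_matching (colour_dist d) S", OF M])
       (erule stable_matching_unique[OF _ M])
qed

end

text \<open>Loop erasure: jump to the last visit of each point. Decreasing step lengths never repeat
  an edge, and a point has finitely many neighbours below a given distance, so each point is visited
  finitely often. Injectivity lets the path be counted by repeated use of the Mecke formula, which
  removes the points already used.\<close>

lemma injective_descending_chain:
  fixes f :: "nat \<Rightarrow> (nat \<Rightarrow> real) \<times> nat"
  assumes fin: "\<And>x t. x \<in> S \<Longrightarrow> finite {y \<in> S. vdist d (fst x) (fst y) < t}"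
    and fS: "\<And>i. f i \<in> S"
    and desc: "\<And>i. vdist d (fst (f (Suc i))) (fst (f (Suc (Suc i)))) < vdist d (fst (f i)) (fst (f (Suc i)))"
  obtains g where "\<And>i. g i \<in> S" "inj g"
    "\<And>i. vdist d (fst (g (Suc i))) (fst (g (Suc (Suc i)))) < vdist d (fst (g i)) (fst (g (Suc i)))"
proof -
  define e where "e i = vdist d (fst (f i)) (fst (f (Suc i)))" for i
  have e: "e j < e i" if "i < j" for i j
    using lift_Suc_mono_less[of "\<lambda>i. - e i" i j] desc that by (simp add: e_def)
  have finv: "finite {i. f i = a}" if a: "a \<in> S" for a
  proof (rule finite_imageD)
    show "inj_on (\<lambda>i. f (Suc i)) {i. f i = a}"
    proof (rule inj_onI)
      fix i j assume ij: "i \<in> {i. f i = a}" "j \<in> {i. f i = a}" "f (Suc i) = f (Suc j)"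
      hence "e i = e j" by (simp add: e_def)
      thus "i = j" using e[of i j] e[of j i] by (cases i j rule: linorder_cases) auto
    qed
    have "e i < e 0 + 1" for i using e[of 0 i] by (cases "i = 0") auto
    hence "(\<lambda>i. f (Suc i)) ` {i. f i = a} \<subseteq> {y \<in> S. vdist d (fst a) (fst y) < e 0 + 1}"
      using fS by (auto simp: e_def)
    thus "finite ((\<lambda>i. f (Suc i)) ` {i. f i = a})" using fin[OF a] by (rule finite_subset)
  qed
  define last where "last a = Max {i. f i = a}" for a
  have last: "f (last (f i)) = f i" "i \<le> last (f i)" for i
    using Max_in[OF finv[OF fS[of i]]] Max_ge[OF finv[OF fS[of i]], of i] by (auto simp: last_def)
  \<comment> \<open>\<open>k (Suc n)\<close> is the last visit to the point that follows
    \<open>f (k n)\<close>, so consecutive points of \<open>g\<close> are still joined by a step of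
    \<open>f\<close>.\<close>
  define k where "k n = rec_nat (last (f 0)) (\<lambda>_ m. last (f (Suc m))) n" for n
  have k0: "k 0 = last (f 0)" and kS: "k (Suc n) = last (f (Suc (k n)))" for n
    by (simp_all add: k_def)
  have k_less: "k n < k (Suc n)" for n using last(2)[of "Suc (k n)"] by (simp add: kS)
  have k_mono: "k m < k n" if "m < n" for m n using lift_Suc_mono_less[of k, OF k_less that] .
  have k_last: "k n = last (f (k n))" for n by (cases n) (simp_all add: k0 kS last)
  define g where "g n = f (k n)" for n
  have gS: "g (Suc n) = f (Suc (k n))" for n by (simp add: g_def kS last)
  show ?thesis
  proof
    show "g i \<in> S" for i using fS by (simp add: g_def)
    have ne: "g m \<noteq> g n" if "m < n" for m n
    proof
      assume "g m = g n"
      hence "k m = k n" using k_last[of m] k_last[of n] by (simp add: g_def)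
      thus False using k_mono[OF that] by simp
    qed
    show "inj g"
    proof (rule injI)
      fix m n assume "g m = g n" thus "m = n" using ne by (metis linorder_neqE_nat)
    qed
    show "vdist d (fst (g (Suc i))) (fst (g (Suc (Suc i)))) < vdist d (fst (g i)) (fst (g (Suc i)))" for i
    proof -
      have "vdist d (fst (g n)) (fst (g (Suc n))) = e (k n)" for n
        unfolding gS e_def by (simp add: g_def)
      thus ?thesis using e[OF k_less] by simp
    qed
  qed
qed

text \<open>
  The number of self-avoiding paths of \<open>m\<close> steps from \<open>x\<close> with decreasing step lengths, the first below \<open>t\<close>.
\<close>

fun npath :: "nat \<Rightarrow> nat \<Rightarrow> ((nat \<Rightarrow> real) \<times> nat) set \<Rightarrow> (nat \<Rightarrow> real) \<times> nat \<Rightarrow> real \<Rightarrow> ennreal" where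
  "npath d 0 S x t = 1"
| "npath d (Suc m) S x t = (\<integral>\<^sup>+y\<in>S. indicator {..<t} (vdist d (fst x) (fst y)) *
     npath d m (S - {y}) y (vdist d (fst x) (fst y)) \<partial>count_space UNIV)"

lemma npath_ge_1:
  assumes "inj g" "\<And>i. i < m \<Longrightarrow> g (Suc i) \<in> S"
    and "\<And>i. vdist d (fst (g (Suc i))) (fst (g (Suc (Suc i)))) < vdist d (fst (g i)) (fst (g (Suc i)))"
    and "vdist d (fst (g 0)) (fst (g 1)) < t"
  shows "1 \<le> npath d m (S - {g 0}) (g 0) t"
  using assms
proof (induction m arbitrary: g S t)
  case (Suc m)
  let ?h = "\<lambda>i. g (Suc i)"
  have inj: "?h i = g 0 \<longleftrightarrow> False" for i using Suc.prems(1) by (auto simp: inj_eq)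
  have "1 \<le> npath d m ((S - {g 0}) - {?h 0}) (?h 0) (vdist d (fst (g 0)) (fst (g 1)))"
  proof (rule Suc.IH)
    show "inj ?h" using Suc.prems(1) by (auto simp: inj_def)
    show "?h (Suc i) \<in> S - {g 0}" if "i < m" for i using that Suc.prems(2)[of "Suc i"] inj by auto
    show "vdist d (fst (?h 0)) (fst (?h 1)) < vdist d (fst (g 0)) (fst (g 1))"
      using Suc.prems(3)[of 0] by simp
  qed (use Suc.prems in auto)
  also have "\<dots> = (\<integral>\<^sup>+y. (indicator {..<t} (vdist d (fst (g 0)) (fst y)) *
     npath d m (S - {g 0} - {y}) y (vdist d (fst (g 0)) (fst y))) * indicator (S - {g 0}) y * indicator {g 1} y \<partial>count_space UNIV)"
    using Suc.prems(2)[of 0] Suc.prems(4) inj[of 0] by (simp add: nn_integral_count_space_indicator[symmetric] nn_integral_count_space_finite)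
  also have "\<dots> \<le> npath d (Suc m) (S - {g 0}) (g 0) t"
    unfolding npath.simps by (intro nn_integral_mono) (auto split: split_indicator)
  finally show ?case .
qed simp

subsection \<open>The coloured Poisson process in a window\<close>

declare split_paired_All [simp] split_paired_Ex [simp]
declare One_nat_def [simp del]

lemma measurable_pair_measure_countable2:
  assumes "countable A" and [measurable]: "\<And>y. y \<in> A \<Longrightarrow> (\<lambda>x. f (x, y)) \<in> N \<rightarrow>\<^sub>M K"
  shows "f \<in> N \<Otimes>\<^sub>M count_space A \<rightarrow>\<^sub>M K"
  using _ _ assms(1)
  by (rule measurable_compose_countable'[where f="\<lambda>a b. f (fst b, a)" and g=snd and I=A, simplified]) simp_all

section \<open>Marked points and their counts in disjoint sets\<close>

locale poisson_model = colour_probs k p for k p +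
  fixes d :: nat and Q :: "(nat \<Rightarrow> nat \<Rightarrow> real) measure"
  assumes d: "d \<ge> 1" and law: "poisson_process_law d Q"
begin

abbreviation "E \<equiv> euclid d"
abbreviation "pm \<equiv> point_measure {1..k} (\<lambda>i. ennreal (p i))"
abbreviation "W \<equiv> coloured_law k p Q"

text \<open>\<open>Mk\<close> only supplies the sigma-algebra of coloured points; the intensity
  measure of the coloured process is \<open>nu\<close>.\<close>

definition Mk :: "((nat \<Rightarrow> real) \<times> nat) measure" where "Mk = E \<Otimes>\<^sub>M count_space {1..k}"
definition nu :: "((nat \<Rightarrow> real) \<times> nat) measure" where "nu = E \<Otimes>\<^sub>M pm"

lemma sets_nu [measurable_cong]: "sets nu = sets Mk"
  unfolding nu_def Mk_def by (intro sets_pair_measure_cong) (simp_all add: sets_point_measure)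

lemma space_Mk: "space Mk = space E \<times> {1..k}"
  by (simp add: Mk_def space_pair_measure)

lemma space_nu: "space nu = space E \<times> {1..k}"
  using sets_nu space_Mk by (metis sets_eq_imp_space_eq)

lemma measurable_fst_Mk [measurable]: "fst \<in> Mk \<rightarrow>\<^sub>M E"
  and measurable_snd_Mk [measurable]: "snd \<in> Mk \<rightarrow>\<^sub>M count_space UNIV"
proof -
  show "fst \<in> Mk \<rightarrow>\<^sub>M E" unfolding Mk_def by simp
  have "snd \<in> Mk \<rightarrow>\<^sub>M count_space {1..k}" unfolding Mk_def by simp
  moreover have "(\<lambda>x. x) \<in> count_space {1..k} \<rightarrow>\<^sub>M count_space UNIV" by simp
  ultimately show "snd \<in> Mk \<rightarrow>\<^sub>M count_space UNIV" using measurable_compose by blast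
qed

lemma emeasure_pm: "i \<in> {1..k} \<Longrightarrow> emeasure pm {i} = ennreal (p i)"
  by (subst emeasure_point_measure_finite) auto

lemma prob_space_pm: "prob_space pm"
proof
  have "emeasure pm {1..k} = (\<Sum>i\<in>{1..k}. ennreal (p i))"
    by (rule emeasure_point_measure_finite) auto
  also have "\<dots> = ennreal (\<Sum>i\<in>{1..k}. p i)" using p_nonneg by (subst sum_ennreal) auto
  finally show "emeasure pm (space pm) = 1" using p_sum by (simp add: space_point_measure)
qed

lemma prob_space_Q: "prob_space Q" and sets_Q [measurable_cong]: "sets Q = sets (\<Pi>\<^sub>M n\<in>UNIV. E)"
  and AE_inj: "AE X in Q. inj X"
  using law by (auto simp: poisson_process_law_def)

sublocale Q: prob_space Q by (rule prob_space_Q)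
sublocale pm: prob_space pm by (rule prob_space_pm)
sublocale PC: product_prob_space "\<lambda>_::nat. pm" UNIV by unfold_locales
abbreviation "PCm \<equiv> PiM UNIV (\<lambda>_::nat. pm)"
sublocale PCm: prob_space PCm by (rule PC.P.prob_space_axioms)
sublocale QC: pair_prob_space Q PCm by unfold_locales
sublocale E: sigma_finite_measure E by (rule sigma_finite_euclid)
sublocale Epm: pair_sigma_finite E pm by unfold_locales

lemma W_eq: "W = Q \<Otimes>\<^sub>M PCm" by (simp add: coloured_law_def)

sublocale W: prob_space W unfolding W_eq by unfold_locales

sublocale nu: sigma_finite_measure nu unfolding nu_def by unfold_locales

definition Z :: "nat \<Rightarrow> (nat \<Rightarrow> nat \<Rightarrow> real) \<times> (nat \<Rightarrow> nat) \<Rightarrow> (nat \<Rightarrow> real) \<times> nat" where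
  "Z m w = (fst w m, snd w m)"

lemma measurable_Q_component [measurable]: "(\<lambda>X. X m) \<in> Q \<rightarrow>\<^sub>M E"
  by (subst measurable_cong_sets[OF sets_Q refl]) measurable

lemma measurable_Z [measurable]: "Z m \<in> W \<rightarrow>\<^sub>M Mk"
proof -
  have c: "(\<lambda>c. c m) \<in> PCm \<rightarrow>\<^sub>M count_space {1..k}"
  proof -
    have "(\<lambda>c. c m) \<in> PCm \<rightarrow>\<^sub>M pm" by measurable
    thus ?thesis by (subst (asm) measurable_cong_sets[of PCm PCm pm "count_space {1..k}"]) (auto simp: sets_point_measure)
  qed
  show ?thesis unfolding Z_def[abs_def] Mk_def W_eq
    by (intro measurable_Pair measurable_compose[OF measurable_fst measurable_Q_component] measurable_compose[OF measurable_snd c])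
qed

lemma coloured_points_eq: "coloured_points w = range (\<lambda>m. Z m w)"
  by (cases w) (simp add: coloured_points_def Z_def)

text \<open>An extended count, infinite where \<open>card\<close> would be 0 because there are
  infinitely many points.\<close>

definition cnt :: "(nat \<Rightarrow> real) set \<Rightarrow> (nat \<Rightarrow> nat \<Rightarrow> real) \<Rightarrow> ennreal" where
  "cnt B X = emeasure (count_space UNIV) {m. X m \<in> B}"

lemma cnt_eq_iff: "cnt B X = of_nat n \<longleftrightarrow> finite {m. X m \<in> B} \<and> card {m. X m \<in> B} = n"
  by (cases "finite {m. X m \<in> B}") (auto simp: cnt_def ennreal_of_nat_eq_real_of_nat)

lemma measurable_cnt [measurable]:
  assumes [measurable]: "B \<in> sets E" shows "cnt B \<in> borel_measurable Q"
proof -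
  have "cnt B = (\<lambda>X. \<Sum>m. indicator B (X m))"
    by (simp add: fun_eq_iff cnt_def nn_integral_count_space_nat[symmetric] nn_integral_indicator[symmetric] indicator_def del: nn_integral_indicator)
  thus ?thesis by simp
qed

lemma emeasure_cnt:
  assumes "B \<in> sets E" "emeasure E B < \<infinity>"
  shows "emeasure Q {X \<in> space Q. cnt B X = of_nat m} = ennreal (exp (- measure E B) * measure E B ^ m / fact m)"
  using law assms unfolding poisson_process_law_def cnt_eq_iff Q.emeasure_eq_measure by auto

lemma AE_cnt_finite:
  assumes B [measurable]: "B \<in> sets E" and fin: "emeasure E B < \<infinity>"
  shows "AE X in Q. finite {m. X m \<in> B}"
proof -
  let ?A = "\<lambda>m. {X \<in> space Q. cnt B X = of_nat m}"
  let ?V = "measure E B"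
  have "emeasure Q (\<Union>m. ?A m) = (\<Sum>m. emeasure Q (?A m))"
    by (intro suminf_emeasure[symmetric]) (auto simp: disjoint_family_on_def)
  also have "\<dots> = (\<Sum>m. ennreal (exp (- ?V) * (?V ^ m / fact m)))"
    using emeasure_cnt[OF assms] by simp
  also have "\<dots> = ennreal (exp (- ?V) * exp ?V)"
    using exp_converges[of ?V]
    by (intro suminf_ennreal_eq sums_mult) (auto simp: divide_inverse mult.commute)
  also have "exp (- ?V) * exp ?V = 1" by (simp flip: exp_add)
  finally have "AE X in Q. X \<in> (\<Union>m. ?A m)" by (intro Q.AE_prob_1) (auto simp: measure_def)
  thus ?thesis by eventually_elim (auto simp: cnt_eq_iff)
qed

text \<open>Independence is assumed for \<open>card\<close>, which cannot tell no points from
  infinitely many. Almost surely all these counts are finite, so the events agree up to null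
  sets.\<close>

lemma emeasure_joint_cnt:
  fixes B :: "nat \<Rightarrow> (nat \<Rightarrow> real) set"
  assumes B [measurable]: "\<And>j. j < n \<Longrightarrow> B j \<in> sets E" and fin: "\<And>j. j < n \<Longrightarrow> emeasure E (B j) < \<infinity>"
    and disj: "disjoint_family_on B {..<n}"
  shows "emeasure Q {X \<in> space Q. \<forall>j<n. cnt (B j) X = of_nat (a j)} =
    (\<Prod>j<n. emeasure Q {X \<in> space Q. cnt (B j) X = of_nat (a j)})"
proof (cases "n = 0")
  case True thus ?thesis using Q.emeasure_space_1 by simp
next
  case False
  define Y where "Y j X = card {m. X m \<in> B j}" for j and X :: "nat \<Rightarrow> nat \<Rightarrow> real"
  have ind: "Q.indep_vars (\<lambda>_. count_space UNIV) Y {..<n}"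
    using law B fin disj unfolding poisson_process_law_def Y_def by blast
  have AE: "AE X in Q. \<forall>j\<in>{..<n}. finite {m. X m \<in> B j}"
    using AE_cnt_finite[OF B fin] by (intro AE_finite_allI) auto
  have "emeasure Q {X \<in> space Q. \<forall>j<n. cnt (B j) X = of_nat (a j)} = emeasure Q (\<Inter>j\<in>{..<n}. Y j -` {a j} \<inter> space Q)"
  proof (rule emeasure_eq_AE)
    show "AE x in Q. (x \<in> {X \<in> space Q. \<forall>j<n. cnt (B j) X = of_nat (a j)}) = (x \<in> (\<Inter>j\<in>{..<n}. Y j -` {a j} \<inter> space Q))"
      by (rule AE_mp[OF AE], rule AE_I2) (use False in \<open>auto simp: cnt_eq_iff Y_def\<close>)
    show "(\<Inter>j\<in>{..<n}. Y j -` {a j} \<inter> space Q) \<in> sets Q"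
      using ind False unfolding Q.indep_vars_def2
      by (intro sets.finite_INT) (auto intro!: measurable_sets)
  qed measurable
  also have "\<dots> = ennreal (\<Prod>j\<in>{..<n}. Q.prob (Y j -` {a j} \<inter> space Q))"
    unfolding Q.emeasure_eq_measure using False
    by (subst Q.indep_varsD[OF ind]) auto
  also have "\<dots> = (\<Prod>j\<in>{..<n}. emeasure Q (Y j -` {a j} \<inter> space Q))"
    by (subst prod_ennreal[symmetric]) (auto simp: Q.emeasure_eq_measure)
  also have "\<dots> = (\<Prod>j<n. emeasure Q {X \<in> space Q. cnt (B j) X = of_nat (a j)})"
  proof (intro prod.cong refl emeasure_eq_AE)
    fix j assume j: "j \<in> {..<n}"
    show "AE x in Q. (x \<in> Y j -` {a j} \<inter> space Q) = (x \<in> {X \<in> space Q. cnt (B j) X = of_nat (a j)})"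
      by (rule AE_mp[OF AE], rule AE_I2) (use j in \<open>auto simp: cnt_eq_iff Y_def\<close>)
    show "Y j -` {a j} \<inter> space Q \<in> sets Q"
      using ind j unfolding Q.indep_vars_def2 by (auto intro!: measurable_sets)
    have [measurable]: "B j \<in> sets E" using j by simp
    show "{X \<in> space Q. cnt (B j) X = of_nat (a j)} \<in> sets Q" by measurable
  qed
  finally show ?thesis .
qed

text \<open>The cells and the remainder of \<open>B\<close> have independent Poisson counts. The
  exponential factors multiply to that of \<open>B\<close>, whose volume is the sum, and each cell
  contributes its volume.\<close>

lemma emeasure_exactly_one:
  fixes A :: "nat \<Rightarrow> (nat \<Rightarrow> real) set"
  assumes B [measurable]: "B \<in> sets E" and fin: "emeasure E B < \<infinity>"
    and A [measurable]: "\<And>j. j < n \<Longrightarrow> A j \<in> sets E" and AB: "\<And>j. j < n \<Longrightarrow> A j \<subseteq> B"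
    and disj: "disjoint_family_on A {..<n}"
  shows "emeasure Q {X \<in> space Q. (\<forall>j<n. cnt (A j) X = 1) \<and> cnt (B - (\<Union>j<n. A j)) X = 0} =
    ennreal (exp (- measure E B)) * (\<Prod>j<n. emeasure E (A j))"
proof -
  define C where "C j = (if j < n then A j else B - (\<Union>j<n. A j))" for j
  define a where "a j = (if j < n then 1 else 0 :: nat)" for j
  have [measurable]: "C j \<in> sets E" for j unfolding C_def using A by auto
  have sub: "C j \<subseteq> B" for j using AB by (auto simp: C_def)
  have finC: "emeasure E (C j) < \<infinity>" for j
    using emeasure_mono[OF sub[of j] B] fin by (auto intro: le_less_trans)
  have disjC: "disjoint_family_on C {..<Suc n}"
    using disj by (auto simp: disjoint_family_on_def C_def)
  have U: "(\<Union>j<Suc n. C j) = B" using AB by (auto simp: C_def split: if_splits)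
  have V: "measure E B = (\<Sum>j<Suc n. measure E (C j))"
    unfolding U[symmetric] using disjC finC
    by (intro measure_finite_Union) (auto simp: less_top simp del: sum.lessThan_Suc)
  have e: "emeasure Q {X \<in> space Q. cnt (C j) X = of_nat (a j)} =
     ennreal (exp (- measure E (C j))) * (if j < n then emeasure E (A j) else 1)" for j
  proof (subst emeasure_cnt[OF _ finC])
    show "ennreal (exp (- measure E (C j)) * measure E (C j) ^ a j / fact (a j)) =
       ennreal (exp (- measure E (C j))) * (if j < n then emeasure E (A j) else 1)"
      using finC[of j] by (auto simp: a_def C_def ennreal_mult' emeasure_eq_ennreal_measure less_top)
  qed simp
  have "{X \<in> space Q. (\<forall>j<n. cnt (A j) X = 1) \<and> cnt (B - (\<Union>j<n. A j)) X = 0} =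
    {X \<in> space Q. \<forall>j<Suc n. cnt (C j) X = of_nat (a j)}"
    by (auto simp: less_Suc_eq C_def a_def)
  also have "emeasure Q \<dots> = (\<Prod>j<Suc n. emeasure Q {X \<in> space Q. cnt (C j) X = of_nat (a j)})"
    by (rule emeasure_joint_cnt) (use finC disjC in auto)
  also have "\<dots> = (\<Prod>j<Suc n. ennreal (exp (- measure E (C j)))) * (\<Prod>j<Suc n. (if j < n then emeasure E (A j) else 1))"
    unfolding e by (rule prod.distrib)
  also have "(\<Prod>j<Suc n. ennreal (exp (- measure E (C j)))) = ennreal (exp (- measure E B))"
    unfolding V by (subst prod_ennreal) (auto simp: exp_sum sum_negf[symmetric] simp del: prod.lessThan_Suc sum.lessThan_Suc)
  also have "(\<Prod>j<Suc n. (if j < n then emeasure E (A j) else 1)) = (\<Prod>j<n. emeasure E (A j))" by simp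
  finally show ?thesis .
qed

lemma emeasure_W_Times:
  assumes "F \<in> sets Q" "C \<in> sets PCm"
  shows "emeasure W (F \<times> C) = emeasure Q F * emeasure PCm C"
  unfolding W_eq
  by (rule sigma_finite_measure.emeasure_pair_measure_Times[OF prob_space_imp_sigma_finite[OF PC.P.prob_space_axioms] assms])

lemma AE_fst:
  assumes "AE X in Q. P X" shows "AE w in W. P (fst w)"
proof -
  obtain N where N: "\<And>X. X \<in> space Q - N \<Longrightarrow> P X" "N \<in> null_sets Q" using AE_E3[OF assms] by blast
  show ?thesis
  proof (rule AE_I')
    have [measurable]: "N \<in> sets Q" using N(2) by blast
    show "N \<times> space PCm \<in> null_sets W"
      using N(2) emeasure_W_Times[of N "space PCm"] by (intro null_setsI) (auto simp: W_eq)
    show "{w \<in> space W. \<not> P (fst w)} \<subseteq> N \<times> space PCm"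
      using N(1) by (fastforce simp: W_eq space_pair_measure)
  qed
qed

lemma AE_inj_W: "AE w in W. inj (fst w)"
  by (rule AE_fst[OF AE_inj])

text \<open>Index tuples are extensional, so there are countably many and each ordering is counted
  once.\<close>

definition Idx :: "nat \<Rightarrow> (nat \<Rightarrow> nat) set" where "Idx n = {..<n} \<rightarrow>\<^sub>E UNIV"

lemma countable_Idx [simp]: "countable (Idx n)"
  unfolding Idx_def by (intro countable_PiE) auto

lemma sigma_finite_Idx: "sigma_finite_measure (count_space (Idx n))"
  by (rule sigma_finite_measure_count_space_countable) simp

definition Zt :: "nat \<Rightarrow> (nat \<Rightarrow> nat) \<Rightarrow> (nat \<Rightarrow> nat \<Rightarrow> real) \<times> (nat \<Rightarrow> nat) \<Rightarrow> nat \<Rightarrow> (nat \<Rightarrow> real) \<times> nat" where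
  "Zt n i w = (\<lambda>j\<in>{..<n}. Z (i j) w)"

abbreviation "Pn n \<equiv> PiM {..<n} (\<lambda>_::nat. Mk)"

text \<open>Together the conditions say that \<open>i\<close> orders the set of all indices of
  points in \<open>B\<close>.\<close>

definition full where
  "full B n i X \<longleftrightarrow> inj_on i {..<n} \<and> (\<forall>j<n. X (i j) \<in> B) \<and> cnt B X = of_nat n"

definition nuB where "nuB B = density nu (indicator (B \<times> UNIV))"

lemma sets_nuB [measurable_cong]: "sets (nuB B) = sets Mk"
  by (simp add: nuB_def sets_nu)

lemma space_nuB: "space (nuB B) = space Mk"
  using sets_nuB sets_eq_imp_space_eq by blast

lemma measurable_indicator_Times [measurable]:
  assumes [measurable]: "B \<in> sets E"
  shows "(indicator (B \<times> (UNIV::nat set)) :: _ \<Rightarrow> ennreal) \<in> borel_measurable Mk"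
proof -
  have "(indicator (B \<times> (UNIV::nat set)) :: _ \<Rightarrow> ennreal) = (\<lambda>z. indicator B (fst z))"
    by (auto simp: fun_eq_iff indicator_def)
  moreover have "(\<lambda>z. indicator B (fst z) :: ennreal) \<in> borel_measurable Mk" by measurable
  ultimately show ?thesis by (simp only:)
qed

lemma nn_integral_nuB:
  assumes B [measurable]: "B \<in> sets E" and [measurable]: "f \<in> borel_measurable Mk"
  shows "(\<integral>\<^sup>+z. f z \<partial>nuB B) = (\<integral>\<^sup>+z. indicator B (fst z) * f z \<partial>nu)"
  unfolding nuB_def
  by (subst nn_integral_density) (auto simp: indicator_def intro!: nn_integral_cong)

lemma emeasure_nuB:
  assumes B [measurable]: "B \<in> sets E" and A [measurable]: "A \<in> sets E" and g: "g \<in> {1..k}"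
  shows "emeasure (nuB B) (A \<times> {g}) = emeasure E (A \<inter> B) * ennreal (p g)"
proof -
  have [measurable]: "A \<times> {g} \<in> sets Mk" unfolding Mk_def using g by simp
  have "emeasure (nuB B) (A \<times> {g}) = (\<integral>\<^sup>+z. indicator ((A \<inter> B) \<times> {g}) z \<partial>nu)"
    by (subst nn_integral_indicator[symmetric], simp, subst nn_integral_nuB)
       (auto intro!: nn_integral_cong split: split_indicator)
  also have "\<dots> = emeasure nu ((A \<inter> B) \<times> {g})"
    using g by (intro nn_integral_indicator) (simp add: nu_def sets_point_measure)
  also have "\<dots> = emeasure E (A \<inter> B) * emeasure pm {g}"
    unfolding nu_def using g by (intro pm.emeasure_pair_measure_Times) (auto simp: sets_point_measure)
  finally show ?thesis by (simp add: emeasure_pm[OF g])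
qed

lemma emeasure_nuB_fst:
  assumes B [measurable]: "B \<in> sets E" and A [measurable]: "A \<in> sets E"
  shows "emeasure (nuB B) {z \<in> space Mk. fst z \<in> A} = emeasure E (A \<inter> B)"
proof -
  have [measurable]: "{z \<in> space Mk. fst z \<in> A} \<in> sets Mk" by measurable
  have "emeasure (nuB B) {z \<in> space Mk. fst z \<in> A} = (\<integral>\<^sup>+z. indicator B (fst z) * indicator {z \<in> space Mk. fst z \<in> A} z \<partial>nu)"
    by (subst nn_integral_indicator[symmetric], simp add: sets_nuB, subst nn_integral_nuB) auto
  also have "\<dots> = (\<integral>\<^sup>+z. indicator ((A \<inter> B) \<times> {1..k}) z \<partial>nu)"
    by (auto intro!: nn_integral_cong simp: space_nu space_Mk split: split_indicator)
  also have "\<dots> = emeasure nu ((A \<inter> B) \<times> {1..k})"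
    by (intro nn_integral_indicator) (simp add: nu_def sets_point_measure)
  also have "\<dots> = emeasure E (A \<inter> B) * emeasure pm {1..k}"
    unfolding nu_def by (intro pm.emeasure_pair_measure_Times) (auto simp: sets_point_measure)
  also have "emeasure pm {1..k} = 1" using pm.emeasure_space_1 by (simp add: space_point_measure)
  finally show ?thesis by simp
qed

lemma finite_measure_nuB:
  assumes B [measurable]: "B \<in> sets E" and fin: "emeasure E B < \<infinity>"
  shows "finite_measure (nuB B)"
proof
  have "emeasure (nuB B) (space (nuB B)) = emeasure (nuB B) {z \<in> space Mk. fst z \<in> space E}"
    by (intro arg_cong2[where f=emeasure]) (auto simp: space_nuB space_Mk)
  also have "\<dots> = emeasure E (space E \<inter> B)" by (rule emeasure_nuB_fst) auto
  also have "space E \<inter> B = B" using sets.sets_into_space[OF B] by auto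
  finally show "emeasure (nuB B) (space (nuB B)) \<noteq> \<infinity>" using fin by simp
qed

text \<open>When the cells are disjoint, prescribing the cell of each entry leaves at most one
  ordering of the points of \<open>B\<close>; it exists exactly when each cell holds one point and
  the rest of \<open>B\<close> none.\<close>

lemma one_tuple:
  assumes disj: "disjoint_family_on A {..<n}" and AB: "\<And>j. j < n \<Longrightarrow> A j \<subseteq> B"
  shows "emeasure (count_space (Idx n)) {i \<in> Idx n. inj_on i {..<n} \<and> (\<forall>j<n. X (i j) \<in> A j) \<and> cnt B X = of_nat n} =
     (if (\<forall>j<n. cnt (A j) X = 1) \<and> cnt (B - (\<Union>j<n. A j)) X = 0 then 1 else 0)"
    (is "emeasure _ ?S = (if ?G then 1 else 0)")
proof -
  have dj: "l = j" if "x \<in> A l" "x \<in> A j" "l < n" "j < n" for x l j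
    using disj that by (auto simp: disjoint_family_on_def)
  have cnt1: "cnt C X = 1 \<longleftrightarrow> (\<exists>m. {m. X m \<in> C} = {m})" for C
  proof -
    have "cnt C X = 1 \<longleftrightarrow> finite {m. X m \<in> C} \<and> card {m. X m \<in> C} = Suc 0"
      using cnt_eq_iff[of C X 1] by (simp add: One_nat_def)
    thus ?thesis by (metis card_1_singleton_iff finite.emptyI finite_insert)
  qed
  have cnt0: "cnt C X = 0 \<longleftrightarrow> {m. X m \<in> C} = {}" for C
    using cnt_eq_iff[of C X 0] by auto
  have G: "?G" if i: "i \<in> ?S" for i
  proof -
    have I: "finite {m. X m \<in> B}" "card {m. X m \<in> B} = n" using i cnt_eq_iff by auto
    have "i ` {..<n} \<subseteq> {m. X m \<in> B}" using i AB by auto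
    moreover have "card (i ` {..<n}) = n" using i by (subst card_image) auto
    ultimately have eq: "{m. X m \<in> B} = i ` {..<n}" using I by (intro card_subset_eq[symmetric]) auto
    have "{m. X m \<in> A j} = {i j}" if j: "j < n" for j
    proof (intro equalityI subsetI)
      fix m assume m: "m \<in> {m. X m \<in> A j}"
      then obtain l where l: "l < n" "m = i l" using eq AB[OF j] by blast
      hence "X m \<in> A l" using i by auto
      thus "m \<in> {i j}" using dj[of "X m" l j] m l j by auto
    qed (use i j in auto)
    moreover have "{m. X m \<in> B - (\<Union>j<n. A j)} = {}"
    proof -
      have "X m \<in> (\<Union>j<n. A j)" if "X m \<in> B" for m
      proof -
        have "m \<in> i ` {..<n}" using eq that by blast
        thus ?thesis using i by blast
      qed
      thus ?thesis by blast
    qed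
    ultimately show ?G unfolding cnt1 cnt0 by blast
  qed
  show ?thesis
  proof (cases ?G)
    case False
    hence "?S = {}" using G by blast
    thus ?thesis using False by (simp only: emeasure_empty if_False)
  next
    case True
    hence "\<forall>j<n. \<exists>m. {m. X m \<in> A j} = {m}" unfolding cnt1 by blast
    then obtain f where f: "\<And>j. j < n \<Longrightarrow> {m. X m \<in> A j} = {f j}" by metis
    define i0 where "i0 = restrict f {..<n}"
    have i0: "{m. X m \<in> A j} = {i0 j}" if "j < n" for j using f[OF that] that by (simp add: i0_def)
    have inj: "inj_on i0 {..<n}"
    proof (rule inj_onI)
      fix l j assume "l \<in> {..<n}" "j \<in> {..<n}" "i0 l = i0 j"
      thus "l = j" using i0[of l] i0[of j] dj[of "X (i0 j)" l j] by auto
    qed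
    have rest: "{m. X m \<in> B - (\<Union>j<n. A j)} = {}" using True unfolding cnt0 by blast
    have "{m. X m \<in> B} = i0 ` {..<n}"
    proof (intro equalityI subsetI)
      fix m assume "m \<in> {m. X m \<in> B}"
      then obtain j where "j < n" "X m \<in> A j" using rest by auto
      thus "m \<in> i0 ` {..<n}" using i0[of j] by auto
    next
      fix m assume "m \<in> i0 ` {..<n}"
      thus "m \<in> {m. X m \<in> B}" using i0 AB by blast
    qed
    hence "cnt B X = of_nat n" unfolding cnt_eq_iff using inj by (simp add: card_image)
    moreover have "i0 \<in> Idx n" by (simp add: Idx_def i0_def)
    moreover have "X (i0 j) \<in> A j" if "j < n" for j using i0[OF that] by auto
    ultimately have mem: "i0 \<in> ?S" using inj by simp
    have "i = i0" if i: "i \<in> ?S" for i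
    proof (rule PiE_ext[of i "{..<n}" "\<lambda>_. UNIV"])
      show "i \<in> {..<n} \<rightarrow>\<^sub>E UNIV" "i0 \<in> {..<n} \<rightarrow>\<^sub>E UNIV" using i mem by (auto simp: Idx_def)
      fix j assume "j \<in> {..<n}"
      thus "i j = i0 j" using i i0[of j] by blast
    qed
    hence S: "?S = {i0}" using mem by blast
    have "emeasure (count_space (Idx n)) {i0} = 1"
      using mem emeasure_count_space_finite[of "{i0}" "Idx n"] by simp
    thus ?thesis unfolding S if_P[OF True] .
  qed
qed

end

section \<open>Ordered points of a window of finite volume\<close>

locale poisson_window = poisson_model +
  fixes B assumes B [measurable]: "B \<in> sets E" and finB: "emeasure E B < \<infinity>"
begin

sublocale nuB: finite_measure "nuB B" by (rule finite_measure_nuB[OF B finB])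
sublocale PnB: product_sigma_finite "\<lambda>_::nat. nuB B" by unfold_locales

lemma sets_PiM_nuB [measurable_cong]: "sets (PiM J (\<lambda>_. nuB B)) = sets (PiM J (\<lambda>_. Mk))"
  by (intro sets_PiM_cong sets_nuB refl)

lemma measurable_Zt [measurable]: "(\<lambda>(w, i). Zt n i w) \<in> W \<Otimes>\<^sub>M count_space (Idx n) \<rightarrow>\<^sub>M Pn n"
  by (rule measurable_pair_measure_countable2) (auto simp: Zt_def[abs_def])

lemma measurable_fst_W [measurable]: "fst \<in> W \<rightarrow>\<^sub>M Q"
  by (simp add: W_eq)

lemma measurable_full_Q [measurable]: "Measurable.pred Q (full B n i)"
  unfolding full_def[abs_def] by measurable

lemma measurable_full [measurable]:
  "(\<lambda>(w, i). indicator {w. full B n i (fst w)} w :: ennreal) \<in> borel_measurable (W \<Otimes>\<^sub>M count_space (Idx n))"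
proof -
  have *: "(\<lambda>(w, i). indicator {w. full B n i (fst w)} w) = (\<lambda>(w, i). if full B n i (fst w) then 1 else 0 :: ennreal)"
    by (auto simp: indicator_def fun_eq_iff)
  show ?thesis unfolding * by (rule measurable_pair_measure_countable2) simp_all
qed

text \<open>
  The law of the \<open>n\<close> points in the window in arbitrary order, summed over the orders, on the event that there are
  exactly \<open>n\<close>. Tuples whose entries lie in distinct grid cells are handled by independence over disjoint cells.
\<close>

definition tuple_measure where
  "tuple_measure n = distr (density (W \<Otimes>\<^sub>M count_space (Idx n)) (\<lambda>(w, i). indicator {w. full B n i (fst w)} w))
     (Pn n) (\<lambda>(w, i). Zt n i w)"

lemma sets_tuple_measure [measurable_cong]: "sets (tuple_measure n) = sets (Pn n)"
  by (simp add: tuple_measure_def)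

lemma nn_integral_tuple:
  assumes [measurable]: "g \<in> borel_measurable (Pn n)"
  shows "(\<integral>\<^sup>+\<zeta>. g \<zeta> \<partial>tuple_measure n) =
     (\<integral>\<^sup>+w. \<integral>\<^sup>+i. indicator {w. full B n i (fst w)} w * g (Zt n i w) \<partial>count_space (Idx n) \<partial>W)"
proof -
  interpret I: sigma_finite_measure "count_space (Idx n)" by (rule sigma_finite_Idx)
  have "(\<integral>\<^sup>+\<zeta>. g \<zeta> \<partial>tuple_measure n) = (\<integral>\<^sup>+x. (case x of (w, i) \<Rightarrow> indicator {w. full B n i (fst w)} w) *
     g (case x of (w, i) \<Rightarrow> Zt n i w) \<partial>(W \<Otimes>\<^sub>M count_space (Idx n)))"
    unfolding tuple_measure_def by (subst nn_integral_distr, simp, simp, subst nn_integral_density) auto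
  also have "\<dots> = (\<integral>\<^sup>+w. \<integral>\<^sup>+i. (case (w, i) of (w, i) \<Rightarrow> indicator {w. full B n i (fst w)} w) *
     g (case (w, i) of (w, i) \<Rightarrow> Zt n i w) \<partial>count_space (Idx n) \<partial>W)"
    by (rule I.nn_integral_fst[symmetric]) measurable
  finally show ?thesis by simp
qed

lemma emeasure_tuple:
  assumes [measurable]: "D \<in> sets (Pn n)"
  shows "emeasure (tuple_measure n) D =
     (\<integral>\<^sup>+i. emeasure W {w \<in> space W. full B n i (fst w) \<and> Zt n i w \<in> D} \<partial>count_space (Idx n))"
proof -
  interpret I: sigma_finite_measure "count_space (Idx n)" by (rule sigma_finite_Idx)
  interpret WI: pair_sigma_finite W "count_space (Idx n)" by unfold_locales
  have "emeasure (tuple_measure n) D = (\<integral>\<^sup>+w. \<integral>\<^sup>+i. indicator {w. full B n i (fst w)} w * indicator D (Zt n i w) \<partial>count_space (Idx n) \<partial>W)"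
    by (subst nn_integral_indicator[symmetric], simp, subst nn_integral_tuple) auto
  also have "\<dots> = (\<integral>\<^sup>+i. \<integral>\<^sup>+w. indicator {w. full B n i (fst w)} w * indicator D (Zt n i w) \<partial>W \<partial>count_space (Idx n))"
    by (rule WI.Fubini'[symmetric]) measurable
  also have "\<dots> = (\<integral>\<^sup>+i. emeasure W {w \<in> space W. full B n i (fst w) \<and> Zt n i w \<in> D} \<partial>count_space (Idx n))"
  proof (intro nn_integral_cong)
    fix i
    have [measurable]: "Zt n i \<in> W \<rightarrow>\<^sub>M Pn n" unfolding Zt_def[abs_def] by measurable
    have "{w \<in> space W. full B n i (fst w) \<and> Zt n i w \<in> D} \<in> sets W" by measurable
    thus "(\<integral>\<^sup>+w. indicator {w. full B n i (fst w)} w * indicator D (Zt n i w) \<partial>W) =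
      emeasure W {w \<in> space W. full B n i (fst w) \<and> Zt n i w \<in> D}"
      by (subst nn_integral_indicator[symmetric])
         (auto intro!: nn_integral_cong simp del: nn_integral_indicator split: split_indicator)
  qed
  finally show ?thesis .
qed

lemma emeasure_colours:
  fixes i g :: "nat \<Rightarrow> nat" and n :: nat
  assumes inj: "inj_on i {..<n}" and g: "\<And>j. j < n \<Longrightarrow> g j \<in> {1..k}"
  shows "emeasure PCm {c \<in> space PCm. \<forall>j<n. c (i j) = g j} = (\<Prod>j<n. ennreal (p (g j)))"
proof -
  \<comment> \<open>\<open>?h\<close> transports the colours from positions in the tuple to indices
    of the colour sequence.\<close>
  let ?h = "\<lambda>m. g (the_inv_into {..<n} i m)"
  have h: "?h (i j) = g j" if "j < n" for j using that inj by (simp add: the_inv_into_f_f)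
  have *: "{c \<in> space PCm. \<forall>j<n. c (i j) = g j} = {c \<in> space PCm. \<forall>m\<in>i ` {..<n}. c m \<in> {?h m}}"
    using h by auto
  have "emeasure PCm {c \<in> space PCm. \<forall>j<n. c (i j) = g j} = (\<Prod>m\<in>i ` {..<n}. emeasure pm {?h m})"
    unfolding *
    by (rule PC.emeasure_PiM_Collect) (use h g in \<open>auto simp: sets_point_measure simp del: atLeastAtMost_iff\<close>)
  also have "\<dots> = (\<Prod>j<n. emeasure pm {?h (i j)})"
    using prod.reindex[OF inj, of "\<lambda>m. emeasure pm {?h m}"] by (simp only: o_def)
  also have "\<dots> = (\<Prod>j<n. ennreal (p (g j)))"
    by (intro prod.cong refl) (simp only: h lessThan_iff emeasure_pm[OF g])
  finally show ?thesis .
qed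

text \<open>Summed over the orderings, the event becomes one about counts
  (\<open>one_tuple\<close>), whose probability \<open>emeasure_exactly_one\<close> gives. The
  colours at distinct indices are independent of it and contribute the product of the
  \<open>p (g j)\<close>.\<close>

lemma emeasure_tuple_rect:
  assumes A [measurable]: "\<And>j. j < n \<Longrightarrow> A j \<in> sets E" and disj: "disjoint_family_on A {..<n}"
    and g: "\<And>j. j < n \<Longrightarrow> g j \<in> {1..k}"
  shows "emeasure (tuple_measure n) (\<Pi>\<^sub>E j\<in>{..<n}. A j \<times> {g j}) =
    ennreal (exp (- measure E B)) * (\<Prod>j<n. emeasure E (A j \<inter> B) * ennreal (p (g j)))"
proof -
  interpret I: sigma_finite_measure "count_space (Idx n)" by (rule sigma_finite_Idx)
  interpret QI: pair_sigma_finite Q "count_space (Idx n)" by unfold_locales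
  let ?D = "\<Pi>\<^sub>E j\<in>{..<n}. A j \<times> {g j}" let ?P = "\<Prod>j<n. ennreal (p (g j))"
  let ?F = "\<lambda>i. {X \<in> space Q. inj_on i {..<n} \<and> (\<forall>j<n. X (i j) \<in> A j \<inter> B) \<and> cnt B X = of_nat n}"
  have D: "?D \<in> sets (Pn n)"
    unfolding Mk_def using A g by (intro sets_PiM_I_finite) auto
  have F [measurable]: "?F i \<in> sets Q" for i
  proof -
    have "{X \<in> space Q. X (i j) \<in> A j \<inter> B} \<in> sets Q" if "j < n" for j
    proof -
      have [measurable]: "A j \<in> sets E" using A that by simp
      show ?thesis by measurable
    qed
    hence "{X \<in> space Q. \<forall>j\<in>{..<n}. X (i j) \<in> A j \<inter> B} \<in> sets Q"
      by (intro sets.sets_Collect_finite_All) auto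
    hence "{X \<in> space Q. \<forall>j<n. X (i j) \<in> A j \<inter> B} \<in> sets Q" by (simp add: Ball_def)
    moreover have "{X \<in> space Q. inj_on i {..<n} \<and> cnt B X = of_nat n} \<in> sets Q" by measurable
    ultimately have "{X \<in> space Q. \<forall>j<n. X (i j) \<in> A j \<inter> B} \<inter> {X \<in> space Q. inj_on i {..<n} \<and> cnt B X = of_nat n} \<in> sets Q"
      by (rule sets.Int)
    also have "{X \<in> space Q. \<forall>j<n. X (i j) \<in> A j \<inter> B} \<inter> {X \<in> space Q. inj_on i {..<n} \<and> cnt B X = of_nat n} = ?F i"
      by auto
    finally show ?thesis .
  qed
  have "emeasure W {w \<in> space W. full B n i (fst w) \<and> Zt n i w \<in> ?D} = emeasure Q (?F i) * ?P" for i
  proof (cases "inj_on i {..<n}")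
    case True
    let ?C = "{c \<in> space PCm. \<forall>j<n. c (i j) = g j}"
    have "{w \<in> space W. full B n i (fst w) \<and> Zt n i w \<in> ?D} = ?F i \<times> ?C"
      by (auto simp: W_eq space_pair_measure full_def Zt_def Z_def PiE_iff)
    moreover have "?C \<in> sets PCm"
    proof -
      have "{c \<in> space PCm. c (i j) = g j} \<in> sets PCm" if "j < n" for j
      proof -
        have "{c \<in> space PCm. c (i j) = g j} = (\<lambda>c. c (i j)) -` {g j} \<inter> space PCm" by auto
        also have "\<dots> \<in> sets PCm"
          using g[OF that] by (intro measurable_sets[OF measurable_component_singleton]) (auto simp: sets_point_measure)
        finally show ?thesis .
      qed
      hence "{c \<in> space PCm. \<forall>j\<in>{..<n}. c (i j) = g j} \<in> sets PCm"
        by (intro sets.sets_Collect_finite_All) auto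
      thus ?thesis by (simp add: Ball_def)
    qed
    ultimately have "emeasure W {w \<in> space W. full B n i (fst w) \<and> Zt n i w \<in> ?D} = emeasure Q (?F i) * emeasure PCm ?C"
      by (simp only: emeasure_W_Times[OF F])
    thus ?thesis by (simp only: emeasure_colours[OF True g])
  next
    case False
    hence "{w \<in> space W. full B n i (fst w) \<and> Zt n i w \<in> ?D} = {}" "?F i = {}" by (auto simp: full_def)
    thus ?thesis by (simp only: emeasure_empty mult_zero_left)
  qed
  hence "emeasure (tuple_measure n) ?D = (\<integral>\<^sup>+i. emeasure Q (?F i) * ?P \<partial>count_space (Idx n))"
    by (simp only: emeasure_tuple[OF D])
  also have "\<dots> = (\<integral>\<^sup>+i. emeasure Q (?F i) \<partial>count_space (Idx n)) * ?P"
    by (rule nn_integral_multc) simp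
  also have "(\<integral>\<^sup>+i. emeasure Q (?F i) \<partial>count_space (Idx n)) = (\<integral>\<^sup>+i. \<integral>\<^sup>+X. indicator (?F i) X \<partial>Q \<partial>count_space (Idx n))"
    by (simp only: nn_integral_indicator[OF F])
  also have "\<dots> = (\<integral>\<^sup>+X. \<integral>\<^sup>+i. indicator (?F i) X \<partial>count_space (Idx n) \<partial>Q)"
    by (rule QI.Fubini') (auto intro!: measurable_pair_measure_countable2)
  also have "\<dots> = (\<integral>\<^sup>+X. indicator {X \<in> space Q. (\<forall>j<n. cnt (A j \<inter> B) X = 1) \<and> cnt (B - (\<Union>j<n. A j \<inter> B)) X = 0} X \<partial>Q)"
  proof (intro nn_integral_cong)
    fix X assume X: "X \<in> space Q"
    have dj: "disjoint_family_on (\<lambda>j. A j \<inter> B) {..<n}" using disj by (auto simp: disjoint_family_on_def)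
    have "(\<integral>\<^sup>+i. indicator (?F i) X \<partial>count_space (Idx n)) =
      (\<integral>\<^sup>+i. indicator {i \<in> Idx n. inj_on i {..<n} \<and> (\<forall>j<n. X (i j) \<in> A j \<inter> B) \<and> cnt B X = of_nat n} i \<partial>count_space (Idx n))"
      using X by (intro nn_integral_cong) (auto simp: indicator_def)
    also have "\<dots> = emeasure (count_space (Idx n)) {i \<in> Idx n. inj_on i {..<n} \<and> (\<forall>j<n. X (i j) \<in> A j \<inter> B) \<and> cnt B X = of_nat n}"
      by (rule nn_integral_indicator) auto
    finally show "(\<integral>\<^sup>+i. indicator (?F i) X \<partial>count_space (Idx n)) =
      indicator {X \<in> space Q. (\<forall>j<n. cnt (A j \<inter> B) X = 1) \<and> cnt (B - (\<Union>j<n. A j \<inter> B)) X = 0} X"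
      using X by (subst (asm) one_tuple[OF dj]) (auto simp: indicator_def)
  qed
  also have "\<dots> = emeasure Q {X \<in> space Q. (\<forall>j<n. cnt (A j \<inter> B) X = 1) \<and> cnt (B - (\<Union>j<n. A j \<inter> B)) X = 0}"
  proof (rule nn_integral_indicator)
    have "{X \<in> space Q. cnt (A j \<inter> B) X = 1} \<in> sets Q" if "j < n" for j
    proof -
      have [measurable]: "A j \<in> sets E" using A that by simp
      show ?thesis by measurable
    qed
    hence "{X \<in> space Q. \<forall>j\<in>{..<n}. cnt (A j \<inter> B) X = 1} \<in> sets Q"
      by (intro sets.sets_Collect_finite_All) auto
    moreover have "(\<Union>j<n. A j \<inter> B) \<in> sets E" using A by (intro sets.finite_UN) auto
    hence "{X \<in> space Q. cnt (B - (\<Union>j<n. A j \<inter> B)) X = 0} \<in> sets Q" by measurable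
    ultimately have "{X \<in> space Q. \<forall>j\<in>{..<n}. cnt (A j \<inter> B) X = 1} \<inter> {X \<in> space Q. cnt (B - (\<Union>j<n. A j \<inter> B)) X = 0} \<in> sets Q"
      by (rule sets.Int)
    thus "{X \<in> space Q. (\<forall>j<n. cnt (A j \<inter> B) X = 1) \<and> cnt (B - (\<Union>j<n. A j \<inter> B)) X = 0} \<in> sets Q"
      by (rule back_subst[where P="\<lambda>S. S \<in> sets Q"]) auto
  qed
  also have "\<dots> = ennreal (exp (- measure E B)) * (\<Prod>j<n. emeasure E (A j \<inter> B))"
    by (rule emeasure_exactly_one[OF B finB]) (use A disj in \<open>auto simp: disjoint_family_on_def\<close>)
  finally show ?thesis by (simp add: prod.distrib mult.assoc)
qed

end

lemma eventually_grid_cell_inj: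
  assumes "finite F" "F \<subseteq> space (euclid d)"
  shows "\<forall>\<^sub>F N in sequentially. inj_on (grid_cell d N) F"
proof -
  have ne: "\<forall>\<^sub>F N in sequentially. grid_cell d N x \<noteq> grid_cell d N y" if xy: "x \<in> F" "y \<in> F" "x \<noteq> y" for x y
  proof -
    obtain N0 where N0: "grid_cell d N0 x \<noteq> grid_cell d N0 y"
      using grid_cell_separates[of x d y] assms(2) xy by blast
    have "grid_cell d N x \<noteq> grid_cell d N y" if "N \<ge> N0" for N
      using that N0 by (induction N rule: dec_induct) (auto dest: grid_cell_refine)
    thus ?thesis unfolding eventually_sequentially by blast
  qed
  have "\<forall>\<^sub>F N in sequentially. \<forall>x\<in>F. \<forall>y\<in>F. x \<noteq> y \<longrightarrow> grid_cell d N x \<noteq> grid_cell d N y"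
    using ne assms(1) by (intro eventually_ball_finite ballI) (auto intro: eventually_mono)
  thus ?thesis by eventually_elim (auto simp: inj_on_def)
qed

definition inj_tuples :: "nat \<Rightarrow> nat set \<Rightarrow> (nat \<Rightarrow> nat) set" where
  "inj_tuples n I = {i \<in> {..<n} \<rightarrow>\<^sub>E UNIV. inj_on i {..<n} \<and> (\<forall>j<n. i j \<in> I)}"

lemma bij_betw_inj_tuples:
  assumes a: "a \<in> I"
  shows "bij_betw (\<lambda>i. restrict i {..<n}) {i \<in> inj_tuples (Suc n) I. i n = a} (inj_tuples n (I - {a}))"
proof (rule bij_betw_byWitness[where f' = "\<lambda>f. f(n := a)"])
  show "\<forall>i\<in>{i \<in> inj_tuples (Suc n) I. i n = a}. (restrict i {..<n})(n := a) = i"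
    by (auto simp: inj_tuples_def fun_eq_iff PiE_iff extensional_def)
  show "\<forall>f\<in>inj_tuples n (I - {a}). restrict (f(n := a)) {..<n} = f"
    by (auto simp: inj_tuples_def fun_eq_iff PiE_iff extensional_def)
  show "(\<lambda>i. restrict i {..<n}) ` {i \<in> inj_tuples (Suc n) I. i n = a} \<subseteq> inj_tuples n (I - {a})"
  proof (intro image_subsetI)
    fix i assume i: "i \<in> {i \<in> inj_tuples (Suc n) I. i n = a}"
    hence inj: "inj_on i {..<Suc n}" by (simp add: inj_tuples_def)
    have "i j \<noteq> a" if "j < n" for j
      using inj_onD[OF inj, of j n] i that by auto
    moreover have "inj_on i {..<n}" using inj by (rule inj_on_subset) auto
    ultimately show "restrict i {..<n} \<in> inj_tuples n (I - {a})"
      using i by (auto simp: inj_tuples_def inj_on_def)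
  qed
  show "(\<lambda>f. f(n := a)) ` inj_tuples n (I - {a}) \<subseteq> {i \<in> inj_tuples (Suc n) I. i n = a}"
  proof (intro image_subsetI)
    fix f assume f: "f \<in> inj_tuples n (I - {a})"
    have "inj_on (f(n := a)) {..<Suc n}"
      unfolding lessThan_Suc inj_on_insert using f by (auto simp: inj_tuples_def inj_on_def)
    thus "f(n := a) \<in> {i \<in> inj_tuples (Suc n) I. i n = a}"
      using f a by (auto simp: inj_tuples_def PiE_iff extensional_def less_Suc_eq)
  qed
qed

lemma card_inj_tuples:
  assumes "finite I" "card I = n"
  shows "finite (inj_tuples n I) \<and> card (inj_tuples n I) = fact n"
  using assms
proof (induction n arbitrary: I)
  case 0 thus ?case by (simp add: inj_tuples_def)
next
  case (Suc n)
  let ?S = "\<lambda>a. {i \<in> inj_tuples (Suc n) I. i n = a}"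
  have S: "finite (?S a) \<and> card (?S a) = fact n" if "a \<in> I" for a
  proof -
    have "finite (inj_tuples n (I - {a})) \<and> card (inj_tuples n (I - {a})) = fact n"
      using Suc.prems that by (intro Suc.IH) auto
    moreover note b = bij_betw_inj_tuples[OF that, of n]
    ultimately show ?thesis using bij_betw_finite[OF b] bij_betw_same_card[OF b] by simp
  qed
  have U: "inj_tuples (Suc n) I = (\<Union>a\<in>I. ?S a)" by (auto simp: inj_tuples_def)
  have "card (\<Union>a\<in>I. ?S a) = (\<Sum>a\<in>I. card (?S a))"
    using Suc.prems S by (intro card_UN_disjoint) auto
  also have "\<dots> = fact (Suc n)" using S Suc.prems by simp
  finally have "card (inj_tuples (Suc n) I) = fact (Suc n)" using U by simp
  moreover have "finite (\<Union>a\<in>I. ?S a)" using S Suc.prems by blast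
  ultimately show ?case using U by simp
qed

lemma card_inj_tuples_last:
  assumes "finite I" "card I = Suc n" "a \<in> I"
  shows "card {i \<in> inj_tuples (Suc n) I. i n = a} = fact n"
proof -
  have "card (inj_tuples n (I - {a})) = fact n"
    using card_inj_tuples[of "I - {a}" n] assms by simp
  thus ?thesis using bij_betw_same_card[OF bij_betw_inj_tuples[OF assms(3), of n]] by simp
qed

lemma image_inj_tuple:
  assumes "i \<in> inj_tuples n I" "finite I" "card I = n"
  shows "i ` {..<n} = I"
proof (rule card_subset_eq[OF assms(2)])
  show "i ` {..<n} \<subseteq> I" using assms(1) by (auto simp: inj_tuples_def)
  show "card (i ` {..<n}) = card I" using assms by (subst card_image) (auto simp: inj_tuples_def)
qed

section \<open>Comparison of the ordered points with a product measure\<close>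

context poisson_window
begin

definition separated :: "nat \<Rightarrow> nat \<Rightarrow> (nat \<Rightarrow> (nat \<Rightarrow> real) \<times> nat) set" where
  "separated n N = {\<zeta> \<in> space (Pn n). inj_on (\<lambda>j. grid_cell d N (fst (\<zeta> j))) {..<n}}"

lemma measurable_Pair_Mk: "g \<in> {1..k} \<Longrightarrow> (\<lambda>x. (x, g)) \<in> E \<rightarrow>\<^sub>M Mk"
  unfolding Mk_def by measurable

text \<open>The separated part of a box is a countable disjoint union of products, indexed by the
  cells and colours of the entries. Within each product the cells are distinct, hence disjoint, and
  \<open>emeasure_tuple_rect\<close> applies.\<close>

lemma emeasure_tuple_separated:
  assumes A: "\<And>j. j < n \<Longrightarrow> A j \<in> sets Mk"
  shows "emeasure (tuple_measure n) (Pi\<^sub>E {..<n} A \<inter> separated n N) =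
    ennreal (exp (- measure E B)) * emeasure (PiM {..<n} (\<lambda>_. nuB B)) (Pi\<^sub>E {..<n} A \<inter> separated n N)"
    and "Pi\<^sub>E {..<n} A \<inter> separated n N \<in> sets (Pn n)"
proof -
  define Qs where "Qs = {q \<in> {..<n} \<rightarrow>\<^sub>E (UNIV :: int list set) \<times> {1..k}. inj_on (\<lambda>j. fst (q j)) {..<n}}"
  have "countable ({..<n} \<rightarrow>\<^sub>E (UNIV :: int list set) \<times> {1..k})" by (intro countable_PiE) auto
  hence Qs: "countable Qs" unfolding Qs_def by (rule countable_subset[rotated]) auto
  define C where "C q j = {x \<in> space E. (x, snd (q j)) \<in> A j \<and> grid_cell d N x = fst (q j)}" for q :: "nat \<Rightarrow> int list \<times> nat" and j
  define D where "D q = (\<Pi>\<^sub>E j\<in>{..<n}. C q j \<times> {snd (q j)})" for q :: "nat \<Rightarrow> int list \<times> nat"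
  have g: "snd (q j) \<in> {1..k}" if "q \<in> Qs" "j < n" for q j
    using that by (auto simp: Qs_def PiE_iff mem_Times_iff simp del: atLeastAtMost_iff)
  have C: "C q j \<in> sets E" if q: "q \<in> Qs" "j < n" for q j
  proof -
    have [measurable]: "(\<lambda>x. (x, snd (q j))) \<in> E \<rightarrow>\<^sub>M Mk" using g[OF q] by (rule measurable_Pair_Mk)
    have [measurable]: "A j \<in> sets Mk" using A q by simp
    show ?thesis unfolding C_def by measurable
  qed
  have Ds: "D q \<in> sets (Pn n)" if "q \<in> Qs" for q
    unfolding D_def Mk_def using C[OF that] g[OF that] by (intro sets_PiM_I_finite) auto
  have U: "Pi\<^sub>E {..<n} A \<inter> separated n N = (\<Union>q\<in>Qs. D q)"
  proof (intro equalityI subsetI)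
    fix \<zeta> assume z: "\<zeta> \<in> Pi\<^sub>E {..<n} A \<inter> separated n N"
    have sp: "\<zeta> j \<in> space Mk" "\<zeta> j \<in> A j" if "j < n" for j
      using z that sets.sets_into_space[OF A[OF that]] by (auto simp: PiE_iff)
    define q where "q = (\<lambda>j\<in>{..<n}. (grid_cell d N (fst (\<zeta> j)), snd (\<zeta> j)))"
    have "q \<in> Qs" using z sp by (auto simp: Qs_def q_def separated_def space_Mk inj_on_def mem_Times_iff)
    moreover have "\<zeta> \<in> D q" using z sp by (auto simp: D_def C_def q_def PiE_iff space_Mk mem_Times_iff)
    ultimately show "\<zeta> \<in> (\<Union>q\<in>Qs. D q)" by blast
  next
    fix \<zeta> assume "\<zeta> \<in> (\<Union>q\<in>Qs. D q)"
    then obtain q where q: "q \<in> Qs" "\<zeta> \<in> D q" by blast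
    have j: "fst (\<zeta> j) \<in> space E \<and> \<zeta> j \<in> A j \<and> grid_cell d N (fst (\<zeta> j)) = fst (q j)" if "j < n" for j
    proof -
      have "\<zeta> j \<in> C q j \<times> {snd (q j)}" using q(2) that by (auto simp: D_def PiE_iff)
      thus ?thesis by (cases "\<zeta> j") (auto simp: C_def)
    qed
    have "\<zeta> \<in> Pi\<^sub>E {..<n} A" using q(2) j by (auto simp: D_def PiE_iff)
    moreover have "\<zeta> \<in> space (Pn n)" using Ds[OF q(1)] q(2) sets.sets_into_space by blast
    moreover have "inj_on (\<lambda>j. grid_cell d N (fst (\<zeta> j))) {..<n} \<longleftrightarrow> inj_on (\<lambda>j. fst (q j)) {..<n}"
      using j by (intro inj_on_cong) auto
    ultimately show "\<zeta> \<in> Pi\<^sub>E {..<n} A \<inter> separated n N" using q(1) by (auto simp: separated_def Qs_def)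
  qed
  have disj: "disjoint_family_on D Qs"
    unfolding disjoint_family_on_def
  proof (intro ballI impI)
    fix q q' assume qq: "q \<in> Qs" "q' \<in> Qs" "q \<noteq> q'"
    show "D q \<inter> D q' = {}"
    proof (rule ccontr)
      assume "D q \<inter> D q' \<noteq> {}"
      then obtain \<zeta> where z: "\<zeta> \<in> D q" "\<zeta> \<in> D q'" by blast
      have "q j = q' j" if "j < n" for j
      proof -
        have "\<zeta> j \<in> C q j \<times> {snd (q j)}" "\<zeta> j \<in> C q' j \<times> {snd (q' j)}"
          using z that by (auto simp: D_def PiE_iff)
        thus ?thesis by (auto simp: C_def prod_eq_iff)
      qed
      hence "q = q'" using qq(1,2) unfolding Qs_def by (auto intro!: PiE_ext[of q "{..<n}" _ q'])
      thus False using qq by simp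
    qed
  qed
  show "Pi\<^sub>E {..<n} A \<inter> separated n N \<in> sets (Pn n)"
    unfolding U using Qs Ds by (intro sets.countable_UN'') auto
  have P: "emeasure (PiM {..<n} (\<lambda>_. nuB B)) (D q) = (\<Prod>j<n. emeasure E (C q j \<inter> B) * ennreal (p (snd (q j))))"
    if q: "q \<in> Qs" for q
  proof -
    have "emeasure (PiM {..<n} (\<lambda>_. nuB B)) (D q) = (\<Prod>j<n. emeasure (nuB B) (C q j \<times> {snd (q j)}))"
      unfolding D_def using C[OF q] g[OF q] by (intro PnB.emeasure_PiM) (auto simp: sets_nuB Mk_def)
    thus ?thesis using C[OF q] g[OF q] emeasure_nuB[OF B] by simp
  qed
  have T: "emeasure (tuple_measure n) (D q) = ennreal (exp (- measure E B)) * emeasure (PiM {..<n} (\<lambda>_. nuB B)) (D q)"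
    if q: "q \<in> Qs" for q
    unfolding P[OF q] unfolding D_def
  proof (rule emeasure_tuple_rect)
    show "disjoint_family_on (C q) {..<n}"
      using q by (auto simp: disjoint_family_on_def C_def Qs_def inj_on_def)
  qed (use C[OF q] g[OF q] in auto)
  have "emeasure (tuple_measure n) (\<Union>q\<in>Qs. D q) = (\<integral>\<^sup>+q. emeasure (tuple_measure n) (D q) \<partial>count_space Qs)"
    using Qs Ds disj by (intro emeasure_UN_countable) (auto simp: sets_tuple_measure)
  also have "\<dots> = (\<integral>\<^sup>+q. ennreal (exp (- measure E B)) * emeasure (PiM {..<n} (\<lambda>_. nuB B)) (D q) \<partial>count_space Qs)"
    using T by (intro nn_integral_cong) auto
  also have "\<dots> = ennreal (exp (- measure E B)) * (\<integral>\<^sup>+q. emeasure (PiM {..<n} (\<lambda>_. nuB B)) (D q) \<partial>count_space Qs)"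
    by (rule nn_integral_cmult) simp
  also have "(\<integral>\<^sup>+q. emeasure (PiM {..<n} (\<lambda>_. nuB B)) (D q) \<partial>count_space Qs) = emeasure (PiM {..<n} (\<lambda>_. nuB B)) (\<Union>q\<in>Qs. D q)"
    using Qs Ds disj by (intro emeasure_UN_countable[symmetric]) (auto simp: sets_PiM_nuB)
  finally show "emeasure (tuple_measure n) (Pi\<^sub>E {..<n} A \<inter> separated n N) =
    ennreal (exp (- measure E B)) * emeasure (PiM {..<n} (\<lambda>_. nuB B)) (Pi\<^sub>E {..<n} A \<inter> separated n N)"
    unfolding U .
qed

text \<open>Coincidence is expressed by distance 0, which makes it visibly measurable.\<close>

definition collide :: "nat \<Rightarrow> nat \<Rightarrow> nat \<Rightarrow> (nat \<Rightarrow> (nat \<Rightarrow> real) \<times> nat) set" where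
  "collide n j l = {\<zeta> \<in> space (Pn n). vdist d (fst (\<zeta> j)) (fst (\<zeta> l)) = 0}"

lemma measurable_vdist_components:
  "j < n \<Longrightarrow> l < n \<Longrightarrow> (\<lambda>\<zeta>. vdist d (fst (\<zeta> j)) (fst (\<zeta> l))) \<in> borel_measurable (Pn n)"
  by (intro measurable_vdist) simp_all

lemma sets_collide:
  assumes "j < n" "l < n" shows "collide n j l \<in> sets (Pn n)"
proof -
  note m = measurable_vdist_components[OF assms]
  have "collide n j l = (\<lambda>\<zeta>. vdist d (fst (\<zeta> j)) (fst (\<zeta> l))) -` {0} \<inter> space (Pn n)"
    by (auto simp: collide_def)
  thus ?thesis using measurable_sets[OF m, of "{0}"] by simp
qed

text \<open>With the other entries fixed, entry \<open>l\<close> would have to lie on a sphere of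
  radius 0, which is null.\<close>

lemma emeasure_PiM_collide:
  assumes jl: "j < n" "l < n" "j \<noteq> l"
  shows "emeasure (PiM {..<n} (\<lambda>_. nuB B)) (collide n j l) = 0"
proof -
  let ?f = "\<lambda>\<zeta>. indicator {0} (vdist d (fst (\<zeta> j)) (fst (\<zeta> l))) :: ennreal"
  let ?I = "{..<n} - {l}"
  have ins: "insert l ?I = {..<n}" using jl by auto
  note [measurable] = measurable_vdist_components[OF jl(1,2)]
  have fm [measurable]: "?f \<in> borel_measurable (Pn n)" by measurable
  have fm': "?f \<in> borel_measurable (PiM (insert l ?I) (\<lambda>_. nuB B))"
    unfolding ins measurable_cong_sets[OF sets_PiM_nuB refl] by (rule fm)
  have "emeasure (PiM {..<n} (\<lambda>_. nuB B)) (collide n j l) = (\<integral>\<^sup>+\<zeta>. ?f \<zeta> \<partial>PiM {..<n} (\<lambda>_. nuB B))"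
    using sets_collide[OF jl(1,2)]
    by (subst nn_integral_indicator[symmetric])
       (auto intro!: nn_integral_cong simp: sets_PiM_nuB collide_def space_PiM space_nuB simp del: nn_integral_indicator split: split_indicator)
  also have "\<dots> = (\<integral>\<^sup>+\<zeta>. ?f \<zeta> \<partial>PiM (insert l ?I) (\<lambda>_. nuB B))" by (simp only: ins)
  also have "\<dots> = (\<integral>\<^sup>+x. \<integral>\<^sup>+y. ?f (x(l := y)) \<partial>nuB B \<partial>PiM ?I (\<lambda>_. nuB B))"
    by (rule PnB.product_nn_integral_insert[OF _ _ fm']) simp_all
  also have "\<dots> = (\<integral>\<^sup>+x. 0 \<partial>PiM ?I (\<lambda>_. nuB B))"
  proof (intro nn_integral_cong)
    fix x :: "nat \<Rightarrow> (nat \<Rightarrow> real) \<times> nat"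
    let ?S = "{y \<in> space E. vdist d (fst (x j)) y = 0}"
    have S: "?S \<in> sets E" by measurable
    have "(\<integral>\<^sup>+y. ?f (x(l := y)) \<partial>nuB B) = (\<integral>\<^sup>+y. indicator {z \<in> space Mk. fst z \<in> ?S} y \<partial>nuB B)"
      using jl by (intro nn_integral_cong) (auto simp: space_nuB space_Mk split: split_indicator)
    also have "\<dots> = emeasure (nuB B) {z \<in> space Mk. fst z \<in> ?S}"
      using S by (intro nn_integral_indicator) (simp add: sets_nuB)
    also have "\<dots> = emeasure E (?S \<inter> B)" by (rule emeasure_nuB_fst[OF B S])
    also have "\<dots> \<le> emeasure E ?S" by (rule emeasure_mono) (auto simp: S)
    also have "\<dots> = 0" by (rule emeasure_vsphere[OF d])
    finally show "(\<integral>\<^sup>+y. ?f (x(l := y)) \<partial>nuB B) = 0" by simp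
  qed
  finally show ?thesis by simp
qed

text \<open>The enumeration is almost surely injective and the tuples use distinct indices.\<close>

lemma emeasure_tuple_collide:
  assumes jl: "j < n" "l < n" "j \<noteq> l"
  shows "emeasure (tuple_measure n) (collide n j l) = 0"
proof -
  have "emeasure W {w \<in> space W. full B n i (fst w) \<and> Zt n i w \<in> collide n j l} = 0" for i
  proof (rule emeasure_eq_0_AE)
    show "AE w in W. \<not> (full B n i (fst w) \<and> Zt n i w \<in> collide n j l)"
      using AE_inj_W
    proof (eventually_elim, intro notI, elim conjE)
      fix w assume inj: "inj (fst w)" and f: "full B n i (fst w)" and c: "Zt n i w \<in> collide n j l"
      have "i j \<noteq> i l" using f jl by (auto simp: full_def inj_on_def)
      hence ne: "fst w (i j) \<noteq> fst w (i l)" using inj by (auto simp: inj_eq)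
      have "Zt n i w \<in> space (Pn n)" using c by (simp add: collide_def)
      hence "Zt n i w j \<in> space Mk" "Zt n i w l \<in> space Mk" using jl by (auto simp: space_PiM)
      hence "fst w (i j) \<in> space E" "fst w (i l) \<in> space E" using jl by (auto simp: Zt_def Z_def space_Mk)
      hence "vdist d (fst w (i j)) (fst w (i l)) \<noteq> 0" using ne vdist_eq_0_iff[OF d] by blast
      thus False using c jl by (simp add: collide_def Zt_def Z_def)
    qed
  qed
  thus ?thesis by (simp add: emeasure_tuple[OF sets_collide[OF jl(1,2)]])
qed

lemma not_collide_imp_separated:
  assumes z: "\<zeta> \<in> space (Pn n)" and nc: "\<And>j l. j < n \<Longrightarrow> l < n \<Longrightarrow> j \<noteq> l \<Longrightarrow> \<zeta> \<notin> collide n j l"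
  shows "\<exists>N. \<zeta> \<in> separated n N"
proof -
  let ?F = "(\<lambda>j. fst (\<zeta> j)) ` {..<n}"
  have sp: "fst (\<zeta> j) \<in> space E" if "j < n" for j using z that by (auto simp: space_PiM space_Mk PiE_iff mem_Times_iff)
  have inj: "inj_on (\<lambda>j. fst (\<zeta> j)) {..<n}"
  proof (rule inj_onI, rule ccontr)
    fix j l assume jl: "j \<in> {..<n}" "l \<in> {..<n}" "fst (\<zeta> j) = fst (\<zeta> l)" "j \<noteq> l"
    hence "vdist d (fst (\<zeta> j)) (fst (\<zeta> l)) = 0" using sp vdist_eq_0_iff[OF d] by auto
    thus False using nc[of j l] jl z by (auto simp: collide_def)
  qed
  have "\<forall>\<^sub>F N in sequentially. inj_on (grid_cell d N) ?F"
    using sp by (intro eventually_grid_cell_inj) auto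
  then obtain N where "inj_on (grid_cell d N) ?F" using eventually_happens'[OF sequentially_bot] by blast
  hence "inj_on (grid_cell d N \<circ> (\<lambda>j. fst (\<zeta> j))) {..<n}" using inj by (rule comp_inj_on[rotated])
  thus ?thesis using z by (auto simp: separated_def o_def)
qed

text \<open>Distinct points are separated by a fine enough grid, and refinement preserves
  separation. A measure that ignores collisions is therefore the supremum over grid levels of its
  separated parts.\<close>

lemma emeasure_eq_Sup_separated:
  assumes M: "sets M = sets (Pn n)" and c: "\<And>j l. j < n \<Longrightarrow> l < n \<Longrightarrow> j \<noteq> l \<Longrightarrow> emeasure M (collide n j l) = 0"
    and A: "\<And>j. j < n \<Longrightarrow> A j \<in> sets Mk"
  shows "emeasure M (Pi\<^sub>E {..<n} A) = (SUP N. emeasure M (Pi\<^sub>E {..<n} A \<inter> separated n N))"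
proof -
  have sub: "separated n N \<subseteq> separated n (Suc N)" for N
    by (auto simp: separated_def inj_on_def dest: grid_cell_refine)
  have "(SUP N. emeasure M (Pi\<^sub>E {..<n} A \<inter> separated n N)) = emeasure M (\<Union>N. Pi\<^sub>E {..<n} A \<inter> separated n N)"
  proof (rule SUP_emeasure_incseq)
    show "range (\<lambda>N. Pi\<^sub>E {..<n} A \<inter> separated n N) \<subseteq> sets M"
      unfolding M using emeasure_tuple_separated(2)[of n A] A by blast
    show "incseq (\<lambda>N. Pi\<^sub>E {..<n} A \<inter> separated n N)"
      using sub by (intro incseq_SucI) blast
  qed
  also have "\<dots> = emeasure M (Pi\<^sub>E {..<n} A)"
  proof (rule emeasure_eq_AE)
    have AE1: "AE \<zeta> in M. \<forall>j\<in>{..<n}. \<forall>l\<in>{..<n}. j \<noteq> l \<longrightarrow> \<zeta> \<notin> collide n j l"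
    proof (intro AE_finite_allI finite_lessThan)
      fix j l assume "j \<in> {..<n}" "l \<in> {..<n}"
      show "AE \<zeta> in M. j \<noteq> l \<longrightarrow> \<zeta> \<notin> collide n j l"
      proof (cases "j = l")
        case False
        hence "collide n j l \<in> null_sets M"
          using c[of j l] sets_collide[of j n l] M \<open>j \<in> {..<n}\<close> \<open>l \<in> {..<n}\<close> by (auto intro: null_setsI)
        from AE_not_in[OF this] show ?thesis by eventually_elim auto
      qed simp
    qed
    show "AE x in M. (x \<in> (\<Union>N. Pi\<^sub>E {..<n} A \<inter> separated n N)) = (x \<in> Pi\<^sub>E {..<n} A)"
    proof (rule AE_mp[OF AE1], rule AE_I2, rule impI)
      fix \<zeta> assume "\<zeta> \<in> space M" and nc: "\<forall>j\<in>{..<n}. \<forall>l\<in>{..<n}. j \<noteq> l \<longrightarrow> \<zeta> \<notin> collide n j l"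
      hence "\<zeta> \<in> space (Pn n)" using sets_eq_imp_space_eq[OF M] by simp
      hence "\<exists>N. \<zeta> \<in> separated n N" using nc by (intro not_collide_imp_separated) auto
      thus "(\<zeta> \<in> (\<Union>N. Pi\<^sub>E {..<n} A \<inter> separated n N)) = (\<zeta> \<in> Pi\<^sub>E {..<n} A)" by blast
    qed
    show "(\<Union>N. Pi\<^sub>E {..<n} A \<inter> separated n N) \<in> sets M"
      unfolding M using emeasure_tuple_separated(2)[of n A] A by blast
    show "Pi\<^sub>E {..<n} A \<in> sets M" unfolding M using A by (intro sets_PiM_I_finite) auto
  qed
  finally show ?thesis by simp
qed

text \<open>The Janossy measures of the Poisson process. Both sides ignore collisions and agree on
  the separated parts of boxes, so they agree on boxes, which generate the sigma-algebra.\<close>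

lemma tuple_measure_eq:
  "tuple_measure n = density (PiM {..<n} (\<lambda>_. nuB B)) (\<lambda>_. ennreal (exp (- measure E B)))" (is "_ = ?R")
proof -
  have eq: "emeasure (tuple_measure n) (Pi\<^sub>E {..<n} A) = emeasure ?R (Pi\<^sub>E {..<n} A)"
    if A: "\<And>j. j < n \<Longrightarrow> A j \<in> sets Mk" for A
  proof -
    have D: "emeasure ?R S = ennreal (exp (- measure E B)) * emeasure (PiM {..<n} (\<lambda>_. nuB B)) S"
      if "S \<in> sets (Pn n)" for S
      using that by (subst emeasure_density) (auto simp: sets_PiM_nuB nn_integral_cmult_indicator)
    have "emeasure (tuple_measure n) (Pi\<^sub>E {..<n} A) = (SUP N. emeasure (tuple_measure n) (Pi\<^sub>E {..<n} A \<inter> separated n N))"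
      by (rule emeasure_eq_Sup_separated[OF sets_tuple_measure emeasure_tuple_collide A])
    also have "\<dots> = (SUP N. emeasure ?R (Pi\<^sub>E {..<n} A \<inter> separated n N))"
      using emeasure_tuple_separated[of n A] A D by simp
    also have "\<dots> = emeasure ?R (Pi\<^sub>E {..<n} A)"
    proof (rule emeasure_eq_Sup_separated[symmetric])
      show "sets ?R = sets (Pn n)" by (simp add: sets_PiM_nuB)
      show "emeasure ?R (collide n j l) = 0" if "j < n" "l < n" "j \<noteq> l" for j l
        using D[OF sets_collide] emeasure_PiM_collide that by simp
    qed (rule A)
    finally show ?thesis .
  qed
  interpret PB: finite_product_sigma_finite "\<lambda>_::nat. nuB B" "{..<n}" by unfold_locales simp
  show ?thesis
  proof (rule measure_eqI_PiM_finite[of "{..<n}" _ "\<lambda>_. Mk" _ "\<lambda>_. space (Pn n)"])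
    show "range (\<lambda>_. space (Pn n)) \<subseteq> prod_algebra {..<n} (\<lambda>_. Mk)"
      using prod_algebraI_finite[of "{..<n}" "\<lambda>_. space Mk" "\<lambda>_. Mk"] by (auto simp: space_PiM)
    have "emeasure (PiM {..<n} (\<lambda>_. nuB B)) (Pi\<^sub>E {..<n} (\<lambda>_. space Mk)) = (\<Prod>j<n. emeasure (nuB B) (space Mk))"
      by (intro PnB.emeasure_PiM) (auto simp: sets_nuB)
    also have "\<dots> < \<infinity>"
    proof -
      have "emeasure (nuB B) (space Mk) < \<top>" using nuB.emeasure_finite[of "space Mk"] by (simp only: less_top[symmetric]) simp
      thus ?thesis by (simp add: power_less_top_ennreal)
    qed
    finally have "emeasure ?R (space (Pn n)) < \<infinity>"
      by (subst emeasure_density) (auto simp: nn_integral_cmult_indicator ennreal_mult_less_top space_PiM sets_PiM_nuB intro!: sets_PiM_I_finite)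
    thus "emeasure (tuple_measure n) (space (Pn n)) \<noteq> \<infinity>" using eq[of "\<lambda>_. space Mk"] by (simp add: space_PiM)
  qed (use eq in \<open>auto simp: sets_tuple_measure sets_PiM_nuB\<close>)
qed

theorem nn_integral_tuples:
  assumes [measurable]: "g \<in> borel_measurable (Pn n)"
  shows "(\<integral>\<^sup>+w. \<integral>\<^sup>+i. indicator {w. full B n i (fst w)} w * g (Zt n i w) \<partial>count_space (Idx n) \<partial>W) =
    ennreal (exp (- measure E B)) * (\<integral>\<^sup>+\<zeta>. g \<zeta> \<partial>PiM {..<n} (\<lambda>_. nuB B))"
  unfolding nn_integral_tuple[OF assms, symmetric] tuple_measure_eq
  by (subst nn_integral_density) (auto intro!: nn_integral_cmult)

end

section \<open>The law of a window and the Mecke formula\<close>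

context poisson_window
begin

definition eta :: "(nat \<Rightarrow> nat \<Rightarrow> real) \<times> (nat \<Rightarrow> nat) \<Rightarrow> ((nat \<Rightarrow> real) \<times> nat) set" where
  "eta w = coloured_points w \<inter> (B \<times> UNIV)"

lemma eta_eq: "eta w = (\<lambda>m. Z m w) ` {m. fst w m \<in> B}"
  unfolding eta_def coloured_points_eq by (auto simp: Z_def)

lemma inj_Z: "inj (fst w) \<Longrightarrow> inj (\<lambda>m. Z m w)"
  by (auto simp: inj_def Z_def)

lemma AE_good: "AE w in W. inj (fst w) \<and> finite {m. fst w m \<in> B}"
  using AE_inj_W AE_fst[OF AE_cnt_finite[OF B finB]] by eventually_elim auto

lemma nn_integral_cong_good:
  assumes "\<And>w. inj (fst w) \<and> finite {m. fst w m \<in> B} \<Longrightarrow> f w = g w"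
  shows "(\<integral>\<^sup>+w. f w \<partial>W) = (\<integral>\<^sup>+w. g w \<partial>W)"
proof (rule nn_integral_cong_AE)
  show "AE w in W. f w = g w" using AE_good by eventually_elim (rule assms)
qed

lemma measurable_tuple_sum:
  assumes [measurable]: "g \<in> borel_measurable (Pn n)"
  shows "(\<lambda>w. \<integral>\<^sup>+i. indicator {w. full B n i (fst w)} w * g (Zt n i w) \<partial>count_space (Idx n)) \<in> borel_measurable W"
proof -
  interpret I: sigma_finite_measure "count_space (Idx n)" by (rule sigma_finite_Idx)
  have "(\<lambda>(w, i). (case (w, i) of (w, i) \<Rightarrow> indicator {w. full B n i (fst w)} w) * g (case (w, i) of (w, i) \<Rightarrow> Zt n i w))
    \<in> borel_measurable (W \<Otimes>\<^sub>M count_space (Idx n))"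
    by measurable
  from I.borel_measurable_nn_integral[OF this] show ?thesis by simp
qed

lemma tuple_sum:
  assumes fin: "finite {m. fst w m \<in> B}"
  shows "(\<integral>\<^sup>+i. indicator {w. full B n i (fst w)} w * (\<phi> i :: ennreal) \<partial>count_space (Idx n)) =
    (if card {m. fst w m \<in> B} = n then \<Sum>i\<in>inj_tuples n {m. fst w m \<in> B}. \<phi> i else 0)"
proof (cases "card {m. fst w m \<in> B} = n")
  case True
  let ?S = "inj_tuples n {m. fst w m \<in> B}"
  have full: "full B n i (fst w) \<longleftrightarrow> i \<in> ?S" if "i \<in> Idx n" for i
    using that True fin by (simp add: full_def inj_tuples_def Idx_def cnt_eq_iff)
  have "(\<integral>\<^sup>+i. indicator {w. full B n i (fst w)} w * \<phi> i \<partial>count_space (Idx n)) =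
    (\<Sum>i\<in>?S. indicator {w. full B n i (fst w)} w * \<phi> i)"
  proof (rule nn_integral_count_space')
    show "finite ?S" using card_inj_tuples[OF fin True] by simp
    show "?S \<subseteq> Idx n" by (auto simp: inj_tuples_def Idx_def)
    show "indicator {w. full B n i (fst w)} w * \<phi> i = 0" if "i \<in> Idx n" "i \<notin> ?S" for i
      using that full by simp
  qed
  also have "\<dots> = (\<Sum>i\<in>?S. \<phi> i)"
    using full by (intro sum.cong) (auto simp: inj_tuples_def Idx_def)
  finally show ?thesis using True by simp
next
  case False
  hence "\<not> full B n i (fst w)" for i by (auto simp: full_def cnt_eq_iff)
  thus ?thesis using False by simp
qed

lemma suminf_single: "(\<And>n. n \<noteq> m \<Longrightarrow> f n = 0) \<Longrightarrow> (\<Sum>n. f n) = (f m :: ennreal)"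
  by (subst suminf_finite[of "{m}"]) auto

lemma ennreal_fact_cancel: "ennreal (1 / fact n) * (of_nat (fact n) * x) = x"
proof -
  have "ennreal (1 / fact n) * of_nat (fact n) = 1"
    by (simp add: ennreal_of_nat_eq_real_of_nat ennreal_mult'[symmetric] flip: ennreal_1)
  thus ?thesis by (simp add: mult.assoc[symmetric])
qed

lemma ennreal_fact_cancel': "ennreal (1 / fact n) * (fact n * x) = x"
  using ennreal_fact_cancel[of n x] by simp

text \<open>Each configuration of \<open>n\<close> points is listed by \<open>fact n\<close> tuples.
  The right-hand side does not involve \<open>Q\<close>: functionals of a window have the same mean
  for every enumeration of the process, which later stands in for translation invariance of
  \<open>Q\<close>.\<close>

theorem nn_integral_eta:
  assumes G: "\<And>n. (\<lambda>\<zeta>. G (\<zeta> ` {..<n})) \<in> borel_measurable (Pn n)"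
  shows "(\<integral>\<^sup>+w. G (eta w) \<partial>W) =
    (\<Sum>n. ennreal (1 / fact n) * (ennreal (exp (- measure E B)) * (\<integral>\<^sup>+\<zeta>. G (\<zeta> ` {..<n}) \<partial>PiM {..<n} (\<lambda>_. nuB B))))"
proof -
  let ?T = "\<lambda>n w. \<integral>\<^sup>+i. indicator {w. full B n i (fst w)} w * G (Zt n i w ` {..<n}) \<partial>count_space (Idx n)"
  have "G (eta w) = (\<Sum>n. ennreal (1 / fact n) * ?T n w)" if w: "inj (fst w) \<and> finite {m. fst w m \<in> B}" for w
  proof -
    let ?I = "{m. fst w m \<in> B}"
    have fin: "finite ?I" using w by simp
    have T: "?T n w = (if card ?I = n then of_nat (fact n) * G (eta w) else 0)" for n
    proof (cases "card ?I = n")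
      case True
      have "Zt n i w ` {..<n} = eta w" if "i \<in> inj_tuples n ?I" for i
      proof -
        have "Zt n i w ` {..<n} = (\<lambda>m. Z m w) ` (i ` {..<n})" by (simp add: Zt_def image_image)
        thus ?thesis by (simp only: image_inj_tuple[OF that fin True] eta_eq)
      qed
      hence "?T n w = (\<Sum>i\<in>inj_tuples n ?I. G (eta w))"
        unfolding tuple_sum[OF fin] using True by simp
      thus ?thesis using True card_inj_tuples[OF fin True] by simp
    qed (simp add: tuple_sum[OF fin])
    show ?thesis
      by (subst suminf_single[of "card ?I"]) (auto simp: T ennreal_fact_cancel')
  qed
  hence "(\<integral>\<^sup>+w. G (eta w) \<partial>W) = (\<integral>\<^sup>+w. (\<Sum>n. ennreal (1 / fact n) * ?T n w) \<partial>W)"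
    by (rule nn_integral_cong_good)
  also have "\<dots> = (\<Sum>n. \<integral>\<^sup>+w. ennreal (1 / fact n) * ?T n w \<partial>W)"
    by (rule nn_integral_suminf) (intro borel_measurable_times_ennreal measurable_tuple_sum G borel_measurable_const)
  also have "\<dots> = (\<Sum>n. ennreal (1 / fact n) * (\<integral>\<^sup>+w. ?T n w \<partial>W))"
    by (intro suminf_cong nn_integral_cmult measurable_tuple_sum G)
  finally show ?thesis by (simp only: nn_integral_tuples[OF G])
qed

lemma nn_integral_eta_measurable:
  assumes F: "\<And>n. (\<lambda>(z, \<zeta>). F z (\<zeta> ` {..<n})) \<in> borel_measurable (Mk \<Otimes>\<^sub>M Pn n)"
  shows "(\<lambda>z. \<integral>\<^sup>+w. F z (eta w) \<partial>W) \<in> borel_measurable Mk"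
    and "\<And>z::(nat \<Rightarrow> real) \<times> nat. z \<in> space Mk \<Longrightarrow> (\<integral>\<^sup>+w. F z (eta w) \<partial>W) =
    (\<Sum>n. ennreal (1 / fact n) * (ennreal (exp (- measure E B)) * (\<integral>\<^sup>+\<zeta>. F z (\<zeta> ` {..<n}) \<partial>PiM {..<n} (\<lambda>_. nuB B))))"
    and "\<And>n::nat. (\<lambda>z. \<integral>\<^sup>+\<zeta>. F z (\<zeta> ` {..<n}) \<partial>PiM {..<n} (\<lambda>_. nuB B)) \<in> borel_measurable Mk"
proof -
  show eq: "(\<integral>\<^sup>+w. F z (eta w) \<partial>W) =
    (\<Sum>n. ennreal (1 / fact n) * (ennreal (exp (- measure E B)) * (\<integral>\<^sup>+\<zeta>. F z (\<zeta> ` {..<n}) \<partial>PiM {..<n} (\<lambda>_. nuB B))))"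
    if z: "z \<in> space Mk" for z
  proof (rule nn_integral_eta)
    fix n
    have "(\<lambda>\<zeta>. (z, \<zeta>)) \<in> Pn n \<rightarrow>\<^sub>M Mk \<Otimes>\<^sub>M Pn n" using z by measurable
    from measurable_compose[OF this F] show "(\<lambda>\<zeta>. F z (\<zeta> ` {..<n})) \<in> borel_measurable (Pn n)" by simp
  qed
  have m: "(\<lambda>z. \<integral>\<^sup>+\<zeta>. F z (\<zeta> ` {..<n}) \<partial>PiM {..<n} (\<lambda>_. nuB B)) \<in> borel_measurable Mk" for n :: nat
  proof -
    interpret PB: finite_product_sigma_finite "\<lambda>_::nat. nuB B" "{..<n}" by unfold_locales simp
    have "(\<lambda>(z, \<zeta>). F z (\<zeta> ` {..<n})) \<in> borel_measurable (Mk \<Otimes>\<^sub>M PiM {..<n} (\<lambda>_. nuB B))"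
      using F[of n] by (simp cong: measurable_cong_sets sets_pair_measure_cong add: measurable_cong_sets[OF sets_pair_measure_cong[OF refl sets_PiM_nuB] refl])
    thus ?thesis by (rule PB.borel_measurable_nn_integral)
  qed
  show "(\<lambda>z. \<integral>\<^sup>+\<zeta>. F z (\<zeta> ` {..<n}) \<partial>PiM {..<n} (\<lambda>_. nuB B)) \<in> borel_measurable Mk" for n :: nat by (rule m)
  have "(\<lambda>z. \<Sum>n. ennreal (1 / fact n) * (ennreal (exp (- measure E B)) * (\<integral>\<^sup>+\<zeta>. F z (\<zeta> ` {..<n}) \<partial>PiM {..<n} (\<lambda>_. nuB B)))) \<in> borel_measurable Mk"
    using m by measurable
  thus "(\<lambda>z. \<integral>\<^sup>+w. F z (eta w) \<partial>W) \<in> borel_measurable Mk"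
    by (subst measurable_cong[OF eq])
qed

text \<open>Summing over the points of a configuration of size \<open>Suc n\<close> amounts to
  singling out the last entry of an ordering, and each point is last in \<open>fact n\<close>
  orderings. Integrating that entry separately leaves the weight \<open>1 / fact n\<close>, which is
  the weight of configurations of size \<open>n\<close> in \<open>nn_integral_eta\<close>.\<close>

theorem mecke:
  assumes F: "\<And>n. (\<lambda>(z, \<zeta>). F z (\<zeta> ` {..<n})) \<in> borel_measurable (Mk \<Otimes>\<^sub>M Pn n)"
  shows "(\<integral>\<^sup>+w. (\<integral>\<^sup>+z\<in>eta w. F z (eta w - {z}) \<partial>count_space UNIV) \<partial>W) = (\<integral>\<^sup>+z. (\<integral>\<^sup>+w. F z (eta w) \<partial>W) \<partial>nuB B)"
proof -
  let ?g = "\<lambda>(n::nat) \<zeta>. F (\<zeta> n) (\<zeta> ` {..<n})"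
  let ?T = "\<lambda>n w. \<integral>\<^sup>+i. indicator {w. full B (Suc n) i (fst w)} w * ?g n (Zt (Suc n) i w) \<partial>count_space (Idx (Suc n))"
  let ?V = "ennreal (exp (- measure E B))"
  have g: "?g n \<in> borel_measurable (Pn (Suc n))" for n
  proof -
    have r: "(\<lambda>\<zeta>. (\<zeta> n, restrict \<zeta> {..<n})) \<in> Pn (Suc n) \<rightarrow>\<^sub>M Mk \<Otimes>\<^sub>M Pn n"
      by (intro measurable_Pair measurable_component_singleton measurable_restrict_subset) auto
    have "?g n = (\<lambda>\<zeta>. (case (\<zeta> n, restrict \<zeta> {..<n}) of (z, \<zeta>) \<Rightarrow> F z (\<zeta> ` {..<n})))" by simp
    also have "\<dots> \<in> borel_measurable (Pn (Suc n))" by (rule measurable_compose[OF r F])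
    finally show ?thesis .
  qed
  have "(\<integral>\<^sup>+z\<in>eta w. F z (eta w - {z}) \<partial>count_space UNIV) = (\<Sum>n. ennreal (1 / fact n) * ?T n w)"
    if w: "inj (fst w) \<and> finite {m. fst w m \<in> B}" for w
  proof -
    let ?I = "{m. fst w m \<in> B}" let ?H = "\<Sum>m\<in>?I. F (Z m w) (eta w - {Z m w})"
    have fin: "finite ?I" using w by simp
    have injZ: "inj (\<lambda>m. Z m w)" using w inj_Z by blast
    have "(\<integral>\<^sup>+z\<in>eta w. F z (eta w - {z}) \<partial>count_space UNIV) = (\<Sum>z\<in>eta w. F z (eta w - {z}))"
      using fin by (subst nn_integral_count_space'[of "eta w"]) (auto simp: eta_eq)
    also have "\<dots> = ?H"
      by (subst eta_eq, subst sum.reindex) (use injZ in \<open>auto simp: inj_on_def inj_eq\<close>)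
    finally have H: "(\<integral>\<^sup>+z\<in>eta w. F z (eta w - {z}) \<partial>count_space UNIV) = ?H" .
    have T: "?T n w = (if card ?I = Suc n then of_nat (fact n) * ?H else 0)" for n
    proof (cases "card ?I = Suc n")
      case True
      have i: "?g n (Zt (Suc n) i w) = F (Z (i n) w) (eta w - {Z (i n) w})" if i: "i \<in> inj_tuples (Suc n) ?I" for i
      proof -
        have "inj_on i {..<Suc n}" using i by (simp add: inj_tuples_def)
        moreover have "{..<n} = {..<Suc n} - {n}" by auto
        ultimately have "i ` {..<n} = i ` {..<Suc n} - {i n}"
          by (simp add: inj_on_image_set_diff[of i "{..<Suc n}"])
        hence "i ` {..<n} = ?I - {i n}" using image_inj_tuple[OF i fin True] by simp
        hence "(\<lambda>m. Z m w) ` (i ` {..<n}) = eta w - {Z (i n) w}"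
          unfolding eta_eq using injZ by (simp add: image_set_diff)
        thus ?thesis by (simp add: Zt_def image_image)
      qed
      have "?T n w = (\<Sum>i\<in>inj_tuples (Suc n) ?I. F (Z (i n) w) (eta w - {Z (i n) w}))"
        unfolding tuple_sum[OF fin] using True i by (simp cong: sum.cong)
      also have "\<dots> = (\<Sum>a\<in>?I. \<Sum>i\<in>{i \<in> inj_tuples (Suc n) ?I. i n = a}. F (Z (i n) w) (eta w - {Z (i n) w}))"
        by (rule sum.group[symmetric]) (use card_inj_tuples[OF fin True] fin in \<open>auto simp: inj_tuples_def\<close>)
      also have "\<dots> = (\<Sum>a\<in>?I. of_nat (fact n) * F (Z a w) (eta w - {Z a w}))"
        using card_inj_tuples_last[OF fin True] by (intro sum.cong refl) simp
      finally show ?thesis using True by (simp add: sum_distrib_left)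
    qed (simp add: tuple_sum[OF fin])
    show ?thesis
    proof (cases "card ?I")
      case 0
      hence "?I = {}" using fin by simp
      hence "?H = 0" by simp
      thus ?thesis unfolding H T using 0 by simp
    next
      case (Suc m)
      thus ?thesis unfolding H by (subst suminf_single[of m]) (auto simp: T ennreal_fact_cancel')
    qed
  qed
  hence "(\<integral>\<^sup>+w. (\<integral>\<^sup>+z\<in>eta w. F z (eta w - {z}) \<partial>count_space UNIV) \<partial>W) = (\<integral>\<^sup>+w. (\<Sum>n. ennreal (1 / fact n) * ?T n w) \<partial>W)"
    by (rule nn_integral_cong_good)
  also have "\<dots> = (\<Sum>n. \<integral>\<^sup>+w. ennreal (1 / fact n) * ?T n w \<partial>W)"
    by (rule nn_integral_suminf) (intro borel_measurable_times_ennreal measurable_tuple_sum g borel_measurable_const)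
  also have "\<dots> = (\<Sum>n. ennreal (1 / fact n) * (\<integral>\<^sup>+w. ?T n w \<partial>W))"
    by (intro suminf_cong nn_integral_cmult measurable_tuple_sum g)
  also have "\<dots> = (\<Sum>n. ennreal (1 / fact n) * (?V * (\<integral>\<^sup>+z. \<integral>\<^sup>+\<zeta>. F z (\<zeta> ` {..<n}) \<partial>PiM {..<n} (\<lambda>_. nuB B) \<partial>nuB B)))"
  proof (intro suminf_cong)
    fix n
    have g': "?g n \<in> borel_measurable (PiM (insert n {..<n}) (\<lambda>_. nuB B))"
      using g[of n] unfolding lessThan_Suc measurable_cong_sets[OF sets_PiM_nuB refl] .
    have "(\<integral>\<^sup>+\<zeta>. ?g n \<zeta> \<partial>PiM {..<Suc n} (\<lambda>_. nuB B)) =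
      (\<integral>\<^sup>+z. \<integral>\<^sup>+\<zeta>. ?g n (\<zeta>(n := z)) \<partial>PiM {..<n} (\<lambda>_. nuB B) \<partial>nuB B)"
      unfolding lessThan_Suc by (rule PnB.product_nn_integral_insert_rev[OF _ _ g']) simp_all
    also have "\<dots> = (\<integral>\<^sup>+z. \<integral>\<^sup>+\<zeta>. F z (\<zeta> ` {..<n}) \<partial>PiM {..<n} (\<lambda>_. nuB B) \<partial>nuB B)"
    proof (intro nn_integral_cong)
      fix z and \<zeta> :: "nat \<Rightarrow> (nat \<Rightarrow> real) \<times> nat"
      have "(\<zeta>(n := z)) ` {..<n} = \<zeta> ` {..<n}" by (intro image_cong) auto
      thus "?g n (\<zeta>(n := z)) = F z (\<zeta> ` {..<n})" by simp
    qed
    finally show "ennreal (1 / fact n) * (\<integral>\<^sup>+w. ?T n w \<partial>W) =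
      ennreal (1 / fact n) * (?V * (\<integral>\<^sup>+z. \<integral>\<^sup>+\<zeta>. F z (\<zeta> ` {..<n}) \<partial>PiM {..<n} (\<lambda>_. nuB B) \<partial>nuB B))"
      unfolding nn_integral_tuples[OF g] by simp
  qed
  also have "\<dots> = (\<Sum>n. \<integral>\<^sup>+z. ennreal (1 / fact n) * (?V * (\<integral>\<^sup>+\<zeta>. F z (\<zeta> ` {..<n}) \<partial>PiM {..<n} (\<lambda>_. nuB B))) \<partial>nuB B)"
    using nn_integral_eta_measurable(3)[OF F]
    by (intro suminf_cong) (subst nn_integral_cmult; (subst nn_integral_cmult)?; simp)
  also have "\<dots> = (\<integral>\<^sup>+z. (\<Sum>n. ennreal (1 / fact n) * (?V * (\<integral>\<^sup>+\<zeta>. F z (\<zeta> ` {..<n}) \<partial>PiM {..<n} (\<lambda>_. nuB B)))) \<partial>nuB B)"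
    using nn_integral_eta_measurable(3)[OF F] by (intro nn_integral_suminf[symmetric]) simp
  also have "\<dots> = (\<integral>\<^sup>+z. (\<integral>\<^sup>+w. F z (eta w) \<partial>W) \<partial>nuB B)"
    using nn_integral_eta_measurable(2)[OF F] by (intro nn_integral_cong) (simp add: space_nuB)
  finally show ?thesis .
qed

end

section \<open>Measurability of functionals of random configurations\<close>

context poisson_model
begin

text \<open>
  A random configuration counts as measurable if it consists of measurable points \<open>Zs j\<close>, each switched on by a
  measurable condition \<open>R j\<close>. This replaces a \<open>\<sigma>\<close>-algebra on configurations.
\<close>

definition mconf :: "'w measure \<Rightarrow> ('w \<Rightarrow> ((nat \<Rightarrow> real) \<times> nat) set) \<Rightarrow> bool" where
  "mconf M \<eta> \<longleftrightarrow> (\<exists>Zs R. (\<forall>j::nat. Zs j \<in> M \<rightarrow>\<^sub>M Mk \<and> Measurable.pred M (R j)) \<and>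
     (\<forall>w\<in>space M. \<eta> w = {Zs j w |j. R j w}))"

lemma mconfE:
  assumes "mconf M \<eta>"
  obtains Zs R where "\<And>j::nat. Zs j \<in> M \<rightarrow>\<^sub>M Mk" "\<And>j. Measurable.pred M (R j)"
    "\<And>w. w \<in> space M \<Longrightarrow> \<eta> w = {Zs j w |j. R j w}"
  using assms unfolding mconf_def by blast

lemma mconfI:
  assumes "\<And>j::nat. Zs j \<in> M \<rightarrow>\<^sub>M Mk" "\<And>j. Measurable.pred M (R j)"
    "\<And>w. w \<in> space M \<Longrightarrow> \<eta> w = {Zs j w |j. R j w}"
  shows "mconf M \<eta>"
  using assms unfolding mconf_def by blast

lemma space_Mk_nonempty: "\<exists>z. z \<in> space Mk"
proof -
  have "{1..k} \<noteq> {}" using p_sum by (cases "{1..k} = {}") auto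
  thus ?thesis by (auto simp: space_Mk space_euclid intro!: exI[of _ "\<lambda>_. undefined"])
qed

text \<open>An enumeration runs over all natural numbers, so the positions from \<open>n\<close> on
  carry a dummy point that is switched off.\<close>

lemma mconf_tuple:
  fixes n :: nat
  assumes "\<And>j. j < n \<Longrightarrow> (\<lambda>w. \<zeta> w j) \<in> M \<rightarrow>\<^sub>M Mk"
  shows "mconf M (\<lambda>w. \<zeta> w ` {..<n})"
proof -
  obtain z where z: "z \<in> space Mk" using space_Mk_nonempty by blast
  have "(\<lambda>w. if j < n then \<zeta> w j else z) \<in> M \<rightarrow>\<^sub>M Mk" for j
    using assms[of j] z by (cases "j < n") simp_all
  thus ?thesis
    by (rule mconfI[where R = "\<lambda>j _. j < n"]) auto
qed

lemma mconf_pair: "mconf (N \<Otimes>\<^sub>M PiM {..<n::nat} (\<lambda>_. Mk)) (\<lambda>w. snd w ` {..<n})"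
  by (rule mconf_tuple) measurable

lemma mconf_PiM: "mconf (PiM {..<n::nat} (\<lambda>_. Mk)) (\<lambda>\<zeta>. \<zeta> ` {..<n})"
  by (rule mconf_tuple) measurable

lemma mconf_points: "mconf W coloured_points"
  by (rule mconfI[where Zs = Z and R = "\<lambda>_ _. True"]) (auto simp: coloured_points_eq)

lemma mconf_filter:
  assumes "mconf M \<eta>" and P: "\<And>y. y \<in> M \<rightarrow>\<^sub>M Mk \<Longrightarrow> Measurable.pred M (\<lambda>w. P w (y w))"
  shows "mconf M (\<lambda>w. {z \<in> \<eta> w. P w z})"
  using assms(1)
proof (rule mconfE)
  fix Zs R assume *: "\<And>j::nat. Zs j \<in> M \<rightarrow>\<^sub>M Mk" "\<And>j. Measurable.pred M (R j)" "\<And>w. w \<in> space M \<Longrightarrow> \<eta> w = {Zs j w |j. R j w}"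
  show ?thesis
  proof (rule mconfI[where Zs = Zs and R = "\<lambda>j w. R j w \<and> P w (Zs j w)"])
    show "Measurable.pred M (\<lambda>w. R j w \<and> P w (Zs j w))" for j
      using *(2) P[OF *(1)] by (rule pred_intros_logic)
  qed (use * in auto)
qed

lemma measurable_eq_nat:
  assumes [measurable]: "f \<in> M \<rightarrow>\<^sub>M count_space (UNIV :: nat set)" "g \<in> M \<rightarrow>\<^sub>M count_space (UNIV :: nat set)"
  shows "Measurable.pred M (\<lambda>w. f w = g w)"
proof -
  have "Measurable.pred M (\<lambda>w. \<exists>n. f w = n \<and> g w = n)" by measurable
  moreover have "(\<lambda>w. \<exists>n. f w = n \<and> g w = n) = (\<lambda>w. f w = g w)" by auto
  ultimately show ?thesis by (simp only:)
qed

text \<open>Equality is tested by distance 0 and equal colours, both measurable.\<close>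

lemma measurable_eq_Mk:
  assumes [measurable]: "x \<in> M \<rightarrow>\<^sub>M Mk" "y \<in> M \<rightarrow>\<^sub>M Mk"
  shows "Measurable.pred M (\<lambda>w. x w = y w)"
proof -
  have "x w = y w \<longleftrightarrow> vdist d (fst (x w)) (fst (y w)) = 0 \<and> snd (x w) = snd (y w)" if "w \<in> space M" for w
    using measurable_space[OF assms(1) that] measurable_space[OF assms(2) that] vdist_eq_0_iff[OF d, of "fst (x w)" "fst (y w)"]
    by (auto simp: space_Mk prod_eq_iff mem_Times_iff)
  moreover define v where "v = (\<lambda>w. vdist d (fst (x w)) (fst (y w)))"
  have [measurable]: "v \<in> borel_measurable M"
    unfolding v_def by (intro measurable_vdist) simp_all
  have [measurable]: "Measurable.pred M (\<lambda>w. snd (x w) = snd (y w))"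
    by (intro measurable_eq_nat) measurable
  have "Measurable.pred M (\<lambda>w. v w = 0 \<and> snd (x w) = snd (y w))" by measurable
  hence "Measurable.pred M (\<lambda>w. vdist d (fst (x w)) (fst (y w)) = 0 \<and> snd (x w) = snd (y w))"
    unfolding v_def .
  ultimately show ?thesis by (subst measurable_cong)
qed

lemma mconf_remove:
  assumes "mconf M \<eta>" "y \<in> M \<rightarrow>\<^sub>M Mk" shows "mconf M (\<lambda>w. \<eta> w - {y w})"
proof -
  have "mconf M (\<lambda>w. {z \<in> \<eta> w. z \<noteq> y w})"
    using measurable_eq_Mk[OF _ assms(2)] by (intro mconf_filter[OF assms(1)] pred_intros_logic)
  thus ?thesis by (simp add: set_diff_eq)
qed

lemma mconf_insert:
  assumes "mconf M \<eta>" and y: "y \<in> M \<rightarrow>\<^sub>M Mk" shows "mconf M (\<lambda>w. insert (y w) (\<eta> w))"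
  using assms(1)
proof (rule mconfE)
  fix Zs R assume *: "\<And>j::nat. Zs j \<in> M \<rightarrow>\<^sub>M Mk" "\<And>j. Measurable.pred M (R j)" "\<And>w. w \<in> space M \<Longrightarrow> \<eta> w = {Zs j w |j. R j w}"
  define Zs' where "Zs' j = (case j of 0 \<Rightarrow> y | Suc j \<Rightarrow> Zs j)" for j
  define R' where "R' j = (case j of 0 \<Rightarrow> \<lambda>_. True | Suc j \<Rightarrow> R j)" for j
  show ?thesis
  proof (rule mconfI[of Zs' _ R'])
    show "Zs' j \<in> M \<rightarrow>\<^sub>M Mk" for j using y * by (auto simp: Zs'_def split: nat.splits)
    show "Measurable.pred M (R' j)" for j using * by (auto simp: R'_def split: nat.splits)
    fix w assume w: "w \<in> space M"
    have "{Zs' j w |j. R' j w} = insert (y w) {Zs j w |j. R j w}"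
    proof (intro equalityI subsetI)
      fix z assume "z \<in> {Zs' j w |j. R' j w}"
      then obtain j where "z = Zs' j w" "R' j w" by blast
      thus "z \<in> insert (y w) {Zs j w |j. R j w}" by (cases j) (auto simp: Zs'_def R'_def)
    next
      fix z assume "z \<in> insert (y w) {Zs j w |j. R j w}"
      then consider "z = y w" | j where "z = Zs j w" "R j w" by blast
      thus "z \<in> {Zs' j w |j. R' j w}"
      proof cases
        case 1 thus ?thesis by (auto simp: Zs'_def R'_def intro!: exI[of _ 0])
      next
        case (2 j) thus ?thesis by (auto simp: Zs'_def R'_def intro!: exI[of _ "Suc j"])
      qed
    qed
    thus "insert (y w) (\<eta> w) = {Zs' j w |j. R' j w}" using *(3)[OF w] by simp
  qed
qed

lemma mconf_Un_finite:
  assumes "mconf M \<eta>" "finite P" "P \<subseteq> space Mk" shows "mconf M (\<lambda>w. \<eta> w \<union> P)"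
  using assms(2,3)
proof (induction P rule: finite_induct)
  case empty thus ?case using assms(1) by simp
next
  case (insert x P)
  have "mconf M (\<lambda>w. insert x (\<eta> w \<union> P))" using insert by (intro mconf_insert) auto
  thus ?case by simp
qed

text \<open>Over an enumerated configuration the quantifier of the recursion is countable. The point
  and the time are random because the recursion passes to random neighbours and distances.\<close>

lemma measurable_avail:
  assumes "mconf M \<eta>" and x: "x \<in> M \<rightarrow>\<^sub>M Mk" and t: "t \<in> borel_measurable M"
  shows "Measurable.pred M (\<lambda>w. avail d n (\<eta> w) (x w) (t w))"
  using x t
proof (induction n arbitrary: x t)
  case (Suc n)
  note [measurable] = Suc.prems
  from assms(1) obtain Zs R where **: "(\<forall>j::nat. Zs j \<in> M \<rightarrow>\<^sub>M Mk \<and> Measurable.pred M (R j)) \<and>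
     (\<forall>w\<in>space M. \<eta> w = {Zs j w |j. R j w})"
    unfolding mconf_def by blast
  hence *: "\<And>j. Zs j \<in> M \<rightarrow>\<^sub>M Mk" "\<And>j. Measurable.pred M (R j)" "\<And>w. w \<in> space M \<Longrightarrow> \<eta> w = {Zs j w |j. R j w}"
    by blast+
  note [measurable] = *(1,2)
  have v [measurable]: "(\<lambda>w. vdist d (fst (x w)) (fst (Zs j w))) \<in> borel_measurable M" for j
    by (intro measurable_vdist) simp_all
  have [measurable]: "Measurable.pred M (\<lambda>w. snd (Zs j w) = snd (x w))" for j
    by (intro measurable_eq_nat) measurable
  have [measurable]: "Measurable.pred M (\<lambda>w. avail d n (\<eta> w) (Zs j w) (vdist d (fst (x w)) (fst (Zs j w))))" for j
    by (intro Suc.IH) simp_all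
  have "Measurable.pred M (\<lambda>w. \<forall>j. R j w \<longrightarrow> snd (Zs j w) \<noteq> snd (x w) \<and> vdist d (fst (x w)) (fst (Zs j w)) < t w \<longrightarrow>
    \<not> avail d n (\<eta> w) (Zs j w) (vdist d (fst (x w)) (fst (Zs j w))))"
    by measurable
  moreover have "avail d (Suc n) (\<eta> w) (x w) (t w) \<longleftrightarrow> (\<forall>j. R j w \<longrightarrow> snd (Zs j w) \<noteq> snd (x w) \<and> vdist d (fst (x w)) (fst (Zs j w)) < t w \<longrightarrow>
    \<not> avail d n (\<eta> w) (Zs j w) (vdist d (fst (x w)) (fst (Zs j w))))" if "w \<in> space M" for w
    unfolding avail.simps(2) Ball_def by (subst *(3)[OF that]) blast
  ultimately show ?case by (subst measurable_cong)
qed simp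

text \<open>The enumeration may list a point repeatedly; each point is counted at its first index
  only.\<close>

lemma measurable_sum_conf:
  fixes f :: "'w \<Rightarrow> (nat \<Rightarrow> real) \<times> nat \<Rightarrow> ennreal"
  assumes "mconf M \<eta>" and f: "\<And>y. y \<in> M \<rightarrow>\<^sub>M Mk \<Longrightarrow> (\<lambda>w. f w (y w)) \<in> borel_measurable M"
  shows "(\<lambda>w. \<integral>\<^sup>+y\<in>\<eta> w. f w y \<partial>count_space UNIV) \<in> borel_measurable M"
  using assms(1)
proof (rule mconfE)
  fix Zs R assume *: "\<And>j::nat. Zs j \<in> M \<rightarrow>\<^sub>M Mk" "\<And>j. Measurable.pred M (R j)" "\<And>w. w \<in> space M \<Longrightarrow> \<eta> w = {Zs j w |j. R j w}"
  let ?J = "\<lambda>w. {j. R j w \<and> (\<forall>i<j. R i w \<longrightarrow> Zs i w \<noteq> Zs j w)}"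
  have eq: "(\<integral>\<^sup>+y\<in>\<eta> w. f w y \<partial>count_space UNIV) = (\<Sum>j. if j \<in> ?J w then f w (Zs j w) else 0)" if w: "w \<in> space M" for w
  proof -
    have im: "(\<lambda>j. Zs j w) ` ?J w = \<eta> w"
    proof (intro equalityI subsetI)
      fix z assume "z \<in> \<eta> w"
      then obtain j where j: "z = Zs j w" "R j w" using *(3)[OF w] by blast
      define i where "i = (LEAST i. R i w \<and> Zs i w = z)"
      have i: "R i w \<and> Zs i w = z" unfolding i_def by (rule LeastI[of _ j]) (use j in auto)
      have "Zs l w \<noteq> Zs i w" if "l < i" "R l w" for l
        using not_less_Least[OF that(1)[unfolded i_def]] that(2) i by auto
      thus "z \<in> (\<lambda>j. Zs j w) ` ?J w" using i by blast
    qed (use *(3)[OF w] in auto)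
    have inj: "inj_on (\<lambda>j. Zs j w) (?J w)"
    proof (rule inj_onI)
      fix i j assume "i \<in> ?J w" "j \<in> ?J w" "Zs i w = Zs j w"
      thus "i = j" by (cases i j rule: linorder_cases) force+
    qed
    have "(\<integral>\<^sup>+y\<in>\<eta> w. f w y \<partial>count_space UNIV) = (\<integral>\<^sup>+y. f w y \<partial>count_space (\<eta> w))"
      by (rule nn_integral_count_space_indicator[symmetric]) simp
    also have "\<dots> = (\<integral>\<^sup>+j. f w (Zs j w) \<partial>count_space (?J w))"
      using im inj by (intro nn_integral_bij_count_space[symmetric]) (simp add: bij_betw_def)
    also have "\<dots> = (\<integral>\<^sup>+j\<in>?J w. f w (Zs j w) \<partial>count_space UNIV)"
      by (rule nn_integral_count_space_indicator) simp
    also have "\<dots> = (\<Sum>j. f w (Zs j w) * indicator (?J w) j)"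
      by (rule nn_integral_count_space_nat)
    also have "\<dots> = (\<Sum>j. if j \<in> ?J w then f w (Zs j w) else 0)"
      by (intro suminf_cong) (auto split: split_indicator)
    finally show ?thesis .
  qed
  have [measurable]: "(\<lambda>w. f w (Zs j w)) \<in> borel_measurable M" "Measurable.pred M (R j)"
    "Measurable.pred M (\<lambda>w. Zs i w = Zs j w)" for i j
    using * by (auto intro: f measurable_eq_Mk)
  have "(\<lambda>w. \<Sum>j. if j \<in> ?J w then f w (Zs j w) else 0) \<in> borel_measurable M"
    unfolding mem_Collect_eq by measurable
  thus ?thesis by (subst measurable_cong[OF eq])
qed

lemma measurable_card_conf:
  assumes "mconf M \<eta>" and fin: "\<And>w. w \<in> space M \<Longrightarrow> finite (\<eta> w)"
    and P: "\<And>y. y \<in> M \<rightarrow>\<^sub>M Mk \<Longrightarrow> Measurable.pred M (\<lambda>w. P w (y w))"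
  shows "(\<lambda>w. card {y \<in> \<eta> w. P w y}) \<in> M \<rightarrow>\<^sub>M count_space UNIV"
proof -
  have m: "(\<lambda>w. \<integral>\<^sup>+y\<in>{y \<in> \<eta> w. P w y}. 1 \<partial>count_space UNIV) \<in> borel_measurable M"
    by (intro measurable_sum_conf mconf_filter assms) simp_all
  have eq: "(\<integral>\<^sup>+y\<in>{y \<in> \<eta> w. P w y}. 1 \<partial>count_space UNIV) = of_nat (card {y \<in> \<eta> w. P w y})" if "w \<in> space M" for w
    using fin[OF that] by simp
  have "(\<lambda>w. card {y \<in> \<eta> w. P w y}) -` {n} \<inter> space M = (\<lambda>w. \<integral>\<^sup>+y\<in>{y \<in> \<eta> w. P w y}. 1 \<partial>count_space UNIV) -` {of_nat n} \<inter> space M" for n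
    using eq by (auto simp del: nn_integral_indicator)
  hence "(\<lambda>w. card {y \<in> \<eta> w. P w y}) -` {n} \<inter> space M \<in> sets M" for n
    using measurable_sets[OF m, of "{of_nat n}"] by simp
  thus ?thesis by (subst measurable_count_space_eq_countable) auto
qed

end

lemma (in poisson_window) mconf_eta: "mconf W eta"
proof -
  have "mconf W (\<lambda>w. {z \<in> coloured_points w. fst z \<in> B})"
    by (intro mconf_filter mconf_points) measurable
  moreover have "{z \<in> coloured_points w. fst z \<in> B} = eta w" for w
    by (auto simp: eta_def mem_Times_iff)
  ultimately show ?thesis by simp
qed

subsection \<open>Decorrelation in high dimension\<close>

text \<open>
  The points from which \<open>n\<close> steps of volume distance below \<open>T\<close> cannot leave \<open>B\<close>.
\<close>

fun core :: "nat \<Rightarrow> real \<Rightarrow> (nat \<Rightarrow> real) set \<Rightarrow> nat \<Rightarrow> (nat \<Rightarrow> real) set" where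
  "core d T B 0 = B"
| "core d T B (Suc n) = {x \<in> core d T B n. \<forall>y\<in>space (euclid d). vdist d x y < T \<longrightarrow> y \<in> core d T B n}"

lemma core_subset: "core d T B n \<subseteq> B"
  by (induction n) auto

text \<open>A family of probes \<open>P\<close> with times \<open>\<tau>\<close>. The separation
  \<open>(1/2)^d * T\<close> is what \<open>vball_overlap\<close> asks for, and a time
  \<open>\<tau> x\<close> not exceeding the distance to the other probes keeps the probes from
  seeing one another.\<close>

definition good :: "nat \<Rightarrow> nat \<Rightarrow> real \<Rightarrow> (nat \<Rightarrow> real) set \<Rightarrow> ((nat \<Rightarrow> real) \<times> nat) set \<Rightarrow>
    ((nat \<Rightarrow> real) \<times> nat \<Rightarrow> real) \<Rightarrow> bool" where
  "good d k T C P \<tau> \<longleftrightarrow> finite P \<and> P \<subseteq> space (euclid d) \<times> {1..k} \<and>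
     (\<forall>x\<in>P. 0 \<le> \<tau> x \<and> \<tau> x \<le> T \<and> fst x \<in> C) \<and>
     (\<forall>x\<in>P. \<forall>y\<in>P. x \<noteq> y \<longrightarrow> (1/2)^d * T \<le> vdist d (fst x) (fst y) \<and> \<tau> x \<le> vdist d (fst x) (fst y))"

text \<open>\<open>y\<close> hits if it prevents some probe from being available at its
  time.\<close>

definition hit :: "nat \<Rightarrow> nat \<Rightarrow> ((nat \<Rightarrow> real) \<times> nat) set \<Rightarrow> ((nat \<Rightarrow> real) \<times> nat \<Rightarrow> real) \<Rightarrow>
    ((nat \<Rightarrow> real) \<times> nat) set \<Rightarrow> (nat \<Rightarrow> real) \<times> nat \<Rightarrow> bool" where
  "hit d n P \<tau> S y \<longleftrightarrow> (\<exists>x\<in>P. snd y \<noteq> snd x \<and> vdist d (fst x) (fst y) < \<tau> x \<and>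
     avail d n S y (vdist d (fst x) (fst y)))"

lemma vdist_not_less_0 [simp]: "\<not> vdist d x y < 0"
  by (simp add: not_less)

lemma avail_time_0 [simp]: "avail d n S x 0"
  by (cases n) auto

lemma choose_ennreal: "of_nat h * of_nat ((h - 1) choose q) = (of_nat (Suc q) * of_nat (h choose Suc q) :: ennreal)"
proof (cases h)
  case (Suc m)
  have "Suc m * (m choose q) = Suc q * (Suc m choose Suc q)"
    by (metis Suc_times_binomial_eq mult.commute)
  thus ?thesis unfolding Suc of_nat_mult[symmetric] by simp
qed simp

section \<open>Factorial moments of the number of hits\<close>

locale probe = poisson_window k p d Q B for k p d Q B +
  fixes T :: real and n :: nat and P \<tau>
  assumes T: "T > 0" and good: "good d k T (core d T B (Suc n)) P \<tau>"
begin

abbreviation v where "v x y \<equiv> vdist d (fst x) (fst y)"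

lemma finite_P: "finite P" and P_space: "P \<subseteq> space Mk"
  using good by (auto simp: good_def space_Mk)

lemma P_time: "x \<in> P \<Longrightarrow> 0 \<le> \<tau> x" "x \<in> P \<Longrightarrow> \<tau> x \<le> T"
  and P_core: "x \<in> P \<Longrightarrow> fst x \<in> core d T B (Suc n)"
  and P_sep: "x \<in> P \<Longrightarrow> y \<in> P \<Longrightarrow> x \<noteq> y \<Longrightarrow> (1/2)^d * T \<le> v x y \<and> \<tau> x \<le> v x y"
  using good by (auto simp: good_def)

abbreviation "hits \<equiv> hit d n P \<tau>"

text \<open>No probe hits another, because \<open>\<tau> x\<close> does not exceed their distance.
  Joint availability of the probes at depth \<open>Suc n\<close> thus means that no point of
  \<open>S\<close> hits.\<close>

lemma avail_iff_no_hit: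
  "(\<forall>x\<in>P. avail d (Suc n) (S \<union> P) x (\<tau> x)) \<longleftrightarrow> (\<forall>y\<in>S. \<not> hits (S \<union> P) y)"
proof -
  have "\<not> hits (S \<union> P) y" if y: "y \<in> P" for y
  proof
    assume "hits (S \<union> P) y"
    then obtain x where x: "x \<in> P" "snd y \<noteq> snd x" "v x y < \<tau> x" by (auto simp: hit_def)
    thus False using P_sep[OF x(1) y] by auto
  qed
  moreover have "(\<forall>x\<in>P. avail d (Suc n) (S \<union> P) x (\<tau> x)) \<longleftrightarrow> (\<forall>y\<in>S \<union> P. \<not> hits (S \<union> P) y)"
    by (auto simp: hit_def)
  ultimately show ?thesis by auto
qed

text \<open>
  The probability that no point hits a probe is found by inclusion-exclusion from the factorial moments of the number of hits.
  Removing one hit \<open>y\<close> by the Mecke formula turns \<open>psi (Suc q) Y\<close> into \<open>psi q (insert y Y)\<close>.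
\<close>

definition psi :: "nat \<Rightarrow> ((nat \<Rightarrow> real) \<times> nat) set \<Rightarrow> ((nat \<Rightarrow> real) \<times> nat) set \<Rightarrow> ennreal" where
  "psi q Y S = (if \<forall>y\<in>Y. hits (S \<union> (P \<union> Y)) y
     then of_nat (card {y \<in> S. hits (S \<union> (P \<union> Y)) y} choose q) else 0)"

text \<open>Moving \<open>y\<close> from \<open>S\<close> to \<open>Y\<close> does not change the
  whole configuration, so being a hit is unaffected and the number of hits in \<open>S\<close> drops
  by one. The rest is absorption for binomial coefficients, \<open>choose_ennreal\<close>.\<close>

lemma psi_rec:
  assumes S: "finite S"
  shows "(\<integral>\<^sup>+y\<in>S. psi q (insert y Y) (S - {y}) \<partial>count_space UNIV) = of_nat (Suc q) * psi (Suc q) Y S"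
proof -
  let ?A = "{y \<in> S. hits (S \<union> (P \<union> Y)) y}"
  have psi: "psi q (insert y Y) (S - {y}) = (if y \<in> ?A then if \<forall>y\<in>Y. hits (S \<union> (P \<union> Y)) y then of_nat ((card ?A - 1) choose q) else 0 else 0)"
    if y: "y \<in> S" for y
  proof -
    have eq: "S - {y} \<union> (P \<union> insert y Y) = S \<union> (P \<union> Y)" using y by auto
    have "{y' \<in> S - {y}. hits (S \<union> (P \<union> Y)) y'} = ?A - {y}" by auto
    moreover have "card (?A - {y}) = card ?A - 1" if "y \<in> ?A" using that by (rule card_Diff_singleton)
    ultimately show ?thesis using y unfolding psi_def eq by auto
  qed
  have "(\<integral>\<^sup>+y\<in>S. psi q (insert y Y) (S - {y}) \<partial>count_space UNIV) = (\<Sum>y\<in>S. psi q (insert y Y) (S - {y}))"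
    using S by (subst nn_integral_count_space'[of S]) auto
  also have "\<dots> = (\<Sum>y\<in>S. if y \<in> ?A then if \<forall>y\<in>Y. hits (S \<union> (P \<union> Y)) y then of_nat ((card ?A - 1) choose q) else 0 else 0)"
    using psi by (rule sum.cong[OF refl])
  also have "\<dots> = (\<Sum>y\<in>?A. if \<forall>y\<in>Y. hits (S \<union> (P \<union> Y)) y then of_nat ((card ?A - 1) choose q) else 0)"
    using S by (simp add: sum.inter_filter[symmetric])
  also have "\<dots> = (if \<forall>y\<in>Y. hits (S \<union> (P \<union> Y)) y then of_nat (card ?A) * of_nat ((card ?A - 1) choose q) else 0)"
    by simp
  also have "\<dots> = of_nat (Suc q) * psi (Suc q) Y S"
    unfolding psi_def choose_ennreal by simp
  finally show ?thesis .
qed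

lemma measurable_hit:
  assumes "mconf M \<eta>" and y: "y \<in> M \<rightarrow>\<^sub>M Mk"
  shows "Measurable.pred M (\<lambda>w. hits (\<eta> w) (y w))"
proof -
  have "Measurable.pred M (\<lambda>w. snd (y w) \<noteq> snd x \<and> v x (y w) < \<tau> x \<and> avail d n (\<eta> w) (y w) (v x (y w)))" if x: "x \<in> P" for x
  proof -
    have xs: "(\<lambda>_. x) \<in> M \<rightarrow>\<^sub>M Mk" using x P_space by auto
    define g where "g = (\<lambda>w. v x (y w))"
    have g [measurable]: "g \<in> borel_measurable M"
      unfolding g_def
      by (rule measurable_vdist[OF measurable_compose[OF xs measurable_fst_Mk] measurable_compose[OF y measurable_fst_Mk]])
    note [measurable] = measurable_avail[OF assms g] y
    have "Measurable.pred M (\<lambda>w. snd (y w) \<noteq> snd x \<and> g w < \<tau> x \<and> avail d n (\<eta> w) (y w) (g w))"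
      by measurable
    thus ?thesis unfolding g_def .
  qed
  thus ?thesis unfolding hit_def by (intro pred_intros_finite finite_P)
qed

lemma measurable_psi:
  assumes "mconf M \<eta>" "\<And>w. w \<in> space M \<Longrightarrow> finite (\<eta> w)" "finite Y" "Y \<subseteq> space Mk" "y \<in> M \<rightarrow>\<^sub>M Mk"
  shows "(\<lambda>w. psi q (insert (y w) Y) (\<eta> w)) \<in> borel_measurable M"
    and "(\<lambda>w. psi q Y (\<eta> w)) \<in> borel_measurable M"
proof -
  have gen: "(\<lambda>w. if \<forall>z\<in>Z w. hits (\<eta> w \<union> (P \<union> Z w)) z then of_nat (card {z \<in> \<eta> w. hits (\<eta> w \<union> (P \<union> Z w)) z} choose q) else 0 :: ennreal) \<in> borel_measurable M"
    if m: "mconf M (\<lambda>w. \<eta> w \<union> (P \<union> Z w))" and p: "Measurable.pred M (\<lambda>w. \<forall>z\<in>Z w. hits (\<eta> w \<union> (P \<union> Z w)) z)" for Z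
  proof -
    have "(\<lambda>w. card {z \<in> \<eta> w. hits (\<eta> w \<union> (P \<union> Z w)) z}) \<in> M \<rightarrow>\<^sub>M count_space UNIV"
      by (intro measurable_card_conf assms measurable_hit m)
    hence "(\<lambda>w. of_nat (card {z \<in> \<eta> w. hits (\<eta> w \<union> (P \<union> Z w)) z} choose q) :: ennreal) \<in> borel_measurable M"
      by (rule measurable_compose) simp
    thus ?thesis using p by (intro measurable_If) auto
  qed
  have mY: "mconf M (\<lambda>w. \<eta> w \<union> (P \<union> Y))"
    using assms finite_P P_space by (intro mconf_Un_finite) auto
  have mi: "mconf M (\<lambda>w. insert (y w) (\<eta> w \<union> (P \<union> Y)))" by (intro mconf_insert mY assms)
  have c: "(\<lambda>_. z) \<in> M \<rightarrow>\<^sub>M Mk" if "z \<in> Y" for z using that assms(4) by auto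
  have eqi: "insert (y w) (\<eta> w \<union> (P \<union> Y)) = \<eta> w \<union> (P \<union> insert (y w) Y)" for w by auto
  show "(\<lambda>w. psi q Y (\<eta> w)) \<in> borel_measurable M"
    unfolding psi_def
    by (rule gen[of "\<lambda>_. Y"]) (use mY c assms(3) in \<open>auto intro!: pred_intros_finite measurable_hit\<close>)
  show "(\<lambda>w. psi q (insert (y w) Y) (\<eta> w)) \<in> borel_measurable M"
    unfolding psi_def
  proof (rule gen[of "\<lambda>w. insert (y w) Y"])
    show "mconf M (\<lambda>w. \<eta> w \<union> (P \<union> insert (y w) Y))" using mi unfolding eqi .
    have "Measurable.pred M (\<lambda>w. hits (\<eta> w \<union> (P \<union> insert (y w) Y)) (y w) \<and> (\<forall>z\<in>Y. hits (\<eta> w \<union> (P \<union> insert (y w) Y)) z))"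
      using mi[unfolded eqi] c assms(3,5) by (intro pred_intros_logic pred_intros_finite measurable_hit) auto
    thus "Measurable.pred M (\<lambda>w. \<forall>z\<in>insert (y w) Y. hits (\<eta> w \<union> (P \<union> insert (y w) Y)) z)" by simp
  qed
qed

definition Epsi :: "nat \<Rightarrow> ((nat \<Rightarrow> real) \<times> nat) set \<Rightarrow> ennreal" where
  "Epsi q Y = (\<integral>\<^sup>+w. psi q Y (eta w) \<partial>W)"

lemma Epsi_rec:
  assumes Y: "finite Y" "Y \<subseteq> space Mk"
  shows "(\<lambda>y. Epsi q (insert y Y)) \<in> borel_measurable Mk"
    and "of_nat (Suc q) * Epsi (Suc q) Y = (\<integral>\<^sup>+y. Epsi q (insert y Y) \<partial>nuB B)"
proof -
  have F: "(\<lambda>(y, \<zeta>). psi q (insert y Y) (\<zeta> ` {..<m})) \<in> borel_measurable (Mk \<Otimes>\<^sub>M Pn m)" for m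
  proof -
    have "(\<lambda>w. psi q (insert (fst w) Y) (snd w ` {..<m})) \<in> borel_measurable (Mk \<Otimes>\<^sub>M Pn m)"
      by (intro measurable_psi mconf_pair Y) auto
    thus ?thesis by (simp add: case_prod_beta')
  qed
  show "(\<lambda>y. Epsi q (insert y Y)) \<in> borel_measurable Mk"
    unfolding Epsi_def by (rule nn_integral_eta_measurable(1)[OF F])
  have fin: "finite (eta w)" if "inj (fst w) \<and> finite {m. fst w m \<in> B}" for w
    using that by (simp add: eta_eq)
  have J: "(\<lambda>\<zeta>. psi (Suc q) Y (\<zeta> ` {..<m})) \<in> borel_measurable (Pn m)" for m
  proof -
    obtain z where "z \<in> space Mk" using space_Mk_nonempty by blast
    thus ?thesis by (intro measurable_psi(2)[OF mconf_PiM _ Y, where y = "\<lambda>_. z"]) auto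
  qed
  have "of_nat (Suc q) * Epsi (Suc q) Y = (\<integral>\<^sup>+w. of_nat (Suc q) * psi (Suc q) Y (eta w) \<partial>W)"
  proof -
    have c: "(\<lambda>\<zeta>. of_nat (Suc q) * psi (Suc q) Y (\<zeta> ` {..<m})) \<in> borel_measurable (Pn m)" for m
      using J by (intro borel_measurable_times_ennreal) auto
    show ?thesis unfolding Epsi_def nn_integral_eta[OF J] nn_integral_eta[OF c]
      by (simp only: nn_integral_cmult[OF J[unfolded measurable_cong_sets[OF sets_PiM_nuB[symmetric] refl]]] ennreal_suminf_cmult[symmetric] mult_ac)
  qed
  also have "\<dots> = (\<integral>\<^sup>+w. (\<integral>\<^sup>+y\<in>eta w. psi q (insert y Y) (eta w - {y}) \<partial>count_space UNIV) \<partial>W)"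
    by (rule nn_integral_cong_good) (simp only: psi_rec[OF fin])
  also have "\<dots> = (\<integral>\<^sup>+y. Epsi q (insert y Y) \<partial>nuB B)"
    unfolding Epsi_def by (rule mecke[OF F])
  finally show "of_nat (Suc q) * Epsi (Suc q) Y = (\<integral>\<^sup>+y. Epsi q (insert y Y) \<partial>nuB B)" .
qed

definition reach :: "((nat \<Rightarrow> real) \<times> nat) set" where
  "reach = {y \<in> space Mk. \<exists>x\<in>P. snd y \<noteq> snd x \<and> v x y < \<tau> x}"

lemma measurable_v_const: "x \<in> space Mk \<Longrightarrow> (\<lambda>y. v x y) \<in> borel_measurable Mk"
  by (intro measurable_vdist measurable_const) (auto simp: space_Mk mem_Times_iff)

lemma sets_near: "x \<in> space Mk \<Longrightarrow> {y \<in> space Mk. v x y < s} \<in> sets Mk"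
  using measurable_sets[OF measurable_v_const, of x "{..<s}"] by (simp add: vimage_def Int_def conj_commute)

lemma nuB_near_le: "emeasure (nuB B) {y \<in> space Mk. vdist d a (fst y) < s} \<le> ennreal s"
proof -
  let ?A = "{y \<in> space E. vdist d a y < s}"
  have A: "?A \<in> sets E" by measurable
  have "{y \<in> space Mk. vdist d a (fst y) < s} = {z \<in> space Mk. fst z \<in> ?A}" by (auto simp: space_Mk)
  hence "emeasure (nuB B) {y \<in> space Mk. vdist d a (fst y) < s} = emeasure E (?A \<inter> B)"
    using emeasure_nuB_fst[OF B A] by simp
  also have "\<dots> \<le> emeasure E ?A" by (intro emeasure_mono A) auto
  also have "\<dots> = ennreal s" by (rule emeasure_open_vball[OF d])
  finally show ?thesis .
qed

lemma sets_reach: "reach \<in> sets Mk"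
proof -
  have "{y \<in> space Mk. snd y \<noteq> snd x \<and> v x y < \<tau> x} \<in> sets Mk" if "x \<in> P" for x
  proof -
    have "{y \<in> space Mk. snd y \<noteq> snd x} \<in> sets Mk" by measurable
    moreover have "{y \<in> space Mk. v x y < \<tau> x} \<in> sets Mk" using that P_space by (intro sets_near) auto
    ultimately have "{y \<in> space Mk. snd y \<noteq> snd x} \<inter> {y \<in> space Mk. v x y < \<tau> x} \<in> sets Mk" by (rule sets.Int)
    thus ?thesis by (rule back_subst[where P="\<lambda>S. S \<in> sets Mk"]) auto
  qed
  hence "(\<Union>x\<in>P. {y \<in> space Mk. snd y \<noteq> snd x \<and> v x y < \<tau> x}) \<in> sets Mk"
    by (intro sets.finite_UN finite_P)
  thus ?thesis by (rule back_subst[where P="\<lambda>S. S \<in> sets Mk"]) (auto simp: reach_def)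
qed

lemma nuB_reach: "emeasure (nuB B) reach \<le> ennreal (real (card P) * T)"
proof -
  have "emeasure (nuB B) reach \<le> emeasure (nuB B) (\<Union>x\<in>P. {y \<in> space Mk. v x y < T})"
    using P_time P_space by (intro emeasure_mono) (auto simp: reach_def sets_nuB intro!: sets.finite_UN finite_P sets_near less_le_trans[of _ "\<tau> _" T])
  also have "\<dots> \<le> (\<Sum>x\<in>P. emeasure (nuB B) {y \<in> space Mk. v x y < T})"
    using P_space by (intro emeasure_subadditive_finite finite_P) (auto simp: sets_nuB intro!: sets_near)
  also have "\<dots> \<le> (\<Sum>x\<in>P. ennreal T)" by (intro sum_mono nuB_near_le)
  also have "\<dots> = ennreal (real (card P) * T)" using T by (simp add: ennreal_mult' ennreal_of_nat_eq_real_of_nat)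
  finally show ?thesis .
qed

lemma psi_eq_0: "y \<in> space Mk \<Longrightarrow> y \<notin> reach \<Longrightarrow> psi q (insert y Y) S = 0"
  unfolding psi_def reach_def hit_def by auto

lemma Epsi_eq_0: "y \<in> space Mk \<Longrightarrow> y \<notin> reach \<Longrightarrow> Epsi q (insert y Y) = 0"
  by (simp add: Epsi_def psi_eq_0)

lemma fact_Epsi_rec:
  assumes Y: "finite Y" "Y \<subseteq> space Mk"
  shows "of_nat (fact (Suc q)) * Epsi (Suc q) Y = (\<integral>\<^sup>+y. of_nat (fact q) * Epsi q (insert y Y) \<partial>nuB B)"
proof -
  have "of_nat (fact (Suc q)) = (of_nat (fact q) * of_nat (Suc q) :: ennreal)"
    by (simp only: fact_Suc of_nat_mult of_nat_id mult.commute)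
  hence "of_nat (fact (Suc q)) * Epsi (Suc q) Y = of_nat (fact q) * (of_nat (Suc q) * Epsi (Suc q) Y)"
    by (simp only: mult.assoc)
  also have "\<dots> = (\<integral>\<^sup>+y. of_nat (fact q) * Epsi q (insert y Y) \<partial>nuB B)"
    unfolding Epsi_rec(2)[OF Y]
    by (rule nn_integral_cmult[symmetric]) (use Epsi_rec(1)[OF Y] in \<open>simp add: measurable_cong_sets[OF sets_nuB refl]\<close>)
  finally show ?thesis .
qed

text \<open>Each removed hit lies in \<open>reach\<close>, of measure at most
  \<open>real (card P) * T\<close>, so the factorial moments are at most those of a Poisson variable
  with that mean. The bound is uniform in \<open>Y\<close>, which makes it usable on the exceptional
  set.\<close>

lemma Epsi_bound:
  "finite Y \<Longrightarrow> Y \<subseteq> space Mk \<Longrightarrow> of_nat (fact q) * Epsi q Y \<le> ennreal ((real (card P) * T) ^ q)"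
proof (induction q arbitrary: Y)
  case 0
  have "Epsi 0 Y \<le> (\<integral>\<^sup>+w. 1 \<partial>W)" unfolding Epsi_def by (intro nn_integral_mono) (simp add: psi_def)
  thus ?case by (simp add: W.emeasure_space_1)
next
  case (Suc q)
  let ?c = "real (card P) * T"
  have "of_nat (fact (Suc q)) * Epsi (Suc q) Y = (\<integral>\<^sup>+y. of_nat (fact q) * Epsi q (insert y Y) \<partial>nuB B)"
    using Suc.prems by (rule fact_Epsi_rec)
  also have "\<dots> \<le> (\<integral>\<^sup>+y. ennreal (?c ^ q) * indicator reach y \<partial>nuB B)"
  proof (intro nn_integral_mono)
    fix y assume "y \<in> space (nuB B)"
    hence y: "y \<in> space Mk" by (simp add: space_nuB)
    show "of_nat (fact q) * Epsi q (insert y Y) \<le> ennreal (?c ^ q) * indicator reach y"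
      using Suc.IH[of "insert y Y"] Suc.prems y Epsi_eq_0[OF y] by (cases "y \<in> reach") auto
  qed
  also have "\<dots> = ennreal (?c ^ q) * emeasure (nuB B) reach"
    using sets_reach by (intro nn_integral_cmult_indicator) (simp add: sets_nuB)
  also have "\<dots> \<le> ennreal (?c ^ q) * ennreal ?c" by (intro mult_left_mono nuB_reach) simp
  also have "\<dots> = ennreal (?c ^ Suc q)" using T by (simp add: ennreal_mult'[symmetric] mult.commute)
  finally show ?case .
qed

text \<open>The tree prediction for a point at \<open>y\<close> to hit, summed over the probes that
  see it; its integral \<open>Lr\<close> is the predicted mean number of hits
  (\<open>nn_integral_hhat\<close>).\<close>

definition hhat :: "(nat \<Rightarrow> real) \<times> nat \<Rightarrow> real" where
  "hhat y = (\<Sum>x\<in>P. if snd y \<noteq> snd x \<and> v x y < \<tau> x then tav n (snd y) (v x y) else 0)"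

definition Lr :: real where "Lr = (\<Sum>x\<in>P. integral {0..\<tau> x} (rate (tav n) (snd x)))"

lemma hhat_nonneg: "0 \<le> hhat y"
  unfolding hhat_def using a_pos by (intro sum_nonneg) (auto intro: less_imp_le)

lemma hhat_le: "hhat y \<le> real (card P)"
proof -
  have "hhat y \<le> (\<Sum>x\<in>P. 1)" unfolding hhat_def using a_le_1 by (intro sum_mono) auto
  thus ?thesis by simp
qed

lemma hhat_eq_0: "y \<in> space Mk \<Longrightarrow> y \<notin> reach \<Longrightarrow> hhat y = 0"
  unfolding hhat_def reach_def by (intro sum.neutral) auto

lemma exp_Lr: "exp (- Lr) = (\<Prod>x\<in>P. tav (Suc n) (snd x) (\<tau> x))"
  unfolding Lr_def a_Suc by (simp add: exp_sum[OF finite_P] flip: sum_negf)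

lemma Lr_bounds: "0 \<le> Lr" "Lr \<le> real (card P) * T"
proof -
  have 0: "0 \<le> integral {0..s} (rate (tav n) i)" for s i
    by (intro integral_nonneg integrable_rate continuous_a rate_nonneg less_imp_le[OF a_pos])
  show "0 \<le> Lr" unfolding Lr_def by (intro sum_nonneg 0)
  have "integral {0..\<tau> x} (rate (tav n) (snd x)) \<le> T" if x: "x \<in> P" for x
  proof -
    have "integral {0..\<tau> x} (rate (tav n) (snd x)) \<le> integral {0..\<tau> x} (\<lambda>_. 1)"
    proof (intro integral_le integrable_rate continuous_a integrable_const_ivl)
      fix s
      have "\<bar>rate (tav n) (snd x) s - rate (\<lambda>_ _. 0) (snd x) s\<bar> \<le> 1"
        by (rule rate_diff_le) (use a_pos[of n _ s] a_le_1[of n _ s] in \<open>auto simp: abs_of_pos\<close>)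
      thus "rate (tav n) (snd x) s \<le> 1" by (simp add: rate_def)
    qed
    also have "\<dots> \<le> T" using P_time[OF x] by simp
    finally show ?thesis .
  qed
  hence "Lr \<le> (\<Sum>x\<in>P. T)" unfolding Lr_def by (intro sum_mono)
  thus "Lr \<le> real (card P) * T" by simp
qed

text \<open>Removed hits in general position: each is seen by exactly one probe, its owner, and
  every other point of \<open>P \<union> Y\<close> is at distance at least \<open>T\<close> from
  it.\<close>

definition ext :: "((nat \<Rightarrow> real) \<times> nat) set \<Rightarrow> bool" where
  "ext Y \<longleftrightarrow> finite Y \<and> Y \<subseteq> space Mk \<and> (\<forall>y\<in>Y. \<exists>x\<in>P. snd y \<noteq> snd x \<and> (1/2)^d * T \<le> v x y \<and> v x y < \<tau> x \<and>
     (\<forall>z\<in>P \<union> Y. z \<noteq> x \<and> z \<noteq> y \<longrightarrow> T \<le> v z y))"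

lemma extD: "ext Y \<Longrightarrow> finite Y" "ext Y \<Longrightarrow> Y \<subseteq> space Mk"
  by (auto simp: ext_def)

definition owner where
  "owner Y y = (SOME x. x \<in> P \<and> snd y \<noteq> snd x \<and> (1/2)^d * T \<le> v x y \<and> v x y < \<tau> x \<and>
     (\<forall>z\<in>P \<union> Y. z \<noteq> x \<and> z \<noteq> y \<longrightarrow> T \<le> v z y))"

lemma owner:
  assumes "ext Y" "y \<in> Y"
  shows "owner Y y \<in> P" "snd y \<noteq> snd (owner Y y)" "(1/2)^d * T \<le> v (owner Y y) y" "v (owner Y y) y < \<tau> (owner Y y)"
    "\<And>z. z \<in> P \<union> Y \<Longrightarrow> z \<noteq> owner Y y \<Longrightarrow> z \<noteq> y \<Longrightarrow> T \<le> v z y"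
proof -
  have "\<exists>x. x \<in> P \<and> snd y \<noteq> snd x \<and> (1/2)^d * T \<le> v x y \<and> v x y < \<tau> x \<and>
     (\<forall>z\<in>P \<union> Y. z \<noteq> x \<and> z \<noteq> y \<longrightarrow> T \<le> v z y)" using assms unfolding ext_def by blast
  from someI_ex[OF this, folded owner_def]
  show "owner Y y \<in> P" "snd y \<noteq> snd (owner Y y)" "(1/2)^d * T \<le> v (owner Y y) y" "v (owner Y y) y < \<tau> (owner Y y)"
    "\<And>z. z \<in> P \<union> Y \<Longrightarrow> z \<noteq> owner Y y \<Longrightarrow> z \<noteq> y \<Longrightarrow> T \<le> v z y" by blast+
qed

lemma ext_disjoint: assumes "ext Y" "y \<in> Y" shows "y \<notin> P"
proof
  assume "y \<in> P"
  moreover have "owner Y y \<noteq> y" using owner(2)[OF assms] by auto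
  ultimately show False using P_sep[OF owner(1)[OF assms], of y] owner(4)[OF assms] by auto
qed

text \<open>A second probe seeing \<open>y\<close> would be closer to it than \<open>T\<close>,
  which \<open>ext\<close> forbids.\<close>

lemma other_owner:
  assumes "ext Y" "y \<in> Y" "x \<in> P" "snd y \<noteq> snd x" "v x y < \<tau> x"
  shows "x = owner Y y"
proof (rule ccontr)
  assume "x \<noteq> owner Y y"
  moreover have "x \<noteq> y" using assms by auto
  ultimately have "T \<le> v x y" using owner(5)[OF assms(1,2)] assms(3) by blast
  thus False using assms(5) P_time[OF assms(3)] by simp
qed

lemma hits_ext:
  assumes "ext Y" "y \<in> Y"
  shows "hits S y \<longleftrightarrow> avail d n S y (v (owner Y y) y)"
proof
  assume "hits S y"
  then obtain x where x: "x \<in> P" "snd y \<noteq> snd x" "v x y < \<tau> x" "avail d n S y (v x y)"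
    unfolding hit_def by blast
  with other_owner[OF assms x(1-3)] show "avail d n S y (v (owner Y y) y)" by simp
next
  assume "avail d n S y (v (owner Y y) y)"
  thus "hits S y" using owner[OF assms] unfolding hit_def by blast
qed

lemma hhat_ext:
  assumes "ext Y" "y \<in> Y"
  shows "hhat y = tav n (snd y) (v (owner Y y) y)"
proof -
  have iff: "(snd y \<noteq> snd x \<and> v x y < \<tau> x) = (x = owner Y y)" if "x \<in> P" for x
    using other_owner[OF assms that] owner(2,4)[OF assms] by blast
  have "hhat y = (\<Sum>x\<in>P. if x = owner Y y then tav n (snd y) (v x y) else 0)"
    unfolding hhat_def by (intro sum.cong refl) (simp only: iff)
  also have "\<dots> = tav n (snd y) (v (owner Y y) y)"
    using owner(1)[OF assms] finite_P by (simp add: sum.delta del: tree_av.simps)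
  finally show ?thesis .
qed

lemma prod_hhat_bounds: "0 \<le> (\<Prod>y\<in>Y. hhat y)" "ext Y \<Longrightarrow> (\<Prod>y\<in>Y. hhat y) \<le> 1"
proof -
  show "0 \<le> (\<Prod>y\<in>Y. hhat y)" by (intro prod_nonneg hhat_nonneg)
  assume Y: "ext Y"
  have "hhat y \<le> 1" if "y \<in> Y" for y unfolding hhat_ext[OF Y that] by (rule a_le_1)
  thus "(\<Prod>y\<in>Y. hhat y) \<le> 1" by (intro prod_le_1) (simp add: hhat_nonneg)
qed

text \<open>Old probes get time 0, at which they are trivially available; only the points of
  \<open>Y\<close> carry a condition, at the distance to their owner.\<close>

definition ext_time where "ext_time Y z = (if z \<in> Y then v (owner Y z) z else 0)"

lemma half_le: "(1/2)^d * T \<le> T"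
  using T by (intro mult_left_le_one_le) (auto intro: power_le_one)

text \<open>This closes the induction on the depth: the probes together with the removed hits form
  an admissible family for depth \<open>n\<close>. One step from a probe leads from
  \<open>core d T B (Suc n)\<close> to \<open>core d T B n\<close>.\<close>

lemma good_ext:
  assumes Y: "ext Y" shows "good d k T (core d T B n) (P \<union> Y) (ext_time Y)"
proof -
  have t: "0 \<le> ext_time Y z \<and> ext_time Y z \<le> T" for z
    using T owner(1,4)[OF Y, of z] P_time[of "owner Y z"] by (auto simp: ext_time_def)
  have c: "fst z \<in> core d T B n" if z: "z \<in> P \<union> Y" for z
  proof (cases "z \<in> Y")
    case True
    have "fst (owner Y z) \<in> core d T B (Suc n)" using owner(1)[OF Y True] by (rule P_core)
    moreover have "v (owner Y z) z < T" using owner(1,4)[OF Y True] P_time[of "owner Y z"] by simp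
    moreover have "fst z \<in> space E" using extD(2)[OF Y] True by (auto simp: space_Mk mem_Times_iff)
    ultimately show ?thesis by simp
  qed (use z P_core[of z] in auto)
  have s: "(1/2)^d * T \<le> v z z' \<and> ext_time Y z \<le> v z z'" if z: "z \<in> P \<union> Y" "z' \<in> P \<union> Y" "z \<noteq> z'" for z z'
  proof -
    consider (1) "z \<in> P" "z' \<in> P" | (2) "z \<in> P" "z' \<in> Y" | (3) "z \<in> Y" "z' \<in> P" | (4) "z \<in> Y" "z' \<in> Y"
      using z by blast
    thus ?thesis
    proof cases
      case 1
      thus ?thesis using P_sep[OF 1 z(3)] ext_disjoint[OF Y, of z] by (auto simp: ext_time_def)
    next
      case 2
      hence "ext_time Y z = 0" using ext_disjoint[OF Y, of z] by (auto simp: ext_time_def)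
      moreover have "(1/2)^d * T \<le> v z z'"
        using owner(3)[OF Y 2(2)] owner(5)[OF Y 2(2), of z] z half_le by (cases "z = owner Y z'") auto
      ultimately show ?thesis by simp
    next
      case 3
      have sym: "v z' z = v z z'" by (rule vdist_commute)
      show ?thesis
        using owner(3)[OF Y 3(1)] owner(5)[OF Y 3(1), of z'] z half_le t[of z] 3 sym
        by (cases "z' = owner Y z") (auto simp: ext_time_def)
    next
      case 4
      have sym: "v z' z = v z z'" by (rule vdist_commute)
      have "z' \<noteq> owner Y z" using ext_disjoint[OF Y 4(2)] owner(1)[OF Y 4(1)] by auto
      hence "T \<le> v z z'" using owner(5)[OF Y 4(1), of z'] z sym by auto
      thus ?thesis using half_le t[of z] by auto
    qed
  qed
  show ?thesis
    unfolding good_def using finite_P P_space extD[OF Y] t c s by (auto simp: space_Mk)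
qed

lemma sets_avail_event:
  assumes "finite R" "R \<subseteq> space Mk"
  shows "{w \<in> space W. \<forall>x\<in>R. avail d m (eta w \<union> R) x (f x)} \<in> sets W"
proof -
  have "Measurable.pred W (\<lambda>w. \<forall>x\<in>R. avail d m (eta w \<union> R) x (f x))"
    using assms by (intro pred_intros_finite measurable_avail mconf_Un_finite mconf_eta) auto
  thus ?thesis by (simp add: pred_def)
qed

text \<open>With no further hits to remove, the moment is the joint availability at depth
  \<open>n\<close> of the enlarged family, and the tree product over that family reduces to the
  points of \<open>Y\<close>.\<close>

lemma Epsi_0:
  assumes Y: "ext Y"
  shows "Epsi 0 Y = emeasure W {w \<in> space W. \<forall>x\<in>P \<union> Y. avail d n (eta w \<union> (P \<union> Y)) x (ext_time Y x)}"
    and "(\<Prod>x\<in>P \<union> Y. tav n (snd x) (ext_time Y x)) = (\<Prod>y\<in>Y. hhat y)"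
proof -
  have iff: "(\<forall>y\<in>Y. hits S y) \<longleftrightarrow> (\<forall>x\<in>P \<union> Y. avail d n S x (ext_time Y x))" for S
  proof -
    have "(\<forall>x\<in>P. avail d n S x (ext_time Y x))"
      using ext_disjoint[OF Y] by (auto simp: ext_time_def)
    moreover have "(\<forall>y\<in>Y. hits S y) \<longleftrightarrow> (\<forall>x\<in>Y. avail d n S x (ext_time Y x))"
      using hits_ext[OF Y] by (auto simp: ext_time_def)
    ultimately show ?thesis by auto
  qed
  let ?A = "{w \<in> space W. \<forall>x\<in>P \<union> Y. avail d n (eta w \<union> (P \<union> Y)) x (ext_time Y x)}"
  have "Epsi 0 Y = (\<integral>\<^sup>+w. indicator ?A w \<partial>W)"
    unfolding Epsi_def psi_def iff by (intro nn_integral_cong) (auto split: split_indicator)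
  also have "\<dots> = emeasure W ?A"
    using finite_P P_space extD[OF Y] by (intro nn_integral_indicator sets_avail_event) auto
  finally show "Epsi 0 Y = emeasure W ?A" .
  have "(\<Prod>x\<in>P \<union> Y. tav n (snd x) (ext_time Y x)) = (\<Prod>x\<in>P. tav n (snd x) (ext_time Y x)) * (\<Prod>x\<in>Y. tav n (snd x) (ext_time Y x))"
    using finite_P extD(1)[OF Y] ext_disjoint[OF Y] by (intro prod.union_disjoint) auto
  also have "(\<Prod>x\<in>P. tav n (snd x) (ext_time Y x)) = 1"
  proof (rule prod.neutral, rule ballI)
    fix x assume "x \<in> P"
    hence "ext_time Y x = 0" using ext_disjoint[OF Y, of x] by (auto simp: ext_time_def)
    thus "tav n (snd x) (ext_time Y x) = 1" by (cases n) simp_all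
  qed
  also have "(\<Prod>x\<in>Y. tav n (snd x) (ext_time Y x)) = (\<Prod>y\<in>Y. hhat y)"
    using hhat_ext[OF Y] by (intro prod.cong) (auto simp: ext_time_def simp del: tree_av.simps)
  finally show "(\<Prod>x\<in>P \<union> Y. tav n (snd x) (ext_time Y x)) = (\<Prod>y\<in>Y. hhat y)" by (simp only: mult_1_left)
qed

text \<open>
  Outside \<open>Bad Y\<close> a further hit is close to a single probe only; the volume of \<open>Bad Y\<close> decays exponentially in \<open>d\<close>.
\<close>

definition Near where "Near Y = (\<Union>z\<in>P \<union> Y. {y \<in> space Mk. v z y < (1/2)^d * T})"
definition Over where "Over Y = (\<Union>(x, z)\<in>{(x, z). x \<in> P \<and> z \<in> P \<union> Y \<and> z \<noteq> x}. {y \<in> space Mk. v x y < T} \<inter> {y \<in> space Mk. v z y < T})"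
definition Bad where "Bad Y = Near Y \<union> Over Y"

text \<open>Outside \<open>Near Y\<close> the new hit keeps the minimal distance from everything,
  and outside \<open>Over Y\<close> the probe that sees it is the only point of
  \<open>P \<union> Y\<close> closer than \<open>T\<close>.\<close>

lemma ext_insert:
  assumes Y: "ext Y" and y: "y \<in> reach" "y \<notin> Bad Y"
  shows "y \<notin> Y" "ext (insert y Y)"
proof -
  have ysp: "y \<in> space Mk" using y(1) by (simp add: reach_def)
  have near: "(1/2)^d * T \<le> v z y" if "z \<in> P \<union> Y" for z
    using y(2) that ysp by (force simp: Bad_def Near_def not_less)
  show yY: "y \<notin> Y"
  proof
    assume "y \<in> Y"
    hence "(1/2)^d * T \<le> v y y" using near by simp
    moreover have "v y y = 0" using d ysp by (subst vdist_eq_0_iff) (auto simp: space_Mk)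
    moreover have "(1/2)^d * T > 0" using T by simp
    ultimately show False by linarith
  qed
  obtain x where x: "x \<in> P" "snd y \<noteq> snd x" "v x y < \<tau> x" using y(1) by (auto simp: reach_def)
  have far: "T \<le> v z y" if z: "z \<in> P \<union> Y" "z \<noteq> x" for z
  proof (rule ccontr)
    assume "\<not> T \<le> v z y"
    moreover have "v x y < T" using x P_time[OF x(1)] by simp
    ultimately have "y \<in> Over Y"
      unfolding Over_def using x(1) z ysp by (intro UN_I[of "(x, z)"]) auto
    thus False using y(2) by (simp add: Bad_def)
  qed
  have old: "\<exists>x\<in>P. snd y' \<noteq> snd x \<and> (1/2)^d * T \<le> v x y' \<and> v x y' < \<tau> x \<and>
     (\<forall>z\<in>P \<union> insert y Y. z \<noteq> x \<and> z \<noteq> y' \<longrightarrow> T \<le> v z y')" if y': "y' \<in> Y" for y'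
  proof (rule bexI[OF _ owner(1)[OF Y y']], intro conjI ballI impI owner(2-4)[OF Y y'])
    fix z assume z: "z \<in> P \<union> insert y Y" "z \<noteq> owner Y y' \<and> z \<noteq> y'"
    show "T \<le> v z y'"
    proof (cases "z = y")
      case True
      have "y' \<noteq> x" using ext_disjoint[OF Y y'] x(1) by auto
      thus ?thesis using far[of y'] y' True vdist_commute[of d "fst z" "fst y'"] by simp
    qed (use z owner(5)[OF Y y', of z] in auto)
  qed
  have new: "\<exists>x\<in>P. snd y \<noteq> snd x \<and> (1/2)^d * T \<le> v x y \<and> v x y < \<tau> x \<and>
     (\<forall>z\<in>P \<union> insert y Y. z \<noteq> x \<and> z \<noteq> y \<longrightarrow> T \<le> v z y)"
    using x near[of x] far by (intro bexI[OF _ x(1)]) auto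
  show "ext (insert y Y)" unfolding ext_def using extD[OF Y] ysp old new by blast
qed

definition bad_bound :: "nat \<Rightarrow> real" where
  "bad_bound m = real (card P + m) * ((1/2)^d * T) + real (card P * (card P + m)) * (sqrt (15/16) ^ d * T)"

lemma sets_Bad: assumes Y: "ext Y" shows "Near Y \<in> sets Mk" "Over Y \<in> sets Mk" "Bad Y \<in> sets Mk"
proof -
  have sp: "z \<in> space Mk" if "z \<in> P \<union> Y" for z using that P_space extD[OF Y] by auto
  have fin: "finite (P \<union> Y)" using finite_P extD[OF Y] by simp
  show n: "Near Y \<in> sets Mk" unfolding Near_def using sp by (intro sets.finite_UN fin sets_near) auto
  have "{(x, z). x \<in> P \<and> z \<in> P \<union> Y \<and> z \<noteq> x} \<subseteq> P \<times> (P \<union> Y)" by auto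
  hence fin2: "finite {(x, z). x \<in> P \<and> z \<in> P \<union> Y \<and> z \<noteq> x}" by (rule finite_subset) (use fin in auto)
  show o: "Over Y \<in> sets Mk" unfolding Over_def
    using sp by (intro sets.finite_UN fin2) (auto intro!: sets.Int sets_near)
  show "Bad Y \<in> sets Mk" unfolding Bad_def using n o by (rule sets.Un)
qed

text \<open>A union bound: small balls for \<open>Near Y\<close>, and \<open>vball_overlap\<close>
  for \<open>Over Y\<close>, where the centres are at least \<open>(1/2)^d * T\<close>
  apart.\<close>

lemma nuB_Bad:
  assumes Y: "ext Y" shows "emeasure (nuB B) (Bad Y) \<le> ennreal (bad_bound (card Y))"
proof -
  have sp: "z \<in> space Mk" if "z \<in> P \<union> Y" for z using that P_space extD[OF Y] by auto
  have fin: "finite (P \<union> Y)" using finite_P extD[OF Y] by simp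
  have card: "card (P \<union> Y) \<le> card P + card Y" by (rule card_Un_le)
  let ?h = "(1/2)^d * T" let ?o = "sqrt (15/16) ^ d * T"
  have h: "0 \<le> ?h" "0 \<le> ?o" using T by auto
  have "emeasure (nuB B) (Near Y) \<le> (\<Sum>z\<in>P \<union> Y. emeasure (nuB B) {y \<in> space Mk. v z y < ?h})"
    unfolding Near_def using sp by (intro emeasure_subadditive_finite fin) (auto simp: sets_nuB intro!: sets_near)
  also have "\<dots> \<le> (\<Sum>z\<in>P \<union> Y. ennreal ?h)" by (intro sum_mono nuB_near_le)
  also have "\<dots> = ennreal (real (card (P \<union> Y)) * ?h)"
    using h by (simp add: ennreal_mult' ennreal_of_nat_eq_real_of_nat)
  also have "\<dots> \<le> ennreal (real (card P + card Y) * ?h)"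
    using card h by (intro ennreal_leI mult_right_mono) auto
  finally have near: "emeasure (nuB B) (Near Y) \<le> ennreal (real (card P + card Y) * ?h)" .
  let ?S = "{(x, z). x \<in> P \<and> z \<in> P \<union> Y \<and> z \<noteq> x}"
  have sub: "?S \<subseteq> P \<times> (P \<union> Y)" by auto
  have fin2: "finite ?S" by (rule finite_subset[OF sub]) (use fin in auto)
  have "card ?S \<le> card (P \<times> (P \<union> Y))" by (rule card_mono[OF _ sub]) (use fin in auto)
  also have "\<dots> \<le> card P * (card P + card Y)" using card by (simp add: card_cartesian_product)
  finally have card2: "card ?S \<le> card P * (card P + card Y)" .
  have ov: "emeasure (nuB B) ({y \<in> space Mk. v x y < T} \<inter> {y \<in> space Mk. v z y < T}) \<le> ennreal ?o"
    if xz: "x \<in> P" "z \<in> P \<union> Y" "z \<noteq> x" for x z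
  proof -
    have far: "?h \<le> v x z"
    proof (cases "z \<in> P")
      case True thus ?thesis using P_sep[OF xz(1), of z] xz by auto
    next
      case False
      hence z: "z \<in> Y" using xz by auto
      show ?thesis using owner(3)[OF Y z] owner(5)[OF Y z, of x] xz half_le by (cases "x = owner Y z") auto
    qed
    let ?A = "{y \<in> space E. vdist d (fst x) y < T \<and> vdist d (fst z) y < T}"
    have A: "?A \<in> sets E" by measurable
    have "{y \<in> space Mk. v x y < T} \<inter> {y \<in> space Mk. v z y < T} = {y \<in> space Mk. fst y \<in> ?A}"
      by (auto simp: space_Mk)
    hence "emeasure (nuB B) ({y \<in> space Mk. v x y < T} \<inter> {y \<in> space Mk. v z y < T}) = emeasure E (?A \<inter> B)"
      using emeasure_nuB_fst[OF B A] by simp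
    also have "\<dots> \<le> emeasure E ?A" by (intro emeasure_mono A) auto
    also have "\<dots> \<le> ennreal ?o" using T far by (intro vball_overlap[OF d]) auto
    finally show ?thesis .
  qed
  have "emeasure (nuB B) (Over Y) \<le> (\<Sum>s\<in>?S. emeasure (nuB B) (case s of (x, z) \<Rightarrow> {y \<in> space Mk. v x y < T} \<inter> {y \<in> space Mk. v z y < T}))"
    unfolding Over_def using sp by (intro emeasure_subadditive_finite fin2) (auto simp: sets_nuB intro!: sets.Int sets_near)
  also have "\<dots> \<le> (\<Sum>s\<in>?S. ennreal ?o)" using ov by (intro sum_mono) auto
  also have "\<dots> = ennreal (real (card ?S) * ?o)"
    using h by (simp add: ennreal_mult' ennreal_of_nat_eq_real_of_nat)
  also have "\<dots> \<le> ennreal (real (card P * (card P + card Y)) * ?o)"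
    using h(2) of_nat_mono[OF card2, where 'a=real] by (intro ennreal_leI mult_right_mono) auto
  finally have over: "emeasure (nuB B) (Over Y) \<le> ennreal (real (card P * (card P + card Y)) * ?o)" .
  have "emeasure (nuB B) (Bad Y) \<le> emeasure (nuB B) (Near Y) + emeasure (nuB B) (Over Y)"
    unfolding Bad_def using sets_Bad[OF Y] by (intro emeasure_subadditive) (auto simp: sets_nuB)
  also have "\<dots> \<le> ennreal (real (card P + card Y) * ?h) + ennreal (real (card P * (card P + card Y)) * ?o)"
    by (rule add_mono[OF near over])
  also have "\<dots> = ennreal (bad_bound (card Y))"
    unfolding bad_bound_def using h by (intro ennreal_plus[symmetric]) auto
  finally show ?thesis .
qed

end

context colour_probs
begin

text \<open>For negative \<open>t\<close> the interval \<open>{0..t}\<close> is empty, so the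
  function is constantly 1 there.\<close>

lemma continuous_a_UNIV: "continuous_on UNIV (tav n i)"
proof -
  have "tav n i = tav n i \<circ> max 0"
  proof
    fix t show "tav n i t = (tav n i \<circ> max 0) t"
      by (cases n) (auto simp: max_def)
  qed
  moreover have "continuous_on UNIV (tav n i \<circ> max 0)"
    by (intro continuous_on_compose continuous_on_subset[OF continuous_a] continuous_intros) auto
  ultimately show ?thesis by simp
qed

lemma measurable_a [measurable]: "tav n i \<in> borel_measurable borel"
  by (rule borel_measurable_continuous_onI[OF continuous_a_UNIV])

lemma nn_integral_rate:
  assumes "s \<ge> 0"
  shows "(\<integral>\<^sup>+u. indicator {0..} u * (indicator {..<s} u * ennreal (rate (tav n) i u)) \<partial>lborel) =
    ennreal (integral {0..s} (rate (tav n) i))"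
proof -
  have "(\<integral>\<^sup>+u. indicator {0..} u * (indicator {..<s} u * ennreal (rate (tav n) i u)) \<partial>lborel) =
    (\<integral>\<^sup>+u. ennreal (indicat_real {0..s} u * rate (tav n) i u) \<partial>lborel)"
  proof (rule nn_integral_cong_AE)
    \<comment> \<open>The strict inequality of the recursion and the closed interval of the integral
      differ only at \<open>s\<close>.\<close>
    have "AE u in lborel. u \<noteq> s" by (rule AE_lborel_singleton)
    thus "AE u in lborel. indicator {0..} u * (indicator {..<s} u * ennreal (rate (tav n) i u)) =
      ennreal (indicat_real {0..s} u * rate (tav n) i u)"
      by eventually_elim (auto split: split_indicator)
  qed
  also have "\<dots> = ennreal (integral {0..s} (rate (tav n) i))"
    by (intro nn_integral_has_integral_lebesgue integrable_integral integrable_rate continuous_a rate_nonneg less_imp_le[OF a_pos])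
  finally show ?thesis .
qed

end

text \<open>A Bonferroni inequality. The alternating partial sum is \<open>(- 1) ^ M\<close> times
  the generalised binomial coefficient of \<open>real h - 1\<close> and \<open>M\<close>. For
  \<open>h = 0\<close> this is 1 and the error vanishes; otherwise its absolute value is at most
  \<open>h choose Suc M\<close> by Pascal's rule.\<close>

lemma alternating_choose_bound:
  "\<bar>(if h = 0 then 1 else 0) - (\<Sum>q\<le>M. (- 1) ^ q * real (h choose q))\<bar> \<le> real (h choose Suc M)"
proof -
  have s: "(\<Sum>q\<le>M. (- 1) ^ q * real (h choose q)) = (- 1) ^ M * (real h - 1 gchoose M)"
    using gbinomial_sum_lower_neg[of "real h" M] by (simp add: binomial_gbinomial mult.commute)
  show ?thesis
  proof (cases h)
    case 0
    have "(- 1 gchoose M :: real) = (- 1) ^ M"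
      using gbinomial_minus[of "1::real" M] gbinomial_of_nat_symmetric[of M M] by (simp add: binomial_gbinomial[symmetric, of M M])
    thus ?thesis unfolding s using 0 by (simp flip: power_mult_distrib)
  next
    case (Suc m)
    have "real h - 1 gchoose M = real (m choose M)" by (simp add: Suc binomial_gbinomial)
    thus ?thesis unfolding s using Suc by (simp add: abs_mult)
  qed
qed

section \<open>Comparison of the moments with their tree values\<close>

context probe
begin

lemma measurable_hhat [measurable]: "hhat \<in> borel_measurable Mk"
proof -
  have "(\<lambda>y. if snd y \<noteq> snd x \<and> v x y < \<tau> x then tav n (snd y) (v x y) else 0) \<in> borel_measurable Mk" if x: "x \<in> P" for x
  proof -
    define g where "g = (\<lambda>y :: (nat \<Rightarrow> real) \<times> nat. v x y)"
    have g [measurable]: "g \<in> borel_measurable Mk"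
      unfolding g_def using x P_space by (intro measurable_v_const) auto
    have "(\<lambda>y. (\<lambda>i y. tav n i (g y)) (snd y) y) \<in> borel_measurable Mk"
      by (rule measurable_compose_countable) measurable
    hence [measurable]: "(\<lambda>y. tav n (snd y) (g y)) \<in> borel_measurable Mk" by simp
    have "(\<lambda>y. if snd y \<noteq> snd x \<and> g y < \<tau> x then tav n (snd y) (g y) else 0) \<in> borel_measurable Mk" by measurable
    thus ?thesis unfolding g_def .
  qed
  thus ?thesis unfolding hhat_def[abs_def] by (rule borel_measurable_sum)
qed

text \<open>By \<open>nn_integral_vdist\<close> the contribution of a probe is the integral of the
  rate over \<open>{0..\<tau> x}\<close>, which is the exponent of \<open>tree_av\<close> at the
  next depth.\<close>

lemma nn_integral_hhat: "(\<integral>\<^sup>+y. ennreal (hhat y) \<partial>nuB B) = ennreal Lr"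
proof -
  let ?f = "\<lambda>x y. if snd y \<noteq> snd x \<and> v x y < \<tau> x then ennreal (tav n (snd y) (v x y)) else 0"
  have m: "?f x \<in> borel_measurable Mk" and i: "(\<integral>\<^sup>+y. ?f x y \<partial>nuB B) = ennreal (integral {0..\<tau> x} (rate (tav n) (snd x)))"
    if x: "x \<in> P" for x
  proof -
    define g where "g = (\<lambda>y :: (nat \<Rightarrow> real) \<times> nat. v x y)"
    have g [measurable]: "g \<in> borel_measurable Mk"
      unfolding g_def using x P_space by (intro measurable_v_const) auto
    have "(\<lambda>y. (\<lambda>i y. tav n i (g y)) (snd y) y) \<in> borel_measurable Mk"
      by (rule measurable_compose_countable) measurable
    hence [measurable]: "(\<lambda>y. tav n (snd y) (g y)) \<in> borel_measurable Mk" by simp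
    have "(\<lambda>y. if snd y \<noteq> snd x \<and> g y < \<tau> x then ennreal (tav n (snd y) (g y)) else 0) \<in> borel_measurable Mk" by measurable
    thus m: "?f x \<in> borel_measurable Mk" unfolding g_def .
    \<comment> \<open>The window does not cut into the ball of a probe, because probes lie in the
      core.\<close>
    have inB: "fst y \<in> B" if "y \<in> space Mk" "v x y < \<tau> x" for y
    proof -
      have "v x y < T" using that P_time[OF x] by simp
      hence "fst y \<in> core d T B n" using P_core[OF x] that(1) by (auto simp: space_Mk)
      thus ?thesis using core_subset by blast
    qed
    have "(\<integral>\<^sup>+y. ?f x y \<partial>nuB B) = (\<integral>\<^sup>+y. indicator B (fst y) * ?f x y \<partial>nu)"
      by (rule nn_integral_nuB[OF B m])
    also have "\<dots> = (\<integral>\<^sup>+y. ?f x y \<partial>nu)"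
      using inB by (intro nn_integral_cong) (auto simp: space_nu space_Mk split: split_indicator)
    also have "\<dots> = (\<integral>\<^sup>+a. \<integral>\<^sup>+c. ?f x (a, c) \<partial>pm \<partial>E)"
      unfolding nu_def
      by (rule pm.nn_integral_fst[symmetric]) (use m in \<open>simp add: nu_def[symmetric] measurable_cong_sets[OF sets_nu refl]\<close>)
    also have "\<dots> = (\<integral>\<^sup>+a. indicator {..<\<tau> x} (vdist d (fst x) a) * ennreal (rate (tav n) (snd x) (vdist d (fst x) a)) \<partial>E)"
    proof (intro nn_integral_cong)
      fix a
      let ?u = "vdist d (fst x) a"
      have "(\<integral>\<^sup>+c. ?f x (a, c) \<partial>pm) = (\<Sum>c\<in>{1..k}. ennreal (p c) * ?f x (a, c))"
        by (rule nn_integral_point_measure_finite) simp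
      also have "\<dots> = (\<Sum>c\<in>{1..k}. if c \<noteq> snd x then indicator {..<\<tau> x} ?u * ennreal (p c * tav n c ?u) else 0)"
        using p_nonneg by (intro sum.cong refl) (auto simp: ennreal_mult' split: split_indicator simp del: tree_av.simps)
      also have "\<dots> = (\<Sum>c\<in>{1..k} - {snd x}. indicator {..<\<tau> x} ?u * ennreal (p c * tav n c ?u))"
        by (simp add: sum.inter_filter[symmetric] set_diff_eq del: tree_av.simps)
      also have "\<dots> = indicator {..<\<tau> x} ?u * ennreal (rate (tav n) (snd x) ?u)"
        unfolding sum_distrib_left[symmetric] rate_def
        by (subst sum_ennreal) (auto intro!: mult_nonneg_nonneg p_nonneg less_imp_le[OF a_pos] simp del: tree_av.simps)
      finally show "(\<integral>\<^sup>+c. ?f x (a, c) \<partial>pm) = indicator {..<\<tau> x} ?u * ennreal (rate (tav n) (snd x) ?u)" .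
    qed
    also have "\<dots> = (\<integral>\<^sup>+s. indicator {0..} s * (indicator {..<\<tau> x} s * ennreal (rate (tav n) (snd x) s)) \<partial>lborel)"
      unfolding rate_def by (rule nn_integral_vdist[OF d, of "\<lambda>u. indicator {..<\<tau> x} u * ennreal (\<Sum>j\<in>{1..k} - {snd x}. p j * tav n j u)"]) measurable
    also have "\<dots> = ennreal (integral {0..\<tau> x} (rate (tav n) (snd x)))"
      using P_time[OF x] by (intro nn_integral_rate)
    finally show "(\<integral>\<^sup>+y. ?f x y \<partial>nuB B) = ennreal (integral {0..\<tau> x} (rate (tav n) (snd x)))" .
  qed
  have "(\<integral>\<^sup>+y. ennreal (hhat y) \<partial>nuB B) = (\<integral>\<^sup>+y. (\<Sum>x\<in>P. ?f x y) \<partial>nuB B)"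
  proof (intro nn_integral_cong)
    fix y show "ennreal (hhat y) = (\<Sum>x\<in>P. ?f x y)"
      unfolding hhat_def using a_pos
      by (subst sum_ennreal[symmetric]) (auto intro!: sum.cong less_imp_le simp del: tree_av.simps)
  qed
  also have "\<dots> = (\<Sum>x\<in>P. \<integral>\<^sup>+y. ?f x y \<partial>nuB B)"
    using m by (intro nn_integral_sum) (simp add: measurable_cong_sets[OF sets_nuB refl])
  also have "\<dots> = (\<Sum>x\<in>P. ennreal (integral {0..\<tau> x} (rate (tav n) (snd x))))"
    using i by (rule sum.cong[OF refl])
  also have "\<dots> = ennreal Lr"
    unfolding Lr_def
    by (intro sum_ennreal integral_nonneg integrable_rate continuous_a rate_nonneg less_imp_le[OF a_pos])
  finally show ?thesis .
qed

text \<open>Two one-sided bounds instead of a difference, because \<open>Epsi\<close> is an extended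
  number. The factor \<open>fact q\<close> makes the tree value the plain power
  \<open>Lr ^ q\<close> times a product.\<close>

definition approx :: "nat \<Rightarrow> ((nat \<Rightarrow> real) \<times> nat) set \<Rightarrow> real \<Rightarrow> bool" where
  "approx q Y e \<longleftrightarrow> of_nat (fact q) * Epsi q Y \<le> ennreal (Lr ^ q * (\<Prod>y\<in>Y. hhat y) + e) \<and>
     ennreal (Lr ^ q * (\<Prod>y\<in>Y. hhat y)) \<le> of_nat (fact q) * Epsi q Y + ennreal e"

lemma approx_mono: "approx q Y e \<Longrightarrow> e \<le> e' \<Longrightarrow> approx q Y e'"
  unfolding approx_def by (meson add_left_mono ennreal_leI order_trans)

lemma bad_bound_nonneg: "0 \<le> bad_bound m"
  using T unfolding bad_bound_def by (intro add_nonneg_nonneg mult_nonneg_nonneg) auto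

text \<open>The shape of both halves of \<open>approx_Suc\<close>: a small error on
  \<open>reach\<close>, which has bounded measure, and a bounded error on \<open>Bad Y\<close>,
  which has small measure.\<close>

lemma nn_integral_bound:
  assumes e: "e \<ge> 0" "b \<ge> 0" and Y: "ext Y" and f [measurable]: "f \<in> borel_measurable Mk"
    and le: "\<And>y. y \<in> space Mk \<Longrightarrow> g y \<le> f y + ennreal e * indicator reach y + ennreal b * indicator (Bad Y) y"
  shows "(\<integral>\<^sup>+y. g y \<partial>nuB B) \<le> (\<integral>\<^sup>+y. f y \<partial>nuB B) + ennreal (e * (real (card P) * T) + b * bad_bound (card Y))"
proof -
  note [measurable] = sets_reach sets_Bad(3)[OF Y]
  have "(\<integral>\<^sup>+y. g y \<partial>nuB B) \<le> (\<integral>\<^sup>+y. f y + ennreal e * indicator reach y + ennreal b * indicator (Bad Y) y \<partial>nuB B)"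
    using le by (intro nn_integral_mono) (simp add: space_nuB)
  also have "\<dots> = (\<integral>\<^sup>+y. f y \<partial>nuB B) + (\<integral>\<^sup>+y. ennreal e * indicator reach y \<partial>nuB B) + (\<integral>\<^sup>+y. ennreal b * indicator (Bad Y) y \<partial>nuB B)"
    by (subst nn_integral_add, measurable, subst nn_integral_add, measurable)
  also have "\<dots> = (\<integral>\<^sup>+y. f y \<partial>nuB B) + ennreal e * emeasure (nuB B) reach + ennreal b * emeasure (nuB B) (Bad Y)"
    using sets_reach sets_Bad(3)[OF Y] by (simp add: nn_integral_cmult_indicator sets_nuB)
  also have "\<dots> \<le> (\<integral>\<^sup>+y. f y \<partial>nuB B) + ennreal e * ennreal (real (card P) * T) + ennreal b * ennreal (bad_bound (card Y))"
    by (intro add_mono mult_left_mono nuB_reach nuB_Bad Y order_refl) auto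
  also have "\<dots> = (\<integral>\<^sup>+y. f y \<partial>nuB B) + ennreal (e * (real (card P) * T) + b * bad_bound (card Y))"
    using e T bad_bound_nonneg by (simp add: ennreal_plus ennreal_mult' add.assoc)
  finally show ?thesis .
qed

text \<open>The induction hypothesis is integrated over one more removed hit. Outside
  \<open>Bad Y\<close> the enlarged set is again admissible; on \<open>Bad Y\<close> a crude bound
  is enough. The factor \<open>hhat y\<close> integrates to one more \<open>Lr\<close>.\<close>

lemma approx_Suc:
  assumes Y: "ext Y" and e: "e \<ge> 0"
    and IH: "\<And>y. ext (insert y Y) \<Longrightarrow> y \<notin> Y \<Longrightarrow> approx q (insert y Y) e"
  shows "approx (Suc q) Y (e * (real (card P) * T) + ((real (card P) * T) ^ q * (real (card P) + 1)) * bad_bound (card Y))"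
proof -
  \<comment> \<open>\<open>?b\<close> dominates both quantities on \<open>Bad Y\<close>: the moment
    is at most \<open>?c ^ q\<close> and the tree value at most
    \<open>?c ^ q * real (card P)\<close>.\<close>
  let ?c = "real (card P) * T" let ?b = "?c ^ q * (real (card P) + 1)"
  let ?K = "Lr ^ q * (\<Prod>y\<in>Y. hhat y)"
  have c: "0 \<le> ?c" using T by simp
  have cq: "0 \<le> ?c ^ q" using c by (rule zero_le_power)
  have "?c ^ q * 1 \<le> ?b" by (intro mult_left_mono cq) simp
  hence b: "?c ^ q \<le> ?b" "0 \<le> ?b" using cq by (simp_all only: mult_1_right)
  have K: "0 \<le> ?K" using Lr_bounds prod_hhat_bounds by simp
  have Kb: "?K * hhat y \<le> ?b" for y
  proof -
    have "?K \<le> ?c ^ q * 1"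
      using Lr_bounds prod_hhat_bounds Y by (intro mult_mono power_mono) auto
    hence "?K * hhat y \<le> (?c ^ q * 1) * real (card P)"
      by (rule mult_mono[OF _ hhat_le]) (simp_all only: mult_1_right cq hhat_nonneg)
    also have "\<dots> \<le> ?b" unfolding mult_1_right by (intro mult_left_mono cq) simp
    finally show ?thesis .
  qed
  have fin: "finite Y" "Y \<subseteq> space Mk" using extD[OF Y] by auto
  have good: "of_nat (fact q) * Epsi q (insert y Y) \<le> ennreal (?K * hhat y) + ennreal e"
     "ennreal (?K * hhat y) \<le> of_nat (fact q) * Epsi q (insert y Y) + ennreal e"
    if y: "y \<in> reach" "y \<notin> Bad Y" for y
  proof -
    note yy = ext_insert[OF Y y]
    have pr: "Lr ^ q * (\<Prod>y\<in>insert y Y. hhat y) = ?K * hhat y" using fin yy(1) by simp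
    have "0 \<le> ?K * hhat y" using K hhat_nonneg by simp
    thus "of_nat (fact q) * Epsi q (insert y Y) \<le> ennreal (?K * hhat y) + ennreal e"
     "ennreal (?K * hhat y) \<le> of_nat (fact q) * Epsi q (insert y Y) + ennreal e"
      using IH[OF yy(2,1)] e unfolding approx_def pr by (simp_all add: ennreal_plus)
  qed
  have mK [measurable]: "(\<lambda>y. ennreal (?K * hhat y)) \<in> borel_measurable Mk" by measurable
  have iK: "(\<integral>\<^sup>+y. ennreal (?K * hhat y) \<partial>nuB B) = ennreal (Lr ^ Suc q * (\<Prod>y\<in>Y. hhat y))"
  proof -
    have "(\<integral>\<^sup>+y. ennreal (?K * hhat y) \<partial>nuB B) = ennreal ?K * (\<integral>\<^sup>+y. ennreal (hhat y) \<partial>nuB B)"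
      using K hhat_nonneg
      by (subst nn_integral_cmult[symmetric]) (auto simp: ennreal_mult' measurable_cong_sets[OF sets_nuB refl] simp del: power_Suc)
    also have "\<dots> = ennreal (?K * Lr)" using K Lr_bounds by (simp add: nn_integral_hhat ennreal_mult')
    finally show ?thesis by (simp add: mult_ac)
  qed
  have mE [measurable]: "(\<lambda>y. of_nat (fact q) * Epsi q (insert y Y)) \<in> borel_measurable Mk"
    using Epsi_rec(1)[OF fin] by (intro borel_measurable_times_ennreal) auto
  have rec: "of_nat (fact (Suc q)) * Epsi (Suc q) Y = (\<integral>\<^sup>+y. of_nat (fact q) * Epsi q (insert y Y) \<partial>nuB B)"
    by (rule fact_Epsi_rec[OF fin])
  have up: "of_nat (fact q) * Epsi q (insert y Y) \<le> ennreal (?K * hhat y) + ennreal e * indicator reach y + ennreal ?b * indicator (Bad Y) y"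
    if y: "y \<in> space Mk" for y
  proof -
    consider "y \<notin> reach" | "y \<in> reach" "y \<in> Bad Y" | "y \<in> reach" "y \<notin> Bad Y" by blast
    thus ?thesis
    proof cases
      case 1 thus ?thesis using Epsi_eq_0[OF y] by simp
    next
      case 2
      have "of_nat (fact q) * Epsi q (insert y Y) \<le> ennreal (?c ^ q)" using fin y by (intro Epsi_bound) auto
      also have "\<dots> \<le> ennreal ?b" using b by (intro ennreal_leI)
      also have "\<dots> \<le> ennreal (?K * hhat y) + ennreal e * indicator reach y + ennreal ?b * indicator (Bad Y) y"
        using 2 by simp
      finally show ?thesis .
    next
      case 3 thus ?thesis using good(1)[OF 3] by simp
    qed
  qed
  have lo: "ennreal (?K * hhat y) \<le> of_nat (fact q) * Epsi q (insert y Y) + ennreal e * indicator reach y + ennreal ?b * indicator (Bad Y) y"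
    if y: "y \<in> space Mk" for y
  proof -
    consider "y \<notin> reach" | "y \<in> reach" "y \<in> Bad Y" | "y \<in> reach" "y \<notin> Bad Y" by blast
    thus ?thesis
    proof cases
      case 1 thus ?thesis using hhat_eq_0[OF y] by simp
    next
      case 2
      have "ennreal (?K * hhat y) \<le> ennreal ?b" using Kb by (intro ennreal_leI)
      also have "\<dots> \<le> of_nat (fact q) * Epsi q (insert y Y) + ennreal e * indicator reach y + ennreal ?b * indicator (Bad Y) y"
        using 2 by simp
      finally show ?thesis .
    next
      case 3 thus ?thesis using good(2)[OF 3] by simp
    qed
  qed
  have nn: "0 \<le> Lr ^ Suc q * (\<Prod>y\<in>Y. hhat y)" "0 \<le> e * ?c + ?b * bad_bound (card Y)"
    using Lr_bounds prod_hhat_bounds e c b bad_bound_nonneg by (auto intro!: mult_nonneg_nonneg add_nonneg_nonneg)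
  show ?thesis
    unfolding approx_def rec
  proof
    show "(\<integral>\<^sup>+y. of_nat (fact q) * Epsi q (insert y Y) \<partial>nuB B) \<le> ennreal (Lr ^ Suc q * (\<Prod>y\<in>Y. hhat y) + (e * ?c + ?b * bad_bound (card Y)))"
      using nn_integral_bound[OF e b(2) Y mK up] unfolding iK by (simp only: ennreal_plus[OF nn])
    show "ennreal (Lr ^ Suc q * (\<Prod>y\<in>Y. hhat y)) \<le> (\<integral>\<^sup>+y. of_nat (fact q) * Epsi q (insert y Y) \<partial>nuB B) + ennreal (e * ?c + ?b * bad_bound (card Y))"
      using nn_integral_bound[OF e b(2) Y mE lo] unfolding iK .
  qed
qed

text \<open>A version of \<open>eta\<close> that is finite everywhere, not just almost surely, so
  that its hits can be counted measurably.\<close>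

definition eta_fin where "eta_fin w = {z \<in> eta w. finite {m. fst w m \<in> B}}"

lemma finite_eta_fin: "finite (eta_fin w)"
  by (cases "finite {m. fst w m \<in> B}") (auto simp: eta_fin_def eta_eq)

lemma mconf_eta_fin: "mconf W eta_fin"
proof -
  have "cnt B X < \<infinity> \<longleftrightarrow> finite {m. X m \<in> B}" for X :: "nat \<Rightarrow> nat \<Rightarrow> real"
    by (simp add: cnt_def emeasure_count_space ennreal_of_nat_eq_real_of_nat)
  moreover have "Measurable.pred W (\<lambda>w. cnt B (fst w) < \<infinity>)" by measurable
  ultimately have "Measurable.pred W (\<lambda>w. finite {m. fst w m \<in> B})" by simp
  thus ?thesis unfolding eta_fin_def[abs_def] by (intro mconf_filter mconf_eta)
qed

lemma eta_fin_eq: "finite {m. fst w m \<in> B} \<Longrightarrow> eta_fin w = eta w"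
  by (simp add: eta_fin_def)

text \<open>Three errors: the Bonferroni remainder, bounded by the moment of order
  \<open>Suc M\<close>; the errors \<open>e\<close> of the \<open>Suc M\<close> lower moments; and
  the Taylor remainder of \<open>exp (- Lr)\<close>, which \<open>exp_Lr\<close> identifies with the
  tree product.\<close>

lemma avail_prob_approx:
  assumes ap: "\<And>q. q \<le> M \<Longrightarrow> approx q {} e" and e: "e \<ge> 0"
  shows "\<bar>measure W {w \<in> space W. \<forall>x\<in>P. avail d (Suc n) (eta w \<union> P) x (\<tau> x)} - (\<Prod>x\<in>P. tav (Suc n) (snd x) (\<tau> x))\<bar> \<le>
    real (Suc M) * e + (real (card P) * T) ^ Suc M / fact (Suc M) * (1 + exp (real (card P) * T))"
proof -
  let ?c = "real (card P) * T"
  define h where "h w = card {y \<in> eta_fin w. hits (eta_fin w \<union> P) y}" for w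
  define g where "g q w = real (h w choose q)" for q w
  define Eq where "Eq q = enn2real (Epsi q {})" for q
  obtain z0 where z0: "z0 \<in> space Mk" using space_Mk_nonempty by blast
  have h [measurable]: "h \<in> W \<rightarrow>\<^sub>M count_space UNIV"
    unfolding h_def[abs_def] using finite_P P_space finite_eta_fin
    by (intro measurable_card_conf mconf_eta_fin measurable_hit mconf_Un_finite) auto
  have g [measurable]: "g q \<in> borel_measurable W" for q
    unfolding g_def[abs_def] by (rule measurable_compose[OF h]) simp
  have gE: "(\<integral>\<^sup>+w. ennreal (g q w) \<partial>W) = Epsi q {}" for q
    unfolding Epsi_def
    by (rule nn_integral_cong_good) (simp add: g_def h_def psi_def eta_fin_eq ennreal_of_nat_eq_real_of_nat)
  have Ebound: "of_nat (fact q) * Epsi q {} \<le> ennreal (?c ^ q)" for q by (rule Epsi_bound) auto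
  have Efin: "Epsi q {} < \<infinity>" for q
  proof -
    have lt: "of_nat (fact q) * Epsi q {} < \<top>" by (rule le_less_trans[OF Ebound ennreal_less_top])
    have f: "(of_nat (fact q) :: ennreal) \<noteq> 0" unfolding of_nat_eq_0_iff by (rule fact_nonzero)
    have "Epsi q {} \<noteq> \<top>"
    proof
      assume "Epsi q {} = \<top>"
      moreover have "of_nat (fact q) * \<top> = (\<top> :: ennreal)" using f unfolding ennreal_mult_eq_top_iff by blast
      ultimately show False using lt by simp
    qed
    thus ?thesis by (simp add: less_top)
  qed
  have Eq: "Epsi q {} = ennreal (Eq q)" "0 \<le> Eq q" for q using Efin[of q] by (auto simp: Eq_def less_top)
  have gi: "integrable W (g q)" for q
    using gE[of q] Efin[of q] by (intro integrableI_nonneg) (auto simp: g_def)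
  have gI: "integral\<^sup>L W (g q) = Eq q" for q
    using gE[of q] Eq[of q] by (subst integral_eq_nn_integral) (auto simp: g_def)
  have fE: "of_nat (fact q) * Epsi q {} = ennreal (fact q * Eq q)" for q
    using Eq[of q] by (simp add: ennreal_mult' ennreal_of_nat_eq_real_of_nat[of "fact q", simplified])
  have Eq_le: "Eq q \<le> ?c ^ q / fact q" for q
  proof -
    have "ennreal (fact q * Eq q) \<le> ennreal (?c ^ q)" using Ebound[of q] unfolding fE .
    hence "fact q * Eq q \<le> ?c ^ q" using T by (subst (asm) ennreal_le_iff) auto
    thus ?thesis by (simp add: field_simps)
  qed
  have Eq_ap: "\<bar>Eq q - Lr ^ q / fact q\<bar> \<le> e" if q: "q \<le> M" for q
  proof -
    have L: "0 \<le> Lr ^ q" using Lr_bounds by simp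
    have "ennreal (fact q * Eq q) \<le> ennreal (Lr ^ q + e)"
      using ap[OF q] unfolding approx_def fE by (simp del: ennreal_plus)
    hence 1: "fact q * Eq q \<le> Lr ^ q + e" using L e by (subst (asm) ennreal_le_iff) auto
    have "ennreal (Lr ^ q) \<le> ennreal (fact q * Eq q + e)"
      using ap[OF q] Eq(2)[of q] e unfolding approx_def fE by (subst ennreal_plus) simp_all
    hence 2: "Lr ^ q \<le> fact q * Eq q + e" using Eq(2)[of q] e by (subst (asm) ennreal_le_iff) auto
    have "\<bar>fact q * (Eq q - Lr ^ q / fact q)\<bar> \<le> e" using 1 2 by (simp add: abs_le_iff algebra_simps)
    hence "fact q * \<bar>Eq q - Lr ^ q / fact q\<bar> \<le> e" by (simp add: abs_mult)
    \<comment> \<open>Since \<open>fact q\<close> is at least 1, the error of the scaled moment also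
      bounds that of the moment itself.\<close>
    moreover have "1 * \<bar>Eq q - Lr ^ q / fact q\<bar> \<le> fact q * \<bar>Eq q - Lr ^ q / fact q\<bar>"
      by (intro mult_right_mono) auto
    ultimately show ?thesis by simp
  qed
  let ?A = "{w \<in> space W. \<forall>x\<in>P. avail d (Suc n) (eta w \<union> P) x (\<tau> x)}"
  let ?S = "\<lambda>w. \<Sum>q\<le>M. (- 1) ^ q * g q w"
  have hA: "AE w in W. indicator ?A w = (if h w = 0 then 1 else 0 :: real)"
    using AE_good AE_space
  proof eventually_elim
    case (elim w)
    have "(\<forall>x\<in>P. avail d (Suc n) (eta w \<union> P) x (\<tau> x)) \<longleftrightarrow> (\<forall>y\<in>eta w. \<not> hits (eta w \<union> P) y)"
      by (rule avail_iff_no_hit)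
    also have "\<dots> \<longleftrightarrow> h w = 0"
      using elim finite_eta_fin[of w] unfolding h_def by (auto simp: eta_fin_eq)
    finally show ?case using elim by (auto simp: indicator_def)
  qed
  have iA: "integrable W (\<lambda>w. if h w = 0 then 1 else 0 :: real)"
    by (intro W.integrable_const_bound[where B=1]) auto
  have "measure W ?A = integral\<^sup>L W (indicator ?A)"
    by (subst Bochner_Integration.integral_indicator) (rule arg_cong[where f="measure W"], auto)
  also have "\<dots> = (\<integral>w. (if h w = 0 then 1 else 0) \<partial>W)"
  proof (rule integral_cong_AE)
    show "indicat_real ?A \<in> borel_measurable W"
      by (intro borel_measurable_indicator sets_avail_event finite_P P_space)
    show "(\<lambda>w. if h w = 0 then 1 else 0 :: real) \<in> borel_measurable W" by measurable
    show "AE w in W. indicator ?A w = (if h w = 0 then 1 else 0 :: real)" by (rule hA)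
  qed
  finally have mA: "measure W ?A = (\<integral>w. (if h w = 0 then 1 else 0) \<partial>W)" .
  have Si: "integrable W ?S" using gi by auto
  have SI: "integral\<^sup>L W ?S = (\<Sum>q\<le>M. (- 1) ^ q * Eq q)"
    using gi by (subst Bochner_Integration.integral_sum) (auto simp: gI)
  have "\<bar>measure W ?A - (\<Sum>q\<le>M. (- 1) ^ q * Eq q)\<bar> = \<bar>\<integral>w. (if h w = 0 then 1 else 0) - ?S w \<partial>W\<bar>"
    using iA Si by (simp only: mA SI[symmetric] Bochner_Integration.integral_diff)
  also have "\<dots> \<le> (\<integral>w. \<bar>(if h w = 0 then 1 else 0) - ?S w\<bar> \<partial>W)" by (rule integral_abs_bound)
  also have "\<dots> \<le> (\<integral>w. g (Suc M) w \<partial>W)"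
  proof (rule integral_mono)
    show "integrable W (\<lambda>w. \<bar>(if h w = 0 then 1 else 0) - ?S w\<bar>)"
      by (intro integrable_abs Bochner_Integration.integrable_diff iA Si)
    show "\<bar>(if h w = 0 then 1 else 0) - ?S w\<bar> \<le> g (Suc M) w" for w
      unfolding g_def by (rule alternating_choose_bound)
  qed (rule gi)
  also have "\<dots> \<le> ?c ^ Suc M / fact (Suc M)" unfolding gI by (rule Eq_le)
  finally have 1: "\<bar>measure W ?A - (\<Sum>q\<le>M. (- 1) ^ q * Eq q)\<bar> \<le> ?c ^ Suc M / fact (Suc M)" .
  have "\<bar>(\<Sum>q\<le>M. (- 1) ^ q * Eq q) - (\<Sum>q\<le>M. (- Lr) ^ q / fact q)\<bar> = \<bar>\<Sum>q\<le>M. (- 1) ^ q * (Eq q - Lr ^ q / fact q)\<bar>"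
    by (simp add: sum_subtractf[symmetric] algebra_simps power_minus[of Lr])
  also have "\<dots> \<le> (\<Sum>q\<le>M. \<bar>(- 1) ^ q * (Eq q - Lr ^ q / fact q)\<bar>)" by (rule sum_abs)
  also have "\<dots> \<le> (\<Sum>q\<le>M. e)" using Eq_ap by (intro sum_mono) (simp add: abs_mult)
  finally have 2: "\<bar>(\<Sum>q\<le>M. (- 1) ^ q * Eq q) - (\<Sum>q\<le>M. (- Lr) ^ q / fact q)\<bar> \<le> real (Suc M) * e" by simp
  obtain t where t: "\<bar>t\<bar> \<le> \<bar>- Lr\<bar>" "exp (- Lr) = (\<Sum>m<Suc M. (- Lr) ^ m / fact m) + exp t / fact (Suc M) * (- Lr) ^ Suc M"
    using Maclaurin_exp_le[of "- Lr" "Suc M"] by blast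
  have "\<bar>(\<Sum>q\<le>M. (- Lr) ^ q / fact q) - exp (- Lr)\<bar> = exp t / fact (Suc M) * Lr ^ Suc M"
    unfolding t(2) lessThan_Suc_atMost using Lr_bounds by (simp add: abs_mult power_abs del: fact_Suc power_Suc)
  also have "\<dots> \<le> exp ?c / fact (Suc M) * ?c ^ Suc M"
    using t(1) Lr_bounds by (intro mult_mono divide_right_mono power_mono) auto
  finally have 3: "\<bar>(\<Sum>q\<le>M. (- Lr) ^ q / fact q) - exp (- Lr)\<bar> \<le> ?c ^ Suc M / fact (Suc M) * exp ?c"
    by (simp add: mult_ac)
  have "\<bar>measure W ?A - exp (- Lr)\<bar> \<le> real (Suc M) * e + ?c ^ Suc M / fact (Suc M) + ?c ^ Suc M / fact (Suc M) * exp ?c"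
    using 1 2 3 by linarith
  thus ?thesis unfolding exp_Lr by (simp add: distrib_left del: fact_Suc power_Suc tree_av.simps of_nat_Suc)
qed

end

section \<open>Decorrelation by induction on the depth\<close>

text \<open>
  For separated probes the availability events become independent, with the probabilities of the tree, uniformly over the
  window, the positions and the law of the enumeration.
\<close>

definition decorr :: "nat \<Rightarrow> (nat \<Rightarrow> real) \<Rightarrow> real \<Rightarrow> nat \<Rightarrow> bool" where
  "decorr k p T n \<longleftrightarrow> (\<forall>l. \<forall>e>0. \<forall>\<^sub>F d in sequentially. \<forall>Q B P \<tau>.
     poisson_window k p d Q B \<longrightarrow> good d k T (core d T B n) P \<tau> \<longrightarrow> card P = l \<longrightarrow>
     \<bar>measure (coloured_law k p Q) {w \<in> space (coloured_law k p Q). \<forall>x\<in>P. avail d n (poisson_window.eta B w \<union> P) x (\<tau> x)}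
       - (\<Prod>x\<in>P. tree_av k p n (snd x) (\<tau> x))\<bar> \<le> e)"

lemma decorr_0: assumes "colour_probs k p" shows "decorr k p T 0"
  unfolding decorr_def
proof (intro allI impI always_eventually)
  fix l :: nat and e :: real and d Q B P \<tau>
  assume "e > 0" and w: "poisson_window k p d Q B"
  interpret poisson_window k p d Q B by (rule w)
  show "\<bar>measure W {w \<in> space W. \<forall>x\<in>P. avail d 0 (eta w \<union> P) x (\<tau> x)} - (\<Prod>x\<in>P. tree_av k p 0 (snd x) (\<tau> x))\<bar> \<le> e"
    using \<open>e > 0\<close> by (simp add: W.prob_space)
qed

text \<open>By induction on the number \<open>q\<close> of hits still to be removed, for all sizes
  \<open>m\<close> of \<open>Y\<close>, since each step enlarges \<open>Y\<close>. With none left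
  the claim is decorrelation at depth \<open>n\<close> for the \<open>l + m\<close> points of
  \<open>P \<union> Y\<close>. The error depends only on sizes, so one dimension threshold serves
  all laws, windows and positions.\<close>

lemma approx_eventually:
  assumes dec: "decorr k p T n" and T: "T > 0"
  shows "e > 0 \<Longrightarrow> \<forall>\<^sub>F d in sequentially. \<forall>Q B P \<tau> Y. probe k p d Q B T n P \<tau> \<longrightarrow> card P = l \<longrightarrow>
    probe.ext k d T P \<tau> Y \<longrightarrow> card Y = m \<longrightarrow> probe.approx k p d Q B n P \<tau> q Y e"
proof (induction q arbitrary: m e)
  case 0
  have "\<forall>\<^sub>F d in sequentially. \<forall>Q B P \<tau>. poisson_window k p d Q B \<longrightarrow> good d k T (core d T B n) P \<tau> \<longrightarrow> card P = l + m \<longrightarrow>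
     \<bar>measure (coloured_law k p Q) {w \<in> space (coloured_law k p Q). \<forall>x\<in>P. avail d n (poisson_window.eta B w \<union> P) x (\<tau> x)}
       - (\<Prod>x\<in>P. tree_av k p n (snd x) (\<tau> x))\<bar> \<le> e"
    using dec 0 unfolding decorr_def by blast
  thus ?case
  proof (rule eventually_mono, intro allI impI)
    fix d Q B P \<tau> Y
    assume dd: "\<forall>Q B P \<tau>. poisson_window k p d Q B \<longrightarrow> good d k T (core d T B n) P \<tau> \<longrightarrow> card P = l + m \<longrightarrow>
     \<bar>measure (coloured_law k p Q) {w \<in> space (coloured_law k p Q). \<forall>x\<in>P. avail d n (poisson_window.eta B w \<union> P) x (\<tau> x)}
       - (\<Prod>x\<in>P. tree_av k p n (snd x) (\<tau> x))\<bar> \<le> e"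
      and pr: "probe k p d Q B T n P \<tau>" and l: "card P = l" and Y: "probe.ext k d T P \<tau> Y" and m: "card Y = m"
    interpret probe k p d Q B T n P \<tau> by (rule pr)
    have card: "card (P \<union> Y) = l + m"
      using l m finite_P extD(1)[OF Y] ext_disjoint[OF Y] by (subst card_Un_disjoint) auto
    let ?A = "{w \<in> space W. \<forall>x\<in>P \<union> Y. avail d n (eta w \<union> (P \<union> Y)) x (ext_time Y x)}"
    have "\<bar>measure W ?A - (\<Prod>x\<in>P \<union> Y. tree_av k p n (snd x) (ext_time Y x))\<bar> \<le> e"
      using dd[rule_format, OF poisson_window_axioms good_ext[OF Y] card] .
    hence "\<bar>measure W ?A - (\<Prod>y\<in>Y. hhat y)\<bar> \<le> e" unfolding Epsi_0(2)[OF Y] .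
    moreover have "Epsi 0 Y = ennreal (measure W ?A)" unfolding Epsi_0(1)[OF Y] by (rule W.emeasure_eq_measure)
    ultimately show "approx 0 Y e"
      using 0 prod_hhat_bounds(1)[of Y] unfolding approx_def
      by (auto simp: ennreal_plus[symmetric] simp del: ennreal_plus intro!: ennreal_leI)
  qed
next
  case (Suc q)
  define c where "c = real l * T"
  define b where "b = c ^ q * (real l + 1)"
  have c: "0 \<le> c" using T by (simp add: c_def)
  have b: "0 \<le> b" using c by (simp add: b_def)
  define bad where "bad d = real (l + m) * ((1/2)^d * T) + real (l * (l + m)) * (sqrt (15/16) ^ d * T)" for d :: nat
  have "bad \<longlonglongrightarrow> real (l + m) * (0 * T) + real (l * (l + m)) * (0 * T)"
    unfolding bad_def[abs_def]
    by (intro tendsto_intros LIMSEQ_power_zero) (auto simp: real_sqrt_lt_1_iff)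
  hence "(\<lambda>d. b * bad d) \<longlonglongrightarrow> b * 0" by (intro tendsto_intros) simp
  hence ev1: "\<forall>\<^sub>F d in sequentially. b * bad d < e / 2" using Suc.prems by (intro order_tendstoD) auto
  \<comment> \<open>The \<open>+ 1\<close> covers \<open>c = 0\<close>, which occurs for
    \<open>l = 0\<close>.\<close>
  define e' where "e' = e / (2 * (c + 1))"
  have e': "e' > 0" "e' * c \<le> e / 2"
    using Suc.prems c unfolding e'_def by (auto simp: field_simps)
  note ev2 = Suc.IH[OF e'(1), of "Suc m"]
  from ev1 ev2 show ?case
  proof eventually_elim
    case (elim d)
    show ?case
    proof (intro allI impI)
      fix Q B P \<tau> Y
      assume pr: "probe k p d Q B T n P \<tau>" and l: "card P = l" and Y: "probe.ext k d T P \<tau> Y" and m: "card Y = m"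
      interpret probe k p d Q B T n P \<tau> by (rule pr)
      have "approx (Suc q) Y (e' * (real (card P) * T) + ((real (card P) * T) ^ q * (real (card P) + 1)) * bad_bound (card Y))"
      proof (rule approx_Suc[OF Y])
        fix y assume y: "ext (insert y Y)" "y \<notin> Y"
        have "card (insert y Y) = Suc m" using m y extD(1)[OF Y] by simp
        thus "approx q (insert y Y) e'" using elim(2)[rule_format, OF pr l y(1)] by simp
      qed (use e' in simp)
      moreover have "bad_bound (card Y) = bad d" by (simp add: bad_bound_def bad_def l m)
      ultimately have "approx (Suc q) Y (e' * c + b * bad d)" by (simp only: l c_def b_def)
      moreover have "e' * c + b * bad d \<le> e" using e'(2) elim(1) by simp
      ultimately show "approx (Suc q) Y e" by (rule approx_mono)
    qed
  qed
qed

text \<open>First \<open>M\<close> is chosen to make the remainders small, then the error of each of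
  the \<open>Suc M\<close> moments, and last the dimension.\<close>

lemma decorr_Suc:
  assumes dec: "decorr k p T n" and T: "T > 0"
  shows "decorr k p T (Suc n)"
  unfolding decorr_def
proof (intro allI impI)
  fix l :: nat and e :: real assume e: "e > 0"
  define c where "c = real l * T"
  have "(\<lambda>M. c ^ M / fact M) \<longlonglongrightarrow> 0"
    using summable_LIMSEQ_zero[OF summable_exp[of c]] by (simp add: divide_inverse mult.commute)
  hence "(\<lambda>M. c ^ Suc M / fact (Suc M)) \<longlonglongrightarrow> 0" by (rule LIMSEQ_Suc)
  hence "(\<lambda>M. c ^ Suc M / fact (Suc M) * (1 + exp c)) \<longlonglongrightarrow> 0 * (1 + exp c)" by (intro tendsto_intros)
  hence "\<forall>\<^sub>F M in sequentially. c ^ Suc M / fact (Suc M) * (1 + exp c) < e / 2"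
    using e by (intro order_tendstoD) auto
  then obtain M where M: "c ^ Suc M / fact (Suc M) * (1 + exp c) < e / 2"
    using eventually_happens'[OF sequentially_bot] by blast
  define e' where "e' = e / (2 * real (Suc M))"
  have e': "e' > 0" "real (Suc M) * e' = e / 2" using e by (auto simp: e'_def simp del: of_nat_Suc)
  have "\<forall>\<^sub>F d in sequentially. \<forall>q\<in>{..M}. \<forall>Q B P \<tau> Y. probe k p d Q B T n P \<tau> \<longrightarrow> card P = l \<longrightarrow>
    probe.ext k d T P \<tau> Y \<longrightarrow> card Y = 0 \<longrightarrow> probe.approx k p d Q B n P \<tau> q Y e'"
    by (intro eventually_ball_finite ballI approx_eventually[OF dec T e'(1)]) simp
  thus "\<forall>\<^sub>F d in sequentially. \<forall>Q B P \<tau>. poisson_window k p d Q B \<longrightarrow> good d k T (core d T B (Suc n)) P \<tau> \<longrightarrow> card P = l \<longrightarrow>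
     \<bar>measure (coloured_law k p Q) {w \<in> space (coloured_law k p Q). \<forall>x\<in>P. avail d (Suc n) (poisson_window.eta B w \<union> P) x (\<tau> x)}
       - (\<Prod>x\<in>P. tree_av k p (Suc n) (snd x) (\<tau> x))\<bar> \<le> e"
  proof (rule eventually_mono, intro allI impI)
    fix d Q B P \<tau>
    assume ap: "\<forall>q\<in>{..M}. \<forall>Q B P \<tau> Y. probe k p d Q B T n P \<tau> \<longrightarrow> card P = l \<longrightarrow>
        probe.ext k d T P \<tau> Y \<longrightarrow> card Y = 0 \<longrightarrow> probe.approx k p d Q B n P \<tau> q Y e'"
      and w: "poisson_window k p d Q B" and g: "good d k T (core d T B (Suc n)) P \<tau>" and l: "card P = l"
    have pr: "probe k p d Q B T n P \<tau>"
      by (intro probe.intro w probe_axioms.intro T g)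
    interpret probe k p d Q B T n P \<tau> by (rule pr)
    have "ext {}" by (simp add: ext_def)
    hence "approx q {} e'" if "q \<le> M" for q using bspec[OF ap, of q] that pr l by simp
    hence "\<bar>measure W {w \<in> space W. \<forall>x\<in>P. avail d (Suc n) (eta w \<union> P) x (\<tau> x)} - (\<Prod>x\<in>P. tav (Suc n) (snd x) (\<tau> x))\<bar> \<le>
      real (Suc M) * e' + (real (card P) * T) ^ Suc M / fact (Suc M) * (1 + exp (real (card P) * T))"
      by (rule avail_prob_approx[OF _ less_imp_le[OF e'(1)]])
    also have "\<dots> \<le> e" using M e'(2) unfolding l c_def[symmetric] by linarith
    finally show "\<bar>measure W {w \<in> space W. \<forall>x\<in>P. avail d (Suc n) (eta w \<union> P) x (\<tau> x)} - (\<Prod>x\<in>P. tree_av k p (Suc n) (snd x) (\<tau> x))\<bar> \<le> e" .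
  qed
qed

theorem decorr: assumes "colour_probs k p" "T > 0" shows "decorr k p T n"
  by (induction n) (auto intro: decorr_0 decorr_Suc assms)

subsection \<open>Almost sure properties of the configuration\<close>

definition euclid_ball :: "nat \<Rightarrow> real \<Rightarrow> (nat \<Rightarrow> real) set" where
  "euclid_ball d R = {y \<in> space (euclid d). euclid_dist d (\<lambda>i\<in>{..<d}. 0) y \<le> R}"

lemma sets_euclid_ball [measurable]: "euclid_ball d R \<in> sets (euclid d)"
proof -
  have "(\<lambda>y. euclid_dist d (\<lambda>i\<in>{..<d}. 0) y) \<in> borel_measurable (euclid d)"
    by (intro measurable_euclid_dist) (auto simp: space_euclid)
  thus ?thesis unfolding euclid_ball_def by measurable
qed

lemma emeasure_euclid_ball_finite:
  assumes d: "d \<ge> 1" shows "emeasure (euclid d) (euclid_ball d R) < \<infinity>"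
proof -
  let ?o = "\<lambda>i\<in>{..<d}. 0 :: real" let ?s = "unit_ball_vol (real d) * \<bar>R\<bar> ^ d"
  have "euclid_ball d R \<subseteq> {y \<in> space (euclid d). vdist d ?o y \<le> ?s}"
    unfolding euclid_ball_def vdist_def using unit_ball_vol_nat_pos[of d]
    by (auto intro!: mult_left_mono power_mono)
  moreover have "{y \<in> space (euclid d). vdist d ?o y \<le> ?s} \<in> sets (euclid d)" by measurable
  ultimately have "emeasure (euclid d) (euclid_ball d R) \<le> emeasure (euclid d) {y \<in> space (euclid d). vdist d ?o y \<le> ?s}"
    by (rule emeasure_mono)
  thus ?thesis unfolding emeasure_vball[OF d] by (rule le_less_trans) simp
qed

text \<open>A step of volume distance below \<open>T\<close> is shorter than
  \<open>vrad d T\<close>, so \<open>m\<close> such steps fit into the margin.\<close>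

lemma euclid_ball_core:
  assumes d: "d \<ge> 1" and T: "T \<ge> 0" and "x \<in> euclid_ball d (R - real m * vrad d T)"
  shows "x \<in> core d T (euclid_ball d R) m"
  using assms(3)
proof (induction m arbitrary: x)
  case (Suc m)
  let ?o = "\<lambda>i\<in>{..<d}. 0 :: real"
  have r: "vrad d T \<ge> 0" using T by (rule vrad_nonneg)
  have "x \<in> euclid_ball d (R - real m * vrad d T)" using Suc.prems r by (auto simp: euclid_ball_def algebra_simps)
  moreover have "y \<in> euclid_ball d (R - real m * vrad d T)" if "y \<in> space (euclid d)" "vdist d x y < T" for y
  proof -
    have "euclid_dist d x y < vrad d T" using that(2) by (simp only: vdist_less_vrad[OF d T])
    thus ?thesis using euclid_dist_triangle[of d ?o y x] Suc.prems that(1)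
      by (simp add: euclid_ball_def algebra_simps)
  qed
  ultimately show ?case using Suc.IH by simp
qed simp

context poisson_model
begin

lemma window: "B \<in> sets E \<Longrightarrow> emeasure E B < \<infinity> \<Longrightarrow> poisson_window k p d Q B"
  by unfold_locales

lemma window_euclid_ball: "poisson_window k p d Q (euclid_ball d R)"
  by (rule window[OF sets_euclid_ball emeasure_euclid_ball_finite[OF d]])

lemma AE_locally_finite: "AE w in W. \<forall>R::nat. finite {m. fst w m \<in> euclid_ball d (real R)}"
  unfolding AE_all_countable
proof
  fix R :: nat
  interpret poisson_window k p d Q "euclid_ball d (real R)" by (rule window_euclid_ball)
  show "AE w in W. finite {m. fst w m \<in> euclid_ball d (real R)}" using AE_good by eventually_elim simp
qed

lemma measurable_npath:
  assumes "mconf M \<eta>" "x \<in> M \<rightarrow>\<^sub>M Mk" "t \<in> borel_measurable M"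
  shows "(\<lambda>w. npath d m (\<eta> w) (x w) (t w)) \<in> borel_measurable M"
  using assms
proof (induction m arbitrary: \<eta> x t)
  case (Suc m)
  show ?case unfolding npath.simps
  proof (rule measurable_sum_conf[OF Suc.prems(1)])
    fix y assume y: "y \<in> M \<rightarrow>\<^sub>M Mk"
    have v: "(\<lambda>w. vdist d (fst (x w)) (fst (y w))) \<in> borel_measurable M"
      by (rule measurable_vdist[OF measurable_compose[OF Suc.prems(2) measurable_fst_Mk] measurable_compose[OF y measurable_fst_Mk]])
    define g where "g = (\<lambda>w. vdist d (fst (x w)) (fst (y w)))"
    have g [measurable]: "g \<in> borel_measurable M" unfolding g_def by (rule v)
    note [measurable] = Suc.prems(3)
    have "(\<lambda>w. indicator {..<t w} (g w) :: ennreal) = (\<lambda>w. if g w < t w then 1 else 0)"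
      by (auto simp: fun_eq_iff indicator_def)
    hence [measurable]: "(\<lambda>w. indicator {..<t w} (g w) :: ennreal) \<in> borel_measurable M" by simp
    have [measurable]: "(\<lambda>w. npath d m (\<eta> w - {y w}) (y w) (g w)) \<in> borel_measurable M"
      by (rule Suc.IH[OF mconf_remove[OF Suc.prems(1) y] y g])
    have "(\<lambda>w. indicator {..<t w} (g w) * npath d m (\<eta> w - {y w}) (y w) (g w)) \<in> borel_measurable M" by measurable
    thus "(\<lambda>w. indicator {..<t w} (vdist d (fst (x w)) (fst (y w))) * npath d m (\<eta> w - {y w}) (y w) (vdist d (fst (x w)) (fst (y w)))) \<in> borel_measurable M"
      unfolding g_def .
  qed
qed simp

end

section \<open>Expected numbers of isosceles triples and of decreasing paths\<close>

context poisson_window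
begin

lemma nn_integral_nuB_fst_le:
  assumes [measurable]: "f \<in> borel_measurable E"
  shows "(\<integral>\<^sup>+y. f (fst y) \<partial>nuB B) \<le> (\<integral>\<^sup>+a. f a \<partial>E)"
proof -
  have "(\<integral>\<^sup>+y. f (fst y) \<partial>nuB B) = (\<integral>\<^sup>+y. indicator B (fst y) * f (fst y) \<partial>nu)"
    by (rule nn_integral_nuB[OF B]) simp
  also have "\<dots> \<le> (\<integral>\<^sup>+y. f (fst y) \<partial>nu)" by (intro nn_integral_mono) (auto split: split_indicator)
  also have "\<dots> = (\<integral>\<^sup>+a. \<integral>\<^sup>+c. f (fst (a, c)) \<partial>pm \<partial>E)"
    unfolding nu_def by (rule pm.nn_integral_fst[symmetric]) simp
  also have "\<dots> = (\<integral>\<^sup>+a. f a \<partial>E)" by (simp add: pm.emeasure_space_1)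
  finally show ?thesis .
qed

lemma intensity_eta:
  assumes [measurable]: "f \<in> borel_measurable Mk"
  shows "(\<integral>\<^sup>+w. (\<integral>\<^sup>+z\<in>eta w. f z \<partial>count_space UNIV) \<partial>W) = (\<integral>\<^sup>+z. f z \<partial>nuB B)"
proof -
  have "(\<integral>\<^sup>+w. (\<integral>\<^sup>+z\<in>eta w. f z \<partial>count_space UNIV) \<partial>W) = (\<integral>\<^sup>+z. (\<integral>\<^sup>+w. f z \<partial>W) \<partial>nuB B)"
    by (rule mecke[where F = "\<lambda>z _. f z"]) measurable
  thus ?thesis by (simp add: W.emeasure_space_1)
qed

text \<open>The Mecke formula splits off the first step, whose length \<open>s\<close> is spread
  like Lebesgue measure on \<open>{0..t}\<close>; integrating \<open>s ^ m / fact m\<close> gives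
  the next term. The decreasing lengths produce the factorial that makes long paths rare.\<close>

lemma npath_bound:
  "x \<in> space Mk \<Longrightarrow> t \<ge> 0 \<Longrightarrow> (\<integral>\<^sup>+w. npath d m (eta w) x t \<partial>W) \<le> ennreal (t ^ m / fact m)"
proof (induction m arbitrary: x t)
  case 0 thus ?case by (simp add: W.emeasure_space_1)
next
  case (Suc m)
  let ?v = "\<lambda>y. vdist d (fst x) (fst y)"
  let ?F = "\<lambda>y S. indicator {..<t} (?v y) * npath d m S y (?v y)"
  have v: "?v \<in> borel_measurable Mk"
    using Suc.prems by (intro measurable_vdist measurable_const) (auto simp: space_Mk)
  have F: "(\<lambda>(y, \<zeta>). ?F y (\<zeta> ` {..<j})) \<in> borel_measurable (Mk \<Otimes>\<^sub>M Pn j)" for j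
  proof -
    have v': "(\<lambda>w. ?v (fst w)) \<in> borel_measurable (Mk \<Otimes>\<^sub>M Pn j)" by (rule measurable_compose[OF measurable_fst v])
    have "(\<lambda>w. npath d m (snd w ` {..<j}) (fst w) (?v (fst w))) \<in> borel_measurable (Mk \<Otimes>\<^sub>M Pn j)"
      by (intro measurable_npath mconf_pair measurable_fst v')
    moreover have "(\<lambda>w. indicator {..<t} (?v (fst w)) :: ennreal) \<in> borel_measurable (Mk \<Otimes>\<^sub>M Pn j)"
      by (rule measurable_compose[OF v']) simp
    ultimately have "(\<lambda>w. ?F (fst w) (snd w ` {..<j})) \<in> borel_measurable (Mk \<Otimes>\<^sub>M Pn j)"
      by (intro borel_measurable_times_ennreal)
    thus ?thesis by (simp add: case_prod_beta')
  qed
  have "(\<integral>\<^sup>+w. npath d (Suc m) (eta w) x t \<partial>W) = (\<integral>\<^sup>+y. (\<integral>\<^sup>+w. ?F y (eta w) \<partial>W) \<partial>nuB B)"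
    unfolding npath.simps by (rule mecke[OF F])
  also have "\<dots> \<le> (\<integral>\<^sup>+y. indicator {..<t} (?v y) * ennreal (?v y ^ m / fact m) \<partial>nuB B)"
  proof (intro nn_integral_mono)
    fix y assume "y \<in> space (nuB B)"
    hence "(\<integral>\<^sup>+w. npath d m (eta w) y (?v y) \<partial>W) \<le> ennreal (?v y ^ m / fact m)"
      by (intro Suc.IH) (auto simp: space_nuB)
    thus "(\<integral>\<^sup>+w. ?F y (eta w) \<partial>W) \<le> indicator {..<t} (?v y) * ennreal (?v y ^ m / fact m)"
      by (auto split: split_indicator)
  qed
  also have "\<dots> \<le> (\<integral>\<^sup>+a. indicator {..<t} (vdist d (fst x) a) * ennreal (vdist d (fst x) a ^ m / fact m) \<partial>E)"
    by (rule nn_integral_nuB_fst_le[where f = "\<lambda>a. indicator {..<t} (vdist d (fst x) a) * ennreal (vdist d (fst x) a ^ m / fact m)"]) measurable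
  also have "\<dots> = (\<integral>\<^sup>+s. indicator {0..} s * (indicator {..<t} s * ennreal (s ^ m / fact m)) \<partial>lborel)"
    by (rule nn_integral_vdist[OF d, of "\<lambda>s. indicator {..<t} s * ennreal (s ^ m / fact m)"]) measurable
  also have "\<dots> \<le> (\<integral>\<^sup>+s. ennreal (s ^ m / fact m) * indicator {0..t} s \<partial>lborel)"
    by (intro nn_integral_mono) (auto split: split_indicator)
  also have "\<dots> = ennreal (t ^ Suc m / fact (Suc m) - 0 ^ Suc m / fact (Suc m))"
  proof (rule nn_integral_FTC_Icc[where F = "\<lambda>s. s ^ Suc m / fact (Suc m)"])
    fix s :: real assume "s \<in> {0..t}"
    show "DERIV (\<lambda>s. s ^ Suc m / fact (Suc m)) s :> s ^ m / fact m"
      using DERIV_cdivide[OF DERIV_pow[of "Suc m" s UNIV], of "fact (Suc m)"]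
      by (simp del: power_Suc of_nat_Suc add: fact_Suc)
  qed (use Suc.prems in auto)
  finally show ?case by simp
qed

text \<open>The expected number of isosceles triples is 0: with two of the points split off by the
  Mecke formula, the third would lie on a sphere, which is null. A single such triple would make the
  sum at least 1.\<close>

lemma AE_no_isosceles_window:
  "AE w in W. \<forall>x\<in>eta w. \<forall>y\<in>eta w. \<forall>y'\<in>eta w. x \<noteq> y \<longrightarrow> x \<noteq> y' \<longrightarrow> y \<noteq> y' \<longrightarrow>
     vdist d (fst x) (fst y) \<noteq> vdist d (fst x) (fst y')"
proof -
  define h where "h x y y' = (if vdist d (fst x) (fst y) = vdist d (fst x) (fst y') then 1 else 0 :: ennreal)"
    for x y y' :: "(nat \<Rightarrow> real) \<times> nat"
  have mh: "(\<lambda>w. h (x w) (y w) (y' w)) \<in> borel_measurable M"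
    if "x \<in> M \<rightarrow>\<^sub>M Mk" "y \<in> M \<rightarrow>\<^sub>M Mk" "y' \<in> M \<rightarrow>\<^sub>M Mk" for M :: "'w measure" and x y y'
  proof -
    define a where "a w = vdist d (fst (x w)) (fst (y w))" for w
    define b where "b w = vdist d (fst (x w)) (fst (y' w))" for w
    have [measurable]: "a \<in> borel_measurable M" "b \<in> borel_measurable M"
      unfolding a_def[abs_def] b_def[abs_def]
      by (intro measurable_vdist measurable_compose[OF _ measurable_fst_Mk] that)+
    have "(\<lambda>w. if a w = b w then 1 else 0 :: ennreal) \<in> borel_measurable M" by measurable
    thus ?thesis unfolding h_def a_def b_def .
  qed
  define G2 where "G2 x y S = (\<integral>\<^sup>+y'\<in>S. h x y y' \<partial>count_space UNIV)" for x y S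
  define G1 where "G1 x S = (\<integral>\<^sup>+y\<in>S. G2 x y (S - {y}) \<partial>count_space UNIV)" for x S
  have m2: "(\<lambda>w. G2 (x w) (y w) (\<eta> w)) \<in> borel_measurable M"
    if "x \<in> M \<rightarrow>\<^sub>M Mk" "y \<in> M \<rightarrow>\<^sub>M Mk" "mconf M \<eta>" for M :: "'w measure" and x y \<eta>
    unfolding G2_def by (intro measurable_sum_conf mh that)
  have m1: "(\<lambda>w. G1 (x w) (\<eta> w)) \<in> borel_measurable M"
    if "x \<in> M \<rightarrow>\<^sub>M Mk" "mconf M \<eta>" for M :: "'w measure" and x \<eta>
    unfolding G1_def by (intro measurable_sum_conf m2 that mconf_remove)
  have e0: "(\<integral>\<^sup>+w. G2 x y (eta w) \<partial>W) = 0" if x: "x \<in> space Mk" and y: "y \<in> space Mk" for x y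
  proof -
    let ?A = "{a \<in> space E. vdist d (fst x) a = vdist d (fst x) (fst y)}"
    have A: "?A \<in> sets E" by measurable
    have "(\<integral>\<^sup>+w. G2 x y (eta w) \<partial>W) = (\<integral>\<^sup>+y'. h x y y' \<partial>nuB B)"
      unfolding G2_def using x y by (intro intensity_eta mh) auto
    also have "\<dots> = (\<integral>\<^sup>+y'. indicator {z \<in> space Mk. fst z \<in> ?A} y' \<partial>nuB B)"
      by (intro nn_integral_cong) (auto simp: h_def space_nuB space_Mk split: split_indicator)
    also have "\<dots> = emeasure (nuB B) {z \<in> space Mk. fst z \<in> ?A}"
      using A by (intro nn_integral_indicator) (simp add: sets_nuB)
    also have "\<dots> = emeasure E (?A \<inter> B)" by (rule emeasure_nuB_fst[OF B A])
    also have "\<dots> \<le> emeasure E ?A" by (intro emeasure_mono A) auto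
    also have "\<dots> = 0" by (rule emeasure_vsphere[OF d])
    finally show ?thesis by simp
  qed
  have e1: "(\<integral>\<^sup>+w. G1 x (eta w) \<partial>W) = 0" if x: "x \<in> space Mk" for x
  proof -
    have F: "(\<lambda>(y, \<zeta>). G2 x y (\<zeta> ` {..<j})) \<in> borel_measurable (Mk \<Otimes>\<^sub>M Pn j)" for j
      unfolding case_prod_beta' by (rule m2[of "\<lambda>_. x", OF _ measurable_fst mconf_pair]) (simp add: x)
    have "(\<integral>\<^sup>+w. G1 x (eta w) \<partial>W) = (\<integral>\<^sup>+y. (\<integral>\<^sup>+w. G2 x y (eta w) \<partial>W) \<partial>nuB B)"
      unfolding G1_def by (rule mecke[OF F])
    also have "\<dots> = (\<integral>\<^sup>+y. 0 \<partial>nuB B)" using e0[OF x] by (intro nn_integral_cong) (simp add: space_nuB)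
    finally show ?thesis by simp
  qed
  have F: "(\<lambda>(x, \<zeta>). G1 x (\<zeta> ` {..<j})) \<in> borel_measurable (Mk \<Otimes>\<^sub>M Pn j)" for j
    unfolding case_prod_beta' by (rule m1[OF measurable_fst mconf_pair])
  let ?T = "\<lambda>w. \<integral>\<^sup>+x\<in>eta w. G1 x (eta w - {x}) \<partial>count_space UNIV"
  have "(\<integral>\<^sup>+w. ?T w \<partial>W) = (\<integral>\<^sup>+x. (\<integral>\<^sup>+w. G1 x (eta w) \<partial>W) \<partial>nuB B)" by (rule mecke[OF F])
  also have "\<dots> = (\<integral>\<^sup>+x. 0 \<partial>nuB B)" using e1 by (intro nn_integral_cong) (simp add: space_nuB)
  finally have "(\<integral>\<^sup>+w. ?T w \<partial>W) = 0" by simp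
  moreover have "?T \<in> borel_measurable W"
    by (intro measurable_sum_conf mconf_eta m1 mconf_remove)
  ultimately have "AE w in W. ?T w = 0" by (simp add: nn_integral_0_iff_AE)
  thus ?thesis
  proof eventually_elim
    case (elim w)
    show ?case
    proof (intro ballI impI notI)
      fix x y y' assume xy: "x \<in> eta w" "y \<in> eta w" "y' \<in> eta w" "x \<noteq> y" "x \<noteq> y'" "y \<noteq> y'"
        and eq: "vdist d (fst x) (fst y) = vdist d (fst x) (fst y')"
      have "1 = h x y y' * indicator (eta w - {x} - {y}) y'" using eq xy by (simp add: h_def)
      also have "\<dots> \<le> G2 x y (eta w - {x} - {y})"
        unfolding G2_def by (rule nn_integral_ge_point) simp
      also have "\<dots> = G2 x y (eta w - {x} - {y}) * indicator (eta w - {x}) y" using xy by simp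
      also have "\<dots> \<le> G1 x (eta w - {x})"
        unfolding G1_def by (rule nn_integral_ge_point) simp
      also have "\<dots> = G1 x (eta w - {x}) * indicator (eta w) x" using xy by simp
      also have "\<dots> \<le> ?T w" by (rule nn_integral_ge_point) simp
      finally show False using elim by simp
    qed
  qed
qed

lemma paths_from_bound:
  assumes C [measurable]: "C \<in> sets E" and t: "t \<ge> 0"
  shows "(\<lambda>w. \<integral>\<^sup>+x\<in>eta w. indicator C (fst x) * npath d m (eta w - {x}) x t \<partial>count_space UNIV) \<in> borel_measurable W"
    and "(\<integral>\<^sup>+w. (\<integral>\<^sup>+x\<in>eta w. indicator C (fst x) * npath d m (eta w - {x}) x t \<partial>count_space UNIV) \<partial>W) \<le>
      ennreal (t ^ m / fact m) * emeasure E C"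
proof -
  have m: "(\<lambda>w. indicator C (fst (x w)) * npath d m (\<eta> w) (x w) t) \<in> borel_measurable M"
    if [measurable]: "x \<in> M \<rightarrow>\<^sub>M Mk" and \<eta>: "mconf M \<eta>" for M :: "'w measure" and x \<eta>
  proof -
    have "(\<lambda>w. indicator C (fst (x w)) :: ennreal) \<in> borel_measurable M" by measurable
    moreover have "(\<lambda>w. npath d m (\<eta> w) (x w) t) \<in> borel_measurable M" by (intro measurable_npath \<eta> that) simp
    ultimately show ?thesis by (rule borel_measurable_times_ennreal)
  qed
  show "(\<lambda>w. \<integral>\<^sup>+x\<in>eta w. indicator C (fst x) * npath d m (eta w - {x}) x t \<partial>count_space UNIV) \<in> borel_measurable W"
    by (intro measurable_sum_conf mconf_eta m mconf_remove)
  have F: "(\<lambda>(x, \<zeta>). indicator C (fst x) * npath d m (\<zeta> ` {..<j}) x t) \<in> borel_measurable (Mk \<Otimes>\<^sub>M Pn j)" for j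
    unfolding case_prod_beta' by (rule m[OF measurable_fst mconf_pair])
  have "(\<integral>\<^sup>+w. (\<integral>\<^sup>+x\<in>eta w. indicator C (fst x) * npath d m (eta w - {x}) x t \<partial>count_space UNIV) \<partial>W) =
     (\<integral>\<^sup>+x. (\<integral>\<^sup>+w. indicator C (fst x) * npath d m (eta w) x t \<partial>W) \<partial>nuB B)" by (rule mecke[OF F])
  also have "\<dots> \<le> (\<integral>\<^sup>+x. ennreal (t ^ m / fact m) * indicator C (fst x) \<partial>nuB B)"
    using npath_bound[OF _ t] by (intro nn_integral_mono) (auto simp: space_nuB split: split_indicator)
  also have "\<dots> \<le> (\<integral>\<^sup>+a. ennreal (t ^ m / fact m) * indicator C a \<partial>E)"
    by (rule nn_integral_nuB_fst_le[where f = "\<lambda>a. ennreal (t ^ m / fact m) * indicator C a"]) measurable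
  also have "\<dots> = ennreal (t ^ m / fact m) * emeasure E C" by (rule nn_integral_cmult_indicator) simp
  finally show "(\<integral>\<^sup>+w. (\<integral>\<^sup>+x\<in>eta w. indicator C (fst x) * npath d m (eta w - {x}) x t \<partial>count_space UNIV) \<partial>W) \<le>
      ennreal (t ^ m / fact m) * emeasure E C" .
qed

end

context poisson_model
begin

abbreviation etaR where "etaR R \<equiv> poisson_window.eta (euclid_ball d R)"

lemma etaR_eq: "etaR R w = {z \<in> coloured_points w. fst z \<in> euclid_ball d R}"
proof -
  interpret poisson_window k p d Q "euclid_ball d R" by (rule window_euclid_ball)
  show ?thesis unfolding eta_def by (auto simp: mem_Times_iff)
qed

text \<open>The expected number of paths of \<open>m\<close> steps from a ball tends to 0 as
  \<open>m\<close> grows, so almost surely some count is below 1. The window grows with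
  \<open>m\<close> to contain every path of \<open>m\<close> steps.\<close>

lemma AE_few_paths: "AE w in W. \<forall>N s :: nat. \<exists>m. (\<integral>\<^sup>+x\<in>etaR (real N + real m * vrad d (real s)) w. indicator (euclid_ball d (real N)) (fst x) *
     npath d m (etaR (real N + real m * vrad d (real s)) w - {x}) x (real s) \<partial>count_space UNIV) < 1"
  unfolding AE_all_countable
proof (intro allI)
  fix N s :: nat
  let ?Y = "\<lambda>m w. \<integral>\<^sup>+x\<in>etaR (real N + real m * vrad d (real s)) w. indicator (euclid_ball d (real N)) (fst x) *
     npath d m (etaR (real N + real m * vrad d (real s)) w - {x}) x (real s) \<partial>count_space UNIV"
  let ?V = "measure E (euclid_ball d (real N))"
  have V: "emeasure E (euclid_ball d (real N)) = ennreal ?V"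
    using emeasure_euclid_ball_finite[OF d, of "real N"] by (intro emeasure_eq_ennreal_measure) auto
  have Y: "?Y m \<in> borel_measurable W" "(\<integral>\<^sup>+w. ?Y m w \<partial>W) \<le> ennreal (real s ^ m / fact m * ?V)" for m
  proof -
    interpret poisson_window k p d Q "euclid_ball d (real N + real m * vrad d (real s))" by (rule window_euclid_ball)
    show "?Y m \<in> borel_measurable W" by (rule paths_from_bound) auto
    show "(\<integral>\<^sup>+w. ?Y m w \<partial>W) \<le> ennreal (real s ^ m / fact m * ?V)"
    proof -
      have "ennreal (real s ^ m / fact m) * ennreal ?V = ennreal (real s ^ m / fact m * ?V)"
        by (rule ennreal_mult'[symmetric]) simp
      thus ?thesis using paths_from_bound(2)[of "euclid_ball d (real N)" "real s" m] unfolding V by simp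
    qed
  qed
  let ?A = "{w \<in> space W. \<forall>m. 1 \<le> ?Y m w}"
  have A: "?A \<in> sets W" using Y(1) by measurable
  have "emeasure W ?A \<le> ennreal (real s ^ m / fact m * ?V)" for m
  proof -
    have "emeasure W ?A = (\<integral>\<^sup>+w. indicator ?A w \<partial>W)" using A by simp
    also have "\<dots> \<le> (\<integral>\<^sup>+w. ?Y m w \<partial>W)" by (intro nn_integral_mono) (auto split: split_indicator)
    also have "\<dots> \<le> ennreal (real s ^ m / fact m * ?V)" by (rule Y)
    finally show ?thesis .
  qed
  moreover have "(\<lambda>m. ennreal (real s ^ m / fact m * ?V)) \<longlonglongrightarrow> ennreal (0 * ?V)"
    using summable_LIMSEQ_zero[OF summable_exp[of "real s"]]
    by (intro tendsto_ennrealI tendsto_intros) (simp add: divide_inverse mult.commute)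
  ultimately have "emeasure W ?A \<le> ennreal (0 * ?V)"
    by (intro tendsto_lowerbound[of _ _ sequentially]) auto
  hence "?A \<in> null_sets W" using A by (intro null_setsI) auto
  from AE_not_in[OF this] AE_space show "AE w in W. \<exists>m. ?Y m w < 1"
    by eventually_elim (auto simp: not_le)
qed

text \<open>A descending chain, made injective, would supply paths of every number of steps from one
  ball, against \<open>AE_few_paths\<close>. The other properties concern finitely many points or a
  bounded region, so an exhaustion by balls gives them almost surely.\<close>

theorem AE_stable_config: "AE w in W. stable_config d (coloured_points w)"
proof -
  have iso: "AE w in W. \<forall>R::nat. \<forall>x\<in>etaR (real R) w. \<forall>y\<in>etaR (real R) w. \<forall>y'\<in>etaR (real R) w. x \<noteq> y \<longrightarrow> x \<noteq> y' \<longrightarrow> y \<noteq> y' \<longrightarrow>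
     vdist d (fst x) (fst y) \<noteq> vdist d (fst x) (fst y')"
    unfolding AE_all_countable
    by (intro allI poisson_window.AE_no_isosceles_window window_euclid_ball)
  from iso AE_locally_finite AE_few_paths AE_inj_W AE_space show ?thesis
  proof eventually_elim
    case (elim w)
    let ?S = "coloured_points w" let ?o = "\<lambda>i\<in>{..<d}. 0 :: real"
    have sp: "fst x \<in> space E" if x: "x \<in> ?S" for x
    proof -
      obtain m where "x = Z m w" using x by (auto simp: coloured_points_eq)
      thus ?thesis using measurable_space[OF measurable_Z elim(5), of m] by (auto simp: space_Mk mem_Times_iff)
    qed
    have in_ball: "x \<in> etaR R w \<longleftrightarrow> euclid_dist d ?o (fst x) \<le> R" if "x \<in> ?S" for x R
      using that sp[OF that] by (subst etaR_eq) (auto simp: euclid_ball_def)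
    have fst_inj: "x = y" if "x \<in> ?S" "y \<in> ?S" "fst x = fst y" for x y
      using that elim(4) by (auto simp: coloured_points_eq Z_def inj_eq)
    have finR: "finite (etaR (real R) w)" for R :: nat
    proof -
      have "etaR (real R) w = (\<lambda>m. Z m w) ` {m. fst w m \<in> euclid_ball d (real R)}"
        unfolding etaR_eq coloured_points_eq by (auto simp: Z_def)
      thus ?thesis using elim(2) by simp
    qed
    have near_ball: "\<exists>R::nat. {y \<in> ?S. vdist d (fst x) (fst y) < t} \<subseteq> etaR (real R) w" for x t
    proof -
      obtain R :: nat where R: "euclid_dist d ?o (fst x) + vrad d \<bar>t\<bar> \<le> real R" using real_arch_simple by blast
      have "y \<in> etaR (real R) w" if y: "y \<in> ?S" "vdist d (fst x) (fst y) < t" for y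
      proof -
        have "vdist d (fst x) (fst y) < \<bar>t\<bar>" using y(2) by simp
        hence "euclid_dist d (fst x) (fst y) < vrad d \<bar>t\<bar>" by (subst (asm) vdist_less_vrad[OF d]) auto
        thus ?thesis using R euclid_dist_triangle[of d ?o "fst y" "fst x"] by (subst in_ball[OF y(1)]) linarith
      qed
      thus ?thesis by blast
    qed
    have fin: "finite {y \<in> ?S. vdist d (fst x) (fst y) < t}" for x t
      using near_ball[of x t] finR finite_subset by metis
    show "stable_config d ?S"
    proof (rule stable_config.intro[OF d fin])
      fix x y y' assume xy: "x \<in> ?S" "y \<in> ?S" "y' \<in> ?S" "vdist d (fst x) (fst y) = vdist d (fst x) (fst y')"
      have v0: "vdist d (fst a) (fst b) = 0 \<longleftrightarrow> a = b" if "a \<in> ?S" "b \<in> ?S" for a b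
        using vdist_eq_0_iff[OF d sp[OF that(1)] sp[OF that(2)]] fst_inj[OF that] by auto
      show "y = y'"
      proof (rule ccontr)
        assume ne: "y \<noteq> y'"
        \<comment> \<open>If \<open>x\<close> were one of them, the common distance would be 0 and
          all three would coincide.\<close>
        have "x \<noteq> y" "x \<noteq> y'" using v0[OF xy(1,2)] v0[OF xy(1,3)] xy(4) ne by auto
        moreover obtain R :: nat where "euclid_dist d ?o (fst x) + euclid_dist d ?o (fst y) + euclid_dist d ?o (fst y') \<le> real R"
          using real_arch_simple by blast
        hence "euclid_dist d ?o (fst x) \<le> real R" "euclid_dist d ?o (fst y) \<le> real R" "euclid_dist d ?o (fst y') \<le> real R"
          using euclid_dist_nonneg[of d ?o "fst x"] euclid_dist_nonneg[of d ?o "fst y"] euclid_dist_nonneg[of d ?o "fst y'"]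
          by linarith+
        hence "x \<in> etaR (real R) w" "y \<in> etaR (real R) w" "y' \<in> etaR (real R) w"
          using in_ball xy(1-3) by auto
        ultimately show False using elim(1) ne xy(4) by blast
      qed
    next
      fix f :: "nat \<Rightarrow> (nat \<Rightarrow> real) \<times> nat"
      assume f: "\<And>i. f i \<in> ?S"
        "\<And>i. vdist d (fst (f (Suc i))) (fst (f (Suc (Suc i)))) < vdist d (fst (f i)) (fst (f (Suc i)))"
      obtain g where g: "\<And>i. g i \<in> ?S" "inj g"
        "\<And>i. vdist d (fst (g (Suc i))) (fst (g (Suc (Suc i)))) < vdist d (fst (g i)) (fst (g (Suc i)))"
        using injective_descending_chain[of ?S d f, OF fin f] by blast
      obtain N :: nat where N: "euclid_dist d ?o (fst (g 0)) \<le> real N" using real_arch_simple by blast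
      obtain s :: nat where s: "vdist d (fst (g 0)) (fst (g 1)) < real s" using reals_Archimedean2 by blast
      have e: "vdist d (fst (g i)) (fst (g (Suc i))) < real s" for i
      proof (induction i)
        case (Suc i) thus ?case using g(3)[of i] by linarith
      qed (use s in \<open>simp add: One_nat_def\<close>)
      obtain m where m: "(\<integral>\<^sup>+x\<in>etaR (real N + real m * vrad d (real s)) w. indicator (euclid_ball d (real N)) (fst x) *
        npath d m (etaR (real N + real m * vrad d (real s)) w - {x}) x (real s) \<partial>count_space UNIV) < 1"
        using elim(3) by blast
      let ?R = "real N + real m * vrad d (real s)" let ?\<eta> = "etaR ?R w"
      have r: "vrad d (real s) \<ge> 0" by (rule vrad_nonneg) simp
      have dist: "euclid_dist d ?o (fst (g i)) \<le> real N + real i * vrad d (real s)" for i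
      proof (induction i)
        case (Suc i)
        have "euclid_dist d (fst (g i)) (fst (g (Suc i))) < vrad d (real s)"
          using e[of i] by (subst (asm) vdist_less_vrad[OF d]) auto
        moreover have "real (Suc i) * vrad d (real s) = real i * vrad d (real s) + vrad d (real s)"
          by (simp add: distrib_right)
        ultimately show ?case using Suc.IH euclid_dist_triangle[of d ?o "fst (g (Suc i))" "fst (g i)"] by linarith
      next
        case 0 show ?case using N by (simp only: of_nat_0 mult_zero_left add_0_right)
      qed
      have mem: "g i \<in> ?\<eta>" if "i \<le> m" for i
      proof -
        have "real i * vrad d (real s) \<le> real m * vrad d (real s)" using that r by (intro mult_right_mono) auto
        thus ?thesis using dist[of i] by (subst in_ball[OF g(1)]) linarith
      qed
      have "1 \<le> npath d m (?\<eta> - {g 0}) (g 0) (real s)"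
        by (rule npath_ge_1[OF g(2)]) (use mem g(3) s in auto)
      also have "\<dots> = indicator (euclid_ball d (real N)) (fst (g 0)) * npath d m (?\<eta> - {g 0}) (g 0) (real s) * indicator ?\<eta> (g 0)"
        using mem[of 0] N sp[OF g(1)] by (simp add: euclid_ball_def)
      also have "\<dots> \<le> (\<integral>\<^sup>+x\<in>?\<eta>. indicator (euclid_ball d (real N)) (fst x) * npath d m (?\<eta> - {x}) x (real s) \<partial>count_space UNIV)"
        by (rule nn_integral_ge_point) simp
      finally show False using m by simp
    qed
  qed
qed

end

subsection \<open>Intensity of available points\<close>

context poisson_model
begin

lemma coloured_points_space: "w \<in> space W \<Longrightarrow> x \<in> coloured_points w \<Longrightarrow> x \<in> space Mk"
  using measurable_space[OF measurable_Z, of w] unfolding coloured_points_eq by blast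

lemma avail_etaR:
  assumes w: "w \<in> space W" and t: "0 \<le> t" "t \<le> T"
    and x: "euclid_dist d (\<lambda>i\<in>{..<d}. 0) (fst x) \<le> R - real n * vrad d T"
  shows "avail d n (etaR R w) x t \<longleftrightarrow> avail d n (coloured_points w) x t"
proof (rule avail_local[OF _ x t(2)])
  have r: "0 \<le> vrad d T" using t by (intro vrad_nonneg) simp
  fix j and y :: "(nat \<Rightarrow> real) \<times> nat" assume "j < n" and y: "euclid_dist d (\<lambda>i\<in>{..<d}. 0) (fst y) \<le> R - real j * vrad d T"
  have "0 \<le> real j * vrad d T" using r by simp
  hence "euclid_dist d (\<lambda>i\<in>{..<d}. 0) (fst y) \<le> R" using y by linarith
  thus "y \<in> etaR R w \<longleftrightarrow> y \<in> coloured_points w"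
    unfolding etaR_eq using coloured_points_space[OF w, of y]
    by (auto simp: euclid_ball_def space_Mk mem_Times_iff)
next
  fix a b assume "vdist d a b < T"
  hence "euclid_dist d a b < vrad d T" by (subst (asm) vdist_less_vrad[OF d]) (use t in auto)
  thus "euclid_dist d a b \<le> vrad d T" by simp
qed

definition alive :: "nat \<Rightarrow> nat \<Rightarrow> real \<Rightarrow> (nat \<Rightarrow> real) set \<Rightarrow> (nat \<Rightarrow> nat \<Rightarrow> real) \<times> (nat \<Rightarrow> nat) \<Rightarrow> ennreal" where
  "alive n i t C w = (\<integral>\<^sup>+z\<in>coloured_points w.
     (if fst z \<in> C \<and> snd z = i \<and> avail d n (coloured_points w) z t then 1 else 0) \<partial>count_space UNIV)"

lemma measurable_alive_summand:
  assumes [measurable]: "C \<in> sets E" "x \<in> M \<rightarrow>\<^sub>M Mk" and \<eta>: "mconf M \<eta>"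
  shows "(\<lambda>w. if fst (x w) \<in> C \<and> snd (x w) = i \<and> avail d n (\<eta> w) (x w) t then 1 else 0 :: ennreal) \<in> borel_measurable M"
proof -
  have [measurable]: "Measurable.pred M (\<lambda>w. avail d n (\<eta> w) (x w) t)" by (intro measurable_avail \<eta>) simp_all
  have [measurable]: "Measurable.pred M (\<lambda>w. snd (x w) = i)" by (intro measurable_eq_nat) simp_all
  show ?thesis by measurable
qed

lemma measurable_alive:
  assumes "C \<in> sets E" shows "alive n i t C \<in> borel_measurable W"
  unfolding alive_def[abs_def]
  by (intro measurable_sum_conf mconf_points measurable_alive_summand assms)

text \<open>The Mecke formula in a window so large that the recursion from \<open>C\<close> does not
  notice its boundary.\<close>

lemma nn_integral_alive:
  assumes C: "C \<in> sets E" "C \<subseteq> euclid_ball d (R - real n * vrad d t)" and t: "t \<ge> 0"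
  shows "(\<integral>\<^sup>+w. alive n i t C w \<partial>W) = (\<integral>\<^sup>+z. indicator (C \<times> {i}) z *
     emeasure W {w \<in> space W. avail d n (insert z (etaR R w)) z t} \<partial>nuB (euclid_ball d R))"
    and "(\<lambda>z. indicator (C \<times> {i}) z * emeasure W {w \<in> space W. avail d n (insert z (etaR R w)) z t}) \<in> borel_measurable Mk"
proof -
  interpret poisson_window k p d Q "euclid_ball d R" by (rule window_euclid_ball)
  let ?F = "\<lambda>z S. if fst z \<in> C \<and> snd z = i \<and> avail d n (insert z S) z t then 1 else 0 :: ennreal"
  have F: "(\<lambda>(z, \<zeta>). ?F z (\<zeta> ` {..<j})) \<in> borel_measurable (Mk \<Otimes>\<^sub>M Pn j)" for j
    unfolding case_prod_beta' by (rule measurable_alive_summand[OF C(1) measurable_fst mconf_insert[OF mconf_pair measurable_fst]])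
  have r: "0 \<le> real n * vrad d t" using vrad_nonneg[OF t, of d] by simp
  have "alive n i t C w = (\<integral>\<^sup>+z\<in>eta w. ?F z (eta w - {z}) \<partial>count_space UNIV)" if w: "w \<in> space W" for w
    unfolding alive_def
  proof (intro nn_integral_cong)
    fix z
    show "(if fst z \<in> C \<and> snd z = i \<and> avail d n (coloured_points w) z t then 1 else 0) * indicator (coloured_points w) z =
      ?F z (eta w - {z}) * indicator (eta w) z"
    proof (cases "fst z \<in> C \<and> z \<in> coloured_points w")
      case True
      hence z: "euclid_dist d (\<lambda>i\<in>{..<d}. 0) (fst z) \<le> R - real n * vrad d t" "fst z \<in> space E"
        using C(2) by (auto simp: euclid_ball_def)
      hence "z \<in> eta w" using True r unfolding etaR_eq by (simp add: euclid_ball_def)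
      moreover from this have "insert z (eta w - {z}) = eta w" by auto
      ultimately show ?thesis using True avail_etaR[OF w t order_refl z(1)] by simp
    next
      case False
      thus ?thesis by (auto simp: etaR_eq split: split_indicator)
    qed
  qed
  hence "(\<integral>\<^sup>+w. alive n i t C w \<partial>W) = (\<integral>\<^sup>+w. (\<integral>\<^sup>+z\<in>eta w. ?F z (eta w - {z}) \<partial>count_space UNIV) \<partial>W)"
    by (rule nn_integral_cong)
  also have "\<dots> = (\<integral>\<^sup>+z. (\<integral>\<^sup>+w. ?F z (eta w) \<partial>W) \<partial>nuB (euclid_ball d R))" by (rule mecke[OF F])
  finally have alive_eq: "(\<integral>\<^sup>+w. alive n i t C w \<partial>W) = (\<integral>\<^sup>+z. (\<integral>\<^sup>+w. ?F z (eta w) \<partial>W) \<partial>nuB (euclid_ball d R))" .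
  have P: "(\<integral>\<^sup>+w. ?F z (eta w) \<partial>W) = indicator (C \<times> {i}) z * emeasure W {w \<in> space W. avail d n (insert z (eta w)) z t}"
    if z: "z \<in> space Mk" for z
  proof -
    have A: "{w \<in> space W. avail d n (insert z (eta w)) z t} \<in> sets W"
      using measurable_avail[OF mconf_insert[OF mconf_eta measurable_const[OF z]] measurable_const[OF z] measurable_const[of t]]
      by simp
    have "(\<integral>\<^sup>+w. ?F z (eta w) \<partial>W) = (\<integral>\<^sup>+w. indicator (C \<times> {i}) z * indicator {w \<in> space W. avail d n (insert z (eta w)) z t} w \<partial>W)"
      by (intro nn_integral_cong) (auto simp: indicator_def mem_Times_iff)
    also have "\<dots> = indicator (C \<times> {i}) z * emeasure W {w \<in> space W. avail d n (insert z (eta w)) z t}"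
      by (rule nn_integral_cmult_indicator[OF A])
    finally show ?thesis .
  qed
  have "(\<integral>\<^sup>+z. (\<integral>\<^sup>+w. ?F z (eta w) \<partial>W) \<partial>nuB (euclid_ball d R)) =
    (\<integral>\<^sup>+z. indicator (C \<times> {i}) z * emeasure W {w \<in> space W. avail d n (insert z (eta w)) z t} \<partial>nuB (euclid_ball d R))"
    using P by (intro nn_integral_cong) (simp add: space_nuB)
  thus "(\<integral>\<^sup>+w. alive n i t C w \<partial>W) = (\<integral>\<^sup>+z. indicator (C \<times> {i}) z *
     emeasure W {w \<in> space W. avail d n (insert z (eta w)) z t} \<partial>nuB (euclid_ball d R))"
    unfolding alive_eq .
  show "(\<lambda>z. indicator (C \<times> {i}) z * emeasure W {w \<in> space W. avail d n (insert z (eta w)) z t}) \<in> borel_measurable Mk"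
    by (rule measurable_cong[THEN iffD1, OF P nn_integral_eta_measurable(1)[OF F]])
qed

end

text \<open>What the Mecke formula leaves is the availability of one added point, that is,
  decorrelation for a single probe; integrating over colour \<open>i\<close> contributes the factor
  \<open>p i\<close>.\<close>

lemma alive_density:
  assumes cp: "colour_probs k p" and t: "t > 0" and e: "e > 0" and i: "i \<in> {1..k}"
  shows "\<forall>\<^sub>F d in sequentially. \<forall>Q C R. poisson_model k p d Q \<longrightarrow> C \<in> sets (euclid d) \<longrightarrow>
    emeasure (euclid d) C = 1 \<longrightarrow> C \<subseteq> euclid_ball d R \<longrightarrow>
    (\<integral>\<^sup>+w. poisson_model.alive d n i t C w \<partial>coloured_law k p Q) \<le> ennreal (p i * tree_av k p n i t + e) \<and>
    ennreal (p i * tree_av k p n i t) \<le> (\<integral>\<^sup>+w. poisson_model.alive d n i t C w \<partial>coloured_law k p Q) + ennreal e"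
proof -
  interpret colour_probs k p by (rule cp)
  have pi: "0 \<le> p i" "p i \<le> 1"
    using p_nonneg[OF i] member_le_sum[of i "{1..k}" p] i p_nonneg p_sum by auto
  have a: "0 \<le> tree_av k p n i t" using a_pos t by (simp add: less_imp_le)
  have "\<forall>\<^sub>F d in sequentially. \<forall>Q B P \<tau>. poisson_window k p d Q B \<longrightarrow> good d k t (core d t B n) P \<tau> \<longrightarrow> card P = 1 \<longrightarrow>
     \<bar>measure (coloured_law k p Q) {w \<in> space (coloured_law k p Q). \<forall>x\<in>P. avail d n (poisson_window.eta B w \<union> P) x (\<tau> x)}
       - (\<Prod>x\<in>P. tree_av k p n (snd x) (\<tau> x))\<bar> \<le> e"
    using decorr[OF cp t, of n] e unfolding decorr_def by blast
  thus ?thesis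
  proof (rule eventually_mono, intro allI impI)
    fix d Q C R
    assume dec: "\<forall>Q B P \<tau>. poisson_window k p d Q B \<longrightarrow> good d k t (core d t B n) P \<tau> \<longrightarrow> card P = 1 \<longrightarrow>
     \<bar>measure (coloured_law k p Q) {w \<in> space (coloured_law k p Q). \<forall>x\<in>P. avail d n (poisson_window.eta B w \<union> P) x (\<tau> x)}
       - (\<Prod>x\<in>P. tree_av k p n (snd x) (\<tau> x))\<bar> \<le> e"
      and pm: "poisson_model k p d Q" and C: "C \<in> sets (euclid d)" "emeasure (euclid d) C = 1" "C \<subseteq> euclid_ball d R"
    interpret poisson_model k p d Q by (rule pm)
    \<comment> \<open>A margin of \<open>n\<close> steps puts all of \<open>C\<close> into the core
      of depth \<open>n\<close>.\<close>
    define R' where "R' = R + real n * vrad d t"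
    interpret poisson_window k p d Q "euclid_ball d R'" by (rule window_euclid_ball)
    have t0: "t \<ge> 0" using t by simp
    have r: "0 \<le> real n * vrad d t" using vrad_nonneg[OF t0, of d] by simp
    have CR: "C \<subseteq> euclid_ball d (R' - real n * vrad d t)" using C(3) by (simp add: R'_def)
    have CB: "C \<subseteq> euclid_ball d R'" using C(3) r by (auto simp: R'_def euclid_ball_def)
    let ?a = "tree_av k p n i t"
    let ?P = "\<lambda>z. emeasure W {w \<in> space W. avail d n (insert z (eta w)) z t}"
    have I: "(\<integral>\<^sup>+w. alive n i t C w \<partial>W) = (\<integral>\<^sup>+z. indicator (C \<times> {i}) z * ?P z \<partial>nuB (euclid_ball d R'))"
      by (rule nn_integral_alive(1)[OF C(1) CR t0])
    have Pm: "(\<lambda>z. indicator (C \<times> {i}) z * ?P z) \<in> borel_measurable (nuB (euclid_ball d R'))"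
      unfolding measurable_cong_sets[OF sets_nuB refl] by (rule nn_integral_alive(2)[OF C(1) CR t0])
    have m: "\<bar>measure W {w \<in> space W. avail d n (insert z (eta w)) z t} - ?a\<bar> \<le> e" if z: "z \<in> C \<times> {i}" for z
    proof -
      have "good d k t (core d t (euclid_ball d R') n) {z} (\<lambda>_. t)"
        using z i t0 sets.sets_into_space[OF C(1)] CR euclid_ball_core[OF d t0, of "fst z" R' n]
        by (auto simp: good_def mem_Times_iff)
      from dec[rule_format, OF poisson_window_axioms this] show ?thesis using z by (simp add: mem_Times_iff)
    qed
    have CC: "C \<times> {i} \<in> sets (nuB (euclid_ball d R'))"
      using C(1) i unfolding sets_nuB Mk_def by (intro pair_measureI) auto
    have mC: "emeasure (nuB (euclid_ball d R')) (C \<times> {i}) = ennreal (p i)"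
      using emeasure_nuB[OF sets_euclid_ball C(1) i, of R'] CB C(2) by (simp add: Int_absorb2)
    show "(\<integral>\<^sup>+w. alive n i t C w \<partial>W) \<le> ennreal (p i * ?a + e) \<and>
      ennreal (p i * ?a) \<le> (\<integral>\<^sup>+w. alive n i t C w \<partial>W) + ennreal e"
    proof
      have "(\<integral>\<^sup>+w. alive n i t C w \<partial>W) \<le> (\<integral>\<^sup>+z. ennreal (?a + e) * indicator (C \<times> {i}) z \<partial>nuB (euclid_ball d R'))"
        unfolding I using m by (intro nn_integral_mono) (force simp: W.emeasure_eq_measure abs_le_iff intro!: ennreal_leI split: split_indicator)
      also have "\<dots> = ennreal (?a + e) * ennreal (p i)" by (simp add: nn_integral_cmult_indicator[OF CC] mC)
      also have "\<dots> = ennreal ((?a + e) * p i)" using a e by (intro ennreal_mult'[symmetric]) simp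
      also have "\<dots> \<le> ennreal (p i * ?a + e)"
        using pi e mult_right_mono[of "p i" 1 e] by (intro ennreal_leI) (simp add: algebra_simps)
      finally show "(\<integral>\<^sup>+w. alive n i t C w \<partial>W) \<le> ennreal (p i * ?a + e)" .
    next
      have "ennreal (p i * ?a) = (\<integral>\<^sup>+z. ennreal ?a * indicator (C \<times> {i}) z \<partial>nuB (euclid_ball d R'))"
        using a pi by (simp add: nn_integral_cmult_indicator[OF CC] mC ennreal_mult mult.commute)
      also have "\<dots> \<le> (\<integral>\<^sup>+z. indicator (C \<times> {i}) z * (?P z + ennreal e) \<partial>nuB (euclid_ball d R'))"
      proof (intro nn_integral_mono)
        fix z
        show "ennreal ?a * indicator (C \<times> {i}) z \<le> indicator (C \<times> {i}) z * (?P z + ennreal e)"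
        proof (cases "z \<in> C \<times> {i}")
          case True
          have "?a \<le> measure W {w \<in> space W. avail d n (insert z (eta w)) z t} + e" using m[OF True] by linarith
          hence "ennreal ?a \<le> ennreal (measure W {w \<in> space W. avail d n (insert z (eta w)) z t} + e)" by (rule ennreal_leI)
          also have "\<dots> = ?P z + ennreal e" using e by (simp add: W.emeasure_eq_measure)
          finally show ?thesis using True by simp
        qed simp
      qed
      also have "\<dots> = (\<integral>\<^sup>+z. indicator (C \<times> {i}) z * ?P z + ennreal e * indicator (C \<times> {i}) z \<partial>nuB (euclid_ball d R'))"
        by (intro nn_integral_cong) (auto split: split_indicator)
      also have "\<dots> = (\<integral>\<^sup>+z. indicator (C \<times> {i}) z * ?P z \<partial>nuB (euclid_ball d R')) + (\<integral>\<^sup>+z. ennreal e * indicator (C \<times> {i}) z \<partial>nuB (euclid_ball d R'))"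
        using CC by (intro nn_integral_add Pm) simp
      also have "\<dots> = (\<integral>\<^sup>+w. alive n i t C w \<partial>W) + ennreal e * ennreal (p i)"
        unfolding I by (simp add: nn_integral_cmult_indicator[OF CC] mC)
      also have "\<dots> \<le> (\<integral>\<^sup>+w. alive n i t C w \<partial>W) + ennreal e"
        using e pi mult_left_le[of "p i" e] by (intro add_left_mono) (simp add: ennreal_mult'[symmetric] ennreal_leI)
      finally show "ennreal (p i * ?a) \<le> (\<integral>\<^sup>+w. alive n i t C w \<partial>W) + ennreal e" .
    qed
  qed
qed

subsection \<open>Translation invariance of pair sums\<close>

lemma eshift_space: "eshift d z x \<in> space (euclid d)"
  by (simp add: eshift_def space_euclid)

lemma eshift_inj: "x \<in> space (euclid d) \<Longrightarrow> y \<in> space (euclid d) \<Longrightarrow> eshift d z x = eshift d z y \<longleftrightarrow> x = y"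
  by (metis euclid_dist_eshift euclid_dist_eq_0_iff eshift_space)

definition pshift :: "nat \<Rightarrow> (nat \<Rightarrow> real) \<Rightarrow> (nat \<Rightarrow> real) \<times> nat \<Rightarrow> (nat \<Rightarrow> real) \<times> nat" where
  "pshift d z x = (eshift d z (fst x), snd x)"

lemma pshift_simps [simp]: "fst (pshift d z x) = eshift d z (fst x)" "snd (pshift d z x) = snd x"
  by (simp_all add: pshift_def)

lemma avail_pshift: "avail d n (pshift d z ` S) (pshift d z x) t \<longleftrightarrow> avail d n S x t"
  by (induction n arbitrary: x t) simp_all

text \<open>For all \<open>N\<close> together, in a well-behaved configuration, this says that
  \<open>x\<close> and \<open>y\<close> are matched to each other at distance at least
  \<open>T\<close>. A finite \<open>N\<close> is kept because the condition then depends on a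
  bounded region only.\<close>

definition far :: "nat \<Rightarrow> real \<Rightarrow> nat \<Rightarrow> ((nat \<Rightarrow> real) \<times> nat) set \<Rightarrow> (nat \<Rightarrow> real) \<times> nat \<Rightarrow> (nat \<Rightarrow> real) \<times> nat \<Rightarrow> bool" where
  "far d T N S x y \<longleftrightarrow> snd x = 1 \<and> snd y \<noteq> 1 \<and> T \<le> vdist d (fst x) (fst y) \<and>
     avail d (2 * N) S x (vdist d (fst x) (fst y)) \<and> avail d (2 * N) S y (vdist d (fst x) (fst y))"

lemma far_antimono: "m \<le> n \<Longrightarrow> far d T n S x y \<Longrightarrow> far d T m S x y"
  using avail_even_antimono unfolding far_def by blast

lemma far_pshift: "far d T N (pshift d z ` S) (pshift d z x) (pshift d z y) \<longleftrightarrow> far d T N S x y"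
  by (simp add: far_def avail_pshift)

definition pair_sum :: "((nat \<Rightarrow> real) set) \<Rightarrow> ((nat \<Rightarrow> real) set) \<Rightarrow>
    ((nat \<Rightarrow> real) \<times> nat \<Rightarrow> (nat \<Rightarrow> real) \<times> nat \<Rightarrow> bool) \<Rightarrow> ((nat \<Rightarrow> real) \<times> nat) set \<Rightarrow> ennreal" where
  "pair_sum A D P S = (\<integral>\<^sup>+x\<in>S. (\<integral>\<^sup>+y\<in>S. (if fst x \<in> A \<and> fst y \<in> D \<and> P x y then 1 else 0) \<partial>count_space UNIV) \<partial>count_space UNIV)"

lemma pair_sum_eq:
  "pair_sum A D P S = (\<integral>\<^sup>+x. \<integral>\<^sup>+y. (if fst x \<in> A \<and> fst y \<in> D \<and> P x y \<and> x \<in> S \<and> y \<in> S then 1 else 0) \<partial>count_space UNIV \<partial>count_space UNIV)"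
  unfolding pair_sum_def by (intro nn_integral_cong) (auto split: split_indicator intro!: nn_integral_cong)

lemma pair_sum_cong:
  assumes "\<And>x y. fst x \<in> A \<Longrightarrow> fst y \<in> D \<Longrightarrow> P x y \<and> x \<in> S \<and> y \<in> S \<longleftrightarrow> P' x y \<and> x \<in> S' \<and> y \<in> S'"
  shows "pair_sum A D P S = pair_sum A D P' S'"
  unfolding pair_sum_eq by (intro nn_integral_cong if_cong conj_cong refl assms)

lemma sum_image_conf:
  fixes g :: "'b \<Rightarrow> ennreal"
  assumes "inj_on f S" shows "(\<integral>\<^sup>+x\<in>f ` S. g x \<partial>count_space UNIV) = (\<integral>\<^sup>+x\<in>S. g (f x) \<partial>count_space UNIV)"
proof -
  have "(\<integral>\<^sup>+x\<in>f ` S. g x \<partial>count_space UNIV) = (\<integral>\<^sup>+x. g x \<partial>count_space (f ` S))"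
    by (rule nn_integral_count_space_indicator[symmetric]) simp
  also have "\<dots> = (\<integral>\<^sup>+x. g (f x) \<partial>count_space S)"
    using assms by (intro nn_integral_bij_count_space[symmetric]) (simp add: bij_betw_def)
  also have "\<dots> = (\<integral>\<^sup>+x\<in>S. g (f x) \<partial>count_space UNIV)"
    by (rule nn_integral_count_space_indicator) simp
  finally show ?thesis .
qed

lemma pair_sum_image:
  assumes "inj_on f S"
  shows "pair_sum A D P (f ` S) =
    (\<integral>\<^sup>+x\<in>S. (\<integral>\<^sup>+y\<in>S. (if fst (f x) \<in> A \<and> fst (f y) \<in> D \<and> P (f x) (f y) then 1 else 0) \<partial>count_space UNIV) \<partial>count_space UNIV)"
  unfolding pair_sum_def sum_image_conf[OF assms] ..

lemma pair_sum_pshift: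
  assumes S: "S \<subseteq> space (euclid d) \<times> UNIV"
    and P: "\<And>x y. P' (pshift d z x) (pshift d z y) \<longleftrightarrow> P x y"
  shows "pair_sum A D P' (pshift d z ` S) =
    pair_sum (eshift d z -` A \<inter> space (euclid d)) (eshift d z -` D \<inter> space (euclid d)) P S"
proof -
  have inj: "inj_on (pshift d z) S"
  proof (rule inj_onI)
    fix x y assume xy: "x \<in> S" "y \<in> S" "pshift d z x = pshift d z y"
    have "fst x \<in> space (euclid d)" "fst y \<in> space (euclid d)" using S xy by auto
    thus "x = y" using xy(3) eshift_inj[of "fst x" d "fst y" z] by (simp add: pshift_def prod_eq_iff)
  qed
  show ?thesis unfolding pair_sum_image[OF inj] unfolding pair_sum_def
    using S by (intro nn_integral_cong) (auto simp: P split: split_indicator intro!: nn_integral_cong)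
qed

text \<open>Downward monotone convergence needs a finite bound, supplied here by the finitely many
  points in \<open>A\<close> and \<open>D\<close>.\<close>

lemma pair_sum_INF:
  assumes fin: "finite {x \<in> S. fst x \<in> A}" "finite {y \<in> S. fst y \<in> D}"
    and P: "\<And>m n x y. m \<le> n \<Longrightarrow> P n x y \<Longrightarrow> P m x y"
  shows "pair_sum A D (\<lambda>x y. \<forall>N::nat. P N x y) S = (INF N. pair_sum A D (P N) S)"
proof -
  let ?h = "\<lambda>x y. if fst x \<in> A \<and> fst y \<in> D \<and> x \<in> S \<and> y \<in> S then 1 else 0 :: ennreal"
  let ?g = "\<lambda>N x y. if fst x \<in> A \<and> fst y \<in> D \<and> P N x y \<and> x \<in> S \<and> y \<in> S then 1 else 0 :: ennreal"
  let ?C = "count_space UNIV :: ((nat \<Rightarrow> real) \<times> nat) measure"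
  note eq = pair_sum_eq
  have mono: "?g n x y \<le> ?g m x y" if "m \<le> n" for m n x y using P[OF that, of x y] by simp
  have dec1: "decseq (\<lambda>N y. ?g N x y)" for x
    unfolding decseq_def by (intro allI impI le_funI mono)
  have dec2: "decseq (\<lambda>N x. \<integral>\<^sup>+y. ?g N x y \<partial>?C)"
    unfolding decseq_def by (intro allI impI le_funI nn_integral_mono mono)
  have b1: "(\<integral>\<^sup>+y. ?g N x y \<partial>?C) \<le> indicator {x \<in> S. fst x \<in> A} x * of_nat (card {y \<in> S. fst y \<in> D})" for N x
  proof -
    have "(\<integral>\<^sup>+y. ?g N x y \<partial>?C) \<le> (\<integral>\<^sup>+y. indicator {x \<in> S. fst x \<in> A} x * indicator {y \<in> S. fst y \<in> D} y \<partial>?C)"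
      by (intro nn_integral_mono) (auto split: split_indicator)
    also have "\<dots> = indicator {x \<in> S. fst x \<in> A} x * emeasure ?C {y \<in> S. fst y \<in> D}"
      by (rule nn_integral_cmult_indicator) simp
    finally show ?thesis using fin by simp
  qed
  have f1: "(\<integral>\<^sup>+y. ?g N x y \<partial>?C) < \<infinity>" for N x
    by (rule le_less_trans[OF b1]) (auto simp: indicator_def of_nat_less_top)
  have f2: "(\<integral>\<^sup>+x. \<integral>\<^sup>+y. ?g N x y \<partial>?C \<partial>?C) < \<infinity>" for N
  proof -
    have "(\<integral>\<^sup>+x. \<integral>\<^sup>+y. ?g N x y \<partial>?C \<partial>?C) \<le> (\<integral>\<^sup>+x. indicator {x \<in> S. fst x \<in> A} x * of_nat (card {y \<in> S. fst y \<in> D}) \<partial>?C)"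
      by (intro nn_integral_mono b1)
    also have "\<dots> = of_nat (card {x \<in> S. fst x \<in> A}) * of_nat (card {y \<in> S. fst y \<in> D})"
      using fin by (subst nn_integral_multc) simp_all
    also have "\<dots> < \<infinity>" by (simp add: of_nat_less_top flip: of_nat_mult)
    finally show ?thesis .
  qed
  have INF: "(if fst x \<in> A \<and> fst y \<in> D \<and> (\<forall>N. P N x y) \<and> x \<in> S \<and> y \<in> S then 1 else 0) = (INF N. ?g N x y)" for x y
  proof (cases "fst x \<in> A \<and> fst y \<in> D \<and> (\<forall>N. P N x y) \<and> x \<in> S \<and> y \<in> S")
    case False
    then obtain N where N: "\<not> (fst x \<in> A \<and> fst y \<in> D \<and> P N x y \<and> x \<in> S \<and> y \<in> S)" by blast
    have "(INF N. ?g N x y) \<le> 0" by (rule INF_lower2[of N]) (simp_all only: N if_False order_refl UNIV_I)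
    thus ?thesis using False by simp
  qed simp
  have "pair_sum A D (\<lambda>x y. \<forall>N. P N x y) S = (\<integral>\<^sup>+x. \<integral>\<^sup>+y. (INF N. ?g N x y) \<partial>?C \<partial>?C)"
    unfolding eq INF ..
  also have "\<dots> = (\<integral>\<^sup>+x. (INF N. \<integral>\<^sup>+y. ?g N x y \<partial>?C) \<partial>?C)"
    by (intro nn_integral_cong nn_integral_monotone_convergence_INF_decseq[OF dec1 _ f1[where N=0]]) simp
  also have "\<dots> = (INF N. \<integral>\<^sup>+x. \<integral>\<^sup>+y. ?g N x y \<partial>?C \<partial>?C)"
    by (intro nn_integral_monotone_convergence_INF_decseq[OF dec2 _ f2[where N=0]]) simp
  finally show ?thesis unfolding eq .
qed

lemma pair_sum_mono: "(\<And>x y. P x y \<Longrightarrow> P' x y) \<Longrightarrow> pair_sum A D P S \<le> pair_sum A D P' S"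
  unfolding pair_sum_def by (intro nn_integral_mono mult_right_mono) auto

context poisson_model
begin

lemma measurable_pair_sum:
  assumes [measurable]: "A \<in> sets E" "D \<in> sets E" and \<eta>: "mconf M \<eta>"
    and P: "\<And>x y. x \<in> M \<rightarrow>\<^sub>M Mk \<Longrightarrow> y \<in> M \<rightarrow>\<^sub>M Mk \<Longrightarrow> Measurable.pred M (\<lambda>w. P w (x w) (y w))"
  shows "(\<lambda>w. pair_sum A D (P w) (\<eta> w)) \<in> borel_measurable M"
  unfolding pair_sum_def
proof (intro measurable_sum_conf[OF \<eta>])
  fix x y assume [measurable]: "x \<in> M \<rightarrow>\<^sub>M Mk" "y \<in> M \<rightarrow>\<^sub>M Mk"
  have [measurable]: "Measurable.pred M (\<lambda>w. P w (x w) (y w))" by (intro P) simp_all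
  show "(\<lambda>w. if fst (x w) \<in> A \<and> fst (y w) \<in> D \<and> P w (x w) (y w) then 1 else 0 :: ennreal) \<in> borel_measurable M"
    by measurable
qed

lemma measurable_far:
  assumes \<eta>: "mconf M \<eta>" and [measurable]: "x \<in> M \<rightarrow>\<^sub>M Mk" "y \<in> M \<rightarrow>\<^sub>M Mk"
  shows "Measurable.pred M (\<lambda>w. far d T N (\<eta> w) (x w) (y w))"
proof -
  define v where "v = (\<lambda>w. vdist d (fst (x w)) (fst (y w)))"
  have [measurable]: "v \<in> borel_measurable M" unfolding v_def by (intro measurable_vdist) simp_all
  have [measurable]: "Measurable.pred M (\<lambda>w. avail d (2 * N) (\<eta> w) (x w) (v w))"
    "Measurable.pred M (\<lambda>w. avail d (2 * N) (\<eta> w) (y w) (v w))" by (intro measurable_avail \<eta>; simp)+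
  have [measurable]: "Measurable.pred M (\<lambda>w. snd (x w) = 1)" "Measurable.pred M (\<lambda>w. snd (y w) = 1)"
    by (intro measurable_eq_nat; simp)+
  have "Measurable.pred M (\<lambda>w. snd (x w) = 1 \<and> snd (y w) \<noteq> 1 \<and> T \<le> v w \<and>
     avail d (2 * N) (\<eta> w) (x w) (v w) \<and> avail d (2 * N) (\<eta> w) (y w) (v w))" by measurable
  thus ?thesis unfolding far_def v_def .
qed

abbreviation "pairs N T A D S \<equiv> pair_sum A D (far d T N S) S"
abbreviation "pairs_inf T A D S \<equiv> pair_sum A D (\<lambda>x y. \<forall>N. far d T N S x y) S"

lemma measurable_pairs:
  assumes "A \<in> sets E" "D \<in> sets E" "mconf M \<eta>"
  shows "(\<lambda>w. pairs N T A D (\<eta> w)) \<in> borel_measurable M" "(\<lambda>w. pairs_inf T A D (\<eta> w)) \<in> borel_measurable M"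
proof -
  show "(\<lambda>w. pairs N T A D (\<eta> w)) \<in> borel_measurable M"
    by (intro measurable_pair_sum assms measurable_far)
  have "Measurable.pred M (\<lambda>w. \<forall>N. far d T N (\<eta> w) (x w) (y w))"
    if "x \<in> M \<rightarrow>\<^sub>M Mk" "y \<in> M \<rightarrow>\<^sub>M Mk" for x y
    by (intro pred_intros_countable measurable_far assms that)
  thus "(\<lambda>w. pairs_inf T A D (\<eta> w)) \<in> borel_measurable M"
    by (intro measurable_pair_sum[where P = "\<lambda>w x y. \<forall>N. far d T N (\<eta> w) x y"] assms)
qed

text \<open>At finite depth the pairs are decided inside a ball. Two points of
  \<open>euclid_ball d R0\<close> are at Euclidean distance at most
  \<open>2 * \<bar>R0\<bar>\<close>, which bounds every time that occurs and hence the length of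
  each step.\<close>

lemma pairs_local:
  assumes A: "A \<subseteq> euclid_ball d R0" "D \<subseteq> euclid_ball d R0" and w: "w \<in> space W"
  shows "pairs N T A D (coloured_points w) =
    pairs N T A D (etaR (R0 + real (2 * N) * vrad d (unit_ball_vol (real d) * (2 * \<bar>R0\<bar>) ^ d)) w)"
proof -
  let ?o = "\<lambda>i\<in>{..<d}. 0 :: real"
  define T' where "T' = unit_ball_vol (real d) * (2 * \<bar>R0\<bar>) ^ d"
  define R where "R = R0 + real (2 * N) * vrad d T'"
  have T': "0 \<le> T'" using unit_ball_vol_nat_pos[of d] by (simp add: T'_def)
  have r: "0 \<le> real (2 * N) * vrad d T'" using vrad_nonneg[OF T', of d] by simp
  have "pairs N T A D (coloured_points w) = pairs N T A D (etaR R w)"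
  proof -
    have mem: "x \<in> coloured_points w \<longleftrightarrow> x \<in> etaR R w" if "fst x \<in> euclid_ball d R0" for x
      using that r unfolding etaR_eq by (auto simp: euclid_ball_def R_def)
    have av: "avail d (2 * N) (coloured_points w) x (vdist d (fst a) (fst b)) \<longleftrightarrow> avail d (2 * N) (etaR R w) x (vdist d (fst a) (fst b))"
      if "fst x \<in> euclid_ball d R0" "fst a \<in> euclid_ball d R0" "fst b \<in> euclid_ball d R0" for x a b
    proof (rule avail_etaR[symmetric, OF w, of _ T'])
      have "euclid_dist d (fst a) (fst b) \<le> euclid_dist d ?o (fst a) + euclid_dist d ?o (fst b)"
        using euclid_dist_triangle[of d "fst a" "fst b" ?o] euclid_dist_commute[of d "fst a" ?o] by simp
      also have "\<dots> \<le> 2 * \<bar>R0\<bar>" using that unfolding euclid_ball_def mem_Collect_eq by linarith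
      finally show "vdist d (fst a) (fst b) \<le> T'"
        unfolding vdist_def T'_def using unit_ball_vol_nat_pos[of d] by (intro mult_left_mono power_mono) auto
      show "euclid_dist d ?o (fst x) \<le> R - real (2 * N) * vrad d T'" using that by (simp add: euclid_ball_def R_def)
    qed simp
    have far: "far d T N (coloured_points w) x y \<longleftrightarrow> far d T N (etaR R w) x y"
      if "fst x \<in> euclid_ball d R0" "fst y \<in> euclid_ball d R0" for x y
      unfolding far_def using av that by blast
    show ?thesis
    proof (rule pair_sum_cong)
      fix x y :: "(nat \<Rightarrow> real) \<times> nat" assume "fst x \<in> A" "fst y \<in> D"
      hence "fst x \<in> euclid_ball d R0" "fst y \<in> euclid_ball d R0" using A by auto
      from far[OF this] mem[OF this(1)] mem[OF this(2)]
      show "far d T N (coloured_points w) x y \<and> x \<in> coloured_points w \<and> y \<in> coloured_points w \<longleftrightarrow>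
        far d T N (etaR R w) x y \<and> x \<in> etaR R w \<and> y \<in> etaR R w" by simp
    qed
  qed
  thus ?thesis unfolding R_def T'_def .
qed

end

section \<open>Translates of the enumerated process\<close>

context poisson_model
begin

abbreviation "XM \<equiv> \<Pi>\<^sub>M m\<in>(UNIV :: nat set). E"

abbreviation shift_seq :: "(nat \<Rightarrow> real) \<Rightarrow> (nat \<Rightarrow> nat \<Rightarrow> real) \<Rightarrow> nat \<Rightarrow> nat \<Rightarrow> real" where
  "shift_seq z X \<equiv> \<lambda>m. eshift d z (X m)"

lemma measurable_shift_seq: "shift_seq z \<in> Q \<rightarrow>\<^sub>M XM"
proof -
  have "(\<lambda>X. eshift d z (X m)) \<in> Q \<rightarrow>\<^sub>M E" for m
    by (rule measurable_compose[OF measurable_Q_component measurable_eshift])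
  hence "(\<lambda>X. \<lambda>m\<in>UNIV. eshift d z (X m)) \<in> Q \<rightarrow>\<^sub>M XM" by (intro measurable_restrict)
  thus ?thesis by (simp add: restrict_def)
qed

lemma space_Q_component: "X \<in> space Q \<Longrightarrow> X m \<in> space E"
  using measurable_space[OF measurable_Q_component] .

text \<open>Counts in \<open>B\<close> after the shift are counts before it in the preimage of
  \<open>B\<close>, a set of equal volume. The shifted sequence need not have the law
  \<open>Q\<close>; it is only another enumeration of a Poisson process.\<close>

lemma translate_law: "poisson_process_law d (distr Q XM (shift_seq z))"
proof -
  let ?Q = "distr Q XM (shift_seq z)" and ?f = "shift_seq z"
  define pre where "pre B = eshift d z -` B \<inter> space E" for B
  have pre [measurable]: "pre B \<in> sets E" if "B \<in> sets E" for B
    unfolding pre_def using that by measurable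
  have pre_em: "emeasure E (pre B) = emeasure E B" if "B \<in> sets E" for B
    unfolding pre_def by (rule emeasure_euclid_eshift[OF that])
  have pre_idx: "{m. ?f X m \<in> B} = {m. X m \<in> pre B}" if "X \<in> space Q" for X B
    using space_Q_component[OF that] by (auto simp: pre_def)
  have sp: "?f X \<in> space ?Q" if "X \<in> space Q" for X
    using measurable_space[OF measurable_shift_seq that] by simp
  have mQ: "f \<in> ?Q \<rightarrow>\<^sub>M N" if "f \<in> Q \<rightarrow>\<^sub>M N" for f and N :: "'n measure"
    using that by (simp add: measurable_cong_sets[OF sets_Q refl])
  have 1: "prob_space ?Q" by (rule Q.prob_space_distr[OF measurable_shift_seq])
  have inj: "AE X in ?Q. inj X"
  proof -
    \<comment> \<open>Injectivity is expressed through distances, as a measurable event that can be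
      moved along \<open>distr\<close>.\<close>
    have m: "{X \<in> space XM. \<forall>m n. m \<noteq> n \<longrightarrow> vdist d (X m) (X n) \<noteq> 0} \<in> sets XM"
    proof -
      have [measurable]: "(\<lambda>X. vdist d (X m) (X n)) \<in> borel_measurable XM" for m n
        by (intro measurable_vdist measurable_component_singleton) simp_all
      show ?thesis by measurable
    qed
    have "AE X in Q. \<forall>m n. m \<noteq> n \<longrightarrow> vdist d (?f X m) (?f X n) \<noteq> 0"
      using AE_inj AE_space
    proof eventually_elim
      case (elim X)
      show ?case
      proof (intro allI impI)
        fix m n :: nat assume "m \<noteq> n"
        hence "X m \<noteq> X n" using elim(1) by (auto simp: inj_def)
        thus "vdist d (?f X m) (?f X n) \<noteq> 0"
          using vdist_eq_0_iff[OF d space_Q_component[OF elim(2)] space_Q_component[OF elim(2)], of m n] by simp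
      qed
    qed
    hence "AE X in ?Q. \<forall>m n. m \<noteq> n \<longrightarrow> vdist d (X m) (X n) \<noteq> 0"
      by (subst AE_distr_iff[OF measurable_shift_seq m])
    thus ?thesis
    proof eventually_elim
      case (elim X)
      have "vdist d a a = 0" for a
        using d by (simp add: vdist_def euclid_dist_def L2_set_def)
      thus ?case using elim unfolding inj_def by metis
    qed
  qed
  have counts: "measure ?Q {X \<in> space ?Q. finite {n. X n \<in> B} \<and> card {n. X n \<in> B} = m} =
             exp (- measure E B) * measure E B ^ m / fact m"
    if B: "B \<in> sets E" "emeasure E B < \<infinity>" for B m
  proof -
    have "{X \<in> space Q. cnt B X = of_nat m} \<in> sets Q" using B(1) by measurable
    hence S: "{X \<in> space ?Q. finite {n. X n \<in> B} \<and> card {n. X n \<in> B} = m} \<in> sets XM"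
      unfolding cnt_eq_iff using sets_Q sets_eq_imp_space_eq[OF sets_Q] by simp
    have "measure ?Q {X \<in> space ?Q. finite {n. X n \<in> B} \<and> card {n. X n \<in> B} = m} =
      measure Q {X \<in> space Q. finite {n. X n \<in> pre B} \<and> card {n. X n \<in> pre B} = m}"
      unfolding measure_distr[OF measurable_shift_seq S]
      by (rule arg_cong[where f = "measure Q"]) (use sp in \<open>auto simp: pre_idx\<close>)
    also have "\<dots> = exp (- measure E (pre B)) * measure E (pre B) ^ m / fact m"
      using law pre[OF B(1)] B(2) pre_em[OF B(1)] unfolding poisson_process_law_def by simp
    finally show ?thesis using pre_em[OF B(1)] by (simp add: measure_def)
  qed
  have indep: "prob_space.indep_vars ?Q (\<lambda>_. count_space UNIV) (\<lambda>j X. card {n. X n \<in> B j}) {..<N}"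
    if B: "\<forall>j<N. B j \<in> sets E \<and> emeasure E (B j) < \<infinity>" and disj: "disjoint_family_on B {..<N}"
    for N and B :: "nat \<Rightarrow> (nat \<Rightarrow> real) set"
  proof (cases "N = 0")
    case True
    thus ?thesis by (simp add: prob_space.indep_vars_def2[OF 1] prob_space.indep_sets_def[OF 1])
  next
    case False
    let ?c = "\<lambda>B X. card {n::nat. X n \<in> B}"
    have L: "Q.indep_vars (\<lambda>_. count_space UNIV) (\<lambda>j X. card {n. X n \<in> B j}) {..<N}"
      if "\<forall>j<N. B j \<in> sets E \<and> emeasure E (B j) < \<infinity>" "disjoint_family_on B {..<N}"
      for N and B :: "nat \<Rightarrow> (nat \<Rightarrow> real) set"
      using law that unfolding poisson_process_law_def by blast
    have indB: "Q.indep_vars (\<lambda>_. count_space UNIV) (\<lambda>j. ?c (B j)) {..<N}"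
      using B disj by (rule L)
    have indpre: "Q.indep_vars (\<lambda>_. count_space UNIV) (\<lambda>j. ?c (pre (B j))) {..<N}"
    proof -
      have "\<forall>j<N. pre (B j) \<in> sets E \<and> emeasure E (pre (B j)) < \<infinity>" using B by (simp add: pre pre_em)
      moreover have "disjoint_family_on (\<lambda>j. pre (B j)) {..<N}"
        using disj by (auto simp: disjoint_family_on_def pre_def)
      ultimately show ?thesis by (rule L)
    qed
    have mB: "?c (B j) \<in> Q \<rightarrow>\<^sub>M count_space UNIV" and mpre: "?c (pre (B j)) \<in> Q \<rightarrow>\<^sub>M count_space UNIV"
      if "j \<in> {..<N}" for j using indB indpre that unfolding Q.indep_vars_def2 by blast+
    have cf: "?c (B j) (?f X) = ?c (pre (B j)) X" if "X \<in> space Q" for j X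
      using pre_idx[OF that] by simp
    show ?thesis
    \<comment> \<open>Independence is carried over as a statement about joint distributions: on the
      space, the counts of the shifted sequence are the counts in the preimages.\<close>
    proof (subst prob_space.indep_vars_iff_distr_eq_PiM'[OF 1])
      show "{..<N} \<noteq> {}" using False by auto
      show "?c (B j) \<in> ?Q \<rightarrow>\<^sub>M count_space UNIV" if "j \<in> {..<N}" for j by (rule mQ[OF mB[OF that]])
      have mm: "(\<lambda>X. \<lambda>j\<in>{..<N}. ?c (B j) X) \<in> XM \<rightarrow>\<^sub>M (\<Pi>\<^sub>M j\<in>{..<N}. count_space UNIV)"
        using mB by (intro measurable_restrict) (simp add: measurable_cong_sets[OF sets_Q refl])
      have "distr ?Q (\<Pi>\<^sub>M j\<in>{..<N}. count_space UNIV) (\<lambda>X. \<lambda>j\<in>{..<N}. ?c (B j) X) =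
        distr Q (\<Pi>\<^sub>M j\<in>{..<N}. count_space UNIV) (\<lambda>X. \<lambda>j\<in>{..<N}. ?c (B j) (?f X))"
        by (subst distr_distr[OF mm measurable_shift_seq]) (simp add: comp_def)
      also have "\<dots> = distr Q (\<Pi>\<^sub>M j\<in>{..<N}. count_space UNIV) (\<lambda>X. \<lambda>j\<in>{..<N}. ?c (pre (B j)) X)"
        by (intro distr_cong refl) (simp add: cf)
      also have "\<dots> = (\<Pi>\<^sub>M j\<in>{..<N}. distr Q (count_space UNIV) (?c (pre (B j))))"
        using indpre False by (subst Q.indep_vars_iff_distr_eq_PiM'[symmetric]) (auto intro: mpre)
      also have "\<dots> = (\<Pi>\<^sub>M j\<in>{..<N}. distr ?Q (count_space UNIV) (?c (B j)))"
      proof (intro PiM_cong refl)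
        fix j assume j: "j \<in> {..<N}"
        have "?c (B j) \<in> XM \<rightarrow>\<^sub>M count_space UNIV" using mB[OF j] by (simp add: measurable_cong_sets[OF sets_Q refl])
        hence "distr ?Q (count_space UNIV) (?c (B j)) = distr Q (count_space UNIV) (\<lambda>X. ?c (B j) (?f X))"
          by (subst distr_distr[OF _ measurable_shift_seq]) (simp_all add: comp_def)
        also have "\<dots> = distr Q (count_space UNIV) (?c (pre (B j)))" by (intro distr_cong refl cf)
        finally show "distr Q (count_space UNIV) (?c (pre (B j))) = distr ?Q (count_space UNIV) (?c (B j))" ..
      qed
      finally show "distr ?Q (\<Pi>\<^sub>M j\<in>{..<N}. count_space UNIV) (\<lambda>X. \<lambda>j\<in>{..<N}. ?c (B j) X) =
        (\<Pi>\<^sub>M j\<in>{..<N}. distr ?Q (count_space UNIV) (?c (B j)))" .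
    qed
  qed
  show ?thesis unfolding poisson_process_law_def
    using 1 inj counts indep by auto
qed

lemma coloured_law_translate:
  "coloured_law k p (distr Q XM (shift_seq z)) = distr W (XM \<Otimes>\<^sub>M PCm) (\<lambda>(X, c). (shift_seq z X, c))"
proof -
  have "distr Q XM (shift_seq z) \<Otimes>\<^sub>M distr PCm PCm (\<lambda>c. c) = distr (Q \<Otimes>\<^sub>M PCm) (XM \<Otimes>\<^sub>M PCm) (\<lambda>(X, c). (shift_seq z X, c))"
    by (rule pair_measure_distr[OF measurable_shift_seq measurable_ident_sets[OF refl]])
       (simp add: prob_space_imp_sigma_finite PC.P.prob_space_axioms)
  thus ?thesis by (simp add: coloured_law_def)
qed

lemma nn_integral_translate:
  assumes "G \<in> borel_measurable (XM \<Otimes>\<^sub>M PCm)" and G: "\<And>w. G w = H (coloured_points w)"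
  shows "(\<integral>\<^sup>+w. G w \<partial>coloured_law k p (distr Q XM (shift_seq z))) = (\<integral>\<^sup>+w. H (pshift d z ` coloured_points w) \<partial>W)"
proof -
  have m: "(\<lambda>(X, c). (shift_seq z X, c)) \<in> W \<rightarrow>\<^sub>M XM \<Otimes>\<^sub>M PCm"
    unfolding W_eq case_prod_beta'
    by (intro measurable_Pair measurable_compose[OF measurable_fst measurable_shift_seq] measurable_snd)
  have "coloured_points (shift_seq z X, c) = pshift d z ` coloured_points (X, c)" for X c
    by (simp add: coloured_points_def pshift_def image_image)
  thus ?thesis
    unfolding coloured_law_translate using assms(1)
    by (subst nn_integral_distr[OF m]) (auto intro!: nn_integral_cong simp: G)
qed

end

lemma (in poisson_window) nn_integral_eta_law_cong:
  assumes "poisson_model k p d Q'"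
    and G: "\<And>n. (\<lambda>\<zeta>. G (\<zeta> ` {..<n})) \<in> borel_measurable (Pn n)"
  shows "(\<integral>\<^sup>+w. G (eta w) \<partial>W) = (\<integral>\<^sup>+w. G (eta w) \<partial>coloured_law k p Q')"
proof -
  interpret Q': poisson_model k p d Q' by (rule assms(1))
  interpret Q': poisson_window k p d Q' B by (rule Q'.window[OF B finB])
  show ?thesis unfolding nn_integral_eta[OF G] Q'.nn_integral_eta[OF G] ..
qed

context poisson_model
begin

lemma pairs_law_cong:
  assumes A: "A \<in> sets E" "D \<in> sets E" "A \<subseteq> euclid_ball d R0" "D \<subseteq> euclid_ball d R0"
    and Q': "poisson_model k p d Q'"
  shows "(\<integral>\<^sup>+w. pairs N T A D (coloured_points w) \<partial>W) = (\<integral>\<^sup>+w. pairs N T A D (coloured_points w) \<partial>coloured_law k p Q')"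
proof -
  interpret Q': poisson_model k p d Q' by (rule Q')
  let ?R = "R0 + real (2 * N) * vrad d (unit_ball_vol (real d) * (2 * \<bar>R0\<bar>) ^ d)"
  interpret poisson_window k p d Q "euclid_ball d ?R" by (rule window_euclid_ball)
  have "(\<integral>\<^sup>+w. pairs N T A D (eta w) \<partial>W) = (\<integral>\<^sup>+w. pairs N T A D (eta w) \<partial>coloured_law k p Q')"
    by (rule nn_integral_eta_law_cong[OF Q']) (rule measurable_pairs(1)[OF A(1,2) mconf_PiM])
  moreover have "(\<integral>\<^sup>+w. pairs N T A D (coloured_points w) \<partial>W) = (\<integral>\<^sup>+w. pairs N T A D (eta w) \<partial>W)"
    by (intro nn_integral_cong pairs_local A)
  moreover have "(\<integral>\<^sup>+w. pairs N T A D (coloured_points w) \<partial>coloured_law k p Q') = (\<integral>\<^sup>+w. pairs N T A D (eta w) \<partial>coloured_law k p Q')"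
    by (intro nn_integral_cong Q'.pairs_local A)
  ultimately show ?thesis by simp
qed

text \<open>Bounded by the second factorial moment of the number of points in a ball, the square of
  its volume.\<close>

lemma pairs_finite:
  assumes A: "A \<subseteq> euclid_ball d R0" "D \<subseteq> euclid_ball d R0"
  shows "(\<integral>\<^sup>+w. pairs N T A D (coloured_points w) \<partial>W) < \<infinity>"
proof -
  interpret poisson_window k p d Q "euclid_ball d R0" by (rule window_euclid_ball)
  let ?C = "count_space UNIV :: ((nat \<Rightarrow> real) \<times> nat) measure"
  have le: "pairs N T A D (coloured_points w) \<le> (\<integral>\<^sup>+x\<in>eta w. (\<integral>\<^sup>+y\<in>eta w - {x}. 1 \<partial>?C) \<partial>?C)" for w
  proof -
    have "pairs N T A D (coloured_points w) \<le> (\<integral>\<^sup>+x. (\<integral>\<^sup>+y. indicator (eta w - {x}) y * indicator (eta w) x \<partial>?C) \<partial>?C)"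
      unfolding pair_sum_eq
    proof (intro nn_integral_mono)
      fix x y :: "(nat \<Rightarrow> real) \<times> nat"
      have "y \<in> eta w - {x} \<and> x \<in> eta w" if "fst x \<in> A" "fst y \<in> D" "far d T N (coloured_points w) x y" "x \<in> coloured_points w" "y \<in> coloured_points w"
        using that A unfolding etaR_eq far_def by auto
      thus "(if fst x \<in> A \<and> fst y \<in> D \<and> far d T N (coloured_points w) x y \<and> x \<in> coloured_points w \<and> y \<in> coloured_points w then 1 else 0)
        \<le> (indicator (eta w - {x}) y * indicator (eta w) x :: ennreal)" by (auto simp: indicator_def)
    qed
    also have "\<dots> = (\<integral>\<^sup>+x\<in>eta w. (\<integral>\<^sup>+y\<in>eta w - {x}. 1 \<partial>?C) \<partial>?C)"
      by (intro nn_integral_cong) (subst nn_integral_multc; simp)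
    finally show ?thesis .
  qed
  have F: "(\<lambda>(x, \<zeta>). \<integral>\<^sup>+y\<in>\<zeta> ` {..<n}. 1 \<partial>?C) \<in> borel_measurable (Mk \<Otimes>\<^sub>M Pn n)" for n
    unfolding case_prod_beta' by (rule measurable_sum_conf[OF mconf_pair]) simp
  have "(\<integral>\<^sup>+w. pairs N T A D (coloured_points w) \<partial>W) \<le> (\<integral>\<^sup>+w. (\<integral>\<^sup>+x\<in>eta w. (\<integral>\<^sup>+y\<in>eta w - {x}. 1 \<partial>?C) \<partial>?C) \<partial>W)"
    by (intro nn_integral_mono le)
  also have "\<dots> = (\<integral>\<^sup>+x. (\<integral>\<^sup>+w. (\<integral>\<^sup>+y\<in>eta w. 1 \<partial>?C) \<partial>W) \<partial>nuB (euclid_ball d R0))"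
    by (rule mecke[where F = "\<lambda>x S. \<integral>\<^sup>+y\<in>S. 1 \<partial>?C", OF F])
  also have "\<dots> = (\<integral>\<^sup>+x. (\<integral>\<^sup>+y. 1 \<partial>nuB (euclid_ball d R0)) \<partial>nuB (euclid_ball d R0))"
    by (subst intensity_eta) simp_all
  also have "\<dots> < \<infinity>"
    by (simp add: nuB.emeasure_eq_measure ennreal_mult'[symmetric])
  finally show ?thesis .
qed

lemma AE_finite_ball: "AE w in W. finite {x \<in> coloured_points w. fst x \<in> euclid_ball d R}"
proof -
  interpret poisson_window k p d Q "euclid_ball d R" by (rule window_euclid_ball)
  show ?thesis using AE_good
  proof eventually_elim
    case (elim w)
    have "{x \<in> coloured_points w. fst x \<in> euclid_ball d R} = (\<lambda>m. Z m w) ` {m. fst w m \<in> euclid_ball d R}"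
      unfolding coloured_points_eq by (auto simp: Z_def)
    thus ?case using elim by simp
  qed
qed

lemma pairs_inf_INF:
  assumes A: "A \<in> sets E" "D \<in> sets E" "A \<subseteq> euclid_ball d R0" "D \<subseteq> euclid_ball d R0"
  shows "(\<integral>\<^sup>+w. pairs_inf T A D (coloured_points w) \<partial>W) = (INF N. \<integral>\<^sup>+w. pairs N T A D (coloured_points w) \<partial>W)"
proof -
  have "(\<integral>\<^sup>+w. pairs_inf T A D (coloured_points w) \<partial>W) = (\<integral>\<^sup>+w. (INF N. pairs N T A D (coloured_points w)) \<partial>W)"
  proof (rule nn_integral_cong_AE)
    show "AE w in W. pairs_inf T A D (coloured_points w) = (INF N. pairs N T A D (coloured_points w))"
      using AE_finite_ball[of R0]
    proof eventually_elim
      case (elim w)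
      have "finite {x \<in> coloured_points w. fst x \<in> A}" "finite {x \<in> coloured_points w. fst x \<in> D}"
        by (rule finite_subset[OF _ elim], use A in auto)+
      thus ?case by (rule pair_sum_INF) (rule far_antimono)
    qed
  qed
  also have "\<dots> = (INF N. \<integral>\<^sup>+w. pairs N T A D (coloured_points w) \<partial>W)"
  proof (rule nn_integral_monotone_convergence_INF_decseq)
    show "decseq (\<lambda>N w. pairs N T A D (coloured_points w))"
      unfolding decseq_def by (intro allI impI le_funI pair_sum_mono) (rule far_antimono)
    show "(\<lambda>w. pairs N T A D (coloured_points w)) \<in> borel_measurable W" for N
      by (rule measurable_pairs(1)[OF A(1,2) mconf_points])
    show "(\<integral>\<^sup>+w. pairs 0 T A D (coloured_points w) \<partial>W) < \<infinity>" by (rule pairs_finite[OF A(3,4)])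
  qed
  finally show ?thesis .
qed

text \<open>Availability to all depths is not local, but these counts are decreasing limits of local
  ones, whose means agree for all enumerations of the process. Applied to the shifted enumeration
  this yields translation invariance.\<close>

lemma pairs_inf_translate:
  assumes A: "A \<in> sets E" "D \<in> sets E" "A \<subseteq> euclid_ball d R0" "D \<subseteq> euclid_ball d R0"
  shows "(\<integral>\<^sup>+w. pairs_inf T A D (coloured_points w) \<partial>W) =
    (\<integral>\<^sup>+w. pairs_inf T (eshift d z -` A \<inter> space E) (eshift d z -` D \<inter> space E) (coloured_points w) \<partial>W)"
proof -
  let ?Q = "distr Q XM (shift_seq z)"
  interpret Q': poisson_model k p d ?Q
    by (intro poisson_model.intro poisson_model_axioms.intro colour_probs_axioms d translate_law)
  have "(\<integral>\<^sup>+w. pairs_inf T A D (coloured_points w) \<partial>W) = (\<integral>\<^sup>+w. pairs_inf T A D (coloured_points w) \<partial>coloured_law k p ?Q)"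
    unfolding pairs_inf_INF[OF A] Q'.pairs_inf_INF[OF A]
    using pairs_law_cong[OF A Q'.poisson_model_axioms] by simp
  also have "\<dots> = (\<integral>\<^sup>+w. pairs_inf T A D (pshift d z ` coloured_points w) \<partial>W)"
  proof (rule nn_integral_translate[where H = "pairs_inf T A D"])
    have "sets (coloured_law k p ?Q) = sets (XM \<Otimes>\<^sub>M PCm)" by (simp add: coloured_law_translate)
    with Q'.measurable_pairs(2)[OF A(1,2) Q'.mconf_points]
    show "(\<lambda>w. pairs_inf T A D (coloured_points w)) \<in> borel_measurable (XM \<Otimes>\<^sub>M PCm)"
      by (simp cong: measurable_cong_sets)
  qed simp
  also have "\<dots> = (\<integral>\<^sup>+w. pairs_inf T (eshift d z -` A \<inter> space E) (eshift d z -` D \<inter> space E) (coloured_points w) \<partial>W)"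
  proof (intro nn_integral_cong pair_sum_pshift)
    fix w assume "w \<in> space W"
    thus "coloured_points w \<subseteq> space E \<times> UNIV"
      using coloured_points_space by (fastforce simp: space_Mk)
  qed (simp add: far_pshift)
  finally show ?thesis .
qed

end

subsection \<open>Mass transport\<close>

lemma nn_integral_count_space_swap:
  "(\<integral>\<^sup>+x. \<integral>\<^sup>+y. f x y \<partial>count_space UNIV \<partial>count_space UNIV) = (\<integral>\<^sup>+y. \<integral>\<^sup>+x. f x y \<partial>count_space UNIV \<partial>count_space UNIV)"
  using nn_integral_fst_count_space[of "\<lambda>(x, y). f x y"] nn_integral_snd_count_space[of "\<lambda>(x, y). f x y"]
  by simp

definition tile :: "nat \<Rightarrow> int list \<Rightarrow> (nat \<Rightarrow> real) set" where
  "tile d q = {x \<in> space (euclid d). grid_cell d 0 x = q}"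

lemma sets_tile [measurable]: "tile d q \<in> sets (euclid d)"
  unfolding tile_def by measurable

lemma mem_tile_iff:
  "length q = d \<Longrightarrow> x \<in> tile d q \<longleftrightarrow> x \<in> space (euclid d) \<and> (\<forall>i<d. \<lfloor>x i\<rfloor> = q ! i)"
  by (auto simp: tile_def grid_cell_def list_eq_iff_nth_eq)

lemma tile_empty: "length q \<noteq> d \<Longrightarrow> tile d q = {}"
  by (auto simp: tile_def grid_cell_def)

lemma half_cube_tile: "half_cube d = tile d (replicate d 0)"
proof (rule set_eqI)
  fix x
  have "x \<in> half_cube d \<longleftrightarrow> x \<in> space (euclid d) \<and> (\<forall>i<d. 0 \<le> x i \<and> x i < 1)"
    by (auto simp: half_cube_def space_euclid PiE_iff)
  moreover have "\<lfloor>x i\<rfloor> = 0 \<longleftrightarrow> 0 \<le> x i \<and> x i < 1" for i by linarith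
  moreover have "x \<in> tile d (replicate d 0) \<longleftrightarrow> x \<in> space (euclid d) \<and> (\<forall>i<d. \<lfloor>x i\<rfloor> = 0)"
    by (simp add: mem_tile_iff)
  ultimately show "x \<in> half_cube d \<longleftrightarrow> x \<in> tile d (replicate d 0)" by simp
qed

lemma euclid_ball_box:
  assumes "x \<in> space (euclid d)" "\<And>i. i < d \<Longrightarrow> \<bar>x i\<bar> \<le> b i"
  shows "x \<in> euclid_ball d (\<Sum>i<d. b i)"
proof -
  have "euclid_dist d (\<lambda>i\<in>{..<d}. 0) x \<le> (\<Sum>i<d. \<bar>(\<lambda>i\<in>{..<d}. 0) i - x i\<bar>)"
    unfolding euclid_dist_def by (rule L2_set_le_sum_abs)
  also have "\<dots> \<le> (\<Sum>i<d. b i)" using assms(2) by (intro sum_mono) simp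
  finally show ?thesis using assms(1) by (simp add: euclid_ball_def)
qed

lemma tile_subset_ball: obtains R where "tile d q \<subseteq> euclid_ball d R"
proof (cases "length q = d")
  case True
  have "x \<in> euclid_ball d (\<Sum>i<d. \<bar>real_of_int (q ! i)\<bar> + 1)" if x: "x \<in> tile d q" for x
  proof (rule euclid_ball_box)
    fix i assume "i < d"
    hence "\<lfloor>x i\<rfloor> = q ! i" using x mem_tile_iff[OF True] by auto
    thus "\<bar>x i\<bar> \<le> \<bar>real_of_int (q ! i)\<bar> + 1" by linarith
  qed (use x in \<open>simp add: tile_def\<close>)
  thus ?thesis by (intro that[of "\<Sum>i<d. \<bar>real_of_int (q ! i)\<bar> + 1"]) blast
qed (auto simp: tile_empty intro: that)

lemma unit_cube_subset_ball: "unit_cube d \<subseteq> euclid_ball d (real d)"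
proof
  fix x assume x: "x \<in> unit_cube d"
  have "x \<in> space (euclid d)" using x by (auto simp: unit_cube_def space_euclid)
  moreover have "\<bar>x i\<bar> \<le> 1" if "i < d" for i using x that by (auto simp: unit_cube_def PiE_iff)
  ultimately have "x \<in> euclid_ball d (\<Sum>i<d. 1)" by (rule euclid_ball_box)
  thus "x \<in> euclid_ball d (real d)" by simp
qed

lemma eshift_tiles:
  assumes q: "length q = d"
  shows "eshift d (\<lambda>i. real_of_int (q ! i)) -` tile d (replicate d 0) \<inter> space (euclid d) = tile d (map uminus q)"
    and "eshift d (\<lambda>i. real_of_int (q ! i)) -` tile d q \<inter> space (euclid d) = tile d (replicate d 0)"
proof -
  have e: "\<lfloor>eshift d (\<lambda>i. real_of_int (q ! i)) x i\<rfloor> = \<lfloor>x i\<rfloor> + q ! i" if "i < d" for x i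
    using that by (simp add: eshift_def)
  show "eshift d (\<lambda>i. real_of_int (q ! i)) -` tile d (replicate d 0) \<inter> space (euclid d) = tile d (map uminus q)"
    "eshift d (\<lambda>i. real_of_int (q ! i)) -` tile d q \<inter> space (euclid d) = tile d (replicate d 0)"
    unfolding set_eq_iff Int_iff vimage_eq using q by (simp_all add: mem_tile_iff eshift_space e eq_neg_iff_add_eq_0 cong: conj_cong) blast+
qed

lemma pair_sum_empty: "pair_sum {} D P S = 0" "pair_sum A {} P S = 0"
  by (simp_all add: pair_sum_def)

lemma indicator_tile_sum:
  assumes "x \<in> space (euclid d)"
  shows "(\<integral>\<^sup>+q. (if x \<in> tile d q \<and> R then 1 else 0) \<partial>count_space UNIV) = (if R then 1 else 0 :: ennreal)"
proof -
  have "(\<integral>\<^sup>+q. (if x \<in> tile d q \<and> R then 1 else 0) \<partial>count_space UNIV) =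
    (\<integral>\<^sup>+q. (if R then 1 else 0) * indicator {grid_cell d 0 x} q \<partial>count_space UNIV)"
    using assms by (intro nn_integral_cong) (auto simp: tile_def)
  also have "\<dots> = (if R then 1 else 0) * emeasure (count_space UNIV) {grid_cell d 0 x}"
    by (rule nn_integral_cmult_indicator) simp
  finally show ?thesis by simp
qed

lemma pair_sum_tiles:
  assumes S: "S \<subseteq> space (euclid d) \<times> UNIV"
  shows "pair_sum A (space (euclid d)) P S = (\<integral>\<^sup>+q. pair_sum A (tile d q) P S \<partial>count_space UNIV)"
    and "pair_sum (space (euclid d)) A P S = (\<integral>\<^sup>+q. pair_sum (tile d q) A P S \<partial>count_space UNIV)"
proof -
  let ?C = "count_space UNIV"
  have sp: "fst x \<in> space (euclid d)" if "x \<in> S" for x using S that by auto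
  have "pair_sum A (space (euclid d)) P S = (\<integral>\<^sup>+x. \<integral>\<^sup>+y. \<integral>\<^sup>+q. (if fst y \<in> tile d q \<and> (fst x \<in> A \<and> P x y \<and> x \<in> S \<and> y \<in> S) then 1 else 0) \<partial>?C \<partial>?C \<partial>?C)"
    unfolding pair_sum_eq
  proof (intro nn_integral_cong)
    fix x y :: "(nat \<Rightarrow> real) \<times> nat"
    show "(if fst x \<in> A \<and> fst y \<in> space (euclid d) \<and> P x y \<and> x \<in> S \<and> y \<in> S then 1 else 0) =
      (\<integral>\<^sup>+q. (if fst y \<in> tile d q \<and> (fst x \<in> A \<and> P x y \<and> x \<in> S \<and> y \<in> S) then 1 else 0) \<partial>?C)"
    proof (cases "y \<in> S")
      case True
      thus ?thesis using sp[OF True] by (simp add: indicator_tile_sum)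
    qed simp
  qed
  also have "\<dots> = (\<integral>\<^sup>+x. \<integral>\<^sup>+q. \<integral>\<^sup>+y. (if fst y \<in> tile d q \<and> (fst x \<in> A \<and> P x y \<and> x \<in> S \<and> y \<in> S) then 1 else 0) \<partial>?C \<partial>?C \<partial>?C)"
    by (rule nn_integral_cong) (rule nn_integral_count_space_swap)
  also have "\<dots> = (\<integral>\<^sup>+q. \<integral>\<^sup>+x. \<integral>\<^sup>+y. (if fst y \<in> tile d q \<and> (fst x \<in> A \<and> P x y \<and> x \<in> S \<and> y \<in> S) then 1 else 0) \<partial>?C \<partial>?C \<partial>?C)"
    by (rule nn_integral_count_space_swap)
  also have "\<dots> = (\<integral>\<^sup>+q. pair_sum A (tile d q) P S \<partial>?C)"
    unfolding pair_sum_eq by (intro nn_integral_cong if_cong refl) blast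
  finally show "pair_sum A (space (euclid d)) P S = (\<integral>\<^sup>+q. pair_sum A (tile d q) P S \<partial>count_space UNIV)" .
  have "pair_sum (space (euclid d)) A P S = (\<integral>\<^sup>+x. \<integral>\<^sup>+y. \<integral>\<^sup>+q. (if fst x \<in> tile d q \<and> (fst y \<in> A \<and> P x y \<and> x \<in> S \<and> y \<in> S) then 1 else 0) \<partial>?C \<partial>?C \<partial>?C)"
    unfolding pair_sum_eq
  proof (intro nn_integral_cong)
    fix x y :: "(nat \<Rightarrow> real) \<times> nat"
    show "(if fst x \<in> space (euclid d) \<and> fst y \<in> A \<and> P x y \<and> x \<in> S \<and> y \<in> S then 1 else 0) =
      (\<integral>\<^sup>+q. (if fst x \<in> tile d q \<and> (fst y \<in> A \<and> P x y \<and> x \<in> S \<and> y \<in> S) then 1 else 0) \<partial>?C)"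
    proof (cases "x \<in> S")
      case True
      thus ?thesis using sp[OF True] by (simp add: indicator_tile_sum)
    qed simp
  qed
  also have "\<dots> = (\<integral>\<^sup>+x. \<integral>\<^sup>+q. \<integral>\<^sup>+y. (if fst x \<in> tile d q \<and> (fst y \<in> A \<and> P x y \<and> x \<in> S \<and> y \<in> S) then 1 else 0) \<partial>?C \<partial>?C \<partial>?C)"
    by (rule nn_integral_cong) (rule nn_integral_count_space_swap)
  also have "\<dots> = (\<integral>\<^sup>+q. \<integral>\<^sup>+x. \<integral>\<^sup>+y. (if fst x \<in> tile d q \<and> (fst y \<in> A \<and> P x y \<and> x \<in> S \<and> y \<in> S) then 1 else 0) \<partial>?C \<partial>?C \<partial>?C)"
    by (rule nn_integral_count_space_swap)
  also have "\<dots> = (\<integral>\<^sup>+q. pair_sum (tile d q) A P S \<partial>?C)"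
    unfolding pair_sum_eq by (intro nn_integral_cong if_cong refl)
  finally show "pair_sum (space (euclid d)) A P S = (\<integral>\<^sup>+q. pair_sum (tile d q) A P S \<partial>count_space UNIV)" .
qed

context poisson_model
begin

lemma nn_integral_sum_countable:
  fixes f :: "'q::countable \<Rightarrow> _"
  assumes "\<And>q. f q \<in> borel_measurable W"
  shows "(\<integral>\<^sup>+w. (\<integral>\<^sup>+q. f q w \<partial>count_space UNIV) \<partial>W) = (\<integral>\<^sup>+q. (\<integral>\<^sup>+w. f q w \<partial>W) \<partial>count_space UNIV)"
proof -
  interpret C: sigma_finite_measure "count_space (UNIV :: 'q set)"
    by (rule sigma_finite_measure_count_space_countable) simp
  interpret pair_sigma_finite W "count_space (UNIV :: 'q set)" by unfold_locales
  have "(\<lambda>(w, q). f q w) \<in> borel_measurable (W \<Otimes>\<^sub>M count_space UNIV)"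
    by (rule measurable_pair_measure_countable2) (use assms in simp_all)
  from Fubini'[OF this] show ?thesis by simp
qed

lemma points_subset: "w \<in> space W \<Longrightarrow> coloured_points w \<subseteq> space E \<times> UNIV"
  using coloured_points_space by (fastforce simp: space_Mk)

text \<open>After a translation, the mean number of pairs from the tile at 0 to the tile
  \<open>q\<close> is that from the tile \<open>map uminus q\<close> to the tile at 0. Summing over
  all \<open>q\<close> covers the space on either side.\<close>

lemma mass_transport:
  "(\<integral>\<^sup>+w. pairs_inf T (half_cube d) (space E) (coloured_points w) \<partial>W) =
   (\<integral>\<^sup>+w. pairs_inf T (space E) (half_cube d) (coloured_points w) \<partial>W)"
proof -
  let ?o = "replicate d 0 :: int list"
  let ?E = "\<lambda>q r. \<integral>\<^sup>+w. pairs_inf T (tile d q) (tile d r) (coloured_points w) \<partial>W"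
  have m: "(\<lambda>w. pairs_inf T (tile d q) (tile d r) (coloured_points w)) \<in> borel_measurable W" for q r
    by (intro measurable_pairs mconf_points sets_tile)
  have sym: "?E ?o q = ?E (map uminus q) ?o" for q
  proof (cases "length q = d")
    case True
    obtain R1 where R1: "tile d ?o \<subseteq> euclid_ball d R1" by (rule tile_subset_ball)
    obtain R2 where R2: "tile d q \<subseteq> euclid_ball d R2" by (rule tile_subset_ball)
    have "euclid_ball d R1 \<subseteq> euclid_ball d (max R1 R2)" "euclid_ball d R2 \<subseteq> euclid_ball d (max R1 R2)"
      by (auto simp: euclid_ball_def)
    hence "tile d ?o \<subseteq> euclid_ball d (max R1 R2)" "tile d q \<subseteq> euclid_ball d (max R1 R2)"
      using R1 R2 by blast+
    from pairs_inf_translate[OF sets_tile sets_tile this, of T "\<lambda>i. real_of_int (q ! i)"]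
    show ?thesis unfolding eshift_tiles[OF True] .
  next
    case False
    thus ?thesis by (simp add: tile_empty pair_sum_empty)
  qed
  have "(\<integral>\<^sup>+w. pairs_inf T (half_cube d) (space E) (coloured_points w) \<partial>W) =
    (\<integral>\<^sup>+w. (\<integral>\<^sup>+q. pairs_inf T (tile d ?o) (tile d q) (coloured_points w) \<partial>count_space UNIV) \<partial>W)"
    unfolding half_cube_tile by (intro nn_integral_cong pair_sum_tiles points_subset)
  also have "\<dots> = (\<integral>\<^sup>+q. ?E ?o q \<partial>count_space UNIV)" by (rule nn_integral_sum_countable[OF m])
  also have "\<dots> = (\<integral>\<^sup>+q. ?E (map uminus q) ?o \<partial>count_space UNIV)" unfolding sym ..
  also have "\<dots> = (\<integral>\<^sup>+q. ?E q ?o \<partial>count_space UNIV)"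
  proof (rule nn_integral_bij_count_space)
    show "bij_betw (map uminus) UNIV (UNIV :: int list set)"
      by (rule bij_betwI[where g = "map uminus"]) (auto simp: comp_def)
  qed
  also have "\<dots> = (\<integral>\<^sup>+w. (\<integral>\<^sup>+q. pairs_inf T (tile d q) (tile d ?o) (coloured_points w) \<partial>count_space UNIV) \<partial>W)"
    by (rule nn_integral_sum_countable[OF m, symmetric])
  also have "\<dots> = (\<integral>\<^sup>+w. pairs_inf T (space E) (half_cube d) (coloured_points w) \<partial>W)"
    unfolding half_cube_tile by (intro nn_integral_cong pair_sum_tiles[symmetric] points_subset)
  finally show ?thesis .
qed

text \<open>The count of unmatched points of colour 1, written with countably many depths and times.
  It is measurable without exceptions, whereas \<open>the_stable_matching\<close> is known to be
  meaningful only almost surely.\<close>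

definition never_claimed :: "(nat \<Rightarrow> nat \<Rightarrow> real) \<times> (nat \<Rightarrow> nat) \<Rightarrow> ennreal" where
  "never_claimed w = (\<integral>\<^sup>+z\<in>coloured_points w. (if fst z \<in> unit_cube d \<and> snd z = 1 \<and>
     (\<forall>N t::nat. avail d (2 * N) (coloured_points w) z (real t)) then 1 else 0) \<partial>count_space UNIV)"

lemma measurable_never_claimed: "never_claimed \<in> borel_measurable W"
  unfolding never_claimed_def[abs_def]
proof (intro measurable_sum_conf[OF mconf_points])
  fix y assume [measurable]: "y \<in> W \<rightarrow>\<^sub>M Mk"
  have [measurable]: "Measurable.pred W (\<lambda>w. avail d (2 * N) (coloured_points w) (y w) (real t))" for N t :: nat
    by (intro measurable_avail mconf_points) simp_all
  have [measurable]: "Measurable.pred W (\<lambda>w. snd (y w) = 1)" by (intro measurable_eq_nat) simp_all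
  show "(\<lambda>w. if fst (y w) \<in> unit_cube d \<and> snd (y w) = 1 \<and> (\<forall>N t::nat. avail d (2 * N) (coloured_points w) (y w) (real t)) then 1 else 0 :: ennreal)
     \<in> borel_measurable W" by measurable
qed

lemma unmatched_intensity_eq: "unmatched_intensity d k p Q 1 = (\<integral>\<^sup>+w. never_claimed w \<partial>W)"
  unfolding unmatched_intensity_def
proof (rule nn_integral_cong_AE)
  show "AE w in W. emeasure (count_space UNIV) {v \<in> unmatched_points d 1 w. fst v \<in> unit_cube d} = never_claimed w"
    using AE_stable_config
  proof eventually_elim
    case (elim w)
    let ?S = "coloured_points w" let ?M = "the_stable_matching (colour_dist d) ?S"
    interpret stable_config d ?S by (rule elim)
    note M = the_stable_matching
    have iff: "?M z = z \<longleftrightarrow> (\<forall>N t::nat. avail d (2 * N) ?S z (real t))" if z: "z \<in> ?S" for z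
    proof
      assume "?M z = z"
      hence "av z (real t)" for t :: nat using av_iff_match_dist[OF M z] by simp
      thus "\<forall>N t::nat. avail d (2 * N) ?S z (real t)" using av_iff_all_even[OF z] by blast
    next
      assume "\<forall>N t::nat. avail d (2 * N) ?S z (real t)"
      hence av: "av z (real t)" for t :: nat using av_iff_all_even[OF z] by blast
      \<comment> \<open>Integer times suffice, since the distance to a match lies below some
        integer.\<close>
      obtain t :: nat where "vdist d (fst z) (fst (?M z)) < real t" using reals_Archimedean2 by blast
      thus "?M z = z" using av[of t] av_iff_match_dist[OF M z, of "real t"] by auto
    qed
    have "emeasure (count_space UNIV) {v \<in> unmatched_points d 1 w. fst v \<in> unit_cube d} =
      (\<integral>\<^sup>+z. indicator {v \<in> unmatched_points d 1 w. fst v \<in> unit_cube d} z \<partial>count_space UNIV)"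
      by (rule nn_integral_indicator[symmetric]) simp
    also have "\<dots> = never_claimed w"
      unfolding never_claimed_def
    proof (intro nn_integral_cong)
      fix z
      show "indicator {v \<in> unmatched_points d 1 w. fst v \<in> unit_cube d} z =
        (if fst z \<in> unit_cube d \<and> snd z = 1 \<and> (\<forall>N t::nat. avail d (2 * N) ?S z (real t)) then 1 else 0) * (indicator ?S z :: ennreal)"
        using iff[of z] by (auto simp: unmatched_points_def indicator_def)
    qed
    finally show ?case .
  qed
qed

lemma never_claimed_le:
  assumes t: "t \<ge> 0" shows "never_claimed w \<le> alive (2 * n) 1 t (unit_cube d) w"
  unfolding never_claimed_def alive_def
proof (intro nn_integral_mono mult_right_mono)
  fix z
  obtain s :: nat where s: "t \<le> real s" using real_arch_simple by blast
  have "avail d (2 * n) (coloured_points w) z t" if "\<forall>N t::nat. avail d (2 * N) (coloured_points w) z (real t)"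
    using avail_mono_time[OF s] that by blast
  thus "(if fst z \<in> unit_cube d \<and> snd z = 1 \<and> (\<forall>N t::nat. avail d (2 * N) (coloured_points w) z (real t)) then 1 else 0)
    \<le> (if fst z \<in> unit_cube d \<and> snd z = 1 \<and> avail d (2 * n) (coloured_points w) z t then 1 else 0 :: ennreal)"
    by auto
qed simp

text \<open>A point available at odd depth is truly available at \<open>T\<close>: it is unmatched
  or matched at distance at least \<open>T\<close>. In the second case its partner has another
  colour and the two form a far pair.\<close>

lemma alive_odd_le:
  "AE w in W. alive (Suc (2 * n)) 1 T (half_cube d) w \<le>
     never_claimed w + pairs_inf T (half_cube d) (space E) (coloured_points w)"
  using AE_stable_config AE_space
proof eventually_elim
  case (elim w)
  let ?S = "coloured_points w" let ?M = "the_stable_matching (colour_dist d) ?S"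
  let ?C = "count_space UNIV :: ((nat \<Rightarrow> real) \<times> nat) measure"
  interpret stable_config d ?S by (rule elim)
  note M = the_stable_matching
  let ?f = "\<lambda>z. if fst z \<in> unit_cube d \<and> snd z = 1 \<and> (\<forall>N t::nat. avail d (2 * N) ?S z (real t)) then 1 else 0 :: ennreal"
  let ?g = "\<lambda>z. \<integral>\<^sup>+y\<in>?S. (if fst z \<in> half_cube d \<and> fst y \<in> space E \<and> (\<forall>N. far d T N ?S z y) then 1 else 0) \<partial>?C"
  have "alive (Suc (2 * n)) 1 T (half_cube d) w \<le> (\<integral>\<^sup>+z. ?f z * indicator ?S z + ?g z * indicator ?S z \<partial>?C)"
    unfolding alive_def
  proof (intro nn_integral_mono)
    fix z
    show "(if fst z \<in> half_cube d \<and> snd z = 1 \<and> avail d (Suc (2 * n)) ?S z T then 1 else 0) * indicator ?S z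
      \<le> ?f z * indicator ?S z + ?g z * indicator ?S z"
    proof (cases "z \<in> ?S \<and> fst z \<in> half_cube d \<and> snd z = 1 \<and> avail d (Suc (2 * n)) ?S z T")
      case True
      hence z: "z \<in> ?S" "fst z \<in> half_cube d" "snd z = 1" and av: "av z T"
        using avail_odd_imp_av[of z n T] by auto
      have "1 \<le> ?f z + ?g z"
      proof (cases "?M z = z")
        case True
        hence "av z (real t)" for t :: nat using av_iff_match_dist[OF M z(1)] by simp
        moreover have "fst z \<in> unit_cube d" using z(2) half_cube_subset by blast
        ultimately have "?f z = 1" using av_iff_all_even[OF z(1)] z by auto
        thus ?thesis by simp
      next
        case False
        let ?y = "?M z"
        have y: "?y \<in> ?S" "snd ?y \<noteq> 1" "av z (v z ?y)" "av ?y (v z ?y)"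
          using matched_iff[OF M z(1), of ?y] False z(3) by auto
        have "T \<le> v z ?y" using av av_iff_match_dist[OF M z(1)] False by blast
        hence "far d T N ?S z ?y" for N
          using y z av_iff_all_even[OF z(1), of "v z ?y"] av_iff_all_even[OF y(1), of "v z ?y"] by (simp add: far_def)
        moreover have "fst ?y \<in> space E" using points_subset[OF elim(2)] y(1) by auto
        ultimately have "1 = (if fst z \<in> half_cube d \<and> fst ?y \<in> space E \<and> (\<forall>N. far d T N ?S z ?y) then 1 else 0) * (indicator ?S ?y :: ennreal)"
          using z y(1) by simp
        also have "\<dots> \<le> ?g z" by (rule nn_integral_ge_point) simp
        finally show ?thesis by (rule order_trans) simp
      qed
      thus ?thesis using True by simp
    qed auto
  qed
  also have "\<dots> = never_claimed w + pairs_inf T (half_cube d) (space E) ?S"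
    unfolding never_claimed_def pair_sum_def by (rule nn_integral_add) simp_all
  finally show ?case .
qed

text \<open>Exchanging the sums groups the pairs by the point of the other colour, which has at most
  one partner and is itself available at \<open>T\<close>.\<close>

lemma pairs_inf_le:
  assumes "T \<ge> 0"
  shows "AE w in W. pairs_inf T (space E) (half_cube d) (coloured_points w) \<le> (\<Sum>j=2..k. alive (2 * n) j T (half_cube d) w)"
  using AE_stable_config AE_space
proof eventually_elim
  case (elim w)
  let ?S = "coloured_points w"
  let ?C = "count_space UNIV :: ((nat \<Rightarrow> real) \<times> nat) measure"
  interpret stable_config d ?S by (rule elim)
  let ?h = "\<lambda>j z. if fst z \<in> half_cube d \<and> snd z = j \<and> avail d (2 * n) ?S z T then 1 else 0 :: ennreal"
  have "pairs_inf T (space E) (half_cube d) ?S =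
    (\<integral>\<^sup>+y. \<integral>\<^sup>+x. (if fst x \<in> space E \<and> fst y \<in> half_cube d \<and> (\<forall>N. far d T N ?S x y) \<and> x \<in> ?S \<and> y \<in> ?S then 1 else 0) \<partial>?C \<partial>?C)"
    unfolding pair_sum_eq by (rule nn_integral_count_space_swap)
  also have "\<dots> \<le> (\<integral>\<^sup>+y. (\<Sum>j=2..k. ?h j y * indicator ?S y) \<partial>?C)"
  proof (intro nn_integral_mono)
    fix y
    let ?P = "\<lambda>x. fst x \<in> space E \<and> fst y \<in> half_cube d \<and> (\<forall>N. far d T N ?S x y) \<and> x \<in> ?S \<and> y \<in> ?S"
    show "(\<integral>\<^sup>+x. (if ?P x then 1 else 0) \<partial>?C) \<le> (\<Sum>j=2..k. ?h j y * indicator ?S y)"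
    proof (cases "\<exists>x. ?P x")
      case True
      then obtain x where x: "?P x" by blast
      have partner: "partner y x'" if x': "?P x'" for x'
      proof -
        have "av x' (v x' y)" "av y (v x' y)"
          using x' av_iff_all_even[of x' "v x' y"] av_iff_all_even[of y "v x' y"] by (auto simp: far_def)
        moreover have "snd y \<noteq> snd x'" using x' by (auto simp: far_def)
        ultimately show ?thesis using x' v_commute[of x' y] by (simp add: partner_def)
      qed
      have uniq: "x' = x" if "?P x'" for x'
        by (rule partner_unique[OF partner partner]) (fact that, fact x)
      have "(\<integral>\<^sup>+x. (if ?P x then 1 else 0) \<partial>?C) \<le> (\<integral>\<^sup>+x'. indicator {x} x' \<partial>?C)"
        by (intro nn_integral_mono) (use uniq in \<open>auto simp: indicator_def\<close>)
      also have "\<dots> = 1" by simp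
      also have "1 \<le> ?h (snd y) y * indicator ?S y"
      proof -
        have "far d T n ?S x y" using x by blast
        hence "avail d (2 * n) ?S y (v x y)" "T \<le> v x y" by (auto simp: far_def)
        hence "avail d (2 * n) ?S y T" using avail_mono_time by blast
        thus ?thesis using x by simp
      qed
      also have "\<dots> \<le> (\<Sum>j=2..k. ?h j y * indicator ?S y)"
      proof (rule member_le_sum)
        have "snd y \<noteq> 1" using x by (auto simp: far_def)
        moreover have "y \<in> space Mk" using x coloured_points_space[OF elim(2)] by blast
        hence "snd y \<in> {1..k}" by (auto simp: space_Mk)
        ultimately show "snd y \<in> {2..k}" by auto
      qed simp_all
      finally show ?thesis .
    next
      case False
      hence "(\<integral>\<^sup>+x. (if ?P x then 1 else 0) \<partial>?C) = (\<integral>\<^sup>+x. 0 \<partial>?C)" by (intro nn_integral_cong) metis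
      thus ?thesis by simp
    qed
  qed
  also have "\<dots> = (\<Sum>j=2..k. alive (2 * n) j T (half_cube d) w)"
    unfolding alive_def by (rule nn_integral_sum) simp
  finally show ?case .
qed

text \<open>In the lower bound the far pairs are first counted by their end of colour 1; mass
  transport recounts them by the other end, where available points are rare.\<close>

lemma unmatched_intensity_bounds:
  assumes T: "T \<ge> 0"
  shows "unmatched_intensity d k p Q 1 \<le> (\<integral>\<^sup>+w. alive (2 * n) 1 T (unit_cube d) w \<partial>W)"
    and "(\<integral>\<^sup>+w. alive (Suc (2 * n)) 1 T (half_cube d) w \<partial>W) \<le>
      unmatched_intensity d k p Q 1 + (\<Sum>j=2..k. \<integral>\<^sup>+w. alive (2 * n) j T (half_cube d) w \<partial>W)"
proof -
  show "unmatched_intensity d k p Q 1 \<le> (\<integral>\<^sup>+w. alive (2 * n) 1 T (unit_cube d) w \<partial>W)"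
    unfolding unmatched_intensity_eq by (intro nn_integral_mono never_claimed_le T)
  have "(\<integral>\<^sup>+w. alive (Suc (2 * n)) 1 T (half_cube d) w \<partial>W) \<le>
    (\<integral>\<^sup>+w. never_claimed w + pairs_inf T (half_cube d) (space E) (coloured_points w) \<partial>W)"
    by (rule nn_integral_mono_AE[OF alive_odd_le])
  also have "\<dots> = unmatched_intensity d k p Q 1 + (\<integral>\<^sup>+w. pairs_inf T (half_cube d) (space E) (coloured_points w) \<partial>W)"
    unfolding unmatched_intensity_eq
    by (intro nn_integral_add measurable_never_claimed measurable_pairs mconf_points sets_cubes sets.top)
  also have "(\<integral>\<^sup>+w. pairs_inf T (half_cube d) (space E) (coloured_points w) \<partial>W) \<le>
      (\<integral>\<^sup>+w. (\<Sum>j=2..k. alive (2 * n) j T (half_cube d) w) \<partial>W)"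
    unfolding mass_transport by (rule nn_integral_mono_AE[OF pairs_inf_le[OF T]])
  also have "\<dots> = (\<Sum>j=2..k. \<integral>\<^sup>+w. alive (2 * n) j T (half_cube d) w \<partial>W)"
    by (intro nn_integral_sum measurable_alive sets_cubes)
  finally show "(\<integral>\<^sup>+w. alive (Suc (2 * n)) 1 T (half_cube d) w \<partial>W) \<le>
      unmatched_intensity d k p Q 1 + (\<Sum>j=2..k. \<integral>\<^sup>+w. alive (2 * n) j T (half_cube d) w \<partial>W)"
    by (simp add: add_left_mono)
qed

end

subsection \<open>Convergence of the intensity\<close>

lemma (in dominant_colour) unmatched_intensity_near:
  assumes e: "e > 0" and Q: "\<And>d. d \<ge> 1 \<Longrightarrow> poisson_process_law d (Q d)"
  shows "\<forall>\<^sub>F d in sequentially. unmatched_intensity d k p (Q d) 1 \<le> ennreal (lam + e) \<and>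
    ennreal lam \<le> unmatched_intensity d k p (Q d) 1 + ennreal e"
proof -
  \<comment> \<open>The lower bound loses \<open>c\<close> from the tree limit, \<open>c\<close>
    from the density of colour 1 and at most \<open>c + real k * c\<close> from the other colours;
    \<open>4 + real k\<close> covers this.\<close>
  define c where "c = e / (4 + real k)"
  have c: "c > 0" "c * (4 + real k) = e" using e by (auto simp: c_def)
  obtain t n where t: "t > 0" and l: "\<bar>p 1 * tav (2 * n) 1 t - lam\<bar> < c" "\<bar>p 1 * tav (Suc (2 * n)) 1 t - lam\<bar> < c"
    "(\<Sum>j=2..k. p j * tav (2 * n) j t) < c"
    by (rule tree_av_limit[OF c(1)])
  let ?ok = "\<lambda>d m i. \<forall>Q C R. poisson_model k p d Q \<longrightarrow> C \<in> sets (euclid d) \<longrightarrow>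
    emeasure (euclid d) C = 1 \<longrightarrow> C \<subseteq> euclid_ball d R \<longrightarrow>
    (\<integral>\<^sup>+w. poisson_model.alive d m i t C w \<partial>coloured_law k p Q) \<le> ennreal (p i * tav m i t + c) \<and>
    ennreal (p i * tav m i t) \<le> (\<integral>\<^sup>+w. poisson_model.alive d m i t C w \<partial>coloured_law k p Q) + ennreal c"
  have one: "1 \<in> {1..k}" using k2 by simp
  have ev: "\<forall>\<^sub>F d in sequentially. ?ok d m i" if "i \<in> {1..k}" for m i
    by (rule alive_density[OF colour_probs_axioms t c(1) that])
  have "\<forall>\<^sub>F d in sequentially. \<forall>j\<in>{2..k}. ?ok d (2 * n) j"
    by (intro eventually_ball_finite ballI ev) auto
  with ev[OF one, of "2 * n"] ev[OF one, of "Suc (2 * n)"] eventually_ge_at_top[of 1]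
  show ?thesis
  proof eventually_elim
    case (elim d)
    interpret poisson_model k p d "Q d"
      by (intro poisson_model.intro poisson_model_axioms.intro colour_probs_axioms elim Q)
    let ?I = "unmatched_intensity d k p (Q d) 1"
    have half: "half_cube d \<subseteq> euclid_ball d (real d)" using half_cube_subset unit_cube_subset_ball by blast
    note unit = poisson_model_axioms sets_cubes(2) emeasure_cubes(2) unit_cube_subset_ball
    note half = poisson_model_axioms sets_cubes(1) emeasure_cubes(1) half
    have t0: "t \<ge> 0" using t by simp
    have "?I \<le> (\<integral>\<^sup>+w. alive (2 * n) 1 t (unit_cube d) w \<partial>W)" by (rule unmatched_intensity_bounds(1)[OF t0])
    also have "\<dots> \<le> ennreal (p 1 * tav (2 * n) 1 t + c)" using elim(1)[rule_format, OF unit] by blast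
    also have "\<dots> \<le> ennreal (lam + e)"
    proof (rule ennreal_leI)
      have "c * 2 \<le> c * (4 + real k)" using c(1) by (intro mult_left_mono) auto
      thus "p 1 * tav (2 * n) 1 t + c \<le> lam + e" using l(1) c(2) by linarith
    qed
    finally have 1: "?I \<le> ennreal (lam + e)" .
    have pj: "0 \<le> p j * tav (2 * n) j t" if "j \<in> {2..k}" for j
      using that p_nonneg[of j] a_pos[of "2 * n" j t] by simp
    have "(\<Sum>j=2..k. \<integral>\<^sup>+w. alive (2 * n) j t (half_cube d) w \<partial>W) \<le> (\<Sum>j=2..k. ennreal (p j * tav (2 * n) j t + c))"
      using elim(4) half by (intro sum_mono) blast
    also have "\<dots> = ennreal (\<Sum>j=2..k. p j * tav (2 * n) j t + c)"
      using pj c(1) by (intro sum_ennreal) (simp add: add_nonneg_nonneg less_imp_le)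
    also have "\<dots> \<le> ennreal (c + real k * c)"
    proof (rule ennreal_leI)
      have "real (card {2..k}) * c \<le> real k * c" using c(1) by (intro mult_right_mono) auto
      thus "(\<Sum>j=2..k. p j * tav (2 * n) j t + c) \<le> c + real k * c"
        using l(3) by (simp add: sum.distrib)
    qed
    finally have far: "(\<Sum>j=2..k. \<integral>\<^sup>+w. alive (2 * n) j t (half_cube d) w \<partial>W) \<le> ennreal (c + real k * c)" .
    have "ennreal lam \<le> ennreal (p 1 * tav (Suc (2 * n)) 1 t + c)" using l(2) by (intro ennreal_leI) linarith
    also have "\<dots> \<le> ennreal (p 1 * tav (Suc (2 * n)) 1 t) + ennreal c"
      using c(1) p_nonneg[OF one] a_pos[of "Suc (2 * n)" 1 t] by simp
    also have "ennreal (p 1 * tav (Suc (2 * n)) 1 t) \<le> (\<integral>\<^sup>+w. alive (Suc (2 * n)) 1 t (half_cube d) w \<partial>W) + ennreal c"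
      using elim(2)[rule_format, OF half] by blast
    also have "(\<integral>\<^sup>+w. alive (Suc (2 * n)) 1 t (half_cube d) w \<partial>W) \<le>
      ?I + (\<Sum>j=2..k. \<integral>\<^sup>+w. alive (2 * n) j t (half_cube d) w \<partial>W)"
      by (rule unmatched_intensity_bounds(2)[OF t0])
    also note far
    finally have "ennreal lam \<le> ?I + ennreal (c + real k * c) + ennreal c + ennreal c"
      by (simp add: add_left_mono add_right_mono)
    also have "\<dots> = ?I + ennreal (c + real k * c + c + c)"
      using c(1) by (simp add: add.assoc ennreal_plus[symmetric] del: ennreal_plus)
    also have "\<dots> \<le> ?I + ennreal e"
      using c(1) unfolding c(2)[symmetric] by (intro add_left_mono ennreal_leI) (simp add: algebra_simps)
    finally show ?case using 1 by blast
  qed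
qed

lemma tendsto_ennreal_near:
  assumes "0 \<le> l" and near: "\<And>e. e > 0 \<Longrightarrow> \<forall>\<^sub>F d in F. f d \<le> ennreal (l + e) \<and> ennreal l \<le> f d + ennreal e"
  shows "(f \<longlongrightarrow> ennreal l) F"
proof (rule order_tendstoI)
  fix a assume "ennreal l < a"
  then obtain e where e: "e > 0" "ennreal (l + e) < a"
  proof (cases a)
    case (real r)
    hence "l < r" using \<open>ennreal l < a\<close> assms(1) by (simp add: ennreal_less_iff)
    thus ?thesis using real assms(1) by (intro that[of "(r - l) / 2"]) (auto simp: ennreal_less_iff field_simps)
  next
    case top thus ?thesis by (intro that[of 1]) auto
  qed
  show "\<forall>\<^sub>F d in F. f d < a" using near[OF e(1)] by eventually_elim (use e(2) in \<open>auto intro: le_less_trans\<close>)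
next
  fix a assume a: "a < ennreal l"
  then obtain r where r: "a = ennreal r" "0 \<le> r" "r < l"
    by (cases a) (auto simp: ennreal_less_iff)
  have "0 < (l - r) / 2" using r by simp
  from near[OF this] show "\<forall>\<^sub>F d in F. a < f d"
  proof eventually_elim
    case (elim d)
    show ?case
    proof (rule ccontr)
      assume "\<not> a < f d"
      hence "f d + ennreal ((l - r) / 2) \<le> ennreal r + ennreal ((l - r) / 2)" unfolding r(1) by (intro add_right_mono) simp
      also have "\<dots> = ennreal (r + (l - r) / 2)" using r by (intro ennreal_plus[symmetric]) auto
      finally have "ennreal l \<le> ennreal (r + (l - r) / 2)" using elim by (blast intro: order_trans)
      thus False using r by (simp add: ennreal_le_iff field_simps)
    qed
  qed
qed

theorem theorem2:
  fixes k :: nat and p :: "nat \<Rightarrow> real"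
  assumes "k \<ge> 2"
    and "\<And>i. i \<in> {1..k} \<Longrightarrow> p i \<ge> 0"
    and "(\<Sum>i=1..k. p i) = 1"
    and "p 1 > Max (p ` {2..k})"
  shows "\<exists>lam::real. lam > 0 \<and>
    (\<forall>Q :: nat \<Rightarrow> (nat \<Rightarrow> nat \<Rightarrow> real) measure.
        (\<forall>d\<ge>1. poisson_process_law d (Q d)) \<longrightarrow>
        (\<lambda>d. unmatched_intensity d k p (Q d) 1) \<longlonglongrightarrow> ennreal lam) \<and>
    ((\<forall>i\<in>{2..k}. p i = p 2) \<longrightarrow> lam = (p 1 - p 2) ^ (k - 1) / p 1 ^ (k - 2))"
proof -
  have "p i < p 1" if "i \<in> {2..k}" for i
    using Max_ge[of "p ` {2..k}" "p i"] that assms(4) by simp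
  then interpret dominant_colour k p
    using assms(1-3) by unfold_locales auto
  have "(\<lambda>d. unmatched_intensity d k p (Q d) 1) \<longlonglongrightarrow> ennreal lam"
    if "\<forall>d\<ge>1. poisson_process_law d (Q d)" for Q
    using that unmatched_intensity_near[of _ Q] lam_pos by (intro tendsto_ennreal_near) auto
  with lam_pos lam_equal show ?thesis by blast
qed

end
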